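(* Let $\Gamma$ be a VB-groupoid over $G\rightrightarrows M$ with side bundle $E$ and core $C$, and let $h: s^*E\to\Gamma$ be a (right-)horizontal lift. For $\varphi\in C^p_{\mathcal{VB}}(\Gamma)$, let $\varphi^E\in C^{p-1}(G;E)$ and $\varphi^C\in C^p(G;C)$ be the components of $\varphi$ determined by $$\hat\varphi_{(g_1,\dots,g_p)} = h_{g_1}\big(\varphi^E_{(g_2,\dots,g_p)}\big)+\varphi^C_{(g_1,\dots,g_p)}\cdot\tilde 0_{g_1}.$$ Then the map $\Theta_h:\varphi\mapsto(\varphi^E,\varphi^C)$ is an isomorphism of graded right $C(G)$-modules from $C_{\mathcal{VB}}(\Gamma)[1]$ to $C(G;E\oplus C[1])$.
   Context: Lie groupoids: $G\rightrightarrows M$ has source $s$, target $t$, units $1_x$; $g_1g_2$ is defined iff $s(g_1)=t(g_2)$. $G^{(0)}=M$, $G^{(p)}=\{(g_1,\dots,g_p): s(g_i)=t(g_{i+1})\}$; $C^p(G)=C^\infty(G^{(p)})$ with product $(f_1\star f_2)(g_1,\dots,g_{p+q})=f_1(g_1,\dots,g_p)f_2(g_{p+1},\dots,g_{p+q})$ (a $0$-cochain placed on the left is evaluated at $t(g_1)$, on the right at $s(g_p)$). VB-groupoid: Lie groupoids $\Gamma\rightrightarrows E$ (structure maps $\tilde s,\tilde t,\tilde m,\tilde 1$, inverse $\gamma^{-1}$) and $G\rightrightarrows M$, and vector bundles $\tilde q:\Gamma\to G$ (zero section $\tilde 0$), $q:E\to M$ (zero section $0$), with $q\tilde s=s\tilde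 q$, $q\tilde t=t\tilde q$, such that (1) $(\tilde s,s)$ and (2) $(\tilde t,t)$ are vector bundle morphisms, (3) $(\tilde q,q)$ is a Lie groupoid morphism, (4) $(\gamma_1+\gamma_3)(\gamma_2+\gamma_4)=\gamma_1\gamma_2+\gamma_3\gamma_4$ whenever $(\gamma_1,\gamma_2),(\gamma_3,\gamma_4)$ are composable, $\tilde q(\gamma_1)=\tilde q(\gamma_3)$, $\tilde q(\gamma_2)=\tilde q(\gamma_4)$. Core: $C\to M$ is the vector bundle with $C_x=\{c\in\Gamma_{1_x}:\tilde s(c)=0\}$. Horizontal lift: a vector bundle morphism $h:s^*E\to\Gamma$ over $\mathrm{id}_G$, $h_g:E_{s(g)}\to\Gamma_g$, with $\tilde s(h_g(e))=e$ and $h_{1_x}(e)=\tilde 1_e$. Then every element of $\Gamma_g$ is uniquely $c\cdot\tilde 0_g+h_g(e)$ with $c\in C_{t(g)}$, $e\in E_{s(g)}$. Dual VB-groupoid $\Gamma^*\rightrightarrows C^*$ (over $G\rightrightarrows M$; projection $\check q:\Gamma^*\to G$, zero section $\check 0$): for $\xi\in\Gamma^*_g$, $\langle\check s(\xi)|c_1\rangle=-\langle\xi|\tilde 0_g\cdot c_1^{-1}\rangle$ for $c_1\in C_{s(g)}$, $\langle\check t(\xi)|c_2\rangle=\langle\xi|c_2\cdot\tilde 0_g\rangle$ for $c_2\in C_{t(g)}$, and $\langle\xi_1\cdot\xi_2|\gamma_1\cdot\gamma_2\rangle=\langle\xi_1|\gamma_1\rangle+\langle\xi_2|\gamma_2\rangle$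 for composable $\gamma_i\in\Gamma_{g_i}$. $C^p_{\mathrm{lin}}(\Gamma^* )$: smooth functions on $(\Gamma^* )^{(p)}$ linear on the fibers of the vector bundle $(\Gamma^* )^{(p)}\to G^{(p)}$. $\varphi\in C^p_{\mathrm{lin}}(\Gamma^* )$ is left-projectable if $\varphi(\check 0_g,\xi_1,\dots,\xi_{p-1})=0$ and $\varphi(\check 0_g\cdot\xi_1,\xi_2,\dots,\xi_p)=\varphi(\xi_1,\dots,\xi_p)$ for all composable $(\xi_1,\dots,\xi_p)$ and $g\in G$ with $\check t(\xi_1)=0_{s(g)}$ (no condition when $p=0$). $C^p_{\mathcal{VB}}(\Gamma)$ is the space of left-projectable cochains; $C^0_{\mathcal{VB}}(\Gamma)=\Gamma(C)$. For $\varphi\in C^p_{\mathcal{VB}}(\Gamma)$, $p\ge1$, define $\hat\varphi:G^{(p)}\to\Gamma$, $\hat\varphi_{(g_1,\dots,g_p)}\in\Gamma_{g_1}$, by $\langle\xi_1|\hat\varphi_{(g_1,\dots,g_p)}\rangle=\varphi(\xi_1,\dots,\xi_p)$ for any $\xi_2,\dots,\xi_p$ with $(\xi_1,\dots,\xi_p)\in(\Gamma^* )^{(p)}$, $\check q(\xi_i)=g_i$ (well defined; the $E$-component of $\hat\varphi$ does not depend on $g_1$ other than through the point $s(g_1)$). For $p=1$, $\varphi^E\in C^0(G;E)=\Gamma(E)$ is evaluated at $s(g_1)$; for $p=0$, $\varphi^C=\varphi\in\Gamma(C)$ and there is no $\varphi^E$. The right $C(G)$-module structure on $C_{\mathcal{VB}}(\Gamma)$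 is $\varphi\star f$ with $f\in C^q(G)$ viewed as a fiberwise-constant cochain on $\Gamma^*\rightrightarrows C^*$. For a vector bundle $B\to M$, $C^p(G;B)$ is the space of smooth $\omega$ with $\omega(g_1,\dots,g_p)\in B_{t(g_1)}$ ($C^0(G;B)=\Gamma(B)$), a right $C(G)$-module via $(\omega\star f)(g_1,\dots,g_{p+q})=\omega(g_1,\dots,g_p)f(g_{p+1},\dots,g_{p+q})$ (same conventions for $0$-cochains). $C(G;E\oplus C[1])^p=C^p(G;E)\oplus C^{p+1}(G;C)$, and $(C_{\mathcal{VB}}(\Gamma)[1])^{p}=C^{p+1}_{\mathcal{VB}}(\Gamma)$. *)

theory Defs
  imports "HOL-Analysis.Analysis"
begin

section \<open>Smooth manifolds\<close>

text \<open>
  The model of \<open>\<real>\<^sup>n\<close> is \<^term>\<open>Euclidean_space n\<close>, the sequences of type \<^typ>\<open>nat \<Rightarrow> real\<close> that vanish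
  from index \<open>n\<close> on. The dimension is a number and not a type because the spaces of composable
  \<open>p\<close>-tuples occur for all \<open>p\<close> at once.
\<close>

primrec k_times_diff :: "nat \<Rightarrow> nat \<Rightarrow> (nat \<Rightarrow> real) set \<Rightarrow> ((nat \<Rightarrow> real) \<Rightarrow> real) \<Rightarrow> bool" where
  "k_times_diff n 0 W f \<longleftrightarrow>
     continuous_map (subtopology (Euclidean_space n) W) euclideanreal f"
| "k_times_diff n (Suc k) W f \<longleftrightarrow>
     continuous_map (subtopology (Euclidean_space n) W) euclideanreal f \<and>
     (\<forall>i<n. \<exists>f'. (\<forall>x\<in>W. ((\<lambda>t. f (x(i := x i + t))) has_real_derivative f' x) (at 0)) \<and>
                 k_times_diff n k W f')"

definition smooth_map :: "nat \<Rightarrow> nat \<Rightarrow> (nat \<Rightarrow> real) set \<Rightarrow> ((nat \<Rightarrow> real) \<Rightarrow> (nat \<Rightarrow> real)) \<Rightarrow> bool" where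
  "smooth_map n m W F \<longleftrightarrow>
     openin (Euclidean_space n) W \<and> (\<forall>i<m. \<forall>k. k_times_diff n k W (\<lambda>x. F x i))"

type_synonym 'a chart = "'a set \<times> ('a \<Rightarrow> nat \<Rightarrow> real)"

record 'a manifold =
  points :: "'a set"
  mdim :: nat
  atlas :: "'a chart set"

text \<open>The atlas determines the topology; the atlas need not be maximal.\<close>

definition mtop :: "'a manifold \<Rightarrow> 'a topology" where
  "mtop M = topology (\<lambda>S. S \<subseteq> points M \<and>
     (\<forall>(U, \<phi>) \<in> atlas M. openin (Euclidean_space (mdim M)) (\<phi> ` (S \<inter> U))))"

definition is_manifold :: "'a manifold \<Rightarrow> bool" where
  "is_manifold M \<longleftrightarrow>
     (\<Union>(U, \<phi>) \<in> atlas M. U) = points M \<and>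
     (\<forall>(U, \<phi>) \<in> atlas M. inj_on \<phi> U \<and> openin (Euclidean_space (mdim M)) (\<phi> ` U)) \<and>
     (\<forall>(U, \<phi>) \<in> atlas M. \<forall>(V, \<psi>) \<in> atlas M.
        smooth_map (mdim M) (mdim M) (\<phi> ` (U \<inter> V)) (\<lambda>x. \<psi> (inv_into U \<phi> x))) \<and>
     Hausdorff_space (mtop M) \<and> second_countable (mtop M)"

text \<open>
  Smoothness of a map on an arbitrary subset \<open>A\<close> of a manifold: locally, it is the restriction of a
  smooth map defined on an open set. For an open subset or an embedded submanifold \<open>A\<close> this is
  smoothness in the usual sense, so that spaces such as \<open>G\<^sup>(\<^sup>p\<^sup>) \<subseteq> G\<^sup>p\<close> and
  \<open>s\<^sup>*E \<subseteq> G \<times> E\<close> need no atlas of their own.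
\<close>

definition smooth_on :: "'a manifold \<Rightarrow> 'a set \<Rightarrow> 'b manifold \<Rightarrow> ('a \<Rightarrow> 'b) \<Rightarrow> bool" where
  "smooth_on M A N f \<longleftrightarrow>
     A \<subseteq> points M \<and> f ` A \<subseteq> points N \<and>
     (\<forall>a\<in>A. \<exists>(U, \<phi>) \<in> atlas M. \<exists>(V, \<psi>) \<in> atlas N. \<exists>W F.
        a \<in> U \<and> \<phi> a \<in> W \<and> smooth_map (mdim M) (mdim N) W F \<and>
        (\<forall>y \<in> A \<inter> U. \<phi> y \<in> W \<longrightarrow> f y \<in> V \<and> (\<forall>i < mdim N. \<psi> (f y) i = F (\<phi> y) i)))"

definition submersion :: "'a manifold \<Rightarrow> 'b manifold \<Rightarrow> ('a \<Rightarrow> 'b) \<Rightarrow> bool" where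
  "submersion M N f \<longleftrightarrow>
     smooth_on M (points M) N f \<and>
     (\<forall>(U, \<phi>) \<in> atlas M. \<forall>(V, \<psi>) \<in> atlas N. \<forall>a\<in>U. f a \<in> V \<longrightarrow>
        (\<forall>w::nat \<Rightarrow> real. \<exists>v::nat \<Rightarrow> real. \<forall>i < mdim N.
           (\<Sum>j < mdim M. deriv (\<lambda>t. \<psi> (f (inv_into U \<phi> ((\<phi> a)(j := t)))) i) (\<phi> a j) * v j) = w i))"

definition euclid :: "nat \<Rightarrow> (nat \<Rightarrow> real) manifold" where
  "euclid n = \<lparr>points = topspace (Euclidean_space n), mdim = n,
               atlas = {(topspace (Euclidean_space n), \<lambda>x. x)}\<rparr>"

definition real_line :: "real manifold" where
  "real_line = \<lparr>points = UNIV, mdim = 1, atlas = {(UNIV, \<lambda>r i. if i = 0 then r else 0)}\<rparr>"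

definition prod_manifold :: "'a manifold \<Rightarrow> 'b manifold \<Rightarrow> ('a \<times> 'b) manifold" where
  "prod_manifold M N =
     \<lparr>points = points M \<times> points N, mdim = mdim M + mdim N,
      atlas = {(U \<times> V, \<lambda>(x, y) i. if i < mdim M then \<phi> x i else \<psi> y (i - mdim M)) | U \<phi> V \<psi>.
                 (U, \<phi>) \<in> atlas M \<and> (V, \<psi>) \<in> atlas N}\<rparr>"

definition power_manifold :: "'a manifold \<Rightarrow> nat \<Rightarrow> 'a list manifold" where
  "power_manifold M p =
     \<lparr>points = {xs. length xs = p \<and> set xs \<subseteq> points M}, mdim = p * mdim M,
      atlas = {({xs. length xs = p \<and> (\<forall>i<p. xs ! i \<in> fst (cs ! i))},
                \<lambda>xs j. if j < p * mdim M
                        then snd (cs ! (j div mdim M)) (xs ! (j div mdim M)) (j mod mdim M)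
                        else 0) | cs. length cs = p \<and> set cs \<subseteq> atlas M}\<rparr>"

section \<open>Vector bundles\<close>

definition real_vs :: "'v set \<Rightarrow> ('v \<Rightarrow> 'v \<Rightarrow> 'v) \<Rightarrow> (real \<Rightarrow> 'v \<Rightarrow> 'v) \<Rightarrow> 'v \<Rightarrow> bool" where
  "real_vs S add scl z \<longleftrightarrow>
     z \<in> S \<and> (\<forall>v\<in>S. \<forall>w\<in>S. add v w \<in> S) \<and> (\<forall>r. \<forall>v\<in>S. scl r v \<in> S) \<and>
     (\<forall>u\<in>S. \<forall>v\<in>S. \<forall>w\<in>S. add (add u v) w = add u (add v w)) \<and>
     (\<forall>v\<in>S. \<forall>w\<in>S. add v w = add w v) \<and>
     (\<forall>v\<in>S. add z v = v) \<and> (\<forall>v\<in>S. \<exists>w\<in>S. add v w = z) \<and>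
     (\<forall>r. \<forall>v\<in>S. \<forall>w\<in>S. scl r (add v w) = add (scl r v) (scl r w)) \<and>
     (\<forall>r s. \<forall>v\<in>S. scl (r + s) v = add (scl r v) (scl s v)) \<and>
     (\<forall>r s. \<forall>v\<in>S. scl (r * s) v = scl r (scl s v)) \<and>
     (\<forall>v\<in>S. scl 1 v = v)"

text \<open>
  A family of vector spaces \<open>vfib x\<close> inside one manifold. Besides vector bundles this covers the
  core, which is an embedded submanifold of \<open>\<Gamma>\<close>: a map into it is smooth iff it is smooth as a map
  into \<open>\<Gamma>\<close>.
\<close>

record ('v, 'm) vfamily =
  vtotal :: "'v manifold"
  vfib :: "'m \<Rightarrow> 'v set"
  vadd :: "'v \<Rightarrow> 'v \<Rightarrow> 'v"
  vscale :: "real \<Rightarrow> 'v \<Rightarrow> 'v"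
  vzero :: "'m \<Rightarrow> 'v"

record ('v, 'm) vbundle = "('v, 'm) vfamily" +
  vbase :: "'m manifold"
  vproj :: "'v \<Rightarrow> 'm"
  vrank :: nat

definition local_trivialization ::
    "('v, 'm) vbundle \<Rightarrow> 'm set \<Rightarrow> ('v \<Rightarrow> nat \<Rightarrow> real) \<Rightarrow> bool" where
  "local_trivialization B U \<Psi> \<longleftrightarrow>
     openin (mtop (vbase B)) U \<and>
     (\<forall>x\<in>U. bij_betw \<Psi> (vfib B x) (topspace (Euclidean_space (vrank B))) \<and>
        (\<forall>v\<in>vfib B x. \<forall>w\<in>vfib B x. \<forall>i. \<Psi> (vadd B v w) i = \<Psi> v i + \<Psi> w i) \<and>
        (\<forall>r. \<forall>v\<in>vfib B x. \<forall>i. \<Psi> (vscale B r v) i = r * \<Psi> v i)) \<and>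
     smooth_on (vtotal B) (\<Union>x\<in>U. vfib B x)
       (prod_manifold (vbase B) (euclid (vrank B))) (\<lambda>v. (vproj B v, \<Psi> v)) \<and>
     smooth_on (prod_manifold (vbase B) (euclid (vrank B)))
       (U \<times> topspace (Euclidean_space (vrank B))) (vtotal B)
       (\<lambda>(x, a). inv_into (vfib B x) \<Psi> a)"

definition vector_bundle :: "('v, 'm) vbundle \<Rightarrow> bool" where
  "vector_bundle B \<longleftrightarrow>
     is_manifold (vtotal B) \<and> is_manifold (vbase B) \<and>
     smooth_on (vtotal B) (points (vtotal B)) (vbase B) (vproj B) \<and>
     (\<forall>x\<in>points (vbase B).
        vfib B x = {v \<in> points (vtotal B). vproj B v = x} \<and>
        real_vs (vfib B x) (vadd B) (vscale B) (vzero B x) \<and>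
        (\<exists>U \<Psi>. x \<in> U \<and> local_trivialization B U \<Psi>))"

definition vb_morphism ::
    "('v, 'm) vbundle \<Rightarrow> ('w, 'n) vbundle \<Rightarrow> ('v \<Rightarrow> 'w) \<Rightarrow> ('m \<Rightarrow> 'n) \<Rightarrow> bool" where
  "vb_morphism A B F f \<longleftrightarrow>
     smooth_on (vtotal A) (points (vtotal A)) (vtotal B) F \<and>
     smooth_on (vbase A) (points (vbase A)) (vbase B) f \<and>
     (\<forall>v\<in>points (vtotal A). vproj B (F v) = f (vproj A v)) \<and>
     (\<forall>x\<in>points (vbase A). \<forall>v\<in>vfib A x.
        (\<forall>w\<in>vfib A x. F (vadd A v w) = vadd B (F v) (F w)) \<and>
        (\<forall>r. F (vscale A r v) = vscale B r (F v)))"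

text \<open>
  The dual of a vector space \<open>vfib B x\<close>; an element of the dual bundle is a pair of a base point and
  a linear functional on the fibre over it, \<^const>\<open>undefined\<close> outside that fibre.
\<close>

definition dual_fib :: "('v, 'm, 'z) vfamily_scheme \<Rightarrow> 'm \<Rightarrow> ('v \<Rightarrow> real) set" where
  "dual_fib B x = {\<xi> \<in> extensional (vfib B x).
     (\<forall>v\<in>vfib B x. \<forall>w\<in>vfib B x. \<xi> (vadd B v w) = \<xi> v + \<xi> w) \<and>
     (\<forall>r. \<forall>v\<in>vfib B x. \<xi> (vscale B r v) = r * \<xi> v)}"

definition dual_zero :: "('v, 'm, 'z) vfamily_scheme \<Rightarrow> 'm \<Rightarrow> 'm \<times> ('v \<Rightarrow> real)" where
  "dual_zero B x = (x, \<lambda>v\<in>vfib B x. 0)"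

definition dual_add :: "('v, 'm, 'z) vfamily_scheme \<Rightarrow>
    'm \<times> ('v \<Rightarrow> real) \<Rightarrow> 'm \<times> ('v \<Rightarrow> real) \<Rightarrow> 'm \<times> ('v \<Rightarrow> real)" where
  "dual_add B \<xi> \<eta> = (fst \<xi>, \<lambda>v\<in>vfib B (fst \<xi>). snd \<xi> v + snd \<eta> v)"

definition dual_scale :: "('v, 'm, 'z) vfamily_scheme \<Rightarrow>
    real \<Rightarrow> 'm \<times> ('v \<Rightarrow> real) \<Rightarrow> 'm \<times> ('v \<Rightarrow> real)" where
  "dual_scale B r \<xi> = (fst \<xi>, \<lambda>v\<in>vfib B (fst \<xi>). r * snd \<xi> v)"

text \<open>
  Total space of the dual bundle. Over the common domain of a chart and a local trivialization,
  the fibre coordinates of a functional are its values on the frame given by the trivialization.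
\<close>

definition dual_manifold :: "('v, 'm) vbundle \<Rightarrow> ('m \<times> ('v \<Rightarrow> real)) manifold" where
  "dual_manifold B =
     \<lparr>points = {(x, \<xi>). x \<in> points (vbase B) \<and> \<xi> \<in> dual_fib B x},
      mdim = mdim (vbase B) + vrank B,
      atlas = {({(x, \<xi>). x \<in> U \<inter> V \<and> \<xi> \<in> dual_fib B x},
                \<lambda>(x, \<xi>) j. if j < mdim (vbase B) then \<phi> x j
                            else if j < mdim (vbase B) + vrank B
                            then \<xi> (inv_into (vfib B x) \<Psi> (\<lambda>i. if i = j - mdim (vbase B) then 1 else 0))
                            else 0) | U \<phi> V \<Psi>.
                 (U, \<phi>) \<in> atlas (vbase B) \<and> local_trivialization B V \<Psi>}\<rparr>"

section \<open>Lie groupoids\<close>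

record ('g, 'm) groupoid =
  arrows :: "'g manifold"
  objects :: "'m manifold"
  src :: "'g \<Rightarrow> 'm"
  tgt :: "'g \<Rightarrow> 'm"
  unit :: "'m \<Rightarrow> 'g"
  mul :: "'g \<Rightarrow> 'g \<Rightarrow> 'g"
  ginv :: "'g \<Rightarrow> 'g"

definition composable_pairs :: "('g, 'm) groupoid \<Rightarrow> ('g \<times> 'g) set" where
  "composable_pairs G =
     {(g, h). g \<in> points (arrows G) \<and> h \<in> points (arrows G) \<and> src G g = tgt G h}"

definition lie_groupoid :: "('g, 'm) groupoid \<Rightarrow> bool" where
  "lie_groupoid G \<longleftrightarrow>
     is_manifold (arrows G) \<and> is_manifold (objects G) \<and>
     submersion (arrows G) (objects G) (src G) \<and>
     submersion (arrows G) (objects G) (tgt G) \<and>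
     smooth_on (objects G) (points (objects G)) (arrows G) (unit G) \<and>
     smooth_on (prod_manifold (arrows G) (arrows G)) (composable_pairs G) (arrows G)
       (\<lambda>(g, h). mul G g h) \<and>
     smooth_on (arrows G) (points (arrows G)) (arrows G) (ginv G) \<and>
     (\<forall>(g, h) \<in> composable_pairs G.
        src G (mul G g h) = src G h \<and> tgt G (mul G g h) = tgt G g) \<and>
     (\<forall>g h k. (g, h) \<in> composable_pairs G \<and> (h, k) \<in> composable_pairs G \<longrightarrow>
        mul G (mul G g h) k = mul G g (mul G h k)) \<and>
     (\<forall>x\<in>points (objects G). src G (unit G x) = x \<and> tgt G (unit G x) = x) \<and>
     (\<forall>g\<in>points (arrows G).
        mul G (unit G (tgt G g)) g = g \<and> mul G g (unit G (src G g)) = g \<and>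
        src G (ginv G g) = tgt G g \<and> tgt G (ginv G g) = src G g \<and>
        mul G g (ginv G g) = unit G (tgt G g) \<and> mul G (ginv G g) g = unit G (src G g))"

definition lie_groupoid_morphism ::
    "('h, 'n) groupoid \<Rightarrow> ('g, 'm) groupoid \<Rightarrow> ('h \<Rightarrow> 'g) \<Rightarrow> ('n \<Rightarrow> 'm) \<Rightarrow> bool" where
  "lie_groupoid_morphism H G F f \<longleftrightarrow>
     smooth_on (arrows H) (points (arrows H)) (arrows G) F \<and>
     smooth_on (objects H) (points (objects H)) (objects G) f \<and>
     (\<forall>h\<in>points (arrows H). src G (F h) = f (src H h) \<and> tgt G (F h) = f (tgt H h)) \<and>
     (\<forall>x\<in>points (objects H). F (unit H x) = unit G (f x)) \<and>
     (\<forall>(h, k) \<in> composable_pairs H. F (mul H h k) = mul G (F h) (F k))"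

text \<open>
  The spaces \<open>G\<^sup>(\<^sup>p\<^sup>)\<close>, indexed by all integers \<open>p\<close> (empty for \<open>p < 0\<close>) so that the degree shift below
  is total.
\<close>

datatype ('m, 'g) nerve_point = Obj 'm | Arr "'g list"

definition chains :: "('g, 'm) groupoid \<Rightarrow> nat \<Rightarrow> 'g list set" where
  "chains G p = {gs. length gs = p \<and> set gs \<subseteq> points (arrows G) \<and>
     (\<forall>i. Suc i < p \<longrightarrow> src G (gs ! i) = tgt G (gs ! Suc i))}"

definition nerve :: "('g, 'm) groupoid \<Rightarrow> int \<Rightarrow> ('m, 'g) nerve_point set" where
  "nerve G p = (if p < 0 then {} else if p = 0 then Obj ` points (objects G)
                else Arr ` chains G (nat p))"

fun left_end :: "('g, 'm) groupoid \<Rightarrow> ('m, 'g) nerve_point \<Rightarrow> 'm" where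
  "left_end G (Obj x) = x"
| "left_end G (Arr gs) = tgt G (hd gs)"

text \<open>
  The first \<open>p\<close> arrows of a chain, and what remains after removing them; if no arrow is left
  the result is the left end, respectively the right end, of the chain.
\<close>

fun left_part :: "('g, 'm) groupoid \<Rightarrow> nat \<Rightarrow> ('m, 'g) nerve_point \<Rightarrow> ('m, 'g) nerve_point" where
  "left_part G p (Obj x) = Obj x"
| "left_part G p (Arr gs) = (if p = 0 then Obj (tgt G (hd gs)) else Arr (take p gs))"

fun right_part :: "('g, 'm) groupoid \<Rightarrow> nat \<Rightarrow> ('m, 'g) nerve_point \<Rightarrow> ('m, 'g) nerve_point" where
  "right_part G p (Obj x) = Obj x"
| "right_part G p (Arr gs) = (if p = length gs then Obj (src G (last gs)) else Arr (drop p gs))"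

section \<open>Graded algebras and graded right modules\<close>

record 'a graded_space =
  hcomp :: "int \<Rightarrow> 'a set"
  gadd :: "int \<Rightarrow> 'a \<Rightarrow> 'a \<Rightarrow> 'a"
  gscale :: "int \<Rightarrow> real \<Rightarrow> 'a \<Rightarrow> 'a"

record 'r graded_alg = "'r graded_space" +
  gmul :: "int \<Rightarrow> int \<Rightarrow> 'r \<Rightarrow> 'r \<Rightarrow> 'r"
  gone :: 'r

text \<open>\<open>gact M p q\<close> is the action of elements of degree \<open>q\<close> on elements of degree \<open>p\<close>.\<close>

record ('a, 'r) graded_mod = "'a graded_space" +
  gact :: "int \<Rightarrow> int \<Rightarrow> 'a \<Rightarrow> 'r \<Rightarrow> 'a"

definition is_graded_space :: "('a, 'z) graded_space_scheme \<Rightarrow> bool" where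
  "is_graded_space S \<longleftrightarrow> (\<forall>p. \<exists>z. real_vs (hcomp S p) (gadd S p) (gscale S p) z)"

definition graded_algebra :: "'r graded_alg \<Rightarrow> bool" where
  "graded_algebra R \<longleftrightarrow>
     is_graded_space R \<and> gone R \<in> hcomp R 0 \<and>
     (\<forall>p q. \<forall>a\<in>hcomp R p. \<forall>b\<in>hcomp R q.
        gmul R p q a b \<in> hcomp R (p + q) \<and>
        (\<forall>a'\<in>hcomp R p. gmul R p q (gadd R p a a') b
            = gadd R (p + q) (gmul R p q a b) (gmul R p q a' b)) \<and>
        (\<forall>b'\<in>hcomp R q. gmul R p q a (gadd R q b b')
            = gadd R (p + q) (gmul R p q a b) (gmul R p q a b')) \<and>
        (\<forall>r. gmul R p q (gscale R p r a) b = gscale R (p + q) r (gmul R p q a b) \<and>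
             gmul R p q a (gscale R q r b) = gscale R (p + q) r (gmul R p q a b)) \<and>
        (\<forall>s. \<forall>c\<in>hcomp R s. gmul R (p + q) s (gmul R p q a b) c
            = gmul R p (q + s) a (gmul R q s b c))) \<and>
     (\<forall>p. \<forall>a\<in>hcomp R p. gmul R 0 p (gone R) a = a \<and> gmul R p 0 a (gone R) = a)"

definition graded_right_module :: "'r graded_alg \<Rightarrow> ('a, 'r) graded_mod \<Rightarrow> bool" where
  "graded_right_module R M \<longleftrightarrow>
     graded_algebra R \<and> is_graded_space M \<and>
     (\<forall>p q. \<forall>x\<in>hcomp M p. \<forall>a\<in>hcomp R q.
        gact M p q x a \<in> hcomp M (p + q) \<and>
        (\<forall>y\<in>hcomp M p. gact M p q (gadd M p x y) a
            = gadd M (p + q) (gact M p q x a) (gact M p q y a)) \<and>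
        (\<forall>b\<in>hcomp R q. gact M p q x (gadd R q a b)
            = gadd M (p + q) (gact M p q x a) (gact M p q x b)) \<and>
        (\<forall>r. gact M p q (gscale M p r x) a = gscale M (p + q) r (gact M p q x a) \<and>
             gact M p q x (gscale R q r a) = gscale M (p + q) r (gact M p q x a)) \<and>
        (\<forall>s. \<forall>b\<in>hcomp R s. gact M (p + q) s (gact M p q x a) b
            = gact M p (q + s) x (gmul R q s a b))) \<and>
     (\<forall>p. \<forall>x\<in>hcomp M p. gact M p 0 x (gone R) = x)"

definition graded_right_module_iso ::
    "'r graded_alg \<Rightarrow> ('a, 'r) graded_mod \<Rightarrow> ('b, 'r) graded_mod \<Rightarrow> (int \<Rightarrow> 'a \<Rightarrow> 'b) \<Rightarrow> bool" where
  "graded_right_module_iso R M N \<Theta> \<longleftrightarrow>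
     graded_right_module R M \<and> graded_right_module R N \<and>
     (\<forall>p. bij_betw (\<Theta> p) (hcomp M p) (hcomp N p) \<and>
        (\<forall>x\<in>hcomp M p.
           (\<forall>y\<in>hcomp M p. \<Theta> p (gadd M p x y) = gadd N p (\<Theta> p x) (\<Theta> p y)) \<and>
           (\<forall>r. \<Theta> p (gscale M p r x) = gscale N p r (\<Theta> p x)) \<and>
           (\<forall>q. \<forall>a\<in>hcomp R q. \<Theta> (p + q) (gact M p q x a) = gact N p q (\<Theta> p x) a)))"

definition shift :: "int \<Rightarrow> ('a, 'r) graded_mod \<Rightarrow> ('a, 'r) graded_mod" where
  "shift k M = \<lparr>hcomp = (\<lambda>p. hcomp M (p + k)), gadd = (\<lambda>p. gadd M (p + k)),
                gscale = (\<lambda>p. gscale M (p + k)), gact = (\<lambda>p. gact M (p + k))\<rparr>"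

definition direct_sum ::
    "('a, 'r) graded_mod \<Rightarrow> ('b, 'r) graded_mod \<Rightarrow> ('a \<times> 'b, 'r) graded_mod" where
  "direct_sum M N =
     \<lparr>hcomp = (\<lambda>p. hcomp M p \<times> hcomp N p),
      gadd = (\<lambda>p (a, b) (a', b'). (gadd M p a a', gadd N p b b')),
      gscale = (\<lambda>p r (a, b). (gscale M p r a, gscale N p r b)),
      gact = (\<lambda>p q (a, b) f. (gact M p q a f, gact N p q b f))\<rparr>"

section \<open>Cochains with values in a vector bundle\<close>

definition smooth_cochain ::
    "('g, 'm) groupoid \<Rightarrow> 'v manifold \<Rightarrow> int \<Rightarrow> (('m, 'g) nerve_point \<Rightarrow> 'v) \<Rightarrow> bool" where
  "smooth_cochain G T p \<omega> \<longleftrightarrow>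
     (p = 0 \<longrightarrow> smooth_on (objects G) (points (objects G)) T (\<lambda>x. \<omega> (Obj x))) \<and>
     (p > 0 \<longrightarrow> smooth_on (power_manifold (arrows G) (nat p)) (chains G (nat p)) T
                  (\<lambda>gs. \<omega> (Arr gs)))"

text \<open>For \<open>p < 0\<close> the following is the zero space, with \<^term>\<open>\<lambda>_. undefined\<close> as its only element.\<close>

definition cochains :: "('g, 'm) groupoid \<Rightarrow> ('v, 'm, 'z) vfamily_scheme \<Rightarrow> int \<Rightarrow>
    (('m, 'g) nerve_point \<Rightarrow> 'v) set" where
  "cochains G B p = {\<omega> \<in> extensional (nerve G p).
     (\<forall>\<sigma>\<in>nerve G p. \<omega> \<sigma> \<in> vfib B (left_end G \<sigma>)) \<and> smooth_cochain G (vtotal B) p \<omega>}"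

definition cochain_zero :: "('g, 'm) groupoid \<Rightarrow> ('v, 'm, 'z) vfamily_scheme \<Rightarrow> int \<Rightarrow>
    ('m, 'g) nerve_point \<Rightarrow> 'v" where
  "cochain_zero G B p = (\<lambda>\<sigma>\<in>nerve G p. vzero B (left_end G \<sigma>))"

text \<open>
  The case distinction in \<open>gact\<close> only concerns the zero spaces in negative degrees: a product with
  an element of one of them is zero, also when it has degree at least \<open>0\<close>.
\<close>

definition cochain_module :: "('g, 'm) groupoid \<Rightarrow> ('v, 'm, 'z) vfamily_scheme \<Rightarrow>
    (('m, 'g) nerve_point \<Rightarrow> 'v, ('m, 'g) nerve_point \<Rightarrow> real) graded_mod" where
  "cochain_module G B =
     \<lparr>hcomp = cochains G B,
      gadd = (\<lambda>p \<omega> \<eta>. \<lambda>\<sigma>\<in>nerve G p. vadd B (\<omega> \<sigma>) (\<eta> \<sigma>)),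
      gscale = (\<lambda>p r \<omega>. \<lambda>\<sigma>\<in>nerve G p. vscale B r (\<omega> \<sigma>)),
      gact = (\<lambda>p q \<omega> f. if p < 0 \<or> q < 0 then cochain_zero G B (p + q)
                else (\<lambda>\<sigma>\<in>nerve G (p + q).
                        vscale B (f (right_part G (nat p) \<sigma>)) (\<omega> (left_part G (nat p) \<sigma>))))\<rparr>"

definition real_family :: "(real, 'm) vfamily" where
  "real_family = \<lparr>vtotal = real_line, vfib = (\<lambda>_. UNIV), vadd = (+), vscale = (*), vzero = (\<lambda>_. 0)\<rparr>"

definition cochain_algebra ::
    "('g, 'm) groupoid \<Rightarrow> (('m, 'g) nerve_point \<Rightarrow> real) graded_alg" where
  "cochain_algebra G =
     \<lparr>hcomp = cochains G real_family,
      gadd = (\<lambda>p f f'. \<lambda>\<sigma>\<in>nerve G p. f \<sigma> + f' \<sigma>),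
      gscale = (\<lambda>p r f. \<lambda>\<sigma>\<in>nerve G p. r * f \<sigma>),
      gmul = (\<lambda>p q f f'. if p < 0 \<or> q < 0 then cochain_zero G real_family (p + q)
                else (\<lambda>\<sigma>\<in>nerve G (p + q). f (left_part G (nat p) \<sigma>) * f' (right_part G (nat p) \<sigma>))),
      gone = (\<lambda>\<sigma>\<in>nerve G 0. 1)\<rparr>"

section \<open>VB-groupoids\<close>

record ('c, 'e, 'g, 'm) vb_groupoid_data =
  big :: "('c, 'e) groupoid"
  small :: "('g, 'm) groupoid"
  big_bundle :: "('c, 'g) vbundle"
  side_bundle :: "('e, 'm) vbundle"

definition vb_groupoid :: "('c, 'e, 'g, 'm) vb_groupoid_data \<Rightarrow> bool" where
  "vb_groupoid V \<longleftrightarrow>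
     (let \<Gamma> = big V; G = small V; Q = big_bundle V; E = side_bundle V in
      lie_groupoid \<Gamma> \<and> lie_groupoid G \<and> vector_bundle Q \<and> vector_bundle E \<and>
      vtotal Q = arrows \<Gamma> \<and> vbase Q = arrows G \<and>
      vtotal E = objects \<Gamma> \<and> vbase E = objects G \<and>
      vb_morphism Q E (src \<Gamma>) (src G) \<and>
      vb_morphism Q E (tgt \<Gamma>) (tgt G) \<and>
      lie_groupoid_morphism \<Gamma> G (vproj Q) (vproj E) \<and>
      (\<forall>\<gamma>1 \<gamma>2 \<gamma>3 \<gamma>4.
         (\<gamma>1, \<gamma>2) \<in> composable_pairs \<Gamma> \<and> (\<gamma>3, \<gamma>4) \<in> composable_pairs \<Gamma> \<and>
         vproj Q \<gamma>1 = vproj Q \<gamma>3 \<and> vproj Q \<gamma>2 = vproj Q \<gamma>4 \<longrightarrow>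
         mul \<Gamma> (vadd Q \<gamma>1 \<gamma>3) (vadd Q \<gamma>2 \<gamma>4) = vadd Q (mul \<Gamma> \<gamma>1 \<gamma>2) (mul \<Gamma> \<gamma>3 \<gamma>4)))"

definition core :: "('c, 'e, 'g, 'm) vb_groupoid_data \<Rightarrow> ('c, 'm) vfamily" where
  "core V =
     \<lparr>vtotal = vtotal (big_bundle V),
      vfib = (\<lambda>x. {c \<in> vfib (big_bundle V) (unit (small V) x).
                     src (big V) c = vzero (side_bundle V) x}),
      vadd = vadd (big_bundle V), vscale = vscale (big_bundle V),
      vzero = (\<lambda>x. vzero (big_bundle V) (unit (small V) x))\<rparr>"

definition horizontal_lift ::
    "('c, 'e, 'g, 'm) vb_groupoid_data \<Rightarrow> ('g \<Rightarrow> 'e \<Rightarrow> 'c) \<Rightarrow> bool" where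
  "horizontal_lift V h \<longleftrightarrow>
     (let \<Gamma> = big V; G = small V; Q = big_bundle V; E = side_bundle V in
      smooth_on (prod_manifold (arrows G) (vtotal E))
        {(g, e). g \<in> points (arrows G) \<and> e \<in> vfib E (src G g)} (vtotal Q) (\<lambda>(g, e). h g e) \<and>
      (\<forall>g\<in>points (arrows G). \<forall>e\<in>vfib E (src G g).
         h g e \<in> vfib Q g \<and> src \<Gamma> (h g e) = e \<and>
         (\<forall>e'\<in>vfib E (src G g). h g (vadd E e e') = vadd Q (h g e) (h g e')) \<and>
         (\<forall>r. h g (vscale E r e) = vscale Q r (h g e))) \<and>
      (\<forall>x\<in>points (objects G). \<forall>e\<in>vfib E x. h (unit G x) e = unit \<Gamma> e))"

section \<open>The dual VB-groupoid and VB-cochains\<close>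

definition dual_src :: "('c, 'e, 'g, 'm) vb_groupoid_data \<Rightarrow>
    'g \<times> ('c \<Rightarrow> real) \<Rightarrow> 'm \<times> ('c \<Rightarrow> real)" where
  "dual_src V = (\<lambda>(g, \<xi>). (src (small V) g,
     \<lambda>c \<in> vfib (core V) (src (small V) g).
       - \<xi> (mul (big V) (vzero (big_bundle V) g) (ginv (big V) c))))"

definition dual_tgt :: "('c, 'e, 'g, 'm) vb_groupoid_data \<Rightarrow>
    'g \<times> ('c \<Rightarrow> real) \<Rightarrow> 'm \<times> ('c \<Rightarrow> real)" where
  "dual_tgt V = (\<lambda>(g, \<xi>). (tgt (small V) g,
     \<lambda>c \<in> vfib (core V) (tgt (small V) g).
       \<xi> (mul (big V) c (vzero (big_bundle V) g))))"

definition dual_mul :: "('c, 'e, 'g, 'm) vb_groupoid_data \<Rightarrow>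
    'g \<times> ('c \<Rightarrow> real) \<Rightarrow> 'g \<times> ('c \<Rightarrow> real) \<Rightarrow> 'g \<times> ('c \<Rightarrow> real)" where
  "dual_mul V = (\<lambda>(g1, \<xi>1) (g2, \<xi>2). (mul (small V) g1 g2,
     \<lambda>\<gamma> \<in> vfib (big_bundle V) (mul (small V) g1 g2).
       THE r. \<exists>\<gamma>1 \<in> vfib (big_bundle V) g1. \<exists>\<gamma>2 \<in> vfib (big_bundle V) g2.
         src (big V) \<gamma>1 = tgt (big V) \<gamma>2 \<and> mul (big V) \<gamma>1 \<gamma>2 = \<gamma> \<and> r = \<xi>1 \<gamma>1 + \<xi>2 \<gamma>2))"

definition dual_nerve :: "('c, 'e, 'g, 'm) vb_groupoid_data \<Rightarrow> int \<Rightarrow> ('g \<times> ('c \<Rightarrow> real)) list set" where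
  "dual_nerve V p = {\<xi>s. p > 0 \<and> length \<xi>s = nat p \<and>
     set \<xi>s \<subseteq> points (dual_manifold (big_bundle V)) \<and>
     (\<forall>i. Suc i < nat p \<longrightarrow> dual_src V (\<xi>s ! i) = dual_tgt V (\<xi>s ! Suc i))}"

text \<open>For positive \<open>p\<close>; the degree \<open>0\<close> case is treated separately as sections of the core.\<close>

definition linear_cochains ::
    "('c, 'e, 'g, 'm) vb_groupoid_data \<Rightarrow> int \<Rightarrow> (('g \<times> ('c \<Rightarrow> real)) list \<Rightarrow> real) set" where
  "linear_cochains V p = {\<phi> \<in> extensional (dual_nerve V p).
     smooth_on (power_manifold (dual_manifold (big_bundle V)) (nat p)) (dual_nerve V p)
       real_line \<phi> \<and>
     (\<forall>\<xi>s\<in>dual_nerve V p.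
        (\<forall>\<eta>s\<in>dual_nerve V p. map fst \<xi>s = map fst \<eta>s \<longrightarrow>
           \<phi> (map2 (dual_add (big_bundle V)) \<xi>s \<eta>s) = \<phi> \<xi>s + \<phi> \<eta>s) \<and>
        (\<forall>r. \<phi> (map (dual_scale (big_bundle V) r) \<xi>s) = r * \<phi> \<xi>s))}"

definition left_projectable ::
    "('c, 'e, 'g, 'm) vb_groupoid_data \<Rightarrow> int \<Rightarrow> (('g \<times> ('c \<Rightarrow> real)) list \<Rightarrow> real) \<Rightarrow> bool" where
  "left_projectable V p \<phi> \<longleftrightarrow>
     (\<forall>g \<in> points (arrows (small V)). \<forall>\<xi>s.
        dual_zero (big_bundle V) g # \<xi>s \<in> dual_nerve V p \<longrightarrow>
        \<phi> (dual_zero (big_bundle V) g # \<xi>s) = 0) \<and>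
     (\<forall>g \<in> points (arrows (small V)). \<forall>\<xi> \<xi>s.
        \<xi> # \<xi>s \<in> dual_nerve V p \<and>
        dual_tgt V \<xi> = dual_zero (core V) (src (small V) g) \<longrightarrow>
        \<phi> (dual_mul V (dual_zero (big_bundle V) g) \<xi> # \<xi>s) = \<phi> (\<xi> # \<xi>s))"

text \<open>
  VB-cochains of degree \<open>0\<close> are sections of the core, those of positive degree are functions on
  tuples of elements of the dual VB-groupoid.
\<close>

datatype ('m, 'g, 'c) vb_cochain =
  Sect "('m, 'g) nerve_point \<Rightarrow> 'c" | Lin "('g \<times> ('c \<Rightarrow> real)) list \<Rightarrow> real"

definition vb_cochains ::
    "('c, 'e, 'g, 'm) vb_groupoid_data \<Rightarrow> int \<Rightarrow> ('m, 'g, 'c) vb_cochain set" where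
  "vb_cochains V p = (if p = 0 then Sect ` cochains (small V) (core V) 0
                      else Lin ` {\<phi> \<in> linear_cochains V p. left_projectable V p \<phi>})"

definition vb_zero :: "('c, 'e, 'g, 'm) vb_groupoid_data \<Rightarrow> int \<Rightarrow> ('m, 'g, 'c) vb_cochain" where
  "vb_zero V p = (if p = 0 then Sect (cochain_zero (small V) (core V) 0)
                  else Lin (\<lambda>\<xi>s\<in>dual_nerve V p. 0))"

definition vb_add :: "('c, 'e, 'g, 'm) vb_groupoid_data \<Rightarrow> int \<Rightarrow>
    ('m, 'g, 'c) vb_cochain \<Rightarrow> ('m, 'g, 'c) vb_cochain \<Rightarrow> ('m, 'g, 'c) vb_cochain" where
  "vb_add V p \<phi> \<psi> = (case (\<phi>, \<psi>) of
       (Sect a, Sect b) \<Rightarrow> Sect (gadd (cochain_module (small V) (core V)) p a b)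
     | (Lin a, Lin b) \<Rightarrow> Lin (\<lambda>\<xi>s\<in>dual_nerve V p. a \<xi>s + b \<xi>s)
     | _ \<Rightarrow> undefined)"

definition vb_scale :: "('c, 'e, 'g, 'm) vb_groupoid_data \<Rightarrow> int \<Rightarrow> real \<Rightarrow>
    ('m, 'g, 'c) vb_cochain \<Rightarrow> ('m, 'g, 'c) vb_cochain" where
  "vb_scale V p r \<phi> = (case \<phi> of
       Sect a \<Rightarrow> Sect (gscale (cochain_module (small V) (core V)) p r a)
     | Lin a \<Rightarrow> Lin (\<lambda>\<xi>s\<in>dual_nerve V p. r * a \<xi>s))"

text \<open>
  The product \<open>\<phi> \<star> f\<close>. A section \<open>a\<close> of the core is the linear function \<open>\<mu> \<mapsto> \<langle>\<mu>|a\<rangle>\<close> on \<open>C\<^sup>*\<close>; as the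
  left factor of a product of positive degree it is evaluated at the target of the first argument.
\<close>

definition vb_act :: "('c, 'e, 'g, 'm) vb_groupoid_data \<Rightarrow> int \<Rightarrow> int \<Rightarrow>
    ('m, 'g, 'c) vb_cochain \<Rightarrow> (('m, 'g) nerve_point \<Rightarrow> real) \<Rightarrow> ('m, 'g, 'c) vb_cochain" where
  "vb_act V p q \<phi> f =
     (if p < 0 \<or> q < 0 then vb_zero V (p + q)
      else case \<phi> of
        Sect a \<Rightarrow>
          if q = 0 then Sect (gact (cochain_module (small V) (core V)) 0 0 a f)
          else Lin (\<lambda>\<xi>s\<in>dual_nerve V q.
                 (case dual_tgt V (hd \<xi>s) of (x, \<mu>) \<Rightarrow> \<mu> (a (Obj x))) * f (Arr (map fst \<xi>s)))
      | Lin a \<Rightarrow>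
          Lin (\<lambda>\<xi>s\<in>dual_nerve V (p + q).
                 a (take (nat p) \<xi>s) * f (right_part (small V) (nat p) (Arr (map fst \<xi>s)))))"

definition vb_cochain_module :: "('c, 'e, 'g, 'm) vb_groupoid_data \<Rightarrow>
    (('m, 'g, 'c) vb_cochain, ('m, 'g) nerve_point \<Rightarrow> real) graded_mod" where
  "vb_cochain_module V =
     \<lparr>hcomp = vb_cochains V, gadd = vb_add V, gscale = vb_scale V, gact = vb_act V\<rparr>"

section \<open>The components of a VB-cochain\<close>

definition hat :: "('c, 'e, 'g, 'm) vb_groupoid_data \<Rightarrow> int \<Rightarrow>
    (('g \<times> ('c \<Rightarrow> real)) list \<Rightarrow> real) \<Rightarrow> 'g list \<Rightarrow> 'c" where
  "hat V p \<phi> gs = (THE \<gamma>. \<gamma> \<in> vfib (big_bundle V) (hd gs) \<and>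
     (\<forall>\<xi>s \<in> dual_nerve V p. map fst \<xi>s = gs \<longrightarrow> snd (hd \<xi>s) \<gamma> = \<phi> \<xi>s))"

text \<open>
  In degree \<open>1\<close>, \<open>right_part\<close> evaluates \<open>\<phi>\<^sup>E\<close> at \<open>s(g\<^sub>1)\<close>. In degree \<open>0\<close> there is no \<open>\<phi>\<^sup>E\<close>: it is the element of
  the zero space \<open>C\<^sup>-\<^sup>1(G; E)\<close>.
\<close>

definition is_components :: "('c, 'e, 'g, 'm) vb_groupoid_data \<Rightarrow> ('g \<Rightarrow> 'e \<Rightarrow> 'c) \<Rightarrow> int \<Rightarrow>
    ('m, 'g, 'c) vb_cochain \<Rightarrow>
    (('m, 'g) nerve_point \<Rightarrow> 'e) \<times> (('m, 'g) nerve_point \<Rightarrow> 'c) \<Rightarrow> bool" where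
  "is_components V h p \<phi> = (\<lambda>(\<phi>E, \<phi>C).
     \<phi>E \<in> cochains (small V) (side_bundle V) (p - 1) \<and>
     \<phi>C \<in> cochains (small V) (core V) p \<and>
     (case \<phi> of
        Sect a \<Rightarrow> \<phi>C = a
      | Lin a \<Rightarrow> p > 0 \<longrightarrow> (\<forall>gs \<in> chains (small V) (nat p).
          hat V p a gs =
            vadd (big_bundle V)
              (h (hd gs) (\<phi>E (right_part (small V) 1 (Arr gs))))
              (mul (big V) (\<phi>C (Arr gs)) (vzero (big_bundle V) (hd gs))))))"

text \<open>In degree \<open>p\<close> of the shifted complex, that is on VB-cochains of degree \<open>p + 1\<close>.\<close>

definition Theta :: "('c, 'e, 'g, 'm) vb_groupoid_data \<Rightarrow> ('g \<Rightarrow> 'e \<Rightarrow> 'c) \<Rightarrow> int \<Rightarrow>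
    ('m, 'g, 'c) vb_cochain \<Rightarrow>
    (('m, 'g) nerve_point \<Rightarrow> 'e) \<times> (('m, 'g) nerve_point \<Rightarrow> 'c)" where
  "Theta V h p \<phi> = (THE c. is_components V h (p + 1) \<phi> c)"

end

theory Submission
  imports Defs
begin

text \<open>
  Over fixed arrows a VB-cochain depends on \<open>\<xi>\<^sub>1\<close> only, since any two tuples with the same first entry differ by a tuple
  starting with \<open>0\<close>; it is thus pairing with a section \<open>\<phi>\<close>-hat of \<open>\<Gamma>\<close>, and the second condition
  of left projectability says that the \<open>E\<close>-component of \<open>\<phi>\<close>-hat does not see \<open>g\<^sub>1\<close>. Conversely every pair \<open>(\<phi>\<^sup>E, \<phi>\<^sup>C)\<close>
  defines a VB-cochain by this pairing. Smoothness of \<open>\<phi>\<close>-hat is checked by evaluating \<open>\<phi>\<close> on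
  tuples that start with a dual frame and are continued smoothly by means of the lift \<open>h\<close>: given
  \<open>\<xi> \<in> \<Gamma>\<^sup>*\<^sub>g\<close>, let the next functional be \<open>0\<close> on horizontal vectors and the value that composability
  with \<open>\<xi>\<close> forces on the core part.
\<close>

section \<open>Calculus in coordinates\<close>

text \<open>\<open>src\<close> gives the E-component of \<phi>-hat, and translating what is left of
  it by a zero arrow gives the core component, so linearity and smoothness of both come from the
  structure maps. Two facts about these maps need an argument: condition (4) makes the
  multiplication additive only, and linearity of the units comes from the lift, whose value at a
  unit arrow is a unit. Left projectability multiplies by a zero functional on the left; a
  functional with zero dual target factors through \<open>src\<close>, and this makes the product
  explicit (\<open>left_zero\<close>). The E-component depends on the tail of a chain only; it is
  read off, and shown to be smooth, on chains that start with a unit. Spaces of composable tuples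
  are subsets of powers of manifolds without charts of their own, so the calculus is set up for
  smoothness on arbitrary subsets. Since \<open>Theta\<close> is a definite description, its
  components are shown to exist uniquely in every integer degree, where negative degrees are zero
  spaces with a single element.\<close>

lemma continuous_map_Euclidean_subtopology:
  assumes "W \<subseteq> topspace (Euclidean_space n)"
  shows "continuous_map (subtopology (Euclidean_space n) W) euclideanreal f \<longleftrightarrow> continuous_on W f"
proof -
  have "topspace (Euclidean_space n) \<inter> W = W"
    using assms by blast
  then have "subtopology (Euclidean_space n) W = top_of_set W"
    unfolding Euclidean_space_def topspace_Euclidean_space
    by (simp add: subtopology_subtopology euclidean_product_topology)
  then show ?thesis
    by simp
qed

lemma openin_Euclidean_space:
  "openin (Euclidean_space n) W \<longleftrightarrow> openin (top_of_set (topspace (Euclidean_space n))) W"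
  by (simp add: Euclidean_space_def euclidean_product_topology)

text \<open>A basic open set of the product topology is a product of open sets. Coordinates from
  \<open>m\<close> on are kept fixed, so only finitely many radii matter and they have a positive
  minimum.\<close>

lemma box_in_open:
  fixes T :: "(nat \<Rightarrow> real) set"
  assumes "open T" "y \<in> T"
  obtains e where "e > 0"
    "\<And>z. \<lbrakk>\<And>j. j < m \<Longrightarrow> \<bar>z j - y j\<bar> < e; \<And>j. j \<ge> m \<Longrightarrow> z j = y j\<rbrakk> \<Longrightarrow> z \<in> T"
proof -
  have "openin (product_topology (\<lambda>i. euclidean) UNIV) T"
    using assms(1) by (simp add: euclidean_product_topology)
  from product_topology_open_contains_basis[OF this assms(2)] obtain X where
    X: "y \<in> (\<Pi>\<^sub>E i\<in>UNIV. X i)" "\<And>i. open (X i)" "(\<Pi>\<^sub>E i\<in>UNIV. X i) \<subseteq> T"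
    by auto
  have "\<exists>e>0. \<forall>r. \<bar>r - y j\<bar> < e \<longrightarrow> r \<in> X j" for j
  proof -
    have "y j \<in> X j"
      using X(1) by auto
    then show ?thesis
      using X(2)[of j] by (auto simp: open_dist dist_real_def)
  qed
  then obtain d where d: "\<And>j. d j > 0" "\<And>j r. \<bar>r - y j\<bar> < d j \<Longrightarrow> r \<in> X j"
    by metis
  \<comment> \<open>\<open>insert 1\<close> keeps the minimum defined and positive for
    \<open>m = 0\<close>.\<close>
  define e where "e = Min (insert 1 (d ` {..<m}))"
  have "e > 0"
    using d(1) by (auto simp: e_def)
  moreover have "z \<in> T" if "\<And>j. j < m \<Longrightarrow> \<bar>z j - y j\<bar> < e" "\<And>j. j \<ge> m \<Longrightarrow> z j = y j" for z
  proof -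
    have "\<bar>z j - y j\<bar> < d j" for j
    proof (cases "j < m")
      case True
      then have "e \<le> d j"
        by (auto simp: e_def)
      then show ?thesis
        using that(1)[OF True] by linarith
    qed (use that(2) d(1) in auto)
    then have "z \<in> (\<Pi>\<^sub>E i\<in>UNIV. X i)"
      using d(2) by auto
    then show ?thesis
      using X(3) by blast
  qed
  ultimately show ?thesis
    using that by blast
qed

lemma box_in_openin_Euclidean_space:
  assumes "openin (Euclidean_space m) W" "y \<in> W"
  obtains e where "e > 0"
    "\<And>z. \<lbrakk>\<And>j. j < m \<Longrightarrow> \<bar>z j - y j\<bar> < e; z \<in> topspace (Euclidean_space m)\<rbrakk> \<Longrightarrow> z \<in> W"
proof -
  obtain T where T: "open T" "W = topspace (Euclidean_space m) \<inter> T"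
    using assms(1) by (auto simp: openin_Euclidean_space openin_open)
  have y: "y j = 0" if "j \<ge> m" for j
    using assms(2) T(2) that by (auto simp: topspace_Euclidean_space)
  obtain e where "e > 0"
    "\<And>z. \<lbrakk>\<And>j. j < m \<Longrightarrow> \<bar>z j - y j\<bar> < e; \<And>j. j \<ge> m \<Longrightarrow> z j = y j\<rbrakk> \<Longrightarrow> z \<in> T"
    using box_in_open[OF T(1), of y m] assms(2) T(2) by blast
  with T(2) y show ?thesis
    by (intro that[of e]) (auto simp: topspace_Euclidean_space)
qed

lemma continuous_on_box:
  assumes "openin (Euclidean_space m) W" "y \<in> W" "continuous_on W (f :: (nat \<Rightarrow> real) \<Rightarrow> real)" "\<epsilon> > 0"
  obtains e where "e > 0"
    "\<And>z. \<lbrakk>\<And>j. j < m \<Longrightarrow> \<bar>z j - y j\<bar> < e; z \<in> topspace (Euclidean_space m)\<rbrakk>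
        \<Longrightarrow> z \<in> W \<and> \<bar>f z - f y\<bar> < \<epsilon>"
proof -
  have "openin (top_of_set W) (W \<inter> f -` ball (f y) \<epsilon>)"
    using assms(3) open_ball by (simp add: continuous_openin_preimage_gen)
  then have "openin (Euclidean_space m) (W \<inter> f -` ball (f y) \<epsilon>)"
    using assms(1) by (metis openin_Euclidean_space openin_trans)
  moreover have "y \<in> W \<inter> f -` ball (f y) \<epsilon>"
    using assms by auto
  ultimately obtain e where "e > 0" "\<And>z. \<lbrakk>\<And>j. j < m \<Longrightarrow> \<bar>z j - y j\<bar> < e; z \<in> topspace (Euclidean_space m)\<rbrakk>
        \<Longrightarrow> z \<in> W \<inter> f -` ball (f y) \<epsilon>"
    using box_in_openin_Euclidean_space by metis
  then show ?thesis
    by (intro that[of e]) (auto simp: dist_real_def abs_minus_commute)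
qed

text \<open>\<open>k_times_diff\<close> speaks of derivatives at increment 0; the mean value theorem
  needs the derivative along a coordinate line at every point \<open>s\<close> of that line.\<close>

lemma partial_derivative_shift:
  assumes "((\<lambda>t. f ((z(l := s))(l := (z(l := s)) l + t))) has_real_derivative D) (at 0)"
  shows "((\<lambda>s. f (z(l := s))) has_real_derivative D) (at s)"
  using assms DERIV_shift[of "\<lambda>s. f (z(l := s))" D 0 s] by (simp add: add.commute)

text \<open>The curve is moved one coordinate at a time; each step is the mean value theorem.\<close>

lemma chain_rule_partial_derivatives:
  fixes f :: "(nat \<Rightarrow> real) \<Rightarrow> real" and \<gamma> :: "real \<Rightarrow> nat \<Rightarrow> real"
  assumes W: "openin (Euclidean_space m) W" "\<gamma> 0 \<in> W"
    and \<gamma>: "\<And>t j. j \<ge> m \<Longrightarrow> \<gamma> t j = 0"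
    and d: "\<And>j. j < m \<Longrightarrow> ((\<lambda>t. \<gamma> t j) has_real_derivative d j) (at 0)"
    and f': "\<And>j y. j < m \<Longrightarrow> y \<in> W \<Longrightarrow>
        ((\<lambda>t. f (y(j := y j + t))) has_real_derivative f' j y) (at 0)"
    and cont: "\<And>j. j < m \<Longrightarrow> continuous_on W (f' j)"
  shows "((\<lambda>t. f (\<gamma> t)) has_real_derivative (\<Sum>j<m. f' j (\<gamma> 0) * d j)) (at 0)"
proof -
  define y where "y = \<gamma> 0"
  \<comment> \<open>Intermediate point: \<open>l\<close> coordinates are already moved to
    \<open>\<gamma> t\<close>, the others are still at \<open>y\<close>. Consecutive points differ
    in one coordinate only.\<close>
  define z where "z = (\<lambda>l t j. if j < l then \<gamma> t j else y j)"
  have yW: "y \<in> W"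
    using W(2) by (simp add: y_def)
  have y0: "y j = 0" if "j \<ge> m" for j
    using \<gamma> that by (simp add: y_def)
  have lim: "((\<lambda>t. \<gamma> t j) \<longlongrightarrow> y j) (at 0)" if "j < m" for j
    using DERIV_isCont[OF d[OF that]] by (simp add: isCont_def y_def)
  have near: "\<forall>\<^sub>F t in at 0. \<forall>j<m. \<bar>\<gamma> t j - y j\<bar> < e" if "e > 0" for e
  proof -
    have "\<forall>\<^sub>F t in at 0. \<bar>\<gamma> t j - y j\<bar> < e" if "j < m" for j
      using tendstoD[OF lim[OF that] \<open>e > 0\<close>] by (simp add: dist_real_def)
    then have "\<forall>\<^sub>F t in at 0. \<forall>j\<in>{..<m}. \<bar>\<gamma> t j - y j\<bar> < e"
      by (intro eventually_ball_finite) auto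
    then show ?thesis
      by (simp add: lessThan_def)
  qed
  have zE: "(z l t)(k := s) \<in> topspace (Euclidean_space m)" if "k < m" for l t k s
    using \<gamma> y0 that by (auto simp: z_def topspace_Euclidean_space)
  have step: "((\<lambda>t. f (z (Suc l) t) - f (z l t)) has_real_derivative f' l y * d l) (at 0)" if l: "l < m" for l
  proof -
    have zS: "z (Suc l) t = (z l t)(l := \<gamma> t l)" for t
      by (auto simp: z_def fun_eq_iff less_Suc_eq)
    have zl: "(z l t)(l := y l) = z l t" for t
      by (auto simp: z_def)
    \<comment> \<open>Difference quotient in coordinate \<open>l\<close>. The value
      \<open>f' l y\<close> at a vanishing increment makes the factorization in \<open>diff\<close>
      valid for every \<open>t\<close>, also where this coordinate of the curve returns to
      \<open>y l\<close>.\<close>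
    define q where "q = (\<lambda>t. if \<gamma> t l = y l then f' l y
      else (f (z (Suc l) t) - f (z l t)) / (\<gamma> t l - y l))"
    have diff: "f (z (Suc l) t) - f (z l t) = q t * (\<gamma> t l - y l)" for t
      using zS[of t] zl[of t] by (auto simp: q_def)
    have "(q \<longlongrightarrow> f' l y) (at 0)"
    proof (rule tendstoI)
      fix \<epsilon> :: real
      assume "\<epsilon> > 0"
      obtain e where e: "e > 0" "\<And>z. \<lbrakk>\<And>j. j < m \<Longrightarrow> \<bar>z j - y j\<bar> < e; z \<in> topspace (Euclidean_space m)\<rbrakk>
        \<Longrightarrow> z \<in> W \<and> \<bar>f' l z - f' l y\<bar> < \<epsilon>"
        using continuous_on_box[OF W(1) yW cont[OF l] \<open>\<epsilon> > 0\<close>] by metis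
      have "dist (q t) (f' l y) < \<epsilon>" if t: "\<forall>j<m. \<bar>\<gamma> t j - y j\<bar> < e" for t
      proof (cases "\<gamma> t l = y l")
        case True
        then show ?thesis
          using \<open>\<epsilon> > 0\<close> by (simp add: q_def)
      next
        case False
        let ?g = "\<lambda>s. f ((z l t)(l := s))"
        have in_box: "(z l t)(l := s) \<in> W \<and> \<bar>f' l ((z l t)(l := s)) - f' l y\<bar> < \<epsilon>"
          if "\<bar>s - y l\<bar> \<le> \<bar>\<gamma> t l - y l\<bar>" for s
        proof (rule e(2))
          show "\<bar>((z l t)(l := s)) j - y j\<bar> < e" if "j < m" for j
          proof (cases "j = l")
            case True
            then show ?thesis
              using t l \<open>\<bar>s - y l\<bar> \<le> \<bar>\<gamma> t l - y l\<bar>\<close> by (auto dest: le_less_trans)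
          next
            case False
            then show ?thesis
              using t \<open>j < m\<close> e(1) by (simp add: z_def)
          qed
        qed (rule zE[OF l])
        have D: "(?g has_real_derivative f' l ((z l t)(l := s))) (at s)"
          if "\<bar>s - y l\<bar> \<le> \<bar>\<gamma> t l - y l\<bar>" for s
          using f'[OF l] in_box[OF that] by (intro partial_derivative_shift) blast
        \<comment> \<open>The sign of the increment decides the order of the endpoints. In both
          cases the intermediate point stays in the box on which \<open>f' l\<close> is within
          \<epsilon> of \<open>f' l y\<close>.\<close>
        have "\<exists>s. \<bar>s - y l\<bar> \<le> \<bar>\<gamma> t l - y l\<bar> \<and> ?g (\<gamma> t l) - ?g (y l) = (\<gamma> t l - y l) * f' l ((z l t)(l := s))"
        proof (cases "y l < \<gamma> t l")
          case True
          have "\<exists>s>y l. s < \<gamma> t l \<and> ?g (\<gamma> t l) - ?g (y l) = (\<gamma> t l - y l) * f' l ((z l t)(l := s))"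
            by (rule MVT2[OF True], rule D) (use True in auto)
          then obtain s where "s > y l" "s < \<gamma> t l"
            "?g (\<gamma> t l) - ?g (y l) = (\<gamma> t l - y l) * f' l ((z l t)(l := s))"
            by blast
          then show ?thesis
            by (intro exI[of _ s]) auto
        next
          case F: False
          with False have lt: "\<gamma> t l < y l"
            by simp
          have "\<exists>s>\<gamma> t l. s < y l \<and> ?g (y l) - ?g (\<gamma> t l) = (y l - \<gamma> t l) * f' l ((z l t)(l := s))"
            by (rule MVT2[OF lt], rule D) (use lt in auto)
          then obtain s where "s > \<gamma> t l" "s < y l" 
            "?g (y l) - ?g (\<gamma> t l) = (y l - \<gamma> t l) * f' l ((z l t)(l := s))"
            by blast
          then show ?thesis
            by (intro exI[of _ s]) (auto simp: algebra_simps)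
        qed
        then obtain s where s: "\<bar>s - y l\<bar> \<le> \<bar>\<gamma> t l - y l\<bar>"
          "?g (\<gamma> t l) - ?g (y l) = (\<gamma> t l - y l) * f' l ((z l t)(l := s))"
          by blast
        have "q t = f' l ((z l t)(l := s))"
          using s(2) False by (simp add: q_def zS zl)
        then show ?thesis
          using in_box[OF s(1)] by (simp add: dist_real_def)
      qed
      then show "\<forall>\<^sub>F t in at 0. dist (q t) (f' l y) < \<epsilon>"
        using near[OF e(1)] by (rule eventually_mono[rotated])
    qed
    moreover have "((\<lambda>t. (\<gamma> t l - y l) / (t - 0)) \<longlongrightarrow> d l) (at 0)"
      using d[OF l] by (simp add: has_field_derivative_iff y_def)
    ultimately have "((\<lambda>t. q t * ((\<gamma> t l - y l) / (t - 0))) \<longlongrightarrow> f' l y * d l) (at 0)"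
      by (rule tendsto_mult)
    moreover have "\<gamma> 0 l = y l"
      by (simp add: y_def)
    ultimately show ?thesis
      by (simp add: has_field_derivative_iff diff)
  qed
  \<comment> \<open>The one-coordinate steps telescope; the case \<open>l = m\<close> is the claim,
    since \<open>z m t\<close> is the point \<open>\<gamma> t\<close>.\<close>
  have "((\<lambda>t. f (z l t)) has_real_derivative (\<Sum>j<l. f' j y * d j)) (at 0)" if "l \<le> m" for l
    using that
  proof (induction l)
    case 0
    then show ?case
      by (simp add: z_def)
  next
    case (Suc l)
    have "((\<lambda>t. f (z l t) + (f (z (Suc l) t) - f (z l t))) has_real_derivative
        (\<Sum>j<l. f' j y * d j) + f' l y * d l) (at 0)"
      by (intro DERIV_add Suc.IH step) (use Suc.prems in auto)
    then show ?case
      by simp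
  qed
  from this[of m] have "((\<lambda>t. f (z m t)) has_real_derivative (\<Sum>j<m. f' j y * d j)) (at 0)"
    by simp
  moreover have "z m t = \<gamma> t" for t
    using \<gamma> y0 by (auto simp: z_def fun_eq_iff)
  ultimately show ?thesis
    by (simp add: y_def)
qed

text \<open>The recursion at level k+1 mentions level k for the partial derivatives and not for
  \<open>f\<close> itself, so this takes an induction.\<close>

lemma k_times_diff_SucD: "k_times_diff n (Suc k) W f \<Longrightarrow> k_times_diff n k W f"
proof (induction k arbitrary: f)
  case (Suc k)
  have "continuous_map (subtopology (Euclidean_space n) W) euclideanreal f"
    using Suc.prems by (simp only: k_times_diff.simps)
  moreover have "\<exists>f'. (\<forall>x\<in>W. ((\<lambda>t. f (x(i := x i + t))) has_real_derivative f' x) (at 0)) \<and>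
      k_times_diff n k W f'" if "i < n" for i
  proof -
    have "\<exists>f'. (\<forall>x\<in>W. ((\<lambda>t. f (x(i := x i + t))) has_real_derivative f' x) (at 0)) \<and>
      k_times_diff n (Suc k) W f'"
      using Suc.prems that unfolding k_times_diff.simps(2)[of n "Suc k"] by blast
    then show ?thesis
      using Suc.IH by blast
  qed
  ultimately show ?case
    by simp
qed simp

lemma k_times_diff_continuous_on:
  "k_times_diff n k W f \<Longrightarrow> W \<subseteq> topspace (Euclidean_space n) \<Longrightarrow> continuous_on W f"
  by (cases k) (auto simp: continuous_map_Euclidean_subtopology)

lemma k_times_diff_SucI:
  assumes "W \<subseteq> topspace (Euclidean_space n)" "continuous_on W f"
    and "\<And>i. i < n \<Longrightarrow> \<exists>f'. (\<forall>x\<in>W. ((\<lambda>t. f (x(i := x i + t))) has_real_derivative f' x) (at 0)) \<and>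
                 k_times_diff n k W f'"
  shows "k_times_diff n (Suc k) W f"
  using assms by (simp add: continuous_map_Euclidean_subtopology)

lemma k_times_diff_0I:
  assumes "W \<subseteq> topspace (Euclidean_space n)" "continuous_on W f"
  shows "k_times_diff n 0 W f"
  using assms by (simp add: continuous_map_Euclidean_subtopology)

lemma k_times_diff_subset:
  assumes "k_times_diff n k W f" "W' \<subseteq> W" "W \<subseteq> topspace (Euclidean_space n)"
  shows "k_times_diff n k W' f"
  using assms(1)
proof (induction k arbitrary: f)
  case 0
  then have "continuous_on W f"
    using assms(3) by (simp add: continuous_map_Euclidean_subtopology)
  then show ?case
    using assms(2,3) by (intro k_times_diff_0I) (blast intro: continuous_on_subset)+
next
  case (Suc k)
  show ?case
  proof (rule k_times_diff_SucI)
    show "continuous_on W' f"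
      using Suc.prems assms k_times_diff_continuous_on continuous_on_subset by blast
    fix i assume "i < n"
    then obtain f' where "\<forall>x\<in>W. ((\<lambda>t. f (x(i := x i + t))) has_real_derivative f' x) (at 0)"
      "k_times_diff n k W f'"
      using Suc.prems by auto
    then show "\<exists>f'. (\<forall>x\<in>W'. ((\<lambda>t. f (x(i := x i + t))) has_real_derivative f' x) (at 0)) \<and>
                 k_times_diff n k W' f'"
      using Suc.IH assms(2) by blast
  qed (use assms in auto)
qed

lemma k_times_diff_const:
  assumes "W \<subseteq> topspace (Euclidean_space n)"
  shows "k_times_diff n k W (\<lambda>x. c)"
proof (induction k arbitrary: c)
  case 0
  then show ?case
    using assms by (intro k_times_diff_0I) auto
next
  case (Suc k)
  then show ?case
    using assms by (intro k_times_diff_SucI) (auto intro!: exI[of _ "\<lambda>x. 0"])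
qed

lemma k_times_diff_coordinate:
  assumes "W \<subseteq> topspace (Euclidean_space n)"
  shows "k_times_diff n k W (\<lambda>x. x j)"
proof -
  have c: "continuous_on W (\<lambda>x::nat \<Rightarrow> real. x j)"
    by (rule continuous_on_subset[OF continuous_on_product_coordinates]) simp
  show ?thesis
  proof (cases k)
    case 0
    show ?thesis
      using k_times_diff_0I[OF assms c] by (simp only: 0)
  next
    case (Suc k')
    have D: "((\<lambda>t. (x(i := x i + t)) j) has_real_derivative (if i = j then 1 else 0)) (at 0)" for x i
      by (cases "i = j") (auto intro!: derivative_eq_intros)
    then show ?thesis
      unfolding Suc
    proof (intro k_times_diff_SucI assms c)
      fix i
      show "\<exists>f'. (\<forall>x\<in>W. ((\<lambda>t. (x(i := x i + t)) j) has_real_derivative f' x) (at 0)) \<and>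
          k_times_diff n k' W f'"
        by (intro exI[of _ "\<lambda>_. if i = j then 1 else 0"] conjI ballI D k_times_diff_const assms)
    qed
  qed
qed

lemma k_times_diff_add:
  assumes "k_times_diff n k W f" "k_times_diff n k W g" "W \<subseteq> topspace (Euclidean_space n)"
  shows "k_times_diff n k W (\<lambda>x. f x + g x)"
  using assms(1,2)
proof (induction k arbitrary: f g)
  case 0
  then show ?case
    using assms(3) by (intro k_times_diff_0I continuous_on_add) (auto simp: continuous_map_Euclidean_subtopology)
next
  case (Suc k)
  show ?case
  proof (rule k_times_diff_SucI)
    show "continuous_on W (\<lambda>x. f x + g x)"
      using Suc.prems assms(3) by (intro continuous_on_add) (auto simp: continuous_map_Euclidean_subtopology)
    fix i assume i: "i < n"
    obtain f' where f': "\<forall>x\<in>W. ((\<lambda>t. f (x(i := x i + t))) has_real_derivative f' x) (at 0)"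
      "k_times_diff n k W f'"
      using Suc.prems(1) i by auto
    obtain g' where g': "\<forall>x\<in>W. ((\<lambda>t. g (x(i := x i + t))) has_real_derivative g' x) (at 0)"
      "k_times_diff n k W g'"
      using Suc.prems(2) i by auto
    show "\<exists>h'. (\<forall>x\<in>W. ((\<lambda>t. f (x(i := x i + t)) + g (x(i := x i + t))) has_real_derivative h' x) (at 0)) \<and>
                 k_times_diff n k W h'"
      using f' g' Suc.IH by (intro exI[of _ "\<lambda>x. f' x + g' x"]) (auto intro: DERIV_add)
  qed (use assms in auto)
qed

lemma k_times_diff_mult:
  assumes "k_times_diff n k W f" "k_times_diff n k W g" "W \<subseteq> topspace (Euclidean_space n)"
  shows "k_times_diff n k W (\<lambda>x. f x * g x)"
  using assms(1,2)
proof (induction k arbitrary: f g)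
  case 0
  then show ?case
    using assms(3) by (intro k_times_diff_0I continuous_on_mult) (auto simp: continuous_map_Euclidean_subtopology)
next
  case (Suc k)
  show ?case
  proof (rule k_times_diff_SucI)
    show "continuous_on W (\<lambda>x. f x * g x)"
      using Suc.prems assms(3) by (intro continuous_on_mult) (auto simp: continuous_map_Euclidean_subtopology)
    fix i assume i: "i < n"
    obtain f' where f': "\<forall>x\<in>W. ((\<lambda>t. f (x(i := x i + t))) has_real_derivative f' x) (at 0)"
      "k_times_diff n k W f'"
      using Suc.prems(1) i by auto
    obtain g' where g': "\<forall>x\<in>W. ((\<lambda>t. g (x(i := x i + t))) has_real_derivative g' x) (at 0)"
      "k_times_diff n k W g'"
      using Suc.prems(2) i by auto
    have "((\<lambda>t. f (x(i := x i + t)) * g (x(i := x i + t))) has_real_derivative f' x * g x + f x * g' x) (at 0)"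
      if "x \<in> W" for x
      using DERIV_mult[OF f'(1)[rule_format, OF that] g'(1)[rule_format, OF that]]
      by (simp add: algebra_simps)
    \<comment> \<open>In each summand one factor is a derivative of order k and the other an
      original function, which is lowered from order k+1 to k before the induction hypothesis
      applies.\<close>
    moreover have "k_times_diff n k W (\<lambda>x. f' x * g x + f x * g' x)"
      by (intro k_times_diff_add[OF _ _ assms(3)] Suc.IH[OF f'(2) k_times_diff_SucD[OF Suc.prems(2)]]
          Suc.IH[OF k_times_diff_SucD[OF Suc.prems(1)] g'(2)])
    ultimately show "\<exists>h'. (\<forall>x\<in>W. ((\<lambda>t. f (x(i := x i + t)) * g (x(i := x i + t))) has_real_derivative h' x) (at 0)) \<and>
                 k_times_diff n k W h'"
      by (intro exI[of _ "\<lambda>x. f' x * g x + f x * g' x"] conjI ballI)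
  qed (use assms in auto)
qed

lemma k_times_diff_sum:
  assumes "\<And>j. j < m \<Longrightarrow> k_times_diff n k W (f j)" "W \<subseteq> topspace (Euclidean_space n)"
  shows "k_times_diff n k W (\<lambda>x. \<Sum>j<(m::nat). f j x)"
  using assms(1)
proof (induction m)
  case (Suc m)
  then show ?case
    using k_times_diff_add[OF _ _ assms(2), of k "\<lambda>x. \<Sum>j<m. f j x" "f m"] by simp
qed (simp add: k_times_diff_const[OF assms(2)])

text \<open>Induction on \<open>k\<close> for all \<open>f\<close> with \<open>F\<close> fixed: by
  the chain rule the partial derivatives are sums of \<open>f' j (F x) * F' j x\<close>, whose first
  factors are again compositions with \<open>F\<close>, of one order less. The vanishing of the
  coordinates of \<open>F\<close> from \<open>m\<close> on is used for continuity of
  \<open>F\<close> and as a hypothesis of the chain rule.\<close>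

lemma k_times_diff_compose:
  assumes W: "openin (Euclidean_space n) W" and W': "openin (Euclidean_space m) W'"
    and "\<And>j. j < m \<Longrightarrow> k_times_diff n k W (\<lambda>x. F x j)"
    and F: "\<And>x. x \<in> W \<Longrightarrow> F x \<in> W'" "\<And>x j. j \<ge> m \<Longrightarrow> F x j = 0"
    and "k_times_diff m k W' f"
  shows "k_times_diff n k W (\<lambda>x. f (F x))"
proof -
  have WE: "W \<subseteq> topspace (Euclidean_space n)" and WE': "W' \<subseteq> topspace (Euclidean_space m)"
    using W W' openin_subset by auto
  have cont: "continuous_on W (\<lambda>x. f (F x))"
    if "\<And>j. j < m \<Longrightarrow> k_times_diff n k W (\<lambda>x. F x j)" "k_times_diff m k W' f" for k f
  proof (rule continuous_on_compose2[of W' f W F])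
    show "continuous_on W' f"
      using that(2) WE' k_times_diff_continuous_on by blast
    show "continuous_on W F"
    proof (rule continuous_on_coordinatewise_then_product)
      show "continuous_on W (\<lambda>x. F x j)" for j
        using k_times_diff_continuous_on[OF that(1) WE] F(2) by (cases "j < m") auto
    qed
  qed (use F in auto)
  show ?thesis
    using assms(3,6)
  proof (induction k arbitrary: f)
    case 0
    show ?case
      by (rule k_times_diff_0I[OF WE cont[OF 0]])
  next
    case (Suc k)
    have "\<forall>j. \<exists>g. j < m \<longrightarrow> (\<forall>x\<in>W'. ((\<lambda>t. f (x(j := x j + t))) has_real_derivative g x) (at 0)) \<and>
                   k_times_diff m k W' g"
      using Suc.prems(2) unfolding k_times_diff.simps(2) by blast
    from choice[OF this] obtain f' where f': "\<And>j x. j < m \<Longrightarrow> x \<in> W' \<Longrightarrow> ((\<lambda>t. f (x(j := x j + t))) has_real_derivative f' j x) (at 0)"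
      "\<And>j. j < m \<Longrightarrow> k_times_diff m k W' (f' j)"
      by blast
    show ?case
    proof (rule k_times_diff_SucI[OF WE cont[OF Suc.prems]])
      fix i assume i: "i < n"
      have "\<forall>j. \<exists>g. j < m \<longrightarrow> (\<forall>x\<in>W. ((\<lambda>t. F (x(i := x i + t)) j) has_real_derivative g x) (at 0)) \<and>
                   k_times_diff n k W g"
        using Suc.prems(1) i unfolding k_times_diff.simps(2) by blast
      from choice[OF this] obtain F' where F': "\<And>j x. j < m \<Longrightarrow> x \<in> W \<Longrightarrow> ((\<lambda>t. F (x(i := x i + t)) j) has_real_derivative F' j x) (at 0)"
        "\<And>j. j < m \<Longrightarrow> k_times_diff n k W (F' j)"
        by blast
      have "((\<lambda>t. f (F (x(i := x i + t)))) has_real_derivative (\<Sum>j<m. f' j (F x) * F' j x)) (at 0)"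
        if "x \<in> W" for x
      proof -
        have "F (x(i := x i + 0)) \<in> W'"
          using F(1) that by simp
        from chain_rule_partial_derivatives[OF W' this F(2) F'(1)[OF _ that] f'(1)
            k_times_diff_continuous_on[OF f'(2) WE']]
        show ?thesis
          by simp
      qed
      moreover have "k_times_diff n k W (\<lambda>x. \<Sum>j<m. f' j (F x) * F' j x)"
      proof (rule k_times_diff_sum[OF _ WE])
        fix j assume j: "j < m"
        show "k_times_diff n k W (\<lambda>x. f' j (F x) * F' j x)"
          by (rule k_times_diff_mult[OF Suc.IH[OF k_times_diff_SucD[OF Suc.prems(1)] f'(2)[OF j]] F'(2)[OF j] WE])
      qed
      ultimately show "\<exists>h'. (\<forall>x\<in>W. ((\<lambda>t. f (F (x(i := x i + t)))) has_real_derivative h' x) (at 0)) \<and>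
                   k_times_diff n k W h'"
        by (intro exI[of _ "\<lambda>x. \<Sum>j<m. f' j (F x) * F' j x"] conjI ballI)
    qed
  qed
qed

section \<open>Smooth maps between manifolds\<close>

text \<open>\<open>smooth_map n m\<close> constrains only the first \<open>m\<close> coordinates of
  its map, whereas the next map of a composition expects a point of
  \<open>Euclidean_space m\<close>. With the identity as \<sigma> this truncates; with a translation
  as \<sigma> it cuts a block of coordinates out of a chart of a product or a power.\<close>

definition select :: "nat \<Rightarrow> (nat \<Rightarrow> nat) \<Rightarrow> (nat \<Rightarrow> real) \<Rightarrow> nat \<Rightarrow> real" where
  "select m \<sigma> x = (\<lambda>j. if j < m then x (\<sigma> j) else 0)"

lemma select_in_Euclidean_space [simp]: "select m \<sigma> x \<in> topspace (Euclidean_space m)"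
  by (simp add: select_def topspace_Euclidean_space)

lemma select_id [simp]: "x \<in> topspace (Euclidean_space m) \<Longrightarrow> select m (\<lambda>j. j) x = x"
  by (auto simp: select_def topspace_Euclidean_space fun_eq_iff)

lemma select_eqI:
  assumes "y \<in> topspace (Euclidean_space m)" "\<And>i. i < m \<Longrightarrow> y i = x (\<sigma> i)"
  shows "select m \<sigma> x = y"
  using assms by (auto simp: select_def topspace_Euclidean_space fun_eq_iff)

lemma smooth_mapD:
  assumes "smooth_map n m W F"
  shows "openin (Euclidean_space n) W" "W \<subseteq> topspace (Euclidean_space n)"
    "i < m \<Longrightarrow> k_times_diff n k W (\<lambda>x. F x i)"
  using assms openin_subset by (auto simp: smooth_map_def)

lemma smooth_map_subset:
  "smooth_map n m W F \<Longrightarrow> openin (Euclidean_space n) W' \<Longrightarrow> W' \<subseteq> W \<Longrightarrow> smooth_map n m W' F"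
  by (meson k_times_diff_subset smooth_mapD smooth_map_def)

lemma smooth_map_select:
  assumes "\<And>j. j < m \<Longrightarrow> \<sigma> j < n"
  shows "smooth_map n m (topspace (Euclidean_space n)) (select m \<sigma>)"
  unfolding smooth_map_def
proof (intro conjI allI impI)
  fix i k assume "i < m"
  then show "k_times_diff n k (topspace (Euclidean_space n)) (\<lambda>x. select m \<sigma> x i)"
    using k_times_diff_coordinate[of "topspace (Euclidean_space n)" n k "\<sigma> i"] by (simp add: select_def)
qed simp

lemma smooth_map_compose:
  assumes F: "smooth_map n m W F" and G: "smooth_map m k W' G"
  shows "smooth_map n k {x \<in> W. select m (\<lambda>j. j) (F x) \<in> W'} (\<lambda>x. G (select m (\<lambda>j. j) (F x)))"
proof -
  let ?F = "\<lambda>x. select m (\<lambda>j. j) (F x)" and ?E = "\<lambda>n. topspace (Euclidean_space n)"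
  have WE: "W \<subseteq> ?E n"
    using smooth_mapD(2)[OF F] .
  have "continuous_on W ?F"
  proof (rule continuous_on_coordinatewise_then_product)
    show "continuous_on W (\<lambda>x. ?F x j)" for j
      using k_times_diff_continuous_on[OF smooth_mapD(3)[OF F] WE, of j] 
      by (cases "j < m") (auto simp: select_def)
  qed
  then have "openin (top_of_set W) (W \<inter> ?F -` W')"
    using smooth_mapD(1)[OF G] by (intro continuous_openin_preimage[of _ _ "?E m"]) (auto simp: openin_Euclidean_space)
  then have "openin (top_of_set (?E n)) (W \<inter> ?F -` W')"
    using smooth_mapD(1)[OF F] unfolding openin_Euclidean_space by (rule openin_trans)
  moreover have "W \<inter> ?F -` W' = {x \<in> W. ?F x \<in> W'}"
    by auto
  ultimately have op: "openin (Euclidean_space n) {x \<in> W. ?F x \<in> W'}"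
    by (simp add: openin_Euclidean_space)
  show ?thesis
    unfolding smooth_map_def
  proof (intro conjI allI impI op)
    fix i l assume i: "i < k"
    show "k_times_diff n l {x \<in> W. ?F x \<in> W'} (\<lambda>x. G (?F x) i)"
    proof (rule k_times_diff_compose[OF op smooth_mapD(1)[OF G], where F = ?F and f = "\<lambda>x. G x i"])
      fix j assume j: "j < m"
      have "k_times_diff n l {x \<in> W. ?F x \<in> W'} (\<lambda>x. F x j)"
        by (rule k_times_diff_subset[OF smooth_mapD(3)[OF F j] _ WE]) auto
      moreover have "(\<lambda>x. ?F x j) = (\<lambda>x. F x j)"
        using j by (simp add: select_def)
      ultimately show "k_times_diff n l {x \<in> W. ?F x \<in> W'} (\<lambda>x. ?F x j)"
        by (simp only:)
    next
      show "k_times_diff m l W' (\<lambda>x. G x i)"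
        using smooth_mapD(3)[OF G i] .
    next
      show "?F x \<in> W'" if "x \<in> {x \<in> W. ?F x \<in> W'}" for x
        using that by blast
      show "?F x j = 0" if "j \<ge> m" for x j
        using that by (simp add: select_def)
    qed
  qed
qed

lemma smooth_map_compose_select:
  assumes "smooth_map m k W F" "\<And>j. j < m \<Longrightarrow> \<sigma> j < n"
  shows "smooth_map n k {x \<in> topspace (Euclidean_space n). select m \<sigma> x \<in> W} (\<lambda>x. F (select m \<sigma> x))"
  using smooth_map_compose[OF smooth_map_select assms(1), of \<sigma> n] assms(2) by simp

lemma smooth_map_components:
  assumes "\<And>i. i < m \<Longrightarrow> smooth_map n (Suc 0) (W i) (\<lambda>x _. F x i)"
  shows "smooth_map n m (topspace (Euclidean_space n) \<inter> (\<Inter>i<m. W i)) F"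
proof -
  have "openin (Euclidean_space n) (topspace (Euclidean_space n) \<inter> (\<Inter>i<m. W i))"
  \<comment> \<open>For \<open>m = 0\<close> the intersection over the empty index set is the whole
    type, and the factor \<open>topspace\<close> alone makes the domain open.\<close>
  proof (cases "m = 0")
    case False
    then show ?thesis
      using assms by (intro openin_Int openin_INT2) (auto simp: smooth_map_def)
  qed simp
  moreover from this have "k_times_diff n k (topspace (Euclidean_space n) \<inter> (\<Inter>i<m. W i)) (\<lambda>x. F x i)" if "i < m" for i k
    using smooth_mapD(3)[OF smooth_map_subset[OF assms[OF that]], of _ 0 k] that by blast
  ultimately show ?thesis
    by (simp add: smooth_map_def)
qed

lemma smooth_map_component:
  "smooth_map n m W F \<Longrightarrow> i < m \<Longrightarrow> smooth_map n (Suc 0) W (\<lambda>x _. F x i)"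
  by (simp add: smooth_map_def)

text \<open>
  What is left of a manifold when only the smooth compatibility of the charts matters. Unlike
  \<^const>\<open>is_manifold\<close> it passes to products, powers and duals without any topology.
\<close>

definition charted :: "'a manifold \<Rightarrow> bool" where
  "charted M \<longleftrightarrow>
     (\<forall>a\<in>points M. \<exists>U \<phi>. (U, \<phi>) \<in> atlas M \<and> a \<in> U) \<and>
     (\<forall>U \<phi>. (U, \<phi>) \<in> atlas M \<longrightarrow> U \<subseteq> points M) \<and>
     (\<forall>U \<phi> y. (U, \<phi>) \<in> atlas M \<longrightarrow> y \<in> U \<longrightarrow> \<phi> y \<in> topspace (Euclidean_space (mdim M))) \<and>
     (\<forall>U \<phi> U' \<phi>' a. (U, \<phi>) \<in> atlas M \<longrightarrow> (U', \<phi>') \<in> atlas M \<longrightarrow> a \<in> U \<longrightarrow> a \<in> U' \<longrightarrow>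
       (\<exists>W F. \<phi> a \<in> W \<and> smooth_map (mdim M) (mdim M) W F \<and>
         (\<forall>y\<in>U. \<phi> y \<in> W \<longrightarrow> y \<in> U' \<and> (\<forall>i < mdim M. \<phi>' y i = F (\<phi> y) i))))"

lemma chartedD:
  assumes "charted M"
  shows charted_point: "a \<in> points M \<Longrightarrow> \<exists>U \<phi>. (U, \<phi>) \<in> atlas M \<and> a \<in> U"
    and charted_domain: "(U, \<phi>) \<in> atlas M \<Longrightarrow> U \<subseteq> points M"
    and charted_range: "(U, \<phi>) \<in> atlas M \<Longrightarrow> y \<in> U \<Longrightarrow> \<phi> y \<in> topspace (Euclidean_space (mdim M))"
    and charted_transition: "(U, \<phi>) \<in> atlas M \<Longrightarrow> (U', \<phi>') \<in> atlas M \<Longrightarrow> a \<in> U \<Longrightarrow> a \<in> U' \<Longrightarrow>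
      \<exists>W F. \<phi> a \<in> W \<and> smooth_map (mdim M) (mdim M) W F \<and>
        (\<forall>y\<in>U. \<phi> y \<in> W \<longrightarrow> y \<in> U' \<and> (\<forall>i < mdim M. \<phi>' y i = F (\<phi> y) i))"
  using assms unfolding charted_def by blast+

lemma is_manifold_imp_charted:
  assumes "is_manifold M"
  shows "charted M"
  unfolding charted_def
proof (intro conjI allI impI ballI)
  have *: "(\<Union>(U, \<phi>) \<in> atlas M. U) = points M"
    using assms by (simp add: is_manifold_def)
  show "\<exists>U \<phi>. (U, \<phi>) \<in> atlas M \<and> a \<in> U" if "a \<in> points M" for a
    using that unfolding *[symmetric] by auto
  show "U \<subseteq> points M" if "(U, \<phi>) \<in> atlas M" for U \<phi>
    using that unfolding *[symmetric] by auto
next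
  fix U \<phi> y assume "(U, \<phi>) \<in> atlas M" "y \<in> U"
  then have "openin (Euclidean_space (mdim M)) (\<phi> ` U)"
    using assms by (auto simp: is_manifold_def)
  then show "\<phi> y \<in> topspace (Euclidean_space (mdim M))"
    using \<open>y \<in> U\<close> openin_subset by blast
next
  fix U \<phi> U' \<phi>' a assume *: "(U, \<phi>) \<in> atlas M" "(U', \<phi>') \<in> atlas M" "a \<in> U" "a \<in> U'"
  have inj: "inj_on \<phi> U"
    and sm: "smooth_map (mdim M) (mdim M) (\<phi> ` (U \<inter> U')) (\<lambda>x. \<phi>' (inv_into U \<phi> x))"
    using assms * unfolding is_manifold_def by fast+
  \<comment> \<open>Injectivity of the chart turns a statement about coordinates, lying in the image
    of the overlap, into one about the point.\<close>
  have U': "y \<in> U'" if "y \<in> U" "\<phi> y \<in> \<phi> ` (U \<inter> U')" for y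
    using that inj by (auto dest: inj_onD)
  show "\<exists>W F. \<phi> a \<in> W \<and> smooth_map (mdim M) (mdim M) W F \<and>
        (\<forall>y\<in>U. \<phi> y \<in> W \<longrightarrow> y \<in> U' \<and> (\<forall>i < mdim M. \<phi>' y i = F (\<phi> y) i))"
  proof (intro exI conjI ballI allI impI)
    show "\<phi> a \<in> \<phi> ` (U \<inter> U')"
      using * by blast
    show "y \<in> U'" if "y \<in> U" "\<phi> y \<in> \<phi> ` (U \<inter> U')" for y
      by (rule U'[OF that])
    show "\<phi>' y i = \<phi>' (inv_into U \<phi> (\<phi> y)) i" if "y \<in> U" for y i
      using inv_into_f_f[OF inj that] by simp
  qed (rule sm)
qed

text \<open>
  Near \<open>a\<close>, the points of \<open>A\<close> satisfy \<open>P\<close> and the functions \<open>\<lambda>y. g y i\<close> are smooth for \<open>i < m\<close>.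
\<close>

definition smooth_near ::
    "'a manifold \<Rightarrow> 'a set \<Rightarrow> 'a \<Rightarrow> ('a \<Rightarrow> bool) \<Rightarrow> nat \<Rightarrow> ('a \<Rightarrow> nat \<Rightarrow> real) \<Rightarrow> bool" where
  "smooth_near M A a P m g \<longleftrightarrow> (\<exists>U \<phi> W F. (U, \<phi>) \<in> atlas M \<and>
     a \<in> U \<and> \<phi> a \<in> W \<and> smooth_map (mdim M) m W F \<and>
     (\<forall>y \<in> A \<inter> U. \<phi> y \<in> W \<longrightarrow> P y \<and> (\<forall>i<m. g y i = F (\<phi> y) i)))"

lemma bex_pair: "(\<exists>(a, b) \<in> S. P a b) \<longleftrightarrow> (\<exists>a b. (a, b) \<in> S \<and> P a b)"
  by auto

text \<open>The target chart is pulled out in front, so that everything about the source is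
  collected in \<open>smooth_near\<close>. With 0 coordinates, \<open>smooth_near\<close> alone
  expresses that a predicate holds on \<open>A\<close> near \<open>a\<close>.\<close>

lemma smooth_on_iff:
  "smooth_on M A N f \<longleftrightarrow> A \<subseteq> points M \<and> f ` A \<subseteq> points N \<and>
     (\<forall>a\<in>A. \<exists>V \<psi>. (V, \<psi>) \<in> atlas N \<and> smooth_near M A a (\<lambda>y. f y \<in> V) (mdim N) (\<lambda>y. \<psi> (f y)))"
proof -
  have "(\<exists>U \<phi>. X U \<phi> \<and> (\<exists>V \<psi>. Y V \<psi> \<and> (\<exists>W F. P U \<phi> W F \<and> Q U \<phi> W F \<and> R U \<phi> W F \<and> S U \<phi> V \<psi> W F))) \<longleftrightarrow>
      (\<exists>V \<psi>. Y V \<psi> \<and> (\<exists>U \<phi> W F. X U \<phi> \<and> P U \<phi> W F \<and> Q U \<phi> W F \<and> R U \<phi> W F \<and> S U \<phi> V \<psi> W F))"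
    for X Y P Q R S
    by fast
  then show ?thesis
    unfolding smooth_on_def smooth_near_def bex_pair by (intro conj_cong refl ball_cong) 
qed

lemma smooth_nearI:
  assumes "(U, \<phi>) \<in> atlas M" "a \<in> U" "\<phi> a \<in> W" "smooth_map (mdim M) m W F"
    "\<And>y. y \<in> A \<Longrightarrow> y \<in> U \<Longrightarrow> \<phi> y \<in> W \<Longrightarrow> P y"
    "\<And>y i. y \<in> A \<Longrightarrow> y \<in> U \<Longrightarrow> \<phi> y \<in> W \<Longrightarrow> i < m \<Longrightarrow> g y i = F (\<phi> y) i"
  shows "smooth_near M A a P m g"
  unfolding smooth_near_def using assms by blast

lemma smooth_nearE:
  assumes "smooth_near M A a P m g"
  obtains U \<phi> W F where "(U, \<phi>) \<in> atlas M" "a \<in> U" "\<phi> a \<in> W" "smooth_map (mdim M) m W F"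
    "\<And>y. y \<in> A \<Longrightarrow> y \<in> U \<Longrightarrow> \<phi> y \<in> W \<Longrightarrow> P y"
    "\<And>y i. y \<in> A \<Longrightarrow> y \<in> U \<Longrightarrow> \<phi> y \<in> W \<Longrightarrow> i < m \<Longrightarrow> g y i = F (\<phi> y) i"
  using assms unfolding smooth_near_def by blast

text \<open>A transition map moves the witnesses to any other chart around \<open>a\<close>. This
  brings several smoothness statements at one point to a common chart.\<close>

lemma smooth_near_chart:
  assumes M: "charted M" and near: "smooth_near M A a P m g" and U': "(U', \<phi>') \<in> atlas M" "a \<in> U'"
  obtains W F where "\<phi>' a \<in> W" "smooth_map (mdim M) m W F"
    "\<And>y. y \<in> A \<Longrightarrow> y \<in> U' \<Longrightarrow> \<phi>' y \<in> W \<Longrightarrow> P y"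
    "\<And>y i. y \<in> A \<Longrightarrow> y \<in> U' \<Longrightarrow> \<phi>' y \<in> W \<Longrightarrow> i < m \<Longrightarrow> g y i = F (\<phi>' y) i"
proof -
  obtain U \<phi> W F where *: "(U, \<phi>) \<in> atlas M" "a \<in> U" "\<phi> a \<in> W" "smooth_map (mdim M) m W F"
    "\<And>y. y \<in> A \<Longrightarrow> y \<in> U \<Longrightarrow> \<phi> y \<in> W \<Longrightarrow> P y \<and> (\<forall>i<m. g y i = F (\<phi> y) i)"
    using near unfolding smooth_near_def by blast
  obtain W0 T where T: "\<phi>' a \<in> W0" "smooth_map (mdim M) (mdim M) W0 T"
    "\<And>y. y \<in> U' \<Longrightarrow> \<phi>' y \<in> W0 \<Longrightarrow> y \<in> U \<and> (\<forall>i < mdim M. \<phi> y i = T (\<phi>' y) i)"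
    using charted_transition[OF M U'(1) *(1) U'(2) *(2)] by blast
  have sel: "select (mdim M) (\<lambda>j. j) (T (\<phi>' y)) = \<phi> y" if "y \<in> U'" "\<phi>' y \<in> W0" for y
    using T(3)[OF that] charted_range[OF M *(1)] by (auto intro!: select_eqI)
  show ?thesis
  proof (rule that[OF _ smooth_map_compose[OF T(2) *(4)]])
    show "\<phi>' a \<in> {x \<in> W0. select (mdim M) (\<lambda>j. j) (T x) \<in> W}"
      using T(1) *(3) sel[OF U'(2)] by simp
  qed (use * T(3) sel in auto)
qed

lemma smooth_near_mono:
  assumes "smooth_near M A a P m g" "A' \<subseteq> A"
    "\<And>y. y \<in> A' \<Longrightarrow> P y \<Longrightarrow> Q y"
    "\<And>y i. y \<in> A' \<Longrightarrow> P y \<Longrightarrow> i < m \<Longrightarrow> g y i = g' y i"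
  shows "smooth_near M A' a Q m g'"
proof -
  obtain U \<phi> W F where *: "(U, \<phi>) \<in> atlas M" "a \<in> U" "\<phi> a \<in> W" "smooth_map (mdim M) m W F"
    "\<And>y. y \<in> A \<Longrightarrow> y \<in> U \<Longrightarrow> \<phi> y \<in> W \<Longrightarrow> P y"
    "\<And>y i. y \<in> A \<Longrightarrow> y \<in> U \<Longrightarrow> \<phi> y \<in> W \<Longrightarrow> i < m \<Longrightarrow> g y i = F (\<phi> y) i"
    using smooth_nearE[OF assms(1)] by metis
  show ?thesis
  proof (rule smooth_nearI[OF *(1-4)])
    fix y assume "y \<in> A'" "y \<in> U" "\<phi> y \<in> W"
    then have "P y" "y \<in> A"
      using assms(2) *(5) by auto
    then show "Q y"
      using assms(3) \<open>y \<in> A'\<close> by blast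
    show "g' y i = F (\<phi> y) i" if "i < m" for i
      using assms(4)[OF \<open>y \<in> A'\<close> \<open>P y\<close> that] *(6)[OF \<open>y \<in> A\<close> \<open>y \<in> U\<close> \<open>\<phi> y \<in> W\<close> that] by simp
  qed
qed

lemma smooth_near_component:
  "smooth_near M A a P m g \<Longrightarrow> i < m \<Longrightarrow> smooth_near M A a P (Suc 0) (\<lambda>y _. g y i)"
  unfolding smooth_near_def using smooth_map_component by fastforce

text \<open>All witnesses are moved to one chart, where their finitely many domains can be
  intersected.\<close>

lemma smooth_near_components:
  assumes M: "charted M" and a: "a \<in> points M"
    and "\<And>i. i < m \<Longrightarrow> smooth_near M A a (P i) (Suc 0) (\<lambda>y _. g y i)"
  shows "smooth_near M A a (\<lambda>y. \<forall>i<m. P i y) m g"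
proof -
  obtain U \<phi> where U: "(U, \<phi>) \<in> atlas M" "a \<in> U"
    using charted_point[OF M a] by blast
  have "\<exists>W F. i < m \<longrightarrow> \<phi> a \<in> W \<and> smooth_map (mdim M) (Suc 0) W F \<and>
    (\<forall>y. y \<in> A \<longrightarrow> y \<in> U \<longrightarrow> \<phi> y \<in> W \<longrightarrow> P i y \<and> g y i = F (\<phi> y) 0)" for i
  proof (cases "i < m")
    case True
    from smooth_near_chart[OF M assms(3)[OF True] U] show ?thesis
      by (metis zero_less_Suc)
  qed simp
  then obtain W F where WF: "\<And>i. i < m \<Longrightarrow> \<phi> a \<in> W i" "\<And>i. i < m \<Longrightarrow> smooth_map (mdim M) (Suc 0) (W i) (F i)"
    "\<And>i y. i < m \<Longrightarrow> y \<in> A \<Longrightarrow> y \<in> U \<Longrightarrow> \<phi> y \<in> W i \<Longrightarrow> P i y \<and> g y i = F i (\<phi> y) 0"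
    by metis
  have "smooth_map (mdim M) (Suc 0) (W i) (\<lambda>x _. F i x 0)" if "i < m" for i
    using WF(2)[OF that] by (auto simp: smooth_map_def)
  then have "smooth_map (mdim M) m (topspace (Euclidean_space (mdim M)) \<inter> (\<Inter>i<m. W i)) (\<lambda>x i. F i x 0)"
    by (rule smooth_map_components)
  then show ?thesis
    using U WF charted_range[OF M U] by (intro smooth_nearI[OF U]) auto
qed

lemma smooth_near_conj:
  assumes M: "charted M" and "smooth_near M A a P m g" "smooth_near M A a Q k g'"
  shows "smooth_near M A a (\<lambda>y. P y \<and> Q y) m g"
proof -
  obtain U \<phi> W F where *: "(U, \<phi>) \<in> atlas M" "a \<in> U" "\<phi> a \<in> W" "smooth_map (mdim M) m W F"
    "\<And>y. y \<in> A \<Longrightarrow> y \<in> U \<Longrightarrow> \<phi> y \<in> W \<Longrightarrow> P y \<and> (\<forall>i<m. g y i = F (\<phi> y) i)"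
    using assms(2) unfolding smooth_near_def by blast
  obtain W' F' where W': "\<phi> a \<in> W'" "smooth_map (mdim M) k W' F'"
    "\<And>y. y \<in> A \<Longrightarrow> y \<in> U \<Longrightarrow> \<phi> y \<in> W' \<Longrightarrow> Q y"
    using smooth_near_chart[OF M assms(3) *(1,2)] by metis
  have "smooth_map (mdim M) m (W \<inter> W') F"
    using *(4) W'(2) by (intro smooth_map_subset[OF *(4)]) (auto dest: smooth_mapD)
  then show ?thesis
    using * W' by (intro smooth_nearI[OF *(1,2)]) auto
qed

lemma smooth_near_compose:
  assumes "smooth_near M A a P m g" "smooth_map m k W G" "select m (\<lambda>j. j) (g a) \<in> W" "a \<in> A"
  shows "smooth_near M A a (\<lambda>y. P y \<and> select m (\<lambda>j. j) (g y) \<in> W) k (\<lambda>y. G (select m (\<lambda>j. j) (g y)))"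
proof -
  obtain U \<phi> W' F where *: "(U, \<phi>) \<in> atlas M" "a \<in> U" "\<phi> a \<in> W'" "smooth_map (mdim M) m W' F"
    "\<And>y. y \<in> A \<Longrightarrow> y \<in> U \<Longrightarrow> \<phi> y \<in> W' \<Longrightarrow> P y \<and> (\<forall>i<m. g y i = F (\<phi> y) i)"
    using assms(1) unfolding smooth_near_def by blast
  have sel: "select m (\<lambda>j. j) (F (\<phi> y)) = select m (\<lambda>j. j) (g y)" if "y \<in> A" "y \<in> U" "\<phi> y \<in> W'" for y
    using *(5)[OF that] by (auto simp: select_def)
  show ?thesis
    by (rule smooth_nearI[OF *(1,2) _ smooth_map_compose[OF *(4) assms(2)]])
      (use * assms(3,4) sel in auto)
qed

lemma smooth_on_domain: "smooth_on M A N f \<Longrightarrow> A \<subseteq> points M"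
  and smooth_on_image: "smooth_on M A N f \<Longrightarrow> a \<in> A \<Longrightarrow> f a \<in> points N"
  by (auto simp: smooth_on_def)

text \<open>Free choice of the target chart, by composing with a transition map; the companion of
  \<open>smooth_near_chart\<close> for the other side.\<close>

lemma smooth_on_chart:
  assumes N: "charted N" and f: "smooth_on M A N f" and a: "a \<in> A" and V: "(V, \<psi>) \<in> atlas N" "f a \<in> V"
  shows "smooth_near M A a (\<lambda>y. f y \<in> V) (mdim N) (\<lambda>y. \<psi> (f y))"
proof -
  obtain V0 \<psi>0 where V0: "(V0, \<psi>0) \<in> atlas N"
    and near: "smooth_near M A a (\<lambda>y. f y \<in> V0) (mdim N) (\<lambda>y. \<psi>0 (f y))"
    using f a unfolding smooth_on_iff by blast
  have fa: "f a \<in> V0"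
    using near a by (auto simp: smooth_near_def)
  obtain W T where T: "\<psi>0 (f a) \<in> W" "smooth_map (mdim N) (mdim N) W T"
    "\<And>y. y \<in> V0 \<Longrightarrow> \<psi>0 y \<in> W \<Longrightarrow> y \<in> V \<and> (\<forall>i < mdim N. \<psi> y i = T (\<psi>0 y) i)"
    using charted_transition[OF N V0 V(1) fa V(2)] by blast
  have sel: "select (mdim N) (\<lambda>j. j) (\<psi>0 y) = \<psi>0 y" if "y \<in> V0" for y
    using charted_range[OF N V0 that] by simp
  show ?thesis
    by (rule smooth_near_mono[OF smooth_near_compose[OF near T(2) _ a]]) (use T fa sel in auto)
qed

text \<open>The witness for \<open>g\<close> fixes a chart of the middle manifold;
  \<open>smooth_on_chart\<close> expresses \<open>f\<close> in that same chart, and then the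
  coordinate maps compose.\<close>

lemma smooth_on_compose:
  assumes N: "charted N" and f: "smooth_on M A N f" and g: "smooth_on N B P g"
    and AB: "\<And>a. a \<in> A \<Longrightarrow> f a \<in> B"
  shows "smooth_on M A P (\<lambda>x. g (f x))"
  unfolding smooth_on_iff
proof (intro conjI ballI)
  fix a assume a: "a \<in> A"
  obtain V' \<psi>' where V': "(V', \<psi>') \<in> atlas P" "smooth_near N B (f a) (\<lambda>y. g y \<in> V') (mdim P) (\<lambda>y. \<psi>' (g y))"
    using g AB[OF a] unfolding smooth_on_iff by blast
  obtain V \<psi> W G where V: "(V, \<psi>) \<in> atlas N" "f a \<in> V" "\<psi> (f a) \<in> W" "smooth_map (mdim N) (mdim P) W G"
    "\<And>y. y \<in> B \<Longrightarrow> y \<in> V \<Longrightarrow> \<psi> y \<in> W \<Longrightarrow> g y \<in> V' \<and> (\<forall>i<mdim P. \<psi>' (g y) i = G (\<psi> y) i)"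
    using V'(2) unfolding smooth_near_def by blast
  have sel: "select (mdim N) (\<lambda>j. j) (\<psi> y) = \<psi> y" if "y \<in> V" for y
    using charted_range[OF N V(1) that] by simp
  have near: "smooth_near M A a (\<lambda>y. f y \<in> V) (mdim N) (\<lambda>y. \<psi> (f y))"
    by (rule smooth_on_chart[OF N f a V(1,2)])
  have "smooth_near M A a (\<lambda>y. g (f y) \<in> V') (mdim P) (\<lambda>y. \<psi>' (g (f y)))"
    by (rule smooth_near_mono[OF smooth_near_compose[OF near V(4) _ a]]) (use V sel AB in auto)
  then show "\<exists>V \<psi>. (V, \<psi>) \<in> atlas P \<and> smooth_near M A a (\<lambda>y. g (f y) \<in> V) (mdim P) (\<lambda>y. \<psi> (g (f y)))"
    using V'(1) by blast
qed (use assms in \<open>auto simp: smooth_on_iff\<close>)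

lemma smooth_on_cong:
  assumes "smooth_on M A N f" "\<And>x. x \<in> A \<Longrightarrow> f x = g x"
  shows "smooth_on M A N g"
proof -
  have "f ` A = g ` A"
    using assms(2) by auto
  moreover have "smooth_near M A a (\<lambda>y. g y \<in> V) m (\<lambda>y. \<psi> (g y))"
    if "smooth_near M A a (\<lambda>y. f y \<in> V) m (\<lambda>y. \<psi> (f y))" for a V m and \<psi> :: "'b \<Rightarrow> nat \<Rightarrow> real"
    by (rule smooth_near_mono[OF that]) (use assms(2) in auto)
  ultimately show ?thesis
    using assms(1) unfolding smooth_on_iff by fastforce
qed

lemma smooth_on_subset:
  assumes "smooth_on M A N f" "B \<subseteq> A"
  shows "smooth_on M B N f"
proof -
  have "smooth_near M B a P m g" if "smooth_near M A a P m g" for a P m and g :: "'a \<Rightarrow> nat \<Rightarrow> real"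
    by (rule smooth_near_mono[OF that assms(2)]) auto
  then show ?thesis
    using assms unfolding smooth_on_iff by (meson image_mono subset_iff subset_trans)
qed

lemma smooth_on_id:
  assumes "charted M" "A \<subseteq> points M"
  shows "smooth_on M A M (\<lambda>x. x)"
  unfolding smooth_on_iff
proof (intro conjI ballI)
  fix a assume "a \<in> A"
  then obtain U \<phi> where U: "(U, \<phi>) \<in> atlas M" "a \<in> U"
    using charted_point[OF assms(1)] assms(2) by blast
  have "smooth_near M A a (\<lambda>y. y \<in> U) (mdim M) \<phi>"
    by (rule smooth_nearI[OF U _ smooth_map_select[of "mdim M" "\<lambda>j. j"]]) 
      (use charted_range[OF assms(1) U(1)] U in auto)
  with U show "\<exists>V \<psi>. (V, \<psi>) \<in> atlas M \<and> smooth_near M A a (\<lambda>y. y \<in> V) (mdim M) (\<lambda>y. \<psi> y)"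
    by blast
qed (use assms in auto)

lemma smooth_near_const:
  assumes "charted M" "a \<in> points M"
  shows "smooth_near M A a (\<lambda>_. True) m (\<lambda>_. c)"
proof -
  obtain U \<phi> where U: "(U, \<phi>) \<in> atlas M" "a \<in> U"
    using charted_point[OF assms] by blast
  have "smooth_map (mdim M) m (topspace (Euclidean_space (mdim M))) (\<lambda>_. c)"
    by (simp add: smooth_map_def k_times_diff_const)
  then show ?thesis
    using charted_range[OF assms(1) U(1)] U by (intro smooth_nearI[OF U]) auto
qed

lemma smooth_on_const:
  assumes "charted M" "charted N" "A \<subseteq> points M" "c \<in> points N"
  shows "smooth_on M A N (\<lambda>x. c)"
  unfolding smooth_on_iff
proof (intro conjI ballI)
  fix a assume "a \<in> A"
  obtain V \<psi> where V: "(V, \<psi>) \<in> atlas N" "c \<in> V"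
    using charted_point[OF assms(2,4)] by blast
  have "smooth_near M A a (\<lambda>_. c \<in> V) (mdim N) (\<lambda>_. \<psi> c)"
    by (rule smooth_near_mono[OF smooth_near_const]) (use assms V \<open>a \<in> A\<close> in auto)
  with V show "\<exists>V \<psi>. (V, \<psi>) \<in> atlas N \<and> smooth_near M A a (\<lambda>y. c \<in> V) (mdim N) (\<lambda>y. \<psi> c)"
    by blast
qed (use assms in auto)

text \<open>A condition that holds on \<open>A\<close> near \<open>a\<close> cuts out a relatively
  open part, so smoothness near \<open>a\<close> on this part is smoothness near \<open>a\<close> on
  \<open>A\<close>. It serves to localize to domains of charts and trivializations.\<close>

lemma smooth_near_extend:
  assumes M: "charted M" and "smooth_near M {x \<in> A. P x} a Q m g" "smooth_near M A a P 0 (\<lambda>_ _. 0)"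
  shows "smooth_near M A a (\<lambda>y. P y \<and> Q y) m g"
  using assms(2)
proof (rule smooth_nearE)
  fix U \<phi> W F assume U: "(U, \<phi>) \<in> atlas M" "a \<in> U" "\<phi> a \<in> W" "smooth_map (mdim M) m W F"
    "\<And>y. y \<in> {x \<in> A. P x} \<Longrightarrow> y \<in> U \<Longrightarrow> \<phi> y \<in> W \<Longrightarrow> Q y"
    "\<And>y i. y \<in> {x \<in> A. P x} \<Longrightarrow> y \<in> U \<Longrightarrow> \<phi> y \<in> W \<Longrightarrow> i < m \<Longrightarrow> g y i = F (\<phi> y) i"
  obtain W' F' where W': "\<phi> a \<in> W'" "smooth_map (mdim M) 0 W' F'"
    "\<And>y. y \<in> A \<Longrightarrow> y \<in> U \<Longrightarrow> \<phi> y \<in> W' \<Longrightarrow> P y"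
    using smooth_near_chart[OF M assms(3) U(1,2)] by metis
  have "smooth_map (mdim M) m (W \<inter> W') F"
    using U(4) W'(2) by (intro smooth_map_subset[OF U(4)]) (auto dest: smooth_mapD)
  then show "smooth_near M A a (\<lambda>y. P y \<and> Q y) m g"
    using U W' by (intro smooth_nearI[OF U(1,2)]) auto
qed

lemma smooth_on_local:
  assumes M: "charted M" and A: "A \<subseteq> points M"
    and loc: "\<And>a. a \<in> A \<Longrightarrow> \<exists>P. smooth_near M A a P 0 (\<lambda>_ _. 0) \<and> smooth_on M {x \<in> A. P x} N f"
  shows "smooth_on M A N f"
  unfolding smooth_on_iff
proof (intro conjI ballI)
  have *: "\<exists>V \<psi> P. (V, \<psi>) \<in> atlas N \<and> P a \<and> smooth_near M A a P 0 (\<lambda>_ _. 0) \<and> f a \<in> points N \<and>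
    smooth_near M {x \<in> A. P x} a (\<lambda>y. f y \<in> V) (mdim N) (\<lambda>y. \<psi> (f y))" if a: "a \<in> A" for a
  proof -
    obtain P where P: "smooth_near M A a P 0 (\<lambda>_ _. 0)" "smooth_on M {x \<in> A. P x} N f"
      using loc[OF a] by blast
    have "P a"
      using P(1) a unfolding smooth_near_def by blast
    then have "a \<in> {x \<in> A. P x}"
      using a by simp
    with P \<open>P a\<close> show ?thesis
      unfolding smooth_on_iff[of M "{x \<in> A. P x}"] by blast
  qed
  then show "f ` A \<subseteq> points N"
    by blast
  fix a assume a: "a \<in> A"
  obtain V \<psi> P where V: "(V, \<psi>) \<in> atlas N" "P a" "smooth_near M A a P 0 (\<lambda>_ _. 0)"
    "smooth_near M {x \<in> A. P x} a (\<lambda>y. f y \<in> V) (mdim N) (\<lambda>y. \<psi> (f y))"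
    using *[OF a] by blast
  have "smooth_near M A a (\<lambda>y. f y \<in> V) (mdim N) (\<lambda>y. \<psi> (f y))"
    by (rule smooth_near_mono[OF smooth_near_extend[OF M V(4,3)]]) auto
  with V(1) show "\<exists>V \<psi>. (V, \<psi>) \<in> atlas N \<and> smooth_near M A a (\<lambda>y. f y \<in> V) (mdim N) (\<lambda>y. \<psi> (f y))"
    by blast
qed (use A in auto)

text \<open>\<open>mtop\<close> applies \<open>topology\<close> to a family of sets, which yields
  that family as open sets once it is closed under binary intersections and unions. Injectivity of
  the charts lets images commute with the intersections.\<close>

lemma openin_mtop:
  assumes M: "is_manifold M"
  shows "openin (mtop M) S \<longleftrightarrow> S \<subseteq> points M \<and>
    (\<forall>(U, \<phi>) \<in> atlas M. openin (Euclidean_space (mdim M)) (\<phi> ` (S \<inter> U)))"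
proof -
  let ?P = "\<lambda>S. S \<subseteq> points M \<and> (\<forall>(U, \<phi>) \<in> atlas M. openin (Euclidean_space (mdim M)) (\<phi> ` (S \<inter> U)))"
  have "istopology ?P"
    unfolding istopology_def
  proof (intro conjI allI impI)
    fix S T assume ST: "?P S" "?P T"
    show "S \<inter> T \<subseteq> points M"
      using ST by blast
    show "\<forall>(U, \<phi>) \<in> atlas M. openin (Euclidean_space (mdim M)) (\<phi> ` (S \<inter> T \<inter> U))"
    proof clarify
      fix U \<phi> assume "(U, \<phi>) \<in> atlas M"
      then have "inj_on \<phi> U" and "openin (Euclidean_space (mdim M)) (\<phi> ` (S \<inter> U))"
        "openin (Euclidean_space (mdim M)) (\<phi> ` (T \<inter> U))"
        using M ST unfolding is_manifold_def by fast+
      moreover from this(1) have "\<phi> ` (S \<inter> T \<inter> U) = \<phi> ` (S \<inter> U) \<inter> \<phi> ` (T \<inter> U)"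
        by (auto dest: inj_onD)
      ultimately show "openin (Euclidean_space (mdim M)) (\<phi> ` (S \<inter> T \<inter> U))"
        by (simp add: openin_Int)
    qed
  next
    fix K assume K: "\<forall>S\<in>K. ?P S"
    then show "\<Union>K \<subseteq> points M"
      by blast
    show "\<forall>(U, \<phi>) \<in> atlas M. openin (Euclidean_space (mdim M)) (\<phi> ` (\<Union>K \<inter> U))"
    proof clarify
      fix U \<phi> assume U: "(U, \<phi>) \<in> atlas M"
      have "\<phi> ` (\<Union>K \<inter> U) = (\<Union>S\<in>K. \<phi> ` (S \<inter> U))"
        by blast
      moreover have "openin (Euclidean_space (mdim M)) (\<Union>S\<in>K. \<phi> ` (S \<inter> U))"
        by (rule openin_Union) (use K U in blast)
      ultimately show "openin (Euclidean_space (mdim M)) (\<phi> ` (\<Union>K \<inter> U))"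
        by simp
    qed
  qed
  then show ?thesis
    unfolding mtop_def by (simp add: topology_inverse')
qed

lemma smooth_near_open_preimage:
  assumes N: "is_manifold N" and f: "smooth_on M A N f" and V: "openin (mtop N) V" and a: "a \<in> A" "f a \<in> V"
  shows "smooth_near M A a (\<lambda>x. f x \<in> V) 0 (\<lambda>_ _. 0)"
proof -
  note cN = is_manifold_imp_charted[OF N]
  obtain U \<psi> where U: "(U, \<psi>) \<in> atlas N" "f a \<in> U"
    using charted_point[OF cN smooth_on_image[OF f a(1)]] by blast
  \<comment> \<open>Without output coordinates, \<open>smooth_map\<close> just says that the set is
    open, so continuity becomes an instance of \<open>smooth_near_compose\<close>.\<close>
  have op: "smooth_map (mdim N) 0 (\<psi> ` (V \<inter> U)) (\<lambda>_ _. 0)"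
    using V U(1) by (auto simp: smooth_map_def openin_mtop[OF N])
  have inj: "inj_on \<psi> U"
    using N U unfolding is_manifold_def by fast
  have sel: "select (mdim N) (\<lambda>j. j) (\<psi> y) = \<psi> y" if "y \<in> U" for y
    using charted_range[OF cN U(1) that] by simp
  show ?thesis
  proof (rule smooth_near_mono[OF smooth_near_compose[OF smooth_on_chart[OF cN f a(1) U] op _ a(1)]])
    show "select (mdim N) (\<lambda>j. j) (\<psi> (f a)) \<in> \<psi> ` (V \<inter> U)"
      using U a sel by simp
  next
    fix y assume "f y \<in> U \<and> select (mdim N) (\<lambda>j. j) (\<psi> (f y)) \<in> \<psi> ` (V \<inter> U)"
    then show "f y \<in> V"
      using sel[of "f y"] inj by (auto dest: inj_onD)
  qed auto
qed

subsection \<open>Products and powers\<close>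

lemma points_prod_manifold [simp]: "points (prod_manifold M N) = points M \<times> points N"
  and mdim_prod_manifold [simp]: "mdim (prod_manifold M N) = mdim M + mdim N"
  by (auto simp: prod_manifold_def)

definition prod_chart :: "nat \<Rightarrow> ('a \<Rightarrow> nat \<Rightarrow> real) \<Rightarrow> ('b \<Rightarrow> nat \<Rightarrow> real) \<Rightarrow> 'a \<times> 'b \<Rightarrow> nat \<Rightarrow> real" where
  "prod_chart m \<phi> \<psi> = (\<lambda>(x, y) i. if i < m then \<phi> x i else \<psi> y (i - m))"

lemma atlas_prod_manifold:
  "atlas (prod_manifold M N) = {(U \<times> V, prod_chart (mdim M) \<phi> \<psi>) | U \<phi> V \<psi>.
     (U, \<phi>) \<in> atlas M \<and> (V, \<psi>) \<in> atlas N}"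
  by (auto simp: prod_manifold_def prod_chart_def)

lemma select_prod_chart:
  assumes "\<phi> x \<in> topspace (Euclidean_space m)" "\<psi> y \<in> topspace (Euclidean_space n)"
  shows "select m (\<lambda>j. j) (prod_chart m \<phi> \<psi> (x, y)) = \<phi> x"
    "select n (\<lambda>j. m + j) (prod_chart m \<phi> \<psi> (x, y)) = \<psi> y"
    "prod_chart m \<phi> \<psi> (x, y) \<in> topspace (Euclidean_space (m + n))"
  using assms by (auto intro!: select_eqI simp: prod_chart_def) (auto simp: topspace_Euclidean_space prod_chart_def)

lemma smooth_map_prod:
  assumes F: "smooth_map m k W F" and G: "smooth_map n l W' G"
  shows "smooth_map (m + n) (k + l)
    {z \<in> topspace (Euclidean_space (m + n)). select m (\<lambda>j. j) z \<in> W \<and> select n (\<lambda>j. m + j) z \<in> W'}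
    (\<lambda>z i. if i < k then F (select m (\<lambda>j. j) z) i else G (select n (\<lambda>j. m + j) z) (i - k))"
    (is "smooth_map _ _ ?W ?H")
proof -
  let ?E = "topspace (Euclidean_space (m + n))"
  have 1: "smooth_map (m + n) k {z \<in> ?E. select m (\<lambda>j. j) z \<in> W} (\<lambda>z. F (select m (\<lambda>j. j) z))"
    by (rule smooth_map_compose_select[OF F]) auto
  have 2: "smooth_map (m + n) l {z \<in> ?E. select n (\<lambda>j. m + j) z \<in> W'} (\<lambda>z. G (select n (\<lambda>j. m + j) z))"
    by (rule smooth_map_compose_select[OF G]) auto
  have "openin (Euclidean_space (m + n)) ({z \<in> ?E. select m (\<lambda>j. j) z \<in> W} \<inter> {z \<in> ?E. select n (\<lambda>j. m + j) z \<in> W'})"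
    using smooth_mapD(1)[OF 1] smooth_mapD(1)[OF 2] by (rule openin_Int)
  moreover have "{z \<in> ?E. select m (\<lambda>j. j) z \<in> W} \<inter> {z \<in> ?E. select n (\<lambda>j. m + j) z \<in> W'} = ?W"
    by auto
  ultimately have op: "openin (Euclidean_space (m + n)) ?W"
    by simp
  have "k_times_diff (m + n) j ?W (\<lambda>z. ?H z i)" if "i < k + l" for i j
  proof (cases "i < k")
    case True
    then show ?thesis
      using smooth_mapD(3)[OF smooth_map_subset[OF 1 op], of i j] by auto
  next
    case False
    then show ?thesis
      using smooth_mapD(3)[OF smooth_map_subset[OF 2 op], of "i - k" j] that by (simp add: subset_iff)
  qed
  with op show ?thesis
    by (simp add: smooth_map_def)
qed

lemma charted_prod:
  assumes M: "charted M" and N: "charted N"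
  shows "charted (prod_manifold M N)"
  unfolding charted_def
proof (intro conjI)
  show "\<forall>c\<in>points (prod_manifold M N). \<exists>U \<phi>. (U, \<phi>) \<in> atlas (prod_manifold M N) \<and> c \<in> U"
  proof
    fix c assume "c \<in> points (prod_manifold M N)"
    then obtain a b where "c = (a, b)" "a \<in> points M" "b \<in> points N"
      by auto
    moreover from this charted_point[OF M] charted_point[OF N] obtain U \<phi> V \<psi> where
      "(U, \<phi>) \<in> atlas M" "a \<in> U" "(V, \<psi>) \<in> atlas N" "b \<in> V"
      by metis
    ultimately show "\<exists>U \<phi>. (U, \<phi>) \<in> atlas (prod_manifold M N) \<and> c \<in> U"
      unfolding atlas_prod_manifold by blast
  qed
  show "\<forall>U \<phi>. (U, \<phi>) \<in> atlas (prod_manifold M N) \<longrightarrow> U \<subseteq> points (prod_manifold M N)"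
    using charted_domain[OF M] charted_domain[OF N] by (fastforce simp: atlas_prod_manifold)
  show "\<forall>U \<phi> y. (U, \<phi>) \<in> atlas (prod_manifold M N) \<longrightarrow> y \<in> U \<longrightarrow>
      \<phi> y \<in> topspace (Euclidean_space (mdim (prod_manifold M N)))"
    using charted_range[OF M] charted_range[OF N] by (auto simp: atlas_prod_manifold intro!: select_prod_chart(3))
next
  have "\<exists>W F. prod_chart (mdim M) \<phi> \<psi> (a, b) \<in> W \<and> smooth_map (mdim M + mdim N) (mdim M + mdim N) W F \<and>
      (\<forall>y\<in>U \<times> V. prod_chart (mdim M) \<phi> \<psi> y \<in> W \<longrightarrow> y \<in> U' \<times> V' \<and>
         (\<forall>i<mdim M + mdim N. prod_chart (mdim M) \<phi>' \<psi>' y i = F (prod_chart (mdim M) \<phi> \<psi> y) i))"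
    if U: "(U, \<phi>) \<in> atlas M" "(U', \<phi>') \<in> atlas M" "a \<in> U" "a \<in> U'"
    and V: "(V, \<psi>) \<in> atlas N" "(V', \<psi>') \<in> atlas N" "b \<in> V" "b \<in> V'"
    for U V U' V' \<phi> \<phi>' \<psi> \<psi>' a b
  proof -
    obtain W F where F: "\<phi> a \<in> W" "smooth_map (mdim M) (mdim M) W F"
      "\<And>y. y \<in> U \<Longrightarrow> \<phi> y \<in> W \<Longrightarrow> y \<in> U' \<and> (\<forall>i < mdim M. \<phi>' y i = F (\<phi> y) i)"
      using charted_transition[OF M U] by blast
    obtain W' G where G: "\<psi> b \<in> W'" "smooth_map (mdim N) (mdim N) W' G"
      "\<And>y. y \<in> V \<Longrightarrow> \<psi> y \<in> W' \<Longrightarrow> y \<in> V' \<and> (\<forall>i < mdim N. \<psi>' y i = G (\<psi> y) i)"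
      using charted_transition[OF N V] by blast
    have sel: "select (mdim M) (\<lambda>j. j) (prod_chart (mdim M) \<phi> \<psi> (x, y)) = \<phi> x"
      "select (mdim N) (\<lambda>j. mdim M + j) (prod_chart (mdim M) \<phi> \<psi> (x, y)) = \<psi> y"
      "prod_chart (mdim M) \<phi> \<psi> (x, y) \<in> topspace (Euclidean_space (mdim M + mdim N))"
      if "x \<in> U" "y \<in> V" for x y
      using select_prod_chart[of \<phi> x "mdim M" \<psi> y "mdim N"] charted_range[OF M U(1) that(1)]
        charted_range[OF N V(1) that(2)] by simp_all
    have pc: "prod_chart (mdim M) \<phi>' \<psi>' (x, y) i =
        (if i < mdim M then F (\<phi> x) i else G (\<psi> y) (i - mdim M))"
      if "x \<in> U" "y \<in> V" "\<phi> x \<in> W" "\<psi> y \<in> W'" "i < mdim M + mdim N" for x y i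
      using F(3) G(3) that by (simp add: prod_chart_def)
    show ?thesis
      by (rule exI, rule exI, rule conjI[OF _ conjI[OF smooth_map_prod[OF F(2) G(2)]]])
        (use F(1,3) G(1,3) U(3) V(3) pc in \<open>auto simp: sel\<close>)
  qed
  note transition = this
  show "\<forall>U \<phi> U' \<phi>' a. (U, \<phi>) \<in> atlas (prod_manifold M N) \<longrightarrow> (U', \<phi>') \<in> atlas (prod_manifold M N) \<longrightarrow>
      a \<in> U \<longrightarrow> a \<in> U' \<longrightarrow> (\<exists>W F. \<phi> a \<in> W \<and>
        smooth_map (mdim (prod_manifold M N)) (mdim (prod_manifold M N)) W F \<and>
        (\<forall>y\<in>U. \<phi> y \<in> W \<longrightarrow> y \<in> U' \<and> (\<forall>i < mdim (prod_manifold M N). \<phi>' y i = F (\<phi> y) i)))"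
    unfolding atlas_prod_manifold mdim_prod_manifold
  proof (intro allI impI, elim CollectE exE conjE)
    fix S \<Phi> S' \<Phi>' c U \<phi> V \<psi> U' \<phi>' V' \<psi>'
    assume eq: "(S, \<Phi>) = (U \<times> V, prod_chart (mdim M) \<phi> \<psi>)" "(S', \<Phi>') = (U' \<times> V', prod_chart (mdim M) \<phi>' \<psi>')"
      and at: "(U, \<phi>) \<in> atlas M" "(V, \<psi>) \<in> atlas N" "(U', \<phi>') \<in> atlas M" "(V', \<psi>') \<in> atlas N"
      and c: "c \<in> S" "c \<in> S'"
    obtain a b where ab: "c = (a, b)" "a \<in> U" "a \<in> U'" "b \<in> V" "b \<in> V'"
      using c eq by auto
    show "\<exists>W F. \<Phi> c \<in> W \<and> smooth_map (mdim M + mdim N) (mdim M + mdim N) W F \<and>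
        (\<forall>y\<in>S. \<Phi> y \<in> W \<longrightarrow> y \<in> S' \<and> (\<forall>i < mdim M + mdim N. \<Phi>' y i = F (\<Phi> y) i))"
      using transition[OF at(1,3) ab(2,3) at(2,4) ab(4,5)] eq ab(1) by (simp only: prod.inject)
  qed
qed

lemma smooth_on_Pair:
  assumes M: "charted M" and f: "smooth_on M A N f" and g: "smooth_on M A P g"
  shows "smooth_on M A (prod_manifold N P) (\<lambda>x. (f x, g x))"
  unfolding smooth_on_iff
proof (intro conjI ballI)
  fix a assume a: "a \<in> A"
  then have aM: "a \<in> points M"
    using f by (auto simp: smooth_on_iff)
  obtain V \<psi> where V: "(V, \<psi>) \<in> atlas N" "smooth_near M A a (\<lambda>y. f y \<in> V) (mdim N) (\<lambda>y. \<psi> (f y))"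
    using f a unfolding smooth_on_iff by blast
  obtain V' \<psi>' where V': "(V', \<psi>') \<in> atlas P" "smooth_near M A a (\<lambda>y. g y \<in> V') (mdim P) (\<lambda>y. \<psi>' (g y))"
    using g a unfolding smooth_on_iff by blast
  have "smooth_near M A a (\<lambda>y. f y \<in> V \<and> g y \<in> V') (mdim N) (\<lambda>y. \<psi> (f y))"
    by (rule smooth_near_conj[OF M V(2) V'(2)])
  moreover have "smooth_near M A a (\<lambda>y. g y \<in> V' \<and> f y \<in> V) (mdim P) (\<lambda>y. \<psi>' (g y))"
    by (rule smooth_near_conj[OF M V'(2) V(2)])
  ultimately have *: "smooth_near M A a (\<lambda>y. f y \<in> V \<and> g y \<in> V') (Suc 0)
      (\<lambda>y _. prod_chart (mdim N) \<psi> \<psi>' (f y, g y) i)" if "i < mdim N + mdim P" for i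
  proof (cases "i < mdim N")
    case True
    then show ?thesis
      using smooth_near_component[OF smooth_near_conj[OF M V(2) V'(2)] True] by (simp add: prod_chart_def)
  next
    case False
    then show ?thesis
      using smooth_near_component[OF smooth_near_conj[OF M V'(2) V(2)], of "i - mdim N"] that
      by (simp add: prod_chart_def conj_commute)
  qed
  have "smooth_near M A a (\<lambda>y. \<forall>i<mdim N + mdim P. f y \<in> V \<and> g y \<in> V') (mdim N + mdim P)
      (\<lambda>y. prod_chart (mdim N) \<psi> \<psi>' (f y, g y))"
    by (rule smooth_near_components[OF M aM *])
  from smooth_near_conj[OF M this smooth_near_conj[OF M V(2) V'(2)]]
  have "smooth_near M A a (\<lambda>y. (f y, g y) \<in> V \<times> V') (mdim (prod_manifold N P))
      (\<lambda>y. prod_chart (mdim N) \<psi> \<psi>' (f y, g y))"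
    by (simp, elim smooth_near_mono) auto
  then show "\<exists>V \<psi>. (V, \<psi>) \<in> atlas (prod_manifold N P) \<and> smooth_near M A a (\<lambda>y. (f y, g y) \<in> V)
      (mdim (prod_manifold N P)) (\<lambda>y. \<psi> (f y, g y))"
    using V(1) V'(1) unfolding atlas_prod_manifold by blast
qed (use f g in \<open>auto simp: smooth_on_iff\<close>)

lemma smooth_on_fst:
  assumes M: "charted M" and N: "charted N" and A: "A \<subseteq> points M \<times> points N"
  shows "smooth_on (prod_manifold M N) A M fst"
  unfolding smooth_on_iff
proof (intro conjI ballI)
  fix ab assume ab: "ab \<in> A"
  then obtain a b where [simp]: "ab = (a, b)" and "a \<in> points M" "b \<in> points N"
    using A by auto
  then obtain U \<phi> V \<psi> where U: "(U, \<phi>) \<in> atlas M" "a \<in> U" "(V, \<psi>) \<in> atlas N" "b \<in> V"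
    using charted_point[OF M] charted_point[OF N] by metis
  have at: "(U \<times> V, prod_chart (mdim M) \<phi> \<psi>) \<in> atlas (prod_manifold M N)"
    using U unfolding atlas_prod_manifold by blast
  have sel: "select (mdim M) (\<lambda>j. j) (prod_chart (mdim M) \<phi> \<psi> (x, y)) = \<phi> x"
    "select (mdim N) (\<lambda>j. mdim M + j) (prod_chart (mdim M) \<phi> \<psi> (x, y)) = \<psi> y"
    "prod_chart (mdim M) \<phi> \<psi> (x, y) \<in> topspace (Euclidean_space (mdim M + mdim N))"
    if "x \<in> U" "y \<in> V" for x y
    using select_prod_chart[of \<phi> x "mdim M" \<psi> y "mdim N"] charted_range[OF M U(1) that(1)]
      charted_range[OF N U(3) that(2)] by simp_all
  have "smooth_near (prod_manifold M N) A ab (\<lambda>y. fst y \<in> U) (mdim M) (\<lambda>y. \<phi> (fst y))"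
    by (rule smooth_nearI[OF at _ _ smooth_map_select[of "mdim M" "\<lambda>j. j"]])
      (use U in \<open>auto simp: sel\<close>)
  with U(1) show "\<exists>V \<psi>. (V, \<psi>) \<in> atlas M \<and> smooth_near (prod_manifold M N) A ab (\<lambda>y. fst y \<in> V) (mdim M) (\<lambda>y. \<psi> (fst y))"
    by blast
qed (use A in auto)

lemma smooth_on_snd:
  assumes M: "charted M" and N: "charted N" and A: "A \<subseteq> points M \<times> points N"
  shows "smooth_on (prod_manifold M N) A N snd"
  unfolding smooth_on_iff
proof (intro conjI ballI)
  fix ab assume ab: "ab \<in> A"
  then obtain a b where [simp]: "ab = (a, b)" and "a \<in> points M" "b \<in> points N"
    using A by auto
  then obtain U \<phi> V \<psi> where U: "(U, \<phi>) \<in> atlas M" "a \<in> U" "(V, \<psi>) \<in> atlas N" "b \<in> V"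
    using charted_point[OF M] charted_point[OF N] by metis
  have at: "(U \<times> V, prod_chart (mdim M) \<phi> \<psi>) \<in> atlas (prod_manifold M N)"
    using U unfolding atlas_prod_manifold by blast
  have sel: "select (mdim M) (\<lambda>j. j) (prod_chart (mdim M) \<phi> \<psi> (x, y)) = \<phi> x"
    "select (mdim N) (\<lambda>j. mdim M + j) (prod_chart (mdim M) \<phi> \<psi> (x, y)) = \<psi> y"
    "prod_chart (mdim M) \<phi> \<psi> (x, y) \<in> topspace (Euclidean_space (mdim M + mdim N))"
    if "x \<in> U" "y \<in> V" for x y
    using select_prod_chart[of \<phi> x "mdim M" \<psi> y "mdim N"] charted_range[OF M U(1) that(1)]
      charted_range[OF N U(3) that(2)] by simp_all
  have "smooth_near (prod_manifold M N) A ab (\<lambda>y. snd y \<in> V) (mdim N) (\<lambda>y. \<psi> (snd y))"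
    by (rule smooth_nearI[OF at _ _ smooth_map_select[of "mdim N" "\<lambda>j. mdim M + j"]])
      (use U in \<open>auto simp: sel\<close>)
  with U(3) show "\<exists>V \<psi>. (V, \<psi>) \<in> atlas N \<and> smooth_near (prod_manifold M N) A ab (\<lambda>y. snd y \<in> V) (mdim N) (\<lambda>y. \<psi> (snd y))"
    by blast
qed (use A in auto)

lemma points_power_manifold [simp]: "points (power_manifold M p) = {xs. length xs = p \<and> set xs \<subseteq> points M}"
  and mdim_power_manifold [simp]: "mdim (power_manifold M p) = p * mdim M"
  by (auto simp: power_manifold_def)

definition power_domain :: "'a chart list \<Rightarrow> 'a list set" where
  "power_domain cs = {xs. length xs = length cs \<and> (\<forall>i<length cs. xs ! i \<in> fst (cs ! i))}"

definition power_chart :: "nat \<Rightarrow> 'a chart list \<Rightarrow> 'a list \<Rightarrow> nat \<Rightarrow> real" where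
  "power_chart n cs = (\<lambda>xs j. if j < length cs * n then snd (cs ! (j div n)) (xs ! (j div n)) (j mod n) else 0)"

lemma atlas_power_manifold:
  "atlas (power_manifold M p) =
     {(power_domain cs, power_chart (mdim M) cs) | cs. length cs = p \<and> set cs \<subseteq> atlas M}"
  unfolding power_manifold_def power_domain_def power_chart_def manifold.select_convs
  by (intro Collect_cong ex_cong1) auto

lemma block_less: "i < p \<Longrightarrow> j < n \<Longrightarrow> i * n + j < p * (n::nat)"
  by (metis add.commute div_less div_mult_self3 less_mult_imp_div_less mult.commute nat_neq_iff not_less0 add_0 less_le_trans mult_le_mono1 Suc_leI add_less_cancel_left mult_Suc)

lemma select_power_chart:
  assumes "i < length cs" "snd (cs ! i) (xs ! i) \<in> topspace (Euclidean_space n)"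
  shows "select n (\<lambda>j. i * n + j) (power_chart n cs xs) = snd (cs ! i) (xs ! i)"
  using assms block_less by (intro select_eqI) (auto simp: power_chart_def)

lemma power_chart_in_Euclidean_space: "power_chart n cs xs \<in> topspace (Euclidean_space (length cs * n))"
  by (auto simp: power_chart_def topspace_Euclidean_space)

text \<open>Transition maps act block by block. A coordinate \<open>j < p * n\<close> can exist only
  for positive dimension \<open>n\<close>, so \<open>j mod n\<close> is then a genuine coordinate of
  factor \<open>j div n\<close>.\<close>

lemma charted_power:
  assumes M: "charted M"
  shows "charted (power_manifold M p)"
  unfolding charted_def
proof (intro conjI)
  let ?n = "mdim M"
  show "\<forall>U \<phi>. (U, \<phi>) \<in> atlas (power_manifold M p) \<longrightarrow> U \<subseteq> points (power_manifold M p)"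
  proof (intro allI impI subsetI)
    fix U \<phi> xs assume "(U, \<phi>) \<in> atlas (power_manifold M p)" "xs \<in> U"
    then obtain cs where cs: "length cs = p" "set cs \<subseteq> atlas M" "xs \<in> power_domain cs"
      by (auto simp: atlas_power_manifold)
    have "xs ! i \<in> points M" if "i < p" for i
    proof -
      have "(fst (cs ! i), snd (cs ! i)) \<in> atlas M"
        using cs(1,2) that nth_mem[of i cs] by (auto simp del: nth_mem)
      from charted_domain[OF M this] show ?thesis
        using cs that by (auto simp: power_domain_def)
    qed
    then show "xs \<in> points (power_manifold M p)"
      using cs by (auto simp: power_domain_def in_set_conv_nth)
  qed
  show "\<forall>xs\<in>points (power_manifold M p). \<exists>U \<phi>. (U, \<phi>) \<in> atlas (power_manifold M p) \<and> xs \<in> U"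
  proof
    fix xs assume xs: "xs \<in> points (power_manifold M p)"
    have "\<forall>x. \<exists>c. x \<in> points M \<longrightarrow> c \<in> atlas M \<and> x \<in> fst c"
      using charted_point[OF M] by force
    from choice[OF this] obtain c where c: "\<And>x. x \<in> points M \<Longrightarrow> c x \<in> atlas M \<and> x \<in> fst (c x)"
      by blast
    have "xs \<in> power_domain (map c xs)"
      using xs c by (auto simp: power_domain_def subset_iff)
    moreover have "(power_domain (map c xs), power_chart ?n (map c xs)) \<in> atlas (power_manifold M p)"
      unfolding atlas_power_manifold using xs c by (force simp: subset_iff)
    ultimately show "\<exists>U \<phi>. (U, \<phi>) \<in> atlas (power_manifold M p) \<and> xs \<in> U"
      by blast
  qed
  show "\<forall>U \<phi> y. (U, \<phi>) \<in> atlas (power_manifold M p) \<longrightarrow> y \<in> U \<longrightarrow>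
      \<phi> y \<in> topspace (Euclidean_space (mdim (power_manifold M p)))"
    using power_chart_in_Euclidean_space by (fastforce simp: atlas_power_manifold)
  have "\<exists>W F. power_chart ?n cs xs \<in> W \<and> smooth_map (p * ?n) (p * ?n) W F \<and>
      (\<forall>y\<in>power_domain cs. power_chart ?n cs y \<in> W \<longrightarrow> y \<in> power_domain cs' \<and>
         (\<forall>j<p * ?n. power_chart ?n cs' y j = F (power_chart ?n cs y) j))"
    if cs: "length cs = p" "set cs \<subseteq> atlas M" "xs \<in> power_domain cs"
      and cs': "length cs' = p" "set cs' \<subseteq> atlas M" "xs \<in> power_domain cs'"
    for cs cs' xs
  proof -
    have at: "(fst (cs ! i), snd (cs ! i)) \<in> atlas M" "(fst (cs' ! i), snd (cs' ! i)) \<in> atlas M" if "i < p" for i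
      using cs(1,2) cs'(1,2) that nth_mem[of i cs] nth_mem[of i cs'] by (auto simp del: nth_mem)
    have "\<exists>W F. i < p \<longrightarrow> snd (cs ! i) (xs ! i) \<in> W \<and> smooth_map ?n ?n W F \<and>
      (\<forall>y\<in>fst (cs ! i). snd (cs ! i) y \<in> W \<longrightarrow> y \<in> fst (cs' ! i) \<and> (\<forall>j<?n. snd (cs' ! i) y j = F (snd (cs ! i) y) j))" for i
    proof (cases "i < p")
      case True
      then show ?thesis
        using charted_transition[OF M at(1)[OF True] at(2)[OF True], of "xs ! i"] cs cs'
        by (simp add: power_domain_def)
    qed simp
    then obtain W F where WF: "\<And>i. i < p \<Longrightarrow> snd (cs ! i) (xs ! i) \<in> W i" "\<And>i. i < p \<Longrightarrow> smooth_map ?n ?n (W i) (F i)"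
      "\<And>i y. i < p \<Longrightarrow> y \<in> fst (cs ! i) \<Longrightarrow> snd (cs ! i) y \<in> W i \<Longrightarrow>
         y \<in> fst (cs' ! i) \<and> (\<forall>j<?n. snd (cs' ! i) y j = F i (snd (cs ! i) y) j)"
      by metis
    let ?s = "\<lambda>i. select ?n (\<lambda>j. i * ?n + j)" and ?E = "topspace (Euclidean_space (p * ?n))"
    \<comment> \<open>The factor \<open>?E\<close> gives the right domain for \<open>p = 0\<close>,
      where the intersection is the whole type.\<close>
    define W' where "W' = ?E \<inter> (\<Inter>i<p. {z \<in> ?E. ?s i z \<in> W i})"
    have W'_iff: "z \<in> W' \<longleftrightarrow> z \<in> ?E \<and> (\<forall>i<p. ?s i z \<in> W i)" for z
      by (auto simp: W'_def)
    define H where "H = (\<lambda>z j. F (j div ?n) (?s (j div ?n) z) (j mod ?n))"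
    have sm: "smooth_map (p * ?n) ?n {z \<in> ?E. ?s i z \<in> W i} (\<lambda>z. F i (?s i z))" if "i < p" for i
      by (rule smooth_map_compose_select[OF WF(2)[OF that] block_less[OF that]])
    have op: "openin (Euclidean_space (p * ?n)) W'"
    proof (cases "p = 0")
      case False
      then show ?thesis
        unfolding W'_def using smooth_mapD(1)[OF sm] by (intro openin_Int openin_INT2) auto
    qed (simp add: W'_def)
    have "k_times_diff (p * ?n) k W' (\<lambda>z. H z j)" if j: "j < p * ?n" for j k
    proof -
      have "j div ?n < p" "j mod ?n < ?n"
        using j by (auto simp: less_mult_imp_div_less intro!: mod_less_divisor gr0I)
      then show ?thesis
        unfolding H_def using smooth_mapD(3)[OF smooth_map_subset[OF sm op], of "j div ?n" "j mod ?n" k]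
        by (auto simp: W'_def)
    qed
    with op have H: "smooth_map (p * ?n) (p * ?n) W' H"
      by (simp add: smooth_map_def)
    have sel: "?s i (power_chart ?n cs y) = snd (cs ! i) (y ! i)" if "y \<in> power_domain cs" "i < p" for y i
      using that cs charted_range[OF M at(1)] by (intro select_power_chart) (auto simp: power_domain_def)
    have "power_chart ?n cs xs \<in> W'"
      using power_chart_in_Euclidean_space[of ?n cs xs] sel[OF cs(3)] WF(1) cs(1) by (auto simp: W'_def)
    moreover have "y \<in> power_domain cs' \<and> (\<forall>j<p * ?n. power_chart ?n cs' y j = H (power_chart ?n cs y) j)"
      if y: "y \<in> power_domain cs" "power_chart ?n cs y \<in> W'" for y
    proof -
      have yi: "y ! i \<in> fst (cs ! i)" "snd (cs ! i) (y ! i) \<in> W i" if "i < p" for i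
        using y that sel[OF y(1) that] cs(1) by (auto simp: W'_iff power_domain_def)
      have "y \<in> power_domain cs'"
        using y(1) cs(1) cs'(1) WF(3)[OF _ yi] by (auto simp: power_domain_def)
      moreover have "power_chart ?n cs' y j = H (power_chart ?n cs y) j" if j: "j < p * ?n" for j
      proof -
        have jp: "j div ?n < p" "j mod ?n < ?n"
          using j by (auto simp: less_mult_imp_div_less intro!: mod_less_divisor gr0I)
        then show ?thesis
          using WF(3)[OF jp(1) yi[OF jp(1)]] sel[OF y(1) jp(1)] j cs'(1) by (simp add: power_chart_def H_def)
      qed
      ultimately show ?thesis
        by blast
    qed
    ultimately show ?thesis
      using H by blast
  qed
  note transition = this
  show "\<forall>U \<phi> U' \<phi>' a. (U, \<phi>) \<in> atlas (power_manifold M p) \<longrightarrow> (U', \<phi>') \<in> atlas (power_manifold M p) \<longrightarrow>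
      a \<in> U \<longrightarrow> a \<in> U' \<longrightarrow> (\<exists>W F. \<phi> a \<in> W \<and>
        smooth_map (mdim (power_manifold M p)) (mdim (power_manifold M p)) W F \<and>
        (\<forall>y\<in>U. \<phi> y \<in> W \<longrightarrow> y \<in> U' \<and> (\<forall>i < mdim (power_manifold M p). \<phi>' y i = F (\<phi> y) i)))"
    unfolding atlas_power_manifold mdim_power_manifold
  proof (intro allI impI, elim CollectE exE conjE)
    fix S \<Phi> S' \<Phi>' xs cs cs'
    assume eq: "(S, \<Phi>) = (power_domain cs, power_chart ?n cs)" "(S', \<Phi>') = (power_domain cs', power_chart ?n cs')"
      and cs: "length cs = p" "set cs \<subseteq> atlas M" "length cs' = p" "set cs' \<subseteq> atlas M"
      and xs: "xs \<in> S" "xs \<in> S'"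
    have "xs \<in> power_domain cs" "xs \<in> power_domain cs'"
      using xs eq by auto
    from transition[OF cs(1,2) this(1) cs(3,4) this(2)] eq
    show "\<exists>W F. \<Phi> xs \<in> W \<and> smooth_map (p * ?n) (p * ?n) W F \<and>
        (\<forall>y\<in>S. \<Phi> y \<in> W \<longrightarrow> y \<in> S' \<and> (\<forall>i < p * ?n. \<Phi>' y i = F (\<Phi> y) i))"
      by (simp only: prod.inject)
  qed
qed

lemma smooth_on_nth:
  assumes M: "charted M" and A: "A \<subseteq> points (power_manifold M p)" and i: "i < p"
  shows "smooth_on (power_manifold M p) A M (\<lambda>xs. xs ! i)"
  unfolding smooth_on_iff
proof (intro conjI ballI)
  fix xs assume xs: "xs \<in> A"
  then have "xs \<in> points (power_manifold M p)"
    using A by blast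
  then obtain U \<Phi> where at: "(U, \<Phi>) \<in> atlas (power_manifold M p)" "xs \<in> U"
    using charted_point[OF charted_power[OF M]] by metis
  then obtain cs where cs: "length cs = p" "set cs \<subseteq> atlas M" "U = power_domain cs" "\<Phi> = power_chart (mdim M) cs"
    unfolding atlas_power_manifold by blast
  have ci: "(fst (cs ! i), snd (cs ! i)) \<in> atlas M"
    using cs(1,2) i nth_mem[of i cs] by (auto simp del: nth_mem)
  have sel: "select (mdim M) (\<lambda>j. i * mdim M + j) (\<Phi> y) = snd (cs ! i) (y ! i)" "y ! i \<in> fst (cs ! i)"
    if "y \<in> U" for y
    using that cs i charted_range[OF M ci] by (auto simp: power_domain_def intro!: select_power_chart)
  have "smooth_near (power_manifold M p) A xs (\<lambda>y. y ! i \<in> fst (cs ! i)) (mdim M) (\<lambda>y. snd (cs ! i) (y ! i))"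
    by (rule smooth_nearI[OF at _ smooth_map_select[of "mdim M" "\<lambda>j. i * mdim M + j"]])
      (use sel cs power_chart_in_Euclidean_space[of "mdim M" cs] block_less[OF i] in auto)
  with ci show "\<exists>V \<psi>. (V, \<psi>) \<in> atlas M \<and> smooth_near (power_manifold M p) A xs (\<lambda>y. y ! i \<in> V) (mdim M) (\<lambda>y. \<psi> (y ! i))"
    by blast
qed (use A i in \<open>auto simp: subset_iff\<close>)

text \<open>Charts of \<open>N\<close> at the entries of \<open>f a\<close> are collected into one
  list \<open>cs\<close>, which is a chart of the power. This is how maps into spaces of tuples are
  shown to be smooth.\<close>

lemma smooth_on_list:
  assumes M: "charted M" and A: "A \<subseteq> points M" and f: "\<And>i. i < p \<Longrightarrow> smooth_on M A N (\<lambda>x. f x ! i)"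
    and len: "\<And>x. x \<in> A \<Longrightarrow> length (f x) = p"
  shows "smooth_on M A (power_manifold N p) f"
  unfolding smooth_on_iff
proof (intro conjI ballI)
  let ?n = "mdim N"
  show "f ` A \<subseteq> points (power_manifold N p)"
    using smooth_on_image[OF f] len by (fastforce simp: in_set_conv_nth)
  fix a assume a: "a \<in> A"
  have "\<exists>c. i < p \<longrightarrow> c \<in> atlas N \<and> smooth_near M A a (\<lambda>y. f y ! i \<in> fst c) ?n (\<lambda>y. snd c (f y ! i))" for i
    using f[of i] a unfolding smooth_on_iff by fastforce
  then obtain c where c: "\<And>i. i < p \<Longrightarrow> c i \<in> atlas N"
    "\<And>i. i < p \<Longrightarrow> smooth_near M A a (\<lambda>y. f y ! i \<in> fst (c i)) ?n (\<lambda>y. snd (c i) (f y ! i))"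
    by metis
  define cs where "cs = map c [0..<p]"
  have "smooth_near M A a (\<lambda>y. \<forall>i<p. f y ! i \<in> fst (c i)) p (\<lambda>_ _. 0)"
  proof (rule smooth_near_components[OF M])
    fix i assume "i < p"
    have "smooth_near M A a (\<lambda>y. True \<and> f y ! i \<in> fst (c i)) (Suc 0) (\<lambda>_ _. 0)"
      by (rule smooth_near_conj[OF M smooth_near_const[OF M] c(2)]) (use a A \<open>i < p\<close> in auto)
    then show "smooth_near M A a (\<lambda>y. f y ! i \<in> fst (c i)) (Suc 0) (\<lambda>_ _. 0)"
      by simp
  qed (use a A in auto)
  moreover have "smooth_near M A a (\<lambda>y. \<forall>j<p * ?n. True) (p * ?n) (\<lambda>y. power_chart ?n cs (f y))"
  proof (rule smooth_near_components[OF M])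
    fix j assume j: "j < p * ?n"
    have jp: "j div ?n < p" "j mod ?n < ?n"
      using j by (auto simp: less_mult_imp_div_less intro!: mod_less_divisor gr0I)
    then show "smooth_near M A a (\<lambda>_. True) (Suc 0) (\<lambda>y _. power_chart ?n cs (f y) j)"
      using j by (intro smooth_near_mono[OF smooth_near_component[OF c(2)[OF jp(1)] jp(2)]])
        (auto simp: power_chart_def cs_def)
  qed (use a A in auto)
  ultimately have "smooth_near M A a (\<lambda>y. (\<forall>j<p * ?n. True) \<and> (\<forall>i<p. f y ! i \<in> fst (c i))) (p * ?n) (\<lambda>y. power_chart ?n cs (f y))"
    by (rule smooth_near_conj[OF M, rotated])
  then have "smooth_near M A a (\<lambda>y. f y \<in> power_domain cs) (p * ?n) (\<lambda>y. power_chart ?n cs (f y))"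
    by (rule smooth_near_mono) (use len in \<open>auto simp: power_domain_def cs_def\<close>)
  moreover have "(power_domain cs, power_chart ?n cs) \<in> atlas (power_manifold N p)"
    unfolding atlas_power_manifold using c(1) by (force simp: cs_def)
  ultimately show "\<exists>V \<psi>. (V, \<psi>) \<in> atlas (power_manifold N p) \<and> smooth_near M A a (\<lambda>y. f y \<in> V) (mdim (power_manifold N p)) (\<lambda>y. \<psi> (f y))"
    by auto
qed (use A in auto)

subsection \<open>Real-valued functions\<close>

lemma charted_euclid: "charted (euclid n)"
proof -
  have "smooth_map n n (topspace (Euclidean_space n)) (\<lambda>x. x)"
    by (simp add: smooth_map_def k_times_diff_coordinate)
  then show ?thesis
    unfolding charted_def euclid_def manifold.select_convs singleton_iff prod.inject
    by (auto intro!: exI[of _ "topspace (Euclidean_space n)"] exI[of _ "\<lambda>x. x"])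
qed

lemma points_euclid [simp]: "points (euclid n) = topspace (Euclidean_space n)"
  by (simp add: euclid_def)

lemma charted_real_line: "charted real_line"
proof -
  have "smooth_map 1 1 (topspace (Euclidean_space 1)) (\<lambda>x. x)"
    by (simp add: smooth_map_def k_times_diff_coordinate)
  then show ?thesis
    unfolding charted_def real_line_def manifold.select_convs singleton_iff prod.inject
    by (auto simp: topspace_Euclidean_space intro!: exI[of _ "topspace (Euclidean_space 1)"] exI[of _ "\<lambda>x. x"])
qed

lemma points_real_line [simp]: "points real_line = UNIV"
  by (simp add: real_line_def)

text \<open>The single chart of \<open>real_line\<close> is global, so the condition on the target
  disappears from \<open>smooth_on_iff\<close>.\<close>

lemma smooth_on_real_iff:
  "smooth_on M A real_line f \<longleftrightarrow>
     A \<subseteq> points M \<and> (\<forall>a\<in>A. smooth_near M A a (\<lambda>_. True) (Suc 0) (\<lambda>y _. f y))"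
proof -
  have "smooth_near M A a (\<lambda>_. True) (Suc 0) (\<lambda>y i. if i = 0 then f y else 0) \<longleftrightarrow>
      smooth_near M A a (\<lambda>_. True) (Suc 0) (\<lambda>y _. f y)" for a
    unfolding smooth_near_def by simp
  then show ?thesis
    by (simp add: smooth_on_iff real_line_def)
qed

text \<open>Common source of closure under sums and products, with \<open>G\<close> the polynomial
  \<open>x 0 + x 1\<close> or \<open>x 0 * x 1\<close> in two coordinates.\<close>

lemma smooth_on_real_compose:
  assumes M: "charted M" and A: "A \<subseteq> points M" and f: "\<And>i. i < m \<Longrightarrow> smooth_on M A real_line (f i)"
    and G: "\<And>k. k_times_diff m k (topspace (Euclidean_space m)) G"
  shows "smooth_on M A real_line (\<lambda>x. G (\<lambda>i. if i < m then f i x else 0))"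
  unfolding smooth_on_real_iff
proof (intro conjI ballI A)
  fix a assume a: "a \<in> A"
  have G': "smooth_map m (Suc 0) (topspace (Euclidean_space m)) (\<lambda>x _. G x)"
    using G by (simp add: smooth_map_def)
  have "smooth_near M A a (\<lambda>y. \<forall>i<m. True) m (\<lambda>y i. f i y)"
    by (rule smooth_near_components[OF M]) (use a A f in \<open>auto simp: smooth_on_real_iff\<close>)
  from smooth_near_compose[OF this G' _ a]
  show "smooth_near M A a (\<lambda>_. True) (Suc 0) (\<lambda>y _. G (\<lambda>i. if i < m then f i y else 0))"
    by (simp add: select_def[abs_def] topspace_Euclidean_space)
qed

lemma smooth_on_add:
  assumes "charted M" "smooth_on M A real_line f" "smooth_on M A real_line g"
  shows "smooth_on M A real_line (\<lambda>x. f x + g x)"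
  using smooth_on_real_compose[OF assms(1), of A 2 "\<lambda>i. if i = 0 then f else g" "\<lambda>x. x 0 + x 1"]
    smooth_on_domain[OF assms(2)] assms
  by (simp add: k_times_diff_add k_times_diff_coordinate)

lemma smooth_on_mult:
  assumes "charted M" "smooth_on M A real_line f" "smooth_on M A real_line g"
  shows "smooth_on M A real_line (\<lambda>x. f x * g x)"
  using smooth_on_real_compose[OF assms(1), of A 2 "\<lambda>i. if i = 0 then f else g" "\<lambda>x. x 0 * x 1"]
    smooth_on_domain[OF assms(2)] assms
  by (simp add: k_times_diff_mult k_times_diff_coordinate)

lemma smooth_on_sum:
  assumes "charted M" "A \<subseteq> points M" "\<And>i. i < m \<Longrightarrow> smooth_on M A real_line (f i)"
  shows "smooth_on M A real_line (\<lambda>x. \<Sum>i<(m::nat). f i x)"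
  using assms(3)
proof (induction m)
  case 0
  then show ?case
    using smooth_on_const[OF assms(1) charted_real_line assms(2)] by simp
next
  case (Suc m)
  then show ?case
    using smooth_on_add[OF assms(1), of A "\<lambda>x. \<Sum>i<m. f i x" "f m"] by simp
qed

lemma smooth_on_minus:
  assumes "charted M" "smooth_on M A real_line f"
  shows "smooth_on M A real_line (\<lambda>x. - f x)"
  using smooth_on_mult[OF assms(1) smooth_on_const[OF assms(1) charted_real_line] assms(2), of "-1"]
    smooth_on_domain[OF assms(2)] by simp

lemma smooth_on_euclid_iff:
  assumes M: "charted M"
  shows "smooth_on M A (euclid n) f \<longleftrightarrow> A \<subseteq> points M \<and> f ` A \<subseteq> topspace (Euclidean_space n) \<and>
     (\<forall>i<n. smooth_on M A real_line (\<lambda>x. f x i))"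
proof
  assume f: "smooth_on M A (euclid n) f"
  have *: "smooth_near M A a (\<lambda>y. f y \<in> topspace (Euclidean_space n)) n f" if "a \<in> A" for a
    using f that by (auto simp: smooth_on_iff euclid_def)
  have "smooth_near M A a (\<lambda>_. True) (Suc 0) (\<lambda>y _. f y i)" if "a \<in> A" "i < n" for a i
    using smooth_near_mono[OF smooth_near_component[OF *[OF that(1)] that(2)]] by simp
  with f show "A \<subseteq> points M \<and> f ` A \<subseteq> topspace (Euclidean_space n) \<and>
     (\<forall>i<n. smooth_on M A real_line (\<lambda>x. f x i))"
    using smooth_on_domain[OF f] smooth_on_image[OF f] by (auto simp: smooth_on_real_iff)
next
  assume f: "A \<subseteq> points M \<and> f ` A \<subseteq> topspace (Euclidean_space n) \<and> (\<forall>i<n. smooth_on M A real_line (\<lambda>x. f x i))"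
  have "smooth_near M A a (\<lambda>y. \<forall>i<n. True) n f" if "a \<in> A" for a
    by (rule smooth_near_components[OF M]) (use f that in \<open>auto simp: smooth_on_real_iff\<close>)
  then have "smooth_near M A a (\<lambda>y. f y \<in> topspace (Euclidean_space n)) n f" if "a \<in> A" for a
    by (rule smooth_near_mono) (use f that in auto)
  with f show "smooth_on M A (euclid n) f"
    by (auto simp: smooth_on_iff euclid_def)
qed

lemma smooth_on_chart_coordinate:
  assumes "charted M" "(U, \<phi>) \<in> atlas M" "i < mdim M"
  shows "smooth_on M U real_line (\<lambda>x. \<phi> x i)"
  unfolding smooth_on_real_iff
proof (intro conjI ballI)
  fix a assume a: "a \<in> U"
  have "smooth_map (mdim M) (Suc 0) (topspace (Euclidean_space (mdim M))) (\<lambda>x _. x i)"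
    by (simp add: smooth_map_def k_times_diff_coordinate)
  then show "smooth_near M U a (\<lambda>_. True) (Suc 0) (\<lambda>y _. \<phi> y i)"
    using assms a charted_range[OF assms(1,2)] by (intro smooth_nearI[OF assms(2) a]) auto
qed (use charted_domain[OF assms(1,2)] in auto)

section \<open>Vector bundles and their duals\<close>

lemma real_vsD:
  assumes "real_vs S add scl z"
  shows "z \<in> S" "v \<in> S \<Longrightarrow> w \<in> S \<Longrightarrow> add v w \<in> S" "v \<in> S \<Longrightarrow> scl r v \<in> S"
    "u \<in> S \<Longrightarrow> v \<in> S \<Longrightarrow> w \<in> S \<Longrightarrow> add (add u v) w = add u (add v w)"
    "v \<in> S \<Longrightarrow> w \<in> S \<Longrightarrow> add v w = add w v"
    "v \<in> S \<Longrightarrow> add z v = v" "v \<in> S \<Longrightarrow> \<exists>w\<in>S. add v w = z"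
    "v \<in> S \<Longrightarrow> w \<in> S \<Longrightarrow> scl r (add v w) = add (scl r v) (scl r w)"
    "v \<in> S \<Longrightarrow> scl (r + s) v = add (scl r v) (scl s v)"
    "v \<in> S \<Longrightarrow> scl (r * s) v = scl r (scl s v)" "v \<in> S \<Longrightarrow> scl 1 v = v"
  by (insert assms[unfolded real_vs_def]) metis+

lemma real_vs_add_0_right:
  "real_vs S add scl z \<Longrightarrow> v \<in> S \<Longrightarrow> add v z = v"
  using real_vsD(1,5,6) by metis

lemma real_vs_add_left_cancel:
  assumes V: "real_vs S add scl z" and "u \<in> S" "v \<in> S" "w \<in> S" "add u v = add u w"
  shows "v = w"
proof -
  obtain u' where u': "u' \<in> S" "add u u' = z"
    using real_vsD(7)[OF V assms(2)] by blast
  have "add (add u' u) v = add (add u' u) w"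
    using real_vsD(4)[OF V u'(1) assms(2)] assms(3-5) by simp
  then show ?thesis
    using real_vsD(5,6)[OF V] u' assms by metis
qed

text \<open>Cancel \<open>v\<close>. Zeros are recognized this way below: a multiple by the scalar
  0, a multiple of the zero vector and a product of two zero arrows are each shown to be
  idempotent.\<close>

lemma real_vs_idempotent:
  assumes V: "real_vs S add scl z" and v: "v \<in> S" "add v v = v"
  shows "v = z"
  by (rule real_vs_add_left_cancel[OF V v(1) v(1) real_vsD(1)[OF V]])
    (simp add: v real_vs_add_0_right[OF V])

lemma real_vs_scale_0:
  assumes V: "real_vs S add scl z" and v: "v \<in> S"
  shows "scl 0 v = z"
  by (rule real_vs_idempotent[OF V real_vsD(3)[OF V v]]) (simp add: real_vsD(9)[OF V v, symmetric])

lemma real_vs_scale_zero: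
  assumes V: "real_vs S add scl z"
  shows "scl r z = z"
proof (rule real_vs_idempotent[OF V])
  show "scl r z \<in> S"
    by (intro real_vsD[OF V])
  show "add (scl r z) (scl r z) = scl r z"
    using real_vsD(8)[OF V real_vsD(1)[OF V] real_vsD(1)[OF V], of r] real_vsD(6)[OF V real_vsD(1)[OF V]] by simp
qed

lemma real_vs_right_minus:
  assumes V: "real_vs S add scl z" and v: "v \<in> S"
  shows "add v (scl (-1) v) = z"
  using real_vsD(9)[OF V v, of 1 "-1"] real_vs_scale_0[OF V v] real_vsD(11)[OF V v] by simp

section \<open>Local trivializations and frames\<close>

lemma vector_bundleD:
  assumes "vector_bundle B"
  shows "is_manifold (vtotal B)" "is_manifold (vbase B)"
    "smooth_on (vtotal B) (points (vtotal B)) (vbase B) (vproj B)"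
    "x \<in> points (vbase B) \<Longrightarrow> vfib B x = {v \<in> points (vtotal B). vproj B v = x}"
    "x \<in> points (vbase B) \<Longrightarrow> real_vs (vfib B x) (vadd B) (vscale B) (vzero B x)"
    "x \<in> points (vbase B) \<Longrightarrow> \<exists>U \<Psi>. x \<in> U \<and> local_trivialization B U \<Psi>"
    "charted (vtotal B)" "charted (vbase B)"
  by (insert assms[unfolded vector_bundle_def]) (blast intro: is_manifold_imp_charted)+

lemma vector_bundle_proj:
  assumes "vector_bundle B" "v \<in> points (vtotal B)"
  shows "vproj B v \<in> points (vbase B)"
  using smooth_on_image[OF vector_bundleD(3)[OF assms(1)] assms(2)] .

lemma vector_bundle_fibre:
  assumes "vector_bundle B" "x \<in> points (vbase B)" "v \<in> vfib B x"
  shows "v \<in> points (vtotal B)" "vproj B v = x"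
  using vector_bundleD(4)[OF assms(1,2)] assms(3) by auto

lemma vector_bundle_in_fibre:
  assumes "vector_bundle B" "v \<in> points (vtotal B)"
  shows "v \<in> vfib B (vproj B v)"
  using vector_bundleD(4)[OF assms(1) vector_bundle_proj[OF assms]] assms(2) by simp

text \<open>The local frame of a trivialization; the fibre coordinates in
  \<open>dual_manifold\<close> are the values of a functional on these vectors.\<close>

definition frame :: "('v, 'm) vbundle \<Rightarrow> ('v \<Rightarrow> nat \<Rightarrow> real) \<Rightarrow> nat \<Rightarrow> 'm \<Rightarrow> 'v" where
  "frame B \<Psi> i x = inv_into (vfib B x) \<Psi> (\<lambda>l. if l = i then 1 else 0)"

context
  fixes B :: "('v, 'm) vbundle" and V \<Psi>
  assumes B: "vector_bundle B" and triv: "local_trivialization B V \<Psi>"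
begin

lemma trivialization_domain: "openin (mtop (vbase B)) V" "V \<subseteq> points (vbase B)"
  using triv vector_bundleD(2)[OF B] by (auto simp: local_trivialization_def openin_mtop)

lemma trivialization_bij: "x \<in> V \<Longrightarrow> bij_betw \<Psi> (vfib B x) (topspace (Euclidean_space (vrank B)))"
  using triv unfolding local_trivialization_def by blast

lemma trivialization_linear:
  "x \<in> V \<Longrightarrow> v \<in> vfib B x \<Longrightarrow> w \<in> vfib B x \<Longrightarrow> \<Psi> (vadd B v w) i = \<Psi> v i + \<Psi> w i"
  "x \<in> V \<Longrightarrow> v \<in> vfib B x \<Longrightarrow> \<Psi> (vscale B r v) i = r * \<Psi> v i"
  using triv unfolding local_trivialization_def by blast+

lemma trivialization_smooth:
  "smooth_on (vtotal B) (\<Union>x\<in>V. vfib B x) (prod_manifold (vbase B) (euclid (vrank B)))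
     (\<lambda>v. (vproj B v, \<Psi> v))"
  "smooth_on (prod_manifold (vbase B) (euclid (vrank B))) (V \<times> topspace (Euclidean_space (vrank B)))
     (vtotal B) (\<lambda>(x, a). inv_into (vfib B x) \<Psi> a)"
  using triv unfolding local_trivialization_def by blast+

lemma trivialization_range: "x \<in> V \<Longrightarrow> v \<in> vfib B x \<Longrightarrow> \<Psi> v \<in> topspace (Euclidean_space (vrank B))"
  using trivialization_bij bij_betwE by blast

lemma trivialization_inverse:
  assumes "x \<in> V"
  shows "a \<in> topspace (Euclidean_space (vrank B)) \<Longrightarrow> inv_into (vfib B x) \<Psi> a \<in> vfib B x"
    "a \<in> topspace (Euclidean_space (vrank B)) \<Longrightarrow> \<Psi> (inv_into (vfib B x) \<Psi> a) = a"
    "v \<in> vfib B x \<Longrightarrow> inv_into (vfib B x) \<Psi> (\<Psi> v) = v"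
  using trivialization_bij[OF assms]
  by (auto simp: bij_betw_def inv_into_into f_inv_into_f)

lemma trivialization_eqI:
  assumes "x \<in> V" "v \<in> vfib B x" "w \<in> vfib B x" "\<And>i. i < vrank B \<Longrightarrow> \<Psi> v i = \<Psi> w i"
  shows "v = w"
proof -
  have "\<Psi> v = \<Psi> w"
    using trivialization_range[OF assms(1)] assms(2-4)
    by (auto simp: topspace_Euclidean_space fun_eq_iff) (metis linorder_not_less)
  then show ?thesis
    using trivialization_inverse(3)[OF assms(1)] assms(2,3) by metis
qed

lemma frame_in_fibre: "x \<in> V \<Longrightarrow> i < vrank B \<Longrightarrow> frame B \<Psi> i x \<in> vfib B x"
  and trivialization_frame: "x \<in> V \<Longrightarrow> i < vrank B \<Longrightarrow> \<Psi> (frame B \<Psi> i x) = (\<lambda>l. if l = i then 1 else 0)"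
  unfolding frame_def by (auto intro!: trivialization_inverse simp: topspace_Euclidean_space)

lemma linear_functional_frame:
  assumes x: "x \<in> V" and v: "v \<in> vfib B x"
    and add: "\<And>v w. v \<in> vfib B x \<Longrightarrow> w \<in> vfib B x \<Longrightarrow> L (vadd B v w) = L v + (L w :: real)"
    and scale: "\<And>r v. v \<in> vfib B x \<Longrightarrow> L (vscale B r v) = r * L v"
  shows "L v = (\<Sum>i<vrank B. \<Psi> v i * L (frame B \<Psi> i x))"
proof -
  have xX: "x \<in> points (vbase B)"
    using x trivialization_domain by blast
  note vs = vector_bundleD(5)[OF B xX]
  \<comment> \<open>Partial sums of the expansion of \<open>v\<close> in the frame. Fibre addition
    is a bare function without a finite sum operator, so they are given by their truncated
    coordinates.\<close>
  let ?w = "\<lambda>m. inv_into (vfib B x) \<Psi> (\<lambda>l. if l < m then \<Psi> v l else 0)"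
  have w: "?w m \<in> vfib B x" "\<Psi> (?w m) = (\<lambda>l. if l < m then \<Psi> v l else 0)" if "m \<le> vrank B" for m
    using that trivialization_inverse[OF x] by (auto simp: topspace_Euclidean_space)
  have "L (?w m) = (\<Sum>i<m. \<Psi> v i * L (frame B \<Psi> i x))" if "m \<le> vrank B" for m
    using that
  proof (induction m)
    case 0
    have "?w 0 = vscale B 0 v"
      by (rule trivialization_eqI[OF x w(1)])
        (use v real_vsD(3)[OF vs] w(2)[of 0] trivialization_linear(2)[OF x v] in auto)
    then show ?case
      using scale[OF v, of 0] by simp
  next
    case (Suc m)
    then have m: "m < vrank B" "m \<le> vrank B"
      by auto
    note fr = frame_in_fibre[OF x m(1)]
    have "?w (Suc m) = vadd B (?w m) (vscale B (\<Psi> v m) (frame B \<Psi> m x))"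
    proof (rule trivialization_eqI[OF x w(1)[OF Suc.prems]])
      show "vadd B (?w m) (vscale B (\<Psi> v m) (frame B \<Psi> m x)) \<in> vfib B x"
        by (intro real_vsD(2,3)[OF vs] w(1) m fr)
      show "\<Psi> (?w (Suc m)) i = \<Psi> (vadd B (?w m) (vscale B (\<Psi> v m) (frame B \<Psi> m x))) i" for i
        unfolding trivialization_linear(1)[OF x w(1)[OF m(2)] real_vsD(3)[OF vs fr]]
          trivialization_linear(2)[OF x fr] w(2)[OF m(2)] w(2)[OF Suc.prems] trivialization_frame[OF x m(1)]
        by (auto simp: less_Suc_eq)
    qed
    then show ?case
      using Suc.IH[OF m(2)] add[OF w(1)[OF m(2)] real_vsD(3)[OF vs fr]] scale[OF fr] by simp
  qed
  from this[OF order_refl] have "L (?w (vrank B)) = (\<Sum>i<vrank B. \<Psi> v i * L (frame B \<Psi> i x))" .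
  moreover have "?w (vrank B) = v"
    by (rule trivialization_eqI[OF x w(1)[OF order_refl] v]) (use w(2)[OF order_refl] in simp)
  ultimately show ?thesis
    by (simp only:)
qed

lemma smooth_on_trivialization:
  assumes M: "charted M" and f: "smooth_on M A (vtotal B) f" and A: "\<And>a. a \<in> A \<Longrightarrow> vproj B (f a) \<in> V"
    and i: "i < vrank B"
  shows "smooth_on M A real_line (\<lambda>a. \<Psi> (f a) i)"
proof -
  have pts: "f a \<in> points (vtotal B)" if "a \<in> A" for a
    using smooth_on_image[OF f that] .
  have "smooth_on M A (prod_manifold (vbase B) (euclid (vrank B))) (\<lambda>a. (vproj B (f a), \<Psi> (f a)))"
    by (rule smooth_on_compose[OF vector_bundleD(7)[OF B] f trivialization_smooth(1)])
      (use A pts vector_bundle_in_fibre[OF B] in blast)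
  moreover have "(vproj B (f a), \<Psi> (f a)) \<in> points (vbase B) \<times> points (euclid (vrank B))" if "a \<in> A" for a
    using trivialization_range[OF A[OF that] vector_bundle_in_fibre[OF B pts[OF that]]]
      vector_bundle_proj[OF B pts[OF that]] by simp
  ultimately have "smooth_on M A (euclid (vrank B)) (\<lambda>a. snd (vproj B (f a), \<Psi> (f a)))"
    by (rule smooth_on_compose[OF charted_prod[OF vector_bundleD(8)[OF B] charted_euclid] _
          smooth_on_snd[OF vector_bundleD(8)[OF B] charted_euclid subset_refl]])
  then show ?thesis
    using i by (simp add: smooth_on_euclid_iff[OF M])
qed

text \<open>The inverse of a trivialization is smooth and recovers the map from its base point and
  its fibre coordinates.\<close>

lemma smooth_on_trivialization_inverse:
  assumes M: "charted M" and x: "smooth_on M A (vbase B) x" and A: "\<And>a. a \<in> A \<Longrightarrow> x a \<in> V"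
    and f: "\<And>a. a \<in> A \<Longrightarrow> f a \<in> vfib B (x a)"
    and sm: "\<And>i. i < vrank B \<Longrightarrow> smooth_on M A real_line (\<lambda>a. \<Psi> (f a) i)"
  shows "smooth_on M A (vtotal B) f"
proof -
  have "smooth_on M A (euclid (vrank B)) (\<lambda>a. \<Psi> (f a))"
    unfolding smooth_on_euclid_iff[OF M] using sm trivialization_range[OF A f] smooth_on_domain[OF x] by blast
  from smooth_on_Pair[OF M x this]
  have "smooth_on M A (vtotal B) (\<lambda>a. case (x a, \<Psi> (f a)) of (x, a) \<Rightarrow> inv_into (vfib B x) \<Psi> a)"
    by (rule smooth_on_compose[OF charted_prod[OF vector_bundleD(8)[OF B] charted_euclid] _ trivialization_smooth(2)])
      (use A f trivialization_range in auto)
  then show ?thesis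
    by (rule smooth_on_cong) (use A f trivialization_inverse(3) in auto)
qed

lemma smooth_on_frame:
  assumes M: "charted M" and x: "smooth_on M A (vbase B) x" and A: "\<And>a. a \<in> A \<Longrightarrow> x a \<in> V" and i: "i < vrank B"
  shows "smooth_on M A (vtotal B) (\<lambda>a. frame B \<Psi> i (x a))"
proof (rule smooth_on_trivialization_inverse[OF M x A])
  show "frame B \<Psi> i (x a) \<in> vfib B (x a)" if "a \<in> A" for a
    using frame_in_fibre[OF A[OF that] i] .
  show "smooth_on M A real_line (\<lambda>a. \<Psi> (frame B \<Psi> i (x a)) j)" for j
    by (rule smooth_on_cong[OF smooth_on_const[OF M charted_real_line smooth_on_domain[OF x], of "if j = i then 1 else 0"]])
      (use trivialization_frame[OF A i] in auto)
qed

end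

text \<open>Trivialization domains cover the base and pull back along \<open>x\<close> to relatively
  open parts of \<open>A\<close>; by locality of smoothness it is enough to look at fibre
  coordinates there.\<close>

lemma smooth_into_bundle:
  assumes B: "vector_bundle B" and M: "charted M" and x: "smooth_on M A (vbase B) x"
    and f: "\<And>a. a \<in> A \<Longrightarrow> f a \<in> vfib B (x a)"
    and sm: "\<And>V \<Psi> i. local_trivialization B V \<Psi> \<Longrightarrow> i < vrank B \<Longrightarrow>
        smooth_on M {a \<in> A. x a \<in> V} real_line (\<lambda>a. \<Psi> (f a) i)"
  shows "smooth_on M A (vtotal B) f"
proof (rule smooth_on_local[OF M smooth_on_domain[OF x]])
  fix a assume a: "a \<in> A"
  obtain V \<Psi> where V: "x a \<in> V" "local_trivialization B V \<Psi>"
    using vector_bundleD(6)[OF B smooth_on_image[OF x a]] by blast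
  have "smooth_near M A a (\<lambda>y. x y \<in> V) 0 (\<lambda>_ _. 0)"
    by (rule smooth_near_open_preimage[OF vector_bundleD(2)[OF B] x trivialization_domain(1)[OF B V(2)] a V(1)])
  moreover have "smooth_on M {a \<in> A. x a \<in> V} (vtotal B) f"
    by (rule smooth_on_trivialization_inverse[OF B V(2) M smooth_on_subset[OF x] _ f sm[OF V(2)]]) auto
  ultimately show "\<exists>P. smooth_near M A a P 0 (\<lambda>_ _. 0) \<and> smooth_on M {x \<in> A. P x} (vtotal B) f"
    by blast
qed

context
  fixes B :: "('v, 'm) vbundle" and M :: "'a manifold" and A x
  assumes B: "vector_bundle B" and M: "charted M" and x: "smooth_on M A (vbase B) x"
begin

text \<open>\<open>vector_bundle\<close> does not postulate that the fibre operations are smooth;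
  this holds because trivializations are linear, so that in coordinates the operation is the
  addition of real functions.\<close>

lemma smooth_on_vadd:
  assumes f: "smooth_on M A (vtotal B) f" "\<And>a. a \<in> A \<Longrightarrow> f a \<in> vfib B (x a)"
    and g: "smooth_on M A (vtotal B) g" "\<And>a. a \<in> A \<Longrightarrow> g a \<in> vfib B (x a)"
  shows "smooth_on M A (vtotal B) (\<lambda>a. vadd B (f a) (g a))"
proof (rule smooth_into_bundle[OF B M x])
  have X: "x a \<in> points (vbase B)" if "a \<in> A" for a
    using smooth_on_image[OF x that] .
  show "vadd B (f a) (g a) \<in> vfib B (x a)" if "a \<in> A" for a
    using real_vsD(2)[OF vector_bundleD(5)[OF B X[OF that]]] f g that by blast
  fix V \<Psi> i assume T: "local_trivialization B V \<Psi>" and i: "i < vrank B"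
  have "smooth_on M {a \<in> A. x a \<in> V} real_line (\<lambda>a. \<Psi> (f a) i + \<Psi> (g a) i)"
    by (intro smooth_on_add M smooth_on_trivialization[OF B T M _ _ i] smooth_on_subset[OF f(1)] smooth_on_subset[OF g(1)])
      (use f(2) g(2) vector_bundle_fibre(2)[OF B X] in auto)
  then show "smooth_on M {a \<in> A. x a \<in> V} real_line (\<lambda>a. \<Psi> (vadd B (f a) (g a)) i)"
    by (rule smooth_on_cong) (use f(2) g(2) trivialization_linear(1)[OF B T] in auto)
qed

lemma smooth_on_vscale:
  assumes r: "smooth_on M A real_line r"
    and f: "smooth_on M A (vtotal B) f" "\<And>a. a \<in> A \<Longrightarrow> f a \<in> vfib B (x a)"
  shows "smooth_on M A (vtotal B) (\<lambda>a. vscale B (r a) (f a))"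
proof (rule smooth_into_bundle[OF B M x])
  have X: "x a \<in> points (vbase B)" if "a \<in> A" for a
    using smooth_on_image[OF x that] .
  show "vscale B (r a) (f a) \<in> vfib B (x a)" if "a \<in> A" for a
    using real_vsD(3)[OF vector_bundleD(5)[OF B X[OF that]]] f that by blast
  fix V \<Psi> i assume T: "local_trivialization B V \<Psi>" and i: "i < vrank B"
  have "smooth_on M {a \<in> A. x a \<in> V} real_line (\<lambda>a. r a * \<Psi> (f a) i)"
    by (intro smooth_on_mult M smooth_on_trivialization[OF B T M _ _ i] smooth_on_subset[OF f(1)] smooth_on_subset[OF r])
      (use f(2) vector_bundle_fibre(2)[OF B X] in auto)
  then show "smooth_on M {a \<in> A. x a \<in> V} real_line (\<lambda>a. \<Psi> (vscale B (r a) (f a)) i)"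
    by (rule smooth_on_cong) (use f(2) trivialization_linear(2)[OF B T] in auto)
qed

lemma smooth_on_vzero: "smooth_on M A (vtotal B) (\<lambda>a. vzero B (x a))"
proof (rule smooth_into_bundle[OF B M x])
  have vs: "real_vs (vfib B (x a)) (vadd B) (vscale B) (vzero B (x a))" if "a \<in> A" for a
    using vector_bundleD(5)[OF B smooth_on_image[OF x that]] .
  show z: "vzero B (x a) \<in> vfib B (x a)" if "a \<in> A" for a
    using real_vsD(1)[OF vs[OF that]] .
  fix V \<Psi> i assume T: "local_trivialization B V \<Psi>"
  have "\<Psi> (vzero B (x a)) i = 0" if "a \<in> A" "x a \<in> V" for a
    using trivialization_linear(2)[OF B T that(2) z[OF that(1)], of 0 i]
      real_vs_scale_0[OF vs[OF that(1)] z[OF that(1)]] by simp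
  then show "smooth_on M {a \<in> A. x a \<in> V} real_line (\<lambda>a. \<Psi> (vzero B (x a)) i)"
    by (intro smooth_on_cong[OF smooth_on_const[OF M charted_real_line, where c = 0]])
      (use smooth_on_domain[OF x] in auto)
qed

end

subsection \<open>The dual bundle\<close>

lemma points_dual_manifold: "points (dual_manifold B) = {(x, \<xi>). x \<in> points (vbase B) \<and> \<xi> \<in> dual_fib B x}"
  and mdim_dual_manifold [simp]: "mdim (dual_manifold B) = mdim (vbase B) + vrank B"
  by (auto simp: dual_manifold_def)

lemma dual_fibD:
  assumes "\<xi> \<in> dual_fib B x"
  shows "v \<in> vfib B x \<Longrightarrow> w \<in> vfib B x \<Longrightarrow> \<xi> (vadd B v w) = \<xi> v + \<xi> w"
    "v \<in> vfib B x \<Longrightarrow> \<xi> (vscale B r v) = r * \<xi> v" "\<xi> \<in> extensional (vfib B x)"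
  using assms unfolding dual_fib_def by auto

definition dual_domain :: "('v, 'm) vbundle \<Rightarrow> 'm set \<Rightarrow> 'm set \<Rightarrow> ('m \<times> ('v \<Rightarrow> real)) set" where
  "dual_domain B U V = {(x, \<xi>). x \<in> U \<inter> V \<and> \<xi> \<in> dual_fib B x}"

definition frame_values :: "('v, 'm) vbundle \<Rightarrow> ('v \<Rightarrow> nat \<Rightarrow> real) \<Rightarrow> 'm \<times> ('v \<Rightarrow> real) \<Rightarrow> nat \<Rightarrow> real" where
  "frame_values B \<Psi> = (\<lambda>(x, \<xi>) i. if i < vrank B then \<xi> (frame B \<Psi> i x) else 0)"

text \<open>The chart of \<open>dual_manifold\<close> in factored form: a functional is sent to its
  base point and its frame values, and a product chart follows. Questions about dual charts thus
  become questions on the base times a Euclidean space.\<close>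

definition dual_chart :: "('v, 'm) vbundle \<Rightarrow> ('m \<Rightarrow> nat \<Rightarrow> real) \<Rightarrow> ('v \<Rightarrow> nat \<Rightarrow> real) \<Rightarrow>
    'm \<times> ('v \<Rightarrow> real) \<Rightarrow> nat \<Rightarrow> real" where
  "dual_chart B \<phi> \<Psi> = (\<lambda>\<xi>. prod_chart (mdim (vbase B)) \<phi> (\<lambda>a. a) (fst \<xi>, frame_values B \<Psi> \<xi>))"

lemma atlas_dual_manifold:
  "atlas (dual_manifold B) = {(dual_domain B U V, dual_chart B \<phi> \<Psi>) | U \<phi> V \<Psi>.
     (U, \<phi>) \<in> atlas (vbase B) \<and> local_trivialization B V \<Psi>}"
proof -
  have "dual_chart B \<phi> \<Psi> = (\<lambda>(x, \<xi>) j. if j < mdim (vbase B) then \<phi> x j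
      else if j < mdim (vbase B) + vrank B
      then \<xi> (inv_into (vfib B x) \<Psi> (\<lambda>i. if i = j - mdim (vbase B) then 1 else 0)) else 0)" for \<phi> \<Psi>
    unfolding dual_chart_def prod_chart_def frame_values_def frame_def
    by (auto simp: fun_eq_iff)
  then show ?thesis
    by (simp add: dual_manifold_def dual_domain_def)
qed

lemma frame_values_in_Euclidean_space [simp]: "frame_values B \<Psi> \<xi> \<in> topspace (Euclidean_space (vrank B))"
  by (auto simp: frame_values_def topspace_Euclidean_space split: prod.splits)

lemma dual_chart_base: "i < mdim (vbase B) \<Longrightarrow> dual_chart B \<phi> \<Psi> \<xi> i = \<phi> (fst \<xi>) i"
  and dual_chart_frame: "i < vrank B \<Longrightarrow> dual_chart B \<phi> \<Psi> \<xi> (mdim (vbase B) + i) = snd \<xi> (frame B \<Psi> i (fst \<xi>))"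
  by (auto simp: dual_chart_def prod_chart_def frame_values_def split: prod.splits)

lemma dual_fib_frame:
  assumes B: "vector_bundle B" and T: "local_trivialization B V \<Psi>" and "x \<in> V" "\<xi> \<in> dual_fib B x" "v \<in> vfib B x"
  shows "\<xi> v = (\<Sum>i<vrank B. \<Psi> v i * frame_values B \<Psi> (x, \<xi>) i)"
  using linear_functional_frame[OF B T assms(3,5), of \<xi>] dual_fibD[OF assms(4)]
  by (simp add: frame_values_def)

text \<open>A change of dual charts is studied on the product of the base with a Euclidean space,
  where the calculus of smooth maps is available. There it is a change of chart in the base together
  with a linear change of frame values, whose coefficients are smooth functions of the base
  point.\<close>

lemma charted_dual:
  assumes B: "vector_bundle B"
  shows "charted (dual_manifold B)"
  unfolding charted_def
proof (intro conjI ballI allI impI)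
  let ?n = "mdim (vbase B)" and ?k = "vrank B" and ?X = "vbase B"
  let ?E = "topspace (Euclidean_space ?k)"
  note X = vector_bundleD(8)[OF B]
  show "\<exists>U \<phi>. (U, \<phi>) \<in> atlas (dual_manifold B) \<and> \<xi> \<in> U" if "\<xi> \<in> points (dual_manifold B)" for \<xi>
  proof -
    have x: "fst \<xi> \<in> points ?X" "snd \<xi> \<in> dual_fib B (fst \<xi>)"
      using that by (auto simp: points_dual_manifold)
    obtain U \<phi> where U: "(U, \<phi>) \<in> atlas ?X" "fst \<xi> \<in> U"
      using charted_point[OF X x(1)] by blast
    obtain V \<Psi> where V: "fst \<xi> \<in> V" "local_trivialization B V \<Psi>"
      using vector_bundleD(6)[OF B x(1)] by blast
    have "\<xi> \<in> dual_domain B U V"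
      using x U V by (auto simp: dual_domain_def)
    then show ?thesis
      using U V unfolding atlas_dual_manifold by blast
  qed
  show "U \<subseteq> points (dual_manifold B)" if "(U, \<phi>) \<in> atlas (dual_manifold B)" for U \<phi>
    using that trivialization_domain(2)[OF B]
    by (auto simp: atlas_dual_manifold points_dual_manifold dual_domain_def)
  show "\<phi> y \<in> topspace (Euclidean_space (mdim (dual_manifold B)))"
    if "(U, \<phi>) \<in> atlas (dual_manifold B)" "y \<in> U" for U \<phi> y
    using that charted_range[OF X] unfolding mdim_dual_manifold
    by (auto simp: atlas_dual_manifold dual_chart_def dual_domain_def intro!: select_prod_chart(3))
  have transition: "\<exists>W F. dual_chart B \<phi> \<Psi> \<xi>0 \<in> W \<and> smooth_map (?n + ?k) (?n + ?k) W F \<and>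
      (\<forall>\<xi>\<in>dual_domain B U V. dual_chart B \<phi> \<Psi> \<xi> \<in> W \<longrightarrow> \<xi> \<in> dual_domain B U' V' \<and>
        (\<forall>i<?n + ?k. dual_chart B \<phi>' \<Psi>' \<xi> i = F (dual_chart B \<phi> \<Psi> \<xi>) i))"
    if U: "(U, \<phi>) \<in> atlas ?X" "local_trivialization B V \<Psi>"
      and U': "(U', \<phi>') \<in> atlas ?X" "local_trivialization B V' \<Psi>'"
      and \<xi>0: "\<xi>0 \<in> dual_domain B U V" "\<xi>0 \<in> dual_domain B U' V'"
    for U \<phi> V \<Psi> U' \<phi>' V' \<Psi>' \<xi>0
  proof -
    let ?P = "prod_manifold ?X (euclid ?k)"
    have P: "charted ?P"
      by (intro charted_prod X charted_euclid)
    define x0 where "x0 = fst \<xi>0"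
    define p0 where "p0 = (x0, frame_values B \<Psi> \<xi>0)"
    have x0: "x0 \<in> U" "x0 \<in> V" "x0 \<in> U'" "x0 \<in> V'"
      using \<xi>0 by (auto simp: x0_def dual_domain_def)
    have x0X: "x0 \<in> points ?X"
      using charted_domain[OF X U(1)] x0(1) by blast
    have p0: "p0 \<in> points ?P"
      using x0X by (simp add: p0_def)
    have fst_P: "smooth_on ?P (points ?P) ?X fst"
      by (rule smooth_on_fst[OF X charted_euclid]) auto
    have at: "(U \<times> ?E, prod_chart ?n \<phi> (\<lambda>a. a)) \<in> atlas ?P"
      unfolding atlas_prod_manifold using U(1) by (auto simp: euclid_def)
    have p0': "p0 \<in> U \<times> ?E"
      using x0 by (simp add: p0_def)
    have near_V: "smooth_near ?P (points ?P) p0 (\<lambda>p. fst p \<in> V) 0 (\<lambda>_ _. 0)"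
      by (rule smooth_near_open_preimage[OF vector_bundleD(2)[OF B] fst_P trivialization_domain(1)[OF B U(2)] p0])
        (use x0 in \<open>simp add: p0_def\<close>)
    have near_V': "smooth_near ?P (points ?P) p0 (\<lambda>p. fst p \<in> V') 0 (\<lambda>_ _. 0)"
      by (rule smooth_near_open_preimage[OF vector_bundleD(2)[OF B] fst_P trivialization_domain(1)[OF B U'(2)] p0])
        (use x0 in \<open>simp add: p0_def\<close>)
    have near_VV: "smooth_near ?P (points ?P) p0 (\<lambda>p. fst p \<in> V \<and> fst p \<in> V') 0 (\<lambda>_ _. 0)"
      by (rule smooth_near_conj[OF P near_V near_V'])
    have near_U': "smooth_near ?P (points ?P) p0 (\<lambda>p. fst p \<in> U') ?n (\<lambda>p. \<phi>' (fst p))"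
      by (rule smooth_on_chart[OF X fst_P p0 U'(1)]) (use x0 in \<open>simp add: p0_def\<close>)
    let ?A = "{p \<in> points ?P. fst p \<in> V \<and> fst p \<in> V'}"
    \<comment> \<open>Frame values for the second trivialization: its frame vectors are expanded in
      the first frame, and the functional with frame values \<open>snd p\<close> is applied.\<close>
    define change where "change = (\<lambda>p i. \<Sum>j<?k. \<Psi> (frame B \<Psi>' i (fst p)) j * snd p j)"
    have sm: "smooth_on ?P ?A real_line (\<lambda>p. change p i)" if i: "i < ?k" for i
      unfolding change_def
    proof (rule smooth_on_sum[OF P])
      fix j assume j: "j < ?k"
      have fA: "smooth_on ?P ?A ?X fst"
        by (rule smooth_on_subset[OF fst_P]) auto
      have fr: "smooth_on ?P ?A (vtotal B) (\<lambda>p. frame B \<Psi>' i (fst p))"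
        by (rule smooth_on_frame[OF B U'(2) P fA _ i]) auto
      have 1: "smooth_on ?P ?A real_line (\<lambda>p. \<Psi> (frame B \<Psi>' i (fst p)) j)"
        by (rule smooth_on_trivialization[OF B U(2) P fr _ j])
          (use vector_bundle_fibre(2)[OF B _ frame_in_fibre[OF B U'(2) _ i]] in auto)
      have "smooth_on ?P ?A (euclid ?k) snd"
        by (rule smooth_on_snd[OF X charted_euclid]) auto
      then have 2: "smooth_on ?P ?A real_line (\<lambda>p. snd p j)"
        using j by (simp add: smooth_on_euclid_iff[OF P])
      show "smooth_on ?P ?A real_line (\<lambda>p. \<Psi> (frame B \<Psi>' i (fst p)) j * snd p j)"
        by (rule smooth_on_mult[OF P 1 2])
    qed auto
    have near_c: "smooth_near ?P (points ?P) p0 (\<lambda>p. fst p \<in> V \<and> fst p \<in> V') (Suc 0) (\<lambda>p _. change p i)"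
      if "i < ?k" for i
    proof -
      have "smooth_near ?P ?A p0 (\<lambda>_. True) (Suc 0) (\<lambda>p _. change p i)"
        using sm[OF that] x0 p0 unfolding smooth_on_real_iff by (auto simp: p0_def)
      from smooth_near_extend[OF P this near_VV] show ?thesis
        by simp
    qed
    let ?g = "\<lambda>p i. if i < ?n then \<phi>' (fst p) i else change p (i - ?n)"
    have "smooth_near ?P (points ?P) p0 (\<lambda>p. \<forall>i<?n + ?k. True) (?n + ?k) ?g"
    proof (rule smooth_near_components[OF P p0])
      fix i assume i: "i < ?n + ?k"
      show "smooth_near ?P (points ?P) p0 (\<lambda>_. True) (Suc 0) (\<lambda>p _. ?g p i)"
      proof (cases "i < ?n")
        case True
        show ?thesis
          by (rule smooth_near_mono[OF smooth_near_component[OF near_U' True]]) (use True in auto)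
      next
        case False
        with i have "i - ?n < ?k"
          by auto
        show ?thesis
          by (rule smooth_near_mono[OF near_c[OF \<open>i - ?n < ?k\<close>]]) (use False in auto)
      qed
    qed
    from smooth_near_conj[OF P smooth_near_conj[OF P this near_VV] near_U']
    have "smooth_near ?P (points ?P) p0 (\<lambda>p. fst p \<in> V' \<and> fst p \<in> U') (?n + ?k) ?g"
      by (rule smooth_near_mono) auto
    from smooth_near_chart[OF P this at p0'] obtain W F where
      WF: "prod_chart ?n \<phi> (\<lambda>a. a) p0 \<in> W" "smooth_map (?n + ?k) (?n + ?k) W F"
        "\<And>p. p \<in> points ?P \<Longrightarrow> p \<in> U \<times> ?E \<Longrightarrow> prod_chart ?n \<phi> (\<lambda>a. a) p \<in> W \<Longrightarrow> fst p \<in> V' \<and> fst p \<in> U'"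
        "\<And>p i. p \<in> points ?P \<Longrightarrow> p \<in> U \<times> ?E \<Longrightarrow> prod_chart ?n \<phi> (\<lambda>a. a) p \<in> W \<Longrightarrow> i < ?n + ?k \<Longrightarrow>
           ?g p i = F (prod_chart ?n \<phi> (\<lambda>a. a) p) i"
      by (auto simp: euclid_def)
    show ?thesis
    proof (intro exI conjI ballI impI allI)
      show "dual_chart B \<phi> \<Psi> \<xi>0 \<in> W"
        using WF(1) by (simp add: dual_chart_def p0_def x0_def)
      show "smooth_map (?n + ?k) (?n + ?k) W F"
        by (rule WF(2))
      fix \<xi> assume \<xi>: "\<xi> \<in> dual_domain B U V" "dual_chart B \<phi> \<Psi> \<xi> \<in> W"
      let ?p = "(fst \<xi>, frame_values B \<Psi> \<xi>)"
      have x: "fst \<xi> \<in> U" "fst \<xi> \<in> V" "snd \<xi> \<in> dual_fib B (fst \<xi>)" "fst \<xi> \<in> points ?X"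
        using \<xi>(1) charted_domain[OF X U(1)] by (auto simp: dual_domain_def)
      have p: "?p \<in> points ?P" "?p \<in> U \<times> ?E" "prod_chart ?n \<phi> (\<lambda>a. a) ?p \<in> W"
        using x \<xi>(2) by (simp_all add: dual_chart_def)
      have x': "fst \<xi> \<in> V'" "fst \<xi> \<in> U'"
        using WF(3)[OF p] by auto
      then show "\<xi> \<in> dual_domain B U' V'"
        using x by (auto simp: dual_domain_def)
      fix i assume i: "i < ?n + ?k"
      have "dual_chart B \<phi>' \<Psi>' \<xi> i = ?g ?p i"
      proof (cases "i < ?n")
        case True
        then show ?thesis
          by (simp add: dual_chart_base)
      next
        case False
        with i have i': "i - ?n < ?k"
          by auto
        have "dual_chart B \<phi>' \<Psi>' \<xi> i = snd \<xi> (frame B \<Psi>' (i - ?n) (fst \<xi>))"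
          using dual_chart_frame[OF i', of \<phi>' \<Psi>' \<xi>] False by simp
        also have "\<dots> = change ?p (i - ?n)"
          using dual_fib_frame[OF B U(2) x(2,3) frame_in_fibre[OF B U'(2) x'(1) i']] by (simp add: change_def)
        finally show ?thesis
          using False by simp
      qed
      then show "dual_chart B \<phi>' \<Psi>' \<xi> i = F (dual_chart B \<phi> \<Psi> \<xi>) i"
        using WF(4)[OF p i] by (simp add: dual_chart_def)
    qed
  qed
  fix S \<Phi> S' \<Phi>' \<xi> assume S: "(S, \<Phi>) \<in> atlas (dual_manifold B)" "(S', \<Phi>') \<in> atlas (dual_manifold B)"
    and \<xi>: "\<xi> \<in> S" "\<xi> \<in> S'"
  obtain U \<phi> V \<Psi> where 1: "S = dual_domain B U V" "\<Phi> = dual_chart B \<phi> \<Psi>"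
    "(U, \<phi>) \<in> atlas ?X" "local_trivialization B V \<Psi>"
    using S(1) unfolding atlas_dual_manifold by blast
  obtain U' \<phi>' V' \<Psi>' where 2: "S' = dual_domain B U' V'" "\<Phi>' = dual_chart B \<phi>' \<Psi>'"
    "(U', \<phi>') \<in> atlas ?X" "local_trivialization B V' \<Psi>'"
    using S(2) unfolding atlas_dual_manifold by blast
  show "\<exists>W F. \<Phi> \<xi> \<in> W \<and> smooth_map (mdim (dual_manifold B)) (mdim (dual_manifold B)) W F \<and>
        (\<forall>y\<in>S. \<Phi> y \<in> W \<longrightarrow> y \<in> S' \<and> (\<forall>i < mdim (dual_manifold B). \<Phi>' y i = F (\<Phi> y) i))"
    using transition[OF 1(3,4) 2(3,4)] \<xi> unfolding 1(1,2) 2(1,2) mdim_dual_manifold by blast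
qed

text \<open>The coordinates of a dual chart are those of the base point followed by the values on
  the frame, so these are the only functions to check.\<close>

lemma smooth_into_dual:
  assumes B: "vector_bundle B" and M: "charted M" and base: "smooth_on M A (vbase B) (\<lambda>a. fst (F a))"
    and F: "\<And>a. a \<in> A \<Longrightarrow> snd (F a) \<in> dual_fib B (fst (F a))"
    and sm: "\<And>V \<Psi> i. local_trivialization B V \<Psi> \<Longrightarrow> i < vrank B \<Longrightarrow>
        smooth_on M {a \<in> A. fst (F a) \<in> V} real_line (\<lambda>a. snd (F a) (frame B \<Psi> i (fst (F a))))"
  shows "smooth_on M A (dual_manifold B) F"
  unfolding smooth_on_iff
proof (intro conjI ballI)
  let ?n = "mdim (vbase B)" and ?k = "vrank B" and ?X = "vbase B"
  note X = vector_bundleD(8)[OF B]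
  show A: "A \<subseteq> points M"
    using smooth_on_domain[OF base] .
  show "F ` A \<subseteq> points (dual_manifold B)"
    using smooth_on_image[OF base] F by (auto simp: points_dual_manifold split: prod.splits) (metis fst_conv snd_conv)+
  fix a assume a: "a \<in> A"
  then have aM: "a \<in> points M"
    using A by blast
  obtain U \<phi> where U: "(U, \<phi>) \<in> atlas ?X" "fst (F a) \<in> U"
    using charted_point[OF X smooth_on_image[OF base a]] by blast
  obtain V \<Psi> where V: "fst (F a) \<in> V" "local_trivialization B V \<Psi>"
    using vector_bundleD(6)[OF B smooth_on_image[OF base a]] by blast
  have near_V: "smooth_near M A a (\<lambda>y. fst (F y) \<in> V) 0 (\<lambda>_ _. 0)"
    by (rule smooth_near_open_preimage[OF vector_bundleD(2)[OF B] base trivialization_domain(1)[OF B V(2)] a V(1)])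
  have near_U: "smooth_near M A a (\<lambda>y. fst (F y) \<in> U) ?n (\<lambda>y. \<phi> (fst (F y)))"
    by (rule smooth_on_chart[OF X base a U])
  have "smooth_near M A a (\<lambda>p. \<forall>i<?n + ?k. True) (?n + ?k) (\<lambda>y. dual_chart B \<phi> \<Psi> (F y))"
  proof (rule smooth_near_components[OF M aM])
    fix i assume i: "i < ?n + ?k"
    show "smooth_near M A a (\<lambda>_. True) (Suc 0) (\<lambda>y _. dual_chart B \<phi> \<Psi> (F y) i)"
    proof (cases "i < ?n")
      case True
      show ?thesis
        by (rule smooth_near_mono[OF smooth_near_component[OF near_U True]]) (use True in \<open>auto simp: dual_chart_base\<close>)
    next
      case False
      with i have i': "i - ?n < ?k"
        by auto
      have "smooth_near M {a \<in> A. fst (F a) \<in> V} a (\<lambda>_. True) (Suc 0)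
          (\<lambda>y _. snd (F y) (frame B \<Psi> (i - ?n) (fst (F y))))"
        using sm[OF V(2) i'] a V(1) unfolding smooth_on_real_iff by blast
      from smooth_near_extend[OF M this near_V] show ?thesis
        by (rule smooth_near_mono) (use dual_chart_frame[OF i', of \<phi> \<Psi>] False in auto)
    qed
  qed
  from smooth_near_conj[OF M smooth_near_conj[OF M this near_V] near_U]
  have "smooth_near M A a (\<lambda>y. F y \<in> dual_domain B U V) (mdim (dual_manifold B)) (\<lambda>y. dual_chart B \<phi> \<Psi> (F y))"
    unfolding mdim_dual_manifold
    by (rule smooth_near_mono) (use F in \<open>auto simp: dual_domain_def split: prod.splits\<close>, metis fst_conv snd_conv)
  then show "\<exists>V \<psi>. (V, \<psi>) \<in> atlas (dual_manifold B) \<and>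
      smooth_near M A a (\<lambda>y. F y \<in> V) (mdim (dual_manifold B)) (\<lambda>y. \<psi> (F y))"
    using U(1) V(2) unfolding atlas_dual_manifold by blast
qed

lemma smooth_on_dual_base:
  assumes B: "vector_bundle B" and M: "charted M" and F: "smooth_on M A (dual_manifold B) F"
  shows "smooth_on M A (vbase B) (\<lambda>a. fst (F a))"
  unfolding smooth_on_iff
proof (intro conjI ballI)
  show "A \<subseteq> points M"
    by (rule smooth_on_domain[OF F])
  show "(\<lambda>a. fst (F a)) ` A \<subseteq> points (vbase B)"
    using smooth_on_image[OF F] by (fastforce simp: points_dual_manifold)
  fix a assume a: "a \<in> A"
  obtain S \<Phi> where S: "(S, \<Phi>) \<in> atlas (dual_manifold B)"
    "smooth_near M A a (\<lambda>y. F y \<in> S) (mdim (dual_manifold B)) (\<lambda>y. \<Phi> (F y))"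
    using F a unfolding smooth_on_iff by blast
  obtain U \<phi> V \<Psi> where 1: "S = dual_domain B U V" "\<Phi> = dual_chart B \<phi> \<Psi>"
    "(U, \<phi>) \<in> atlas (vbase B)"
    using S(1) unfolding atlas_dual_manifold by blast
  have "smooth_near M A a (\<lambda>y. \<forall>i<mdim (vbase B). F y \<in> S) (mdim (vbase B)) (\<lambda>y. \<phi> (fst (F y)))"
  proof (rule smooth_near_components[OF M])
    show "a \<in> points M"
      using smooth_on_domain[OF F] a by blast
    fix i assume i: "i < mdim (vbase B)"
    show "smooth_near M A a (\<lambda>y. F y \<in> S) (Suc 0) (\<lambda>y _. \<phi> (fst (F y)) i)"
      by (rule smooth_near_mono[OF smooth_near_component[OF S(2), of i]])
        (use i 1 in \<open>auto simp: dual_chart_base\<close>)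
  qed
  from smooth_near_conj[OF M this S(2)]
  have "smooth_near M A a (\<lambda>y. fst (F y) \<in> U) (mdim (vbase B)) (\<lambda>y. \<phi> (fst (F y)))"
    by (rule smooth_near_mono) (auto simp: 1 dual_domain_def)
  with 1(3) show "\<exists>V \<psi>. (V, \<psi>) \<in> atlas (vbase B) \<and>
      smooth_near M A a (\<lambda>y. fst (F y) \<in> V) (mdim (vbase B)) (\<lambda>y. \<psi> (fst (F y)))"
    by blast
qed

text \<open>Over the domain of a dual chart the pairing is the sum of fibre coordinates of the
  vector times frame values of the functional, and both kinds of functions are smooth.\<close>

lemma smooth_on_pairing:
  assumes B: "vector_bundle B" and M: "charted M" and F: "smooth_on M A (dual_manifold B) F"
    and \<gamma>: "smooth_on M A (vtotal B) \<gamma>" "\<And>a. a \<in> A \<Longrightarrow> \<gamma> a \<in> vfib B (fst (F a))"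
  shows "smooth_on M A real_line (\<lambda>a. snd (F a) (\<gamma> a))"
proof (rule smooth_on_local[OF M smooth_on_domain[OF F]])
  fix a assume a: "a \<in> A"
  let ?n = "mdim (vbase B)" and ?k = "vrank B"
  obtain S \<Phi> where S: "(S, \<Phi>) \<in> atlas (dual_manifold B)"
    "smooth_near M A a (\<lambda>y. F y \<in> S) (mdim (dual_manifold B)) (\<lambda>y. \<Phi> (F y))"
    using F a unfolding smooth_on_iff by blast
  obtain U \<phi> V \<Psi> where 1: "S = dual_domain B U V" "\<Phi> = dual_chart B \<phi> \<Psi>"
    "local_trivialization B V \<Psi>"
    using S(1) unfolding atlas_dual_manifold by blast
  let ?A = "{x \<in> A. F x \<in> S}"
  have A: "?A \<subseteq> points M"
    using smooth_on_domain[OF F] by blast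
  have x: "fst (F y) \<in> V" "snd (F y) \<in> dual_fib B (fst (F y))" "fst (F y) \<in> points (vbase B)" if "y \<in> ?A" for y
    using that trivialization_domain(2)[OF B 1(3)] by (auto simp: 1 dual_domain_def)
  have fr: "smooth_on M ?A real_line (\<lambda>y. snd (F y) (frame B \<Psi> i (fst (F y))))" if i: "i < ?k" for i
  proof -
    have "smooth_on M ?A real_line (\<lambda>y. \<Phi> (F y) (?n + i))"
      by (rule smooth_on_compose[OF charted_dual[OF B] smooth_on_subset[OF F]
            smooth_on_chart_coordinate[OF charted_dual[OF B] S(1)]]) (use i in auto)
    then show ?thesis
      by (simp add: 1(2) dual_chart_frame[OF i])
  qed
  have tr: "smooth_on M ?A real_line (\<lambda>y. \<Psi> (\<gamma> y) i)" if i: "i < ?k" for i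
  proof (rule smooth_on_trivialization[OF B 1(3) M smooth_on_subset[OF \<gamma>(1)] _ i])
    show "vproj B (\<gamma> y) \<in> V" if "y \<in> ?A" for y
      using vector_bundle_fibre(2)[OF B x(3)[OF that] \<gamma>(2)] x(1)[OF that] that by simp
  qed auto
  have "smooth_on M ?A real_line (\<lambda>y. \<Sum>i<?k. \<Psi> (\<gamma> y) i * snd (F y) (frame B \<Psi> i (fst (F y))))"
    by (rule smooth_on_sum[OF M A smooth_on_mult[OF M tr fr]])
  moreover have "(\<Sum>i<?k. \<Psi> (\<gamma> y) i * snd (F y) (frame B \<Psi> i (fst (F y)))) = snd (F y) (\<gamma> y)" if "y \<in> ?A" for y
    using dual_fib_frame[OF B 1(3) x(1,2)[OF that], of "\<gamma> y"] \<gamma>(2) that by (simp add: frame_values_def case_prod_unfold)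
  ultimately have "smooth_on M ?A real_line (\<lambda>y. snd (F y) (\<gamma> y))"
    by (rule smooth_on_cong)
  moreover have "smooth_near M A a (\<lambda>y. F y \<in> S) 0 (\<lambda>_ _. 0)"
    by (rule smooth_near_mono[OF smooth_near_conj[OF M smooth_near_const[OF M] S(2)]])
      (use a smooth_on_domain[OF F] in auto)
  ultimately show "\<exists>P. smooth_near M A a P 0 (\<lambda>_ _. 0) \<and> smooth_on M {x \<in> A. P x} real_line (\<lambda>y. snd (F y) (\<gamma> y))"
    by blast
qed

section \<open>Cochains on a Lie groupoid\<close>

lemma lie_groupoidD:
  assumes "lie_groupoid G"
  shows "charted (arrows G)" "charted (objects G)"
    "smooth_on (arrows G) (points (arrows G)) (objects G) (src G)"
    "smooth_on (arrows G) (points (arrows G)) (objects G) (tgt G)"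
    "smooth_on (objects G) (points (objects G)) (arrows G) (unit G)"
    "smooth_on (prod_manifold (arrows G) (arrows G)) (composable_pairs G) (arrows G) (\<lambda>(g, h). mul G g h)"
    "smooth_on (arrows G) (points (arrows G)) (arrows G) (ginv G)"
  using assms unfolding lie_groupoid_def submersion_def by (simp_all add: is_manifold_imp_charted)

lemma lie_groupoid_points:
  assumes "lie_groupoid G"
  shows "g \<in> points (arrows G) \<Longrightarrow> src G g \<in> points (objects G)"
    "g \<in> points (arrows G) \<Longrightarrow> tgt G g \<in> points (objects G)"
    "x \<in> points (objects G) \<Longrightarrow> unit G x \<in> points (arrows G)"
    "g \<in> points (arrows G) \<Longrightarrow> ginv G g \<in> points (arrows G)"
    "g \<in> points (arrows G) \<Longrightarrow> h \<in> points (arrows G) \<Longrightarrow> src G g = tgt G h \<Longrightarrow> mul G g h \<in> points (arrows G)"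
  using smooth_on_image[OF lie_groupoidD(3)[OF assms]] smooth_on_image[OF lie_groupoidD(4)[OF assms]]
    smooth_on_image[OF lie_groupoidD(5)[OF assms]] smooth_on_image[OF lie_groupoidD(7)[OF assms]]
    smooth_on_image[OF lie_groupoidD(6)[OF assms], of "(g, h)"] by (simp_all add: composable_pairs_def)

lemma chainsD:
  assumes "gs \<in> chains G n"
  shows "length gs = n" "set gs \<subseteq> points (arrows G)" "i < n \<Longrightarrow> gs ! i \<in> points (arrows G)"
    "Suc i < n \<Longrightarrow> src G (gs ! i) = tgt G (gs ! Suc i)"
  using assms by (auto simp: chains_def)

lemma chains_nonempty: "gs \<in> chains G n \<Longrightarrow> 0 < n \<Longrightarrow> gs \<noteq> []"
  by (auto simp: chains_def)

lemma hd_in_arrows: "gs \<in> chains G n \<Longrightarrow> 0 < n \<Longrightarrow> hd gs \<in> points (arrows G)"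
  using chainsD(1,3)[of gs G n] by (simp add: hd_conv_nth chains_nonempty)

lemma last_in_arrows: "gs \<in> chains G n \<Longrightarrow> 0 < n \<Longrightarrow> last gs \<in> points (arrows G)"
  using chainsD(1,3)[of gs G n] by (simp add: last_conv_nth chains_nonempty)

lemma take_in_chains: "gs \<in> chains G (m + n) \<Longrightarrow> take m gs \<in> chains G m"
  using set_take_subset[of m gs] by (fastforce simp: chains_def)

lemma drop_in_chains: "gs \<in> chains G (m + n) \<Longrightarrow> drop m gs \<in> chains G n"
  using set_drop_subset[of m gs] by (fastforce simp: chains_def)

lemma nerve_0: "nerve G 0 = Obj ` points (objects G)"
  and nerve_pos: "0 < n \<Longrightarrow> nerve G (int n) = Arr ` chains G n"
  and nerve_neg: "p < 0 \<Longrightarrow> nerve G p = {}"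
  by (auto simp: nerve_def)

lemma nerve_cases [consumes 1, case_names Obj Arr]:
  assumes "\<sigma> \<in> nerve G (int n)"
  obtains (Obj) x where "n = 0" "\<sigma> = Obj x" "x \<in> points (objects G)"
  | (Arr) gs where "n > 0" "\<sigma> = Arr gs" "gs \<in> chains G n"
  using assms by (cases "n = 0") (auto simp: nerve_0 nerve_pos)

lemma chains_power: "chains G n \<subseteq> points (power_manifold (arrows G) n)"
  by (auto simp: chains_def)

section \<open>Cutting chains: the identities behind associativity of the action\<close>

lemma left_part_left_part:
  assumes "\<sigma> \<in> nerve G (int (m + n + k))"
  shows "left_part G m (left_part G (m + n) \<sigma>) = left_part G m \<sigma>"
  using assms by (cases rule: nerve_cases) (auto simp: hd_take min_def)

lemma right_part_right_part:
  assumes "\<sigma> \<in> nerve G (int (m + n + k))"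
  shows "right_part G n (right_part G m \<sigma>) = right_part G (m + n) \<sigma>"
  using assms by (cases rule: nerve_cases) (auto simp: add.commute dest: chainsD(1))

lemma right_part_left_part:
  assumes "\<sigma> \<in> nerve G (int (m + n + k))"
  shows "right_part G m (left_part G (m + n) \<sigma>) = left_part G n (right_part G m \<sigma>)"
  using assms
proof (cases rule: nerve_cases)
  case (Arr gs)
  have len: "length gs = m + n + k"
    using Arr chainsD(1) by blast
  show ?thesis
  \<comment> \<open>An empty middle piece between two nonempty ones. One side is then the source of
    the arrow before the cut, the other the target of the arrow after it, and composability
    identifies the two objects.\<close>
  proof (cases "n = 0 \<and> m > 0 \<and> k > 0")
    case True
    then have "src G (gs ! (m - 1)) = tgt G (gs ! Suc (m - 1))"
      using Arr chainsD(4)[of gs G "m + n + k" "m - 1"] by auto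
    moreover have "take m gs \<noteq> []"
      using True len by auto
    then have "last (take m gs) = gs ! (m - 1)" "hd (drop m gs) = gs ! m"
      using True len by (simp_all add: last_conv_nth hd_drop_conv_nth)
    ultimately show ?thesis
      using True len Arr by auto
  next
    case False
    then show ?thesis
      using len Arr by (auto simp: drop_take)
  qed
qed auto

lemma left_part_all: "\<sigma> \<in> nerve G (int n) \<Longrightarrow> left_part G n \<sigma> = \<sigma>"
  by (erule nerve_cases) (auto dest: chainsD(1))

lemma right_part_0: "\<sigma> \<in> nerve G (int n) \<Longrightarrow> right_part G 0 \<sigma> = \<sigma>"
  by (erule nerve_cases) (auto dest: chainsD(1))

context
  fixes G :: "('g, 'm) groupoid"
  assumes G: "lie_groupoid G"
begin

lemma left_end_in_objects: "\<sigma> \<in> nerve G p \<Longrightarrow> left_end G \<sigma> \<in> points (objects G)"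
  using lie_groupoid_points(2)[OF G] hd_in_arrows by (fastforce simp: nerve_def split: if_splits)

lemma left_part_in_nerve:
  assumes "\<sigma> \<in> nerve G (int (m + n))"
  shows "left_part G m \<sigma> \<in> nerve G (int m)" "left_end G (left_part G m \<sigma>) = left_end G \<sigma>"
proof -
  show "left_part G m \<sigma> \<in> nerve G (int m)"
    using assms
  proof (cases rule: nerve_cases)
    case (Arr gs)
    then show ?thesis
      using lie_groupoid_points(2)[OF G hd_in_arrows[OF Arr(3,1)]] take_in_chains[of gs G m n]
      by (cases "m = 0") (auto simp: nerve_0 nerve_pos)
  qed (auto simp: nerve_0)
  show "left_end G (left_part G m \<sigma>) = left_end G \<sigma>"
    using assms by (cases rule: nerve_cases) (auto simp: hd_take)
qed

lemma right_part_in_nerve: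
  assumes "\<sigma> \<in> nerve G (int (m + n))"
  shows "right_part G m \<sigma> \<in> nerve G (int n)"
  using assms
proof (cases rule: nerve_cases)
  case (Arr gs)
  then show ?thesis
    using lie_groupoid_points(1)[OF G last_in_arrows[OF Arr(3,1)]] drop_in_chains[of gs G m n] chainsD(1)[OF Arr(3)]
    by (cases "n = 0") (auto simp: nerve_0 nerve_pos)
qed (auto simp: nerve_0)

lemma smooth_cochain_0: "smooth_cochain G T 0 \<omega> \<longleftrightarrow> smooth_on (objects G) (points (objects G)) T (\<lambda>x. \<omega> (Obj x))"
  and smooth_cochain_pos: "0 < n \<Longrightarrow> smooth_cochain G T (int n) \<omega> \<longleftrightarrow>
      smooth_on (power_manifold (arrows G) n) (chains G n) T (\<lambda>gs. \<omega> (Arr gs))"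
  by (auto simp: smooth_cochain_def)

lemma charted_chains: "charted (power_manifold (arrows G) n)"
  by (rule charted_power[OF lie_groupoidD(1)[OF G]])

lemma smooth_cochain_compose:
  assumes "smooth_cochain G N p \<omega>" "charted N" "smooth_on N S P f" "\<And>\<sigma>. \<sigma> \<in> nerve G p \<Longrightarrow> \<omega> \<sigma> \<in> S"
  shows "smooth_cochain G P p (\<lambda>\<sigma>. f (\<omega> \<sigma>))"
  unfolding smooth_cochain_def
proof (intro conjI impI)
  assume p: "p = 0"
  then have "smooth_on (objects G) (points (objects G)) N (\<lambda>x. \<omega> (Obj x))"
    using assms(1) by (simp add: smooth_cochain_def)
  then show "smooth_on (objects G) (points (objects G)) P (\<lambda>x. f (\<omega> (Obj x)))"
    by (rule smooth_on_compose[OF assms(2) _ assms(3)]) (simp add: assms(4) nerve_def p)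
next
  assume p: "p > 0"
  then have "smooth_on (power_manifold (arrows G) (nat p)) (chains G (nat p)) N (\<lambda>gs. \<omega> (Arr gs))"
    using assms(1) by (simp add: smooth_cochain_def)
  then show "smooth_on (power_manifold (arrows G) (nat p)) (chains G (nat p)) P (\<lambda>gs. f (\<omega> (Arr gs)))"
    by (rule smooth_on_compose[OF assms(2) _ assms(3)]) (use p in \<open>simp add: assms(4) nerve_def\<close>)
qed

lemma smooth_cochain_Pair:
  assumes "smooth_cochain G N p \<omega>" "smooth_cochain G P p \<eta>"
  shows "smooth_cochain G (prod_manifold N P) p (\<lambda>\<sigma>. (\<omega> \<sigma>, \<eta> \<sigma>))"
  using assms unfolding smooth_cochain_def
  by (auto intro!: smooth_on_Pair lie_groupoidD(2)[OF G] charted_chains)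

lemma smooth_cochain_cong:
  assumes "smooth_cochain G N p \<omega>" "\<And>\<sigma>. \<sigma> \<in> nerve G p \<Longrightarrow> \<omega> \<sigma> = \<eta> \<sigma>"
  shows "smooth_cochain G N p \<eta>"
  unfolding smooth_cochain_def
proof (intro conjI impI)
  assume p: "p = 0"
  then have "smooth_on (objects G) (points (objects G)) N (\<lambda>x. \<omega> (Obj x))"
    using assms(1) by (simp add: smooth_cochain_def)
  then show "smooth_on (objects G) (points (objects G)) N (\<lambda>x. \<eta> (Obj x))"
    by (rule smooth_on_cong) (simp add: assms(2) nerve_def p)
next
  assume p: "p > 0"
  then have "smooth_on (power_manifold (arrows G) (nat p)) (chains G (nat p)) N (\<lambda>gs. \<omega> (Arr gs))"
    using assms(1) by (simp add: smooth_cochain_def)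
  then show "smooth_on (power_manifold (arrows G) (nat p)) (chains G (nat p)) N (\<lambda>gs. \<eta> (Arr gs))"
    by (rule smooth_on_cong) (use p in \<open>simp add: assms(2) nerve_def\<close>)
qed

lemma smooth_cochain_const:
  assumes "charted N" "c \<in> points N"
  shows "smooth_cochain G N p (\<lambda>_. c)"
  unfolding smooth_cochain_def
  using smooth_on_const[OF lie_groupoidD(2)[OF G] assms(1) subset_refl assms(2)]
    smooth_on_const[OF charted_chains assms(1) chains_power assms(2)] by blast

lemma smooth_on_chain_nth: "i < n \<Longrightarrow> smooth_on (power_manifold (arrows G) n) (chains G n) (arrows G) (\<lambda>gs. gs ! i)"
  by (rule smooth_on_nth[OF lie_groupoidD(1)[OF G] chains_power])

lemma smooth_on_tgt_hd:
  assumes "0 < n"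
  shows "smooth_on (power_manifold (arrows G) n) (chains G n) (objects G) (\<lambda>gs. tgt G (hd gs))"
proof -
  have "smooth_on (power_manifold (arrows G) n) (chains G n) (objects G) (\<lambda>gs. tgt G (gs ! 0))"
    by (rule smooth_on_compose[OF lie_groupoidD(1)[OF G] smooth_on_chain_nth[OF assms] lie_groupoidD(4)[OF G]])
      (use chainsD(3) assms in blast)
  then show ?thesis
    by (rule smooth_on_cong) (simp add: hd_conv_nth chains_nonempty[OF _ assms])
qed

lemma smooth_on_src_last:
  assumes "0 < n"
  shows "smooth_on (power_manifold (arrows G) n) (chains G n) (objects G) (\<lambda>gs. src G (last gs))"
proof -
  have n: "n - 1 < n"
    using assms by simp
  have "smooth_on (power_manifold (arrows G) n) (chains G n) (objects G) (\<lambda>gs. src G (gs ! (n - 1)))"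
    by (rule smooth_on_compose[OF lie_groupoidD(1)[OF G] smooth_on_chain_nth[OF n] lie_groupoidD(3)[OF G]])
      (use chainsD(3) n in blast)
  then show ?thesis
    by (rule smooth_on_cong) (simp add: last_conv_nth chains_nonempty[OF _ assms] chainsD(1))
qed

lemma smooth_cochain_left_end: "smooth_cochain G (objects G) p (left_end G)"
  unfolding smooth_cochain_def
  using smooth_on_tgt_hd smooth_on_id[OF lie_groupoidD(2)[OF G] subset_refl] by auto

lemma smooth_cochain_left_part:
  assumes \<omega>: "smooth_cochain G N (int m) \<omega>"
  shows "smooth_cochain G N (int (m + n)) (\<lambda>\<sigma>. \<omega> (left_part G m \<sigma>))"
proof (cases "m + n = 0")
  case False
  then have mn: "0 < m + n"
    by simp
  show ?thesis
    unfolding smooth_cochain_pos[OF mn]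
  proof (cases "m = 0")
    case True
    with \<omega> have "smooth_on (objects G) (points (objects G)) N (\<lambda>x. \<omega> (Obj x))"
      by (simp add: smooth_cochain_0)
    from smooth_on_compose[OF lie_groupoidD(2)[OF G] smooth_on_tgt_hd[OF mn] this]
    show "smooth_on (power_manifold (arrows G) (m + n)) (chains G (m + n)) N (\<lambda>gs. \<omega> (left_part G m (Arr gs)))"
      using True lie_groupoid_points(2)[OF G hd_in_arrows] mn by simp
  next
    case False
    have "smooth_on (power_manifold (arrows G) (m + n)) (chains G (m + n)) (power_manifold (arrows G) m) (take m)"
    proof (rule smooth_on_list[OF charted_chains chains_power])
      fix i assume i: "i < m"
      have "smooth_on (power_manifold (arrows G) (m + n)) (chains G (m + n)) (arrows G) (\<lambda>gs. gs ! i)"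
        using i by (intro smooth_on_chain_nth) simp
      then show "smooth_on (power_manifold (arrows G) (m + n)) (chains G (m + n)) (arrows G) (\<lambda>gs. take m gs ! i)"
        using i by simp
    qed (auto dest: chainsD(1))
    moreover have "smooth_on (power_manifold (arrows G) m) (chains G m) N (\<lambda>gs. \<omega> (Arr gs))"
      using \<omega> False by (simp add: smooth_cochain_pos)
    ultimately have "smooth_on (power_manifold (arrows G) (m + n)) (chains G (m + n)) N (\<lambda>gs. \<omega> (Arr (take m gs)))"
      by (rule smooth_on_compose[OF charted_chains]) (rule take_in_chains)
    then show "smooth_on (power_manifold (arrows G) (m + n)) (chains G (m + n)) N (\<lambda>gs. \<omega> (left_part G m (Arr gs)))"
      using False by simp
  qed
qed (use \<omega> in \<open>simp add: smooth_cochain_0\<close>)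

lemma smooth_cochain_right_part:
  assumes \<omega>: "smooth_cochain G N (int n) \<omega>"
  shows "smooth_cochain G N (int (m + n)) (\<lambda>\<sigma>. \<omega> (right_part G m \<sigma>))"
proof (cases "m + n = 0")
  case False
  then have mn: "0 < m + n"
    by simp
  show ?thesis
    unfolding smooth_cochain_pos[OF mn]
  proof (cases "n = 0")
    case True
    with \<omega> have "smooth_on (objects G) (points (objects G)) N (\<lambda>x. \<omega> (Obj x))"
      by (simp add: smooth_cochain_0)
    from smooth_on_compose[OF lie_groupoidD(2)[OF G] smooth_on_src_last[OF mn] this]
    have "smooth_on (power_manifold (arrows G) (m + n)) (chains G (m + n)) N (\<lambda>gs. \<omega> (Obj (src G (last gs))))"
      using lie_groupoid_points(1)[OF G last_in_arrows] mn by blast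
    then show "smooth_on (power_manifold (arrows G) (m + n)) (chains G (m + n)) N (\<lambda>gs. \<omega> (right_part G m (Arr gs)))"
      by (rule smooth_on_cong) (use True chainsD(1) in auto)
  next
    case False
    have "smooth_on (power_manifold (arrows G) (m + n)) (chains G (m + n)) (power_manifold (arrows G) n) (drop m)"
    proof (rule smooth_on_list[OF charted_chains chains_power])
      fix i assume i: "i < n"
      have "smooth_on (power_manifold (arrows G) (m + n)) (chains G (m + n)) (arrows G) (\<lambda>gs. gs ! (m + i))"
        using i by (intro smooth_on_chain_nth) simp
      then show "smooth_on (power_manifold (arrows G) (m + n)) (chains G (m + n)) (arrows G) (\<lambda>gs. drop m gs ! i)"
        by (rule smooth_on_cong) (simp add: chainsD(1))
    qed (auto dest: chainsD(1))
    moreover have "smooth_on (power_manifold (arrows G) n) (chains G n) N (\<lambda>gs. \<omega> (Arr gs))"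
      using \<omega> False by (simp add: smooth_cochain_pos)
    ultimately have "smooth_on (power_manifold (arrows G) (m + n)) (chains G (m + n)) N (\<lambda>gs. \<omega> (Arr (drop m gs)))"
      by (rule smooth_on_compose[OF charted_chains]) (rule drop_in_chains)
    then show "smooth_on (power_manifold (arrows G) (m + n)) (chains G (m + n)) N (\<lambda>gs. \<omega> (right_part G m (Arr gs)))"
      by (rule smooth_on_cong) (use False in \<open>simp add: chainsD(1)\<close>)
  qed
qed (use \<omega> in \<open>simp add: smooth_cochain_0\<close>)

end

lemma cochainsD:
  assumes "\<omega> \<in> cochains G B p"
  shows "\<omega> \<in> extensional (nerve G p)" "\<sigma> \<in> nerve G p \<Longrightarrow> \<omega> \<sigma> \<in> vfib B (left_end G \<sigma>)"
    "smooth_cochain G (vtotal B) p \<omega>"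
  using assms by (auto simp: cochains_def)

lemma cochains_eqI:
  "\<omega> \<in> extensional (nerve G p) \<Longrightarrow> \<eta> \<in> extensional (nerve G p) \<Longrightarrow>
    (\<And>\<sigma>. \<sigma> \<in> nerve G p \<Longrightarrow> \<omega> \<sigma> = \<eta> \<sigma>) \<Longrightarrow> \<omega> = \<eta>"
  by (rule extensionalityI)

text \<open>
  The properties shared by vector bundles over the objects, the core and the trivial family
  \<^const>\<open>real_family\<close> that make cochains with values in them a module.
\<close>

locale smooth_family =
  fixes G :: "('g, 'm) groupoid" and B :: "('v, 'm, 'z) vfamily_scheme"
  assumes G: "lie_groupoid G"
    and charted_total: "charted (vtotal B)"
    and fibre_vs: "x \<in> points (objects G) \<Longrightarrow> real_vs (vfib B x) (vadd B) (vscale B) (vzero B x)"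
    and smooth_add: "smooth_on (prod_manifold (vtotal B) (vtotal B))
      {(v, w). \<exists>x\<in>points (objects G). v \<in> vfib B x \<and> w \<in> vfib B x} (vtotal B) (\<lambda>(v, w). vadd B v w)"
    and smooth_scale: "smooth_on (prod_manifold real_line (vtotal B))
      {(r, v). \<exists>x\<in>points (objects G). v \<in> vfib B x} (vtotal B) (\<lambda>(r, v). vscale B r v)"
    and smooth_zero: "smooth_on (objects G) (points (objects G)) (vtotal B) (vzero B)"
begin

section \<open>The graded module of cochains with values in a smooth family\<close>

lemma restrict_in_cochains:
  assumes "\<And>\<sigma>. \<sigma> \<in> nerve G p \<Longrightarrow> \<omega> \<sigma> \<in> vfib B (left_end G \<sigma>)" "smooth_cochain G (vtotal B) p \<omega>"
  shows "restrict \<omega> (nerve G p) \<in> cochains G B p"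
proof -
  have "smooth_cochain G (vtotal B) p (restrict \<omega> (nerve G p))"
    by (rule smooth_cochain_cong[OF G assms(2)]) simp
  with assms(1) show ?thesis
    by (simp add: cochains_def)
qed

lemma vs: "\<sigma> \<in> nerve G p \<Longrightarrow> real_vs (vfib B (left_end G \<sigma>)) (vadd B) (vscale B) (vzero B (left_end G \<sigma>))"
  by (rule fibre_vs[OF left_end_in_objects[OF G]])

lemma cochain_zero_in_cochains: "cochain_zero G B p \<in> cochains G B p"
  unfolding cochain_zero_def
proof (rule restrict_in_cochains)
  show "smooth_cochain G (vtotal B) p (\<lambda>\<sigma>. vzero B (left_end G \<sigma>))"
    by (rule smooth_cochain_compose[OF G smooth_cochain_left_end[OF G] lie_groupoidD(2)[OF G] smooth_zero])
      (rule left_end_in_objects[OF G])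
qed (rule real_vsD(1)[OF vs])

lemma smooth_cochain_vadd:
  assumes "smooth_cochain G (vtotal B) p \<omega>" "smooth_cochain G (vtotal B) p \<eta>"
    "\<And>\<sigma>. \<sigma> \<in> nerve G p \<Longrightarrow> \<omega> \<sigma> \<in> vfib B (left_end G \<sigma>)" "\<And>\<sigma>. \<sigma> \<in> nerve G p \<Longrightarrow> \<eta> \<sigma> \<in> vfib B (left_end G \<sigma>)"
  shows "smooth_cochain G (vtotal B) p (\<lambda>\<sigma>. vadd B (\<omega> \<sigma>) (\<eta> \<sigma>))"
  using smooth_cochain_compose[OF G smooth_cochain_Pair[OF G assms(1,2)] charted_prod[OF charted_total charted_total] smooth_add]
    assms(3,4) left_end_in_objects[OF G] by fastforce

lemma smooth_cochain_vscale:
  assumes "smooth_cochain G real_line p f" "smooth_cochain G (vtotal B) p \<omega>"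
    "\<And>\<sigma>. \<sigma> \<in> nerve G p \<Longrightarrow> \<omega> \<sigma> \<in> vfib B (left_end G \<sigma>)"
  shows "smooth_cochain G (vtotal B) p (\<lambda>\<sigma>. vscale B (f \<sigma>) (\<omega> \<sigma>))"
  using smooth_cochain_compose[OF G smooth_cochain_Pair[OF G assms(1,2)] charted_prod[OF charted_real_line charted_total] smooth_scale]
    assms(3) left_end_in_objects[OF G] by fastforce

lemma gadd_in_cochains:
  "\<omega> \<in> cochains G B p \<Longrightarrow> \<eta> \<in> cochains G B p \<Longrightarrow> gadd (cochain_module G B) p \<omega> \<eta> \<in> cochains G B p"
  unfolding cochain_module_def
  by (simp, rule restrict_in_cochains) (auto intro: real_vsD(2)[OF vs] cochainsD smooth_cochain_vadd)

lemma gscale_in_cochains: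
  "\<omega> \<in> cochains G B p \<Longrightarrow> gscale (cochain_module G B) p r \<omega> \<in> cochains G B p"
  unfolding cochain_module_def
  by (simp, rule restrict_in_cochains)
    (auto intro: real_vsD(3)[OF vs] cochainsD smooth_cochain_vscale[OF smooth_cochain_const[OF G charted_real_line]])

lemma real_vs_cochains:
  "real_vs (cochains G B p) (gadd (cochain_module G B) p) (gscale (cochain_module G B) p) (cochain_zero G B p)"
proof -
  have app: "gadd (cochain_module G B) p \<omega> \<eta> \<sigma> = vadd B (\<omega> \<sigma>) (\<eta> \<sigma>)"
    "gscale (cochain_module G B) p r \<omega> \<sigma> = vscale B r (\<omega> \<sigma>)"
    "cochain_zero G B p \<sigma> = vzero B (left_end G \<sigma>)" if "\<sigma> \<in> nerve G p" for \<omega> \<eta> \<sigma> r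
    using that by (simp_all add: cochain_module_def cochain_zero_def)
  have eqI: "\<omega> = \<eta>" if "\<omega> \<in> cochains G B p" "\<eta> \<in> cochains G B p" "\<And>\<sigma>. \<sigma> \<in> nerve G p \<Longrightarrow> \<omega> \<sigma> = \<eta> \<sigma>" for \<omega> \<eta>
    using that cochains_eqI cochainsD(1) by blast
  note in_cochains = gadd_in_cochains gscale_in_cochains cochain_zero_in_cochains
  show ?thesis
    unfolding real_vs_def
  proof (intro conjI ballI allI)
    fix \<omega> assume \<omega>: "\<omega> \<in> cochains G B p"
    note w = cochainsD(2)[OF \<omega>]
    show "gadd (cochain_module G B) p (cochain_zero G B p) \<omega> = \<omega>"
      by (rule eqI) (simp_all add: in_cochains app \<omega> real_vsD(6)[OF vs w])
    show "\<exists>\<eta>\<in>cochains G B p. gadd (cochain_module G B) p \<omega> \<eta> = cochain_zero G B p"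
    proof (rule bexI[of _ "gscale (cochain_module G B) p (-1) \<omega>"], rule eqI)
      show "gadd (cochain_module G B) p \<omega> (gscale (cochain_module G B) p (-1) \<omega>) \<in> cochains G B p"
        by (intro gadd_in_cochains gscale_in_cochains \<omega>)
    qed (simp_all add: app in_cochains \<omega> real_vs_right_minus[OF vs w])
    show "gscale (cochain_module G B) p (r + s) \<omega> =
        gadd (cochain_module G B) p (gscale (cochain_module G B) p r \<omega>) (gscale (cochain_module G B) p s \<omega>)" for r s
      by (rule eqI) (simp_all add: in_cochains app \<omega> real_vsD(9)[OF vs w])
    show "gscale (cochain_module G B) p (r * s) \<omega> = gscale (cochain_module G B) p r (gscale (cochain_module G B) p s \<omega>)" for r s
      by (rule eqI) (simp_all add: in_cochains app \<omega> real_vsD(10)[OF vs w])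
    show "gscale (cochain_module G B) p 1 \<omega> = \<omega>"
      by (rule eqI) (simp_all add: in_cochains app \<omega> real_vsD(11)[OF vs w])
    fix \<eta> assume \<eta>: "\<eta> \<in> cochains G B p"
    note e = cochainsD(2)[OF \<eta>]
    show "gadd (cochain_module G B) p \<omega> \<eta> = gadd (cochain_module G B) p \<eta> \<omega>"
      by (rule eqI) (simp_all add: app \<omega> \<eta> real_vsD(5)[OF vs w e] in_cochains)
    show "gscale (cochain_module G B) p r (gadd (cochain_module G B) p \<omega> \<eta>) =
        gadd (cochain_module G B) p (gscale (cochain_module G B) p r \<omega>) (gscale (cochain_module G B) p r \<eta>)" for r
      by (rule eqI) (simp_all add: in_cochains app \<omega> \<eta> real_vsD(8)[OF vs w e])
    fix \<zeta> assume \<zeta>: "\<zeta> \<in> cochains G B p"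
    show "gadd (cochain_module G B) p (gadd (cochain_module G B) p \<omega> \<eta>) \<zeta> =
        gadd (cochain_module G B) p \<omega> (gadd (cochain_module G B) p \<eta> \<zeta>)"
      by (rule eqI) (simp_all add: in_cochains app \<omega> \<eta> \<zeta> real_vsD(4)[OF vs w e cochainsD(2)[OF \<zeta>]])
  qed (simp_all add: in_cochains)
qed

lemma gact_nonneg:
  "gact (cochain_module G B) (int m) (int n) \<omega> f = (\<lambda>\<sigma>\<in>nerve G (int (m + n)).
     vscale B (f (right_part G m \<sigma>)) (\<omega> (left_part G m \<sigma>)))"
  by (simp add: cochain_module_def)

lemma gact_neg:
  "p < 0 \<or> q < 0 \<Longrightarrow> gact (cochain_module G B) p q \<omega> f = cochain_zero G B (p + q)"
  by (auto simp: cochain_module_def)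

lemma gact_cases:
  fixes p q :: int
  obtains "p < 0 \<or> q < 0" | m n where "p = int m" "q = int n"
  by (metis nonneg_int_cases not_less)

lemma gact_in_cochains:
  assumes \<omega>: "\<omega> \<in> cochains G B p" and f: "f \<in> cochains G real_family q"
  shows "gact (cochain_module G B) p q \<omega> f \<in> cochains G B (p + q)"
proof (cases p q rule: gact_cases)
  case 1
  then show ?thesis
    by (simp add: gact_neg cochain_zero_in_cochains)
next
  case (2 m n)
  have "(\<lambda>\<sigma>\<in>nerve G (int (m + n)). vscale B (f (right_part G m \<sigma>)) (\<omega> (left_part G m \<sigma>)))
      \<in> cochains G B (int (m + n))"
  proof (rule restrict_in_cochains)
    have mem: "\<omega> (left_part G m \<sigma>) \<in> vfib B (left_end G \<sigma>)" if "\<sigma> \<in> nerve G (int (m + n))" for \<sigma>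
      using cochainsD(2)[OF \<omega>, of "left_part G m \<sigma>"] left_part_in_nerve[OF G that] 2 by simp
    then show "vscale B (f (right_part G m \<sigma>)) (\<omega> (left_part G m \<sigma>)) \<in> vfib B (left_end G \<sigma>)"
      if "\<sigma> \<in> nerve G (int (m + n))" for \<sigma>
      using real_vsD(3)[OF vs] that by blast
    show "smooth_cochain G (vtotal B) (int (m + n)) (\<lambda>\<sigma>. vscale B (f (right_part G m \<sigma>)) (\<omega> (left_part G m \<sigma>)))"
      using cochainsD(3)[OF \<omega>] cochainsD(3)[OF f] 2
      by (intro smooth_cochain_vscale smooth_cochain_right_part[OF G] smooth_cochain_left_part[OF G] mem)
        (simp_all add: real_family_def)
  qed
  then show ?thesis
    using 2 by (simp add: gact_nonneg)
qed

lemma gact_linear: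
  assumes \<omega>: "\<omega> \<in> cochains G B p" and \<eta>: "\<eta> \<in> cochains G B p"
  shows "gact (cochain_module G B) p q (gadd (cochain_module G B) p \<omega> \<eta>) f =
      gadd (cochain_module G B) (p + q) (gact (cochain_module G B) p q \<omega> f) (gact (cochain_module G B) p q \<eta> f)" (is ?th1)
    and "gact (cochain_module G B) p q \<omega> (gadd (cochain_algebra G) q f f') =
      gadd (cochain_module G B) (p + q) (gact (cochain_module G B) p q \<omega> f) (gact (cochain_module G B) p q \<omega> f')" (is ?th2)
    and "gact (cochain_module G B) p q (gscale (cochain_module G B) p r \<omega>) f =
      gscale (cochain_module G B) (p + q) r (gact (cochain_module G B) p q \<omega> f)" (is ?th3)
    and "gact (cochain_module G B) p q \<omega> (gscale (cochain_algebra G) q r f) =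
      gscale (cochain_module G B) (p + q) r (gact (cochain_module G B) p q \<omega> f)" (is ?th4)
proof -
  have "?th1 \<and> ?th2 \<and> ?th3 \<and> ?th4"
  proof (cases p q rule: gact_cases)
    case 1
    have z: "gadd (cochain_module G B) (p + q) (cochain_zero G B (p + q)) (cochain_zero G B (p + q)) = cochain_zero G B (p + q)"
      "gscale (cochain_module G B) (p + q) r (cochain_zero G B (p + q)) = cochain_zero G B (p + q)"
      using real_vsD(1,6)[OF real_vs_cochains] real_vs_scale_zero[OF real_vs_cochains] by blast+
    show ?thesis
      unfolding gact_neg[OF 1] by (simp add: z)
  next
    case (2 m n)
    have L: "left_part G m \<sigma> \<in> nerve G (int m)" "right_part G m \<sigma> \<in> nerve G (int n)"
      if "\<sigma> \<in> nerve G (int (m + n))" for \<sigma>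
      using left_part_in_nerve(1)[OF G that] right_part_in_nerve[OF G that] by auto
    have mem: "\<omega> (left_part G m \<sigma>) \<in> vfib B (left_end G \<sigma>)" "\<eta> (left_part G m \<sigma>) \<in> vfib B (left_end G \<sigma>)"
      if "\<sigma> \<in> nerve G (int (m + n))" for \<sigma>
      using cochainsD(2)[OF \<omega>, of "left_part G m \<sigma>"] cochainsD(2)[OF \<eta>, of "left_part G m \<sigma>"]
        left_part_in_nerve[OF G that] 2 by simp_all
    have comm: "vscale B a (vscale B b v) = vscale B b (vscale B a v)"
      if "\<sigma> \<in> nerve G (int (m + n))" "v \<in> vfib B (left_end G \<sigma>)" for a b v \<sigma>
      unfolding real_vsD(10)[OF vs[OF that(1)] that(2), symmetric] by (simp add: mult.commute)
    have pq: "p + q = int (m + n)"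
      using 2 by simp
    note r = real_vsD(8-10)[OF vs]
    note mn = 2
    have 1: ?th1
      unfolding pq unfolding mn unfolding gact_nonneg unfolding cochain_module_def graded_space.select_convs
      by (rule restrict_ext) (simp add: L r(1)[OF _ mem])
    have 2: ?th2
      unfolding pq unfolding mn unfolding gact_nonneg unfolding cochain_module_def cochain_algebra_def graded_space.select_convs
      by (rule restrict_ext) (simp add: L r(2)[OF _ mem(1)])
    have 3: ?th3
      unfolding pq unfolding mn unfolding gact_nonneg unfolding cochain_module_def graded_space.select_convs
    proof (rule restrict_ext)
      fix \<sigma> assume \<sigma>: "\<sigma> \<in> nerve G (int (m + n))"
      show "vscale B (f (right_part G m \<sigma>)) ((\<lambda>\<sigma>\<in>nerve G (int m). vscale B r (\<omega> \<sigma>)) (left_part G m \<sigma>)) =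
          vscale B r ((\<lambda>\<sigma>\<in>nerve G (int (m + n)). vscale B (f (right_part G m \<sigma>)) (\<omega> (left_part G m \<sigma>))) \<sigma>)"
        using comm(1)[OF \<sigma> mem(1)[OF \<sigma>], of "f (right_part G m \<sigma>)" r] by (simp only: L[OF \<sigma>] \<sigma> restrict_apply if_True)
    qed
    have 4: ?th4
      unfolding pq unfolding mn unfolding gact_nonneg unfolding cochain_module_def cochain_algebra_def graded_space.select_convs
      by (rule restrict_ext) (simp add: L r(3)[OF _ mem(1)])
    show ?thesis
      using 1 2 3 4 by blast
  qed
  then show ?th1 ?th2 ?th3 ?th4
    by blast+
qed

text \<open>A product with a factor of negative degree is set to zero, in a total degree that may be
  nonnegative. Associativity then compares further products of this zero, hence it has to be
  absorbing.\<close>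

lemma gact_zero:
  shows "gact (cochain_module G B) p q (cochain_zero G B p) f = cochain_zero G B (p + q)"
    and "\<omega> \<in> cochains G B p \<Longrightarrow>
      gact (cochain_module G B) p q \<omega> (cochain_zero G real_family q) = cochain_zero G B (p + q)"
proof -
  show "gact (cochain_module G B) p q (cochain_zero G B p) f = cochain_zero G B (p + q)"
  proof (cases p q rule: gact_cases)
    case (2 m n)
    have "gact (cochain_module G B) (int m) (int n) (cochain_zero G B (int m)) f = cochain_zero G B (int (m + n))"
      unfolding gact_nonneg
      by (rule ext) (auto simp: cochain_zero_def left_part_in_nerve[OF G] real_vs_scale_zero[OF vs] restrict_def)
    then show ?thesis
      using 2 by simp
  qed (simp add: gact_neg)
  assume \<omega>: "\<omega> \<in> cochains G B p"
  show "gact (cochain_module G B) p q \<omega> (cochain_zero G real_family q) = cochain_zero G B (p + q)"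
  proof (cases p q rule: gact_cases)
    case (2 m n)
    have mem: "\<omega> (left_part G m \<sigma>) \<in> vfib B (left_end G \<sigma>)" if "\<sigma> \<in> nerve G (int (m + n))" for \<sigma>
      using cochainsD(2)[OF \<omega>, of "left_part G m \<sigma>"] left_part_in_nerve[OF G that] 2 by simp
    have "gact (cochain_module G B) (int m) (int n) \<omega> (cochain_zero G real_family (int n)) = cochain_zero G B (int (m + n))"
      unfolding gact_nonneg
      by (rule ext) (auto simp: cochain_zero_def right_part_in_nerve[OF G] real_vs_scale_0[OF vs mem] restrict_def real_family_def)
    then show ?thesis
      using 2 by simp
  qed (simp add: gact_neg)
qed

lemma gact_assoc:
  assumes \<omega>: "\<omega> \<in> cochains G B p"
  shows "gact (cochain_module G B) (p + q) s (gact (cochain_module G B) p q \<omega> f) f' =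
    gact (cochain_module G B) p (q + s) \<omega> (gmul (cochain_algebra G) q s f f')"
proof (cases "p < 0 \<or> q < 0 \<or> s < 0")
  case True
  have "gact (cochain_module G B) (p + q) s (gact (cochain_module G B) p q \<omega> f) f' = cochain_zero G B (p + q + s)"
    using True by (cases "s < 0") (auto simp: gact_neg gact_zero(1))
  moreover have "gact (cochain_module G B) p (q + s) \<omega> (gmul (cochain_algebra G) q s f f') = cochain_zero G B (p + (q + s))"
  proof (cases "p < 0")
    case False
    with True have "gmul (cochain_algebra G) q s f f' = cochain_zero G real_family (q + s)"
      by (auto simp: cochain_algebra_def)
    then show ?thesis
      using gact_zero(2)[OF \<omega>] by simp
  qed (simp add: gact_neg)
  ultimately show ?thesis
    by (simp add: add.assoc)
next
  case False
  then obtain m n k where p: "p = int m" "q = int n" "s = int k"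
    by (metis nonneg_int_cases not_less)
  have eq: "p + q = int (m + n)" "q + s = int (n + k)"
    using p by auto
  \<comment> \<open>In nonnegative degrees the claim is pointwise; it reduces to the three cutting
    identities and to commutativity of the real scalars.\<close>
  have "gact (cochain_module G B) (int (m + n)) (int k) (gact (cochain_module G B) (int m) (int n) \<omega> f) f' \<sigma> =
    gact (cochain_module G B) (int m) (int (n + k)) \<omega> (gmul (cochain_algebra G) (int n) (int k) f f') \<sigma>" for \<sigma>
  proof (cases "\<sigma> \<in> nerve G (int (m + n + k))")
    case True
    then have T: "\<sigma> \<in> nerve G (int (m + (n + k)))"
      by (simp add: add.assoc)
    have "left_part G (m + n) \<sigma> \<in> nerve G (int (m + n))" "right_part G m \<sigma> \<in> nerve G (int (n + k))"
      using left_part_in_nerve(1)[OF G True] right_part_in_nerve[OF G T] by auto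
    moreover have "\<omega> (left_part G m \<sigma>) \<in> vfib B (left_end G \<sigma>)"
      using cochainsD(2)[OF \<omega>, of "left_part G m \<sigma>"] left_part_in_nerve[OF G T] p by simp
    moreover have "vscale B a (vscale B b v) = vscale B (b * a) v" if "v \<in> vfib B (left_end G \<sigma>)" for a b v
      using real_vsD(10)[OF vs[OF True] that] by (metis mult.commute)
    moreover have "gmul (cochain_algebra G) (int n) (int k) f f' =
        (\<lambda>\<sigma>\<in>nerve G (int (n + k)). f (left_part G n \<sigma>) * f' (right_part G n \<sigma>))"
      by (simp add: cochain_algebra_def)
    ultimately show ?thesis
      using True T unfolding gact_nonneg
      by (simp add: left_part_left_part[OF True] right_part_right_part[OF True] right_part_left_part[OF True])
  next
    case False
    then show ?thesis
      unfolding gact_nonneg by (simp add: add.assoc)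
  qed
  then show ?thesis
    unfolding eq unfolding p by blast
qed

lemma gact_gone:
  assumes \<omega>: "\<omega> \<in> cochains G B p"
  shows "gact (cochain_module G B) p 0 \<omega> (gone (cochain_algebra G)) = \<omega>"
proof (cases "p < 0")
  case True
  then show ?thesis
    using cochainsD(1)[OF \<omega>] by (simp add: gact_neg cochain_zero_def nerve_neg extensional_def fun_eq_iff)
next
  case False
  then obtain m where p: "p = int m"
    by (metis nonneg_int_cases not_less)
  have "gact (cochain_module G B) (int m) (int 0) \<omega> (gone (cochain_algebra G)) \<sigma> = \<omega> \<sigma>" for \<sigma>
  proof (cases "\<sigma> \<in> nerve G (int m)")
    case True
    then show ?thesis
      using right_part_in_nerve[OF G, of \<sigma> m 0] left_part_all[OF True]
        real_vsD(11)[OF vs[OF True] cochainsD(2)[OF \<omega>]] p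
      unfolding gact_nonneg by (simp add: cochain_algebra_def)
  next
    case False
    then show ?thesis
      using cochainsD(1)[OF \<omega>] p unfolding gact_nonneg by (simp add: extensional_def)
  qed
  then show ?thesis
    using p by auto
qed

end

lemma smooth_family_real:
  assumes G: "lie_groupoid G"
  shows "smooth_family G real_family"
proof
  have P: "charted (prod_manifold real_line real_line)"
    by (intro charted_prod charted_real_line)
  have fs: "smooth_on (prod_manifold real_line real_line) UNIV real_line fst"
    "smooth_on (prod_manifold real_line real_line) UNIV real_line snd"
    by (rule smooth_on_fst[OF charted_real_line charted_real_line], simp)
      (rule smooth_on_snd[OF charted_real_line charted_real_line], simp)
  show "smooth_on (prod_manifold (vtotal real_family) (vtotal real_family))
      {(v, w). \<exists>x\<in>points (objects G). v \<in> vfib real_family x \<and> w \<in> vfib real_family x} (vtotal real_family)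
      (\<lambda>(v, w). vadd real_family v w)"
    using smooth_on_subset[OF smooth_on_add[OF P fs]] by (simp add: real_family_def case_prod_unfold)
  show "smooth_on (prod_manifold real_line (vtotal real_family))
      {(r, v). \<exists>x\<in>points (objects G). v \<in> vfib real_family x} (vtotal real_family)
      (\<lambda>(r, v). vscale real_family r v)"
    using smooth_on_subset[OF smooth_on_mult[OF P fs]] by (simp add: real_family_def case_prod_unfold)
  show "smooth_on (objects G) (points (objects G)) (vtotal real_family) (vzero real_family)"
    using smooth_on_const[OF lie_groupoidD(2)[OF G] charted_real_line subset_refl, of 0] by (simp add: real_family_def)
  show "real_vs (vfib real_family x) (vadd real_family) (vscale real_family) (vzero real_family x)" for x :: 'b
    unfolding real_vs_def real_family_def by (auto simp: algebra_simps intro: exI[of _ "- _"])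
qed (use G charted_real_line in \<open>auto simp: real_family_def\<close>)

text \<open>The algebra is the module of cochains with values in \<open>real_family\<close> acting
  on itself: by commutativity of the reals \<open>gmul\<close> and \<open>gact\<close> coincide, so
  the module laws apply. Only the left unit law is extra.\<close>

lemma graded_algebra_cochain_algebra:
  assumes G: "lie_groupoid G"
  shows "graded_algebra (cochain_algebra G)"
proof -
  interpret smooth_family G real_family
    by (rule smooth_family_real[OF G])
  let ?M = "cochain_module G real_family"
  have eq: "hcomp (cochain_algebra G) = cochains G real_family" "gadd (cochain_algebra G) = gadd ?M"
    "gscale (cochain_algebra G) = gscale ?M"
    by (auto simp: cochain_algebra_def cochain_module_def real_family_def)
  have mul: "gmul (cochain_algebra G) = gact ?M"
    by (auto simp: fun_eq_iff cochain_algebra_def cochain_module_def real_family_def restrict_def mult.commute)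
  have one: "gone (cochain_algebra G) \<in> cochains G real_family 0"
    unfolding cochain_algebra_def
    by (simp, rule restrict_in_cochains) (auto intro: smooth_cochain_const[OF G charted_real_line] simp: real_family_def)
  have left_one: "gact ?M 0 p (gone (cochain_algebra G)) a = a" if a: "a \<in> cochains G real_family p" for p a
  proof (cases "p < 0")
    case True
    then show ?thesis
      using cochainsD(1)[OF a] by (simp add: gact_neg cochain_zero_def nerve_neg extensional_def fun_eq_iff)
  next
    case False
    then obtain m where p: "p = int m"
      by (metis nonneg_int_cases not_less)
    have "gact ?M (int 0) (int m) (gone (cochain_algebra G)) a \<sigma> = a \<sigma>" for \<sigma>
    proof (cases "\<sigma> \<in> nerve G (int m)")
      case True
      then show ?thesis
        using left_part_in_nerve(1)[OF G, of \<sigma> 0 m] right_part_0[OF True]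
        unfolding gact_nonneg by (simp add: cochain_algebra_def real_family_def)
    next
      case False
      then show ?thesis
        using cochainsD(1)[OF a] p unfolding gact_nonneg by (simp add: extensional_def)
    qed
    then show ?thesis
      using p by auto
  qed
  show ?thesis
    unfolding graded_algebra_def is_graded_space_def eq mul
    using real_vs_cochains one gact_in_cochains gact_linear[unfolded eq] gact_assoc[unfolded mul] gact_gone left_one
    by (intro conjI allI ballI) blast+
qed

context smooth_family
begin

lemma graded_right_module_cochain_module: "graded_right_module (cochain_algebra G) (cochain_module G B)"
proof -
  have eq: "hcomp (cochain_algebra G) = cochains G real_family" "hcomp (cochain_module G B) = cochains G B"
    by (auto simp: cochain_algebra_def cochain_module_def)
  show ?thesis
    unfolding graded_right_module_def is_graded_space_def eq
    using real_vs_cochains graded_algebra_cochain_algebra[OF G] gact_in_cochains gact_linear gact_assoc gact_gone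
    by (intro conjI allI ballI) blast+
qed

end

section \<open>Direct sums and shifts of graded modules\<close>

lemma real_vs_prod:
  assumes V: "real_vs S add scl z" and W: "real_vs S' add' scl' z'"
  shows "real_vs (S \<times> S') (\<lambda>(a, b) (a', b'). (add a a', add' b b')) (\<lambda>r (a, b). (scl r a, scl' r b)) (z, z')"
  unfolding real_vs_def
proof (intro conjI ballI allI)
  fix v assume v: "v \<in> S \<times> S'"
  obtain w w' where "w \<in> S" "add (fst v) w = z" "w' \<in> S'" "add' (snd v) w' = z'"
    using real_vsD(7)[OF V, of "fst v"] real_vsD(7)[OF W, of "snd v"] v by auto
  then show "\<exists>w\<in>S \<times> S'. (case v of (a, b) \<Rightarrow> \<lambda>(a', b'). (add a a', add' b b')) w = (z, z')"
    by (intro bexI[of _ "(w, w')"]) (auto simp: case_prod_unfold)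
qed (auto simp: real_vsD(1-3,6,8-11)[OF V] real_vsD(1-3,6,8-11)[OF W]
    intro: real_vsD(4,5)[OF V] real_vsD(4,5)[OF W])

lemma graded_right_moduleD:
  assumes "graded_right_module R M"
  shows "graded_algebra R" "\<exists>z. real_vs (hcomp M p) (gadd M p) (gscale M p) z"
    "x \<in> hcomp M p \<Longrightarrow> a \<in> hcomp R q \<Longrightarrow> gact M p q x a \<in> hcomp M (p + q)"
    "x \<in> hcomp M p \<Longrightarrow> y \<in> hcomp M p \<Longrightarrow> a \<in> hcomp R q \<Longrightarrow>
      gact M p q (gadd M p x y) a = gadd M (p + q) (gact M p q x a) (gact M p q y a)"
    "x \<in> hcomp M p \<Longrightarrow> a \<in> hcomp R q \<Longrightarrow> b \<in> hcomp R q \<Longrightarrow>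
      gact M p q x (gadd R q a b) = gadd M (p + q) (gact M p q x a) (gact M p q x b)"
    "x \<in> hcomp M p \<Longrightarrow> a \<in> hcomp R q \<Longrightarrow>
      gact M p q (gscale M p r x) a = gscale M (p + q) r (gact M p q x a)"
    "x \<in> hcomp M p \<Longrightarrow> a \<in> hcomp R q \<Longrightarrow>
      gact M p q x (gscale R q r a) = gscale M (p + q) r (gact M p q x a)"
    "x \<in> hcomp M p \<Longrightarrow> a \<in> hcomp R q \<Longrightarrow> b \<in> hcomp R s \<Longrightarrow>
      gact M (p + q) s (gact M p q x a) b = gact M p (q + s) x (gmul R q s a b)"
    "x \<in> hcomp M p \<Longrightarrow> gact M p 0 x (gone R) = x"
  by (insert assms[unfolded graded_right_module_def is_graded_space_def]) metis+

lemma graded_right_moduleI: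
  assumes "graded_algebra R" "\<And>p. \<exists>z. real_vs (hcomp M p) (gadd M p) (gscale M p) z"
    "\<And>p q x a. x \<in> hcomp M p \<Longrightarrow> a \<in> hcomp R q \<Longrightarrow> gact M p q x a \<in> hcomp M (p + q)"
    "\<And>p q x y a. x \<in> hcomp M p \<Longrightarrow> y \<in> hcomp M p \<Longrightarrow> a \<in> hcomp R q \<Longrightarrow>
      gact M p q (gadd M p x y) a = gadd M (p + q) (gact M p q x a) (gact M p q y a)"
    "\<And>p q x a b. x \<in> hcomp M p \<Longrightarrow> a \<in> hcomp R q \<Longrightarrow> b \<in> hcomp R q \<Longrightarrow>
      gact M p q x (gadd R q a b) = gadd M (p + q) (gact M p q x a) (gact M p q x b)"
    "\<And>p q x a r. x \<in> hcomp M p \<Longrightarrow> a \<in> hcomp R q \<Longrightarrow>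
      gact M p q (gscale M p r x) a = gscale M (p + q) r (gact M p q x a)"
    "\<And>p q x a r. x \<in> hcomp M p \<Longrightarrow> a \<in> hcomp R q \<Longrightarrow>
      gact M p q x (gscale R q r a) = gscale M (p + q) r (gact M p q x a)"
    "\<And>p q s x a b. x \<in> hcomp M p \<Longrightarrow> a \<in> hcomp R q \<Longrightarrow> b \<in> hcomp R s \<Longrightarrow>
      gact M (p + q) s (gact M p q x a) b = gact M p (q + s) x (gmul R q s a b)"
    "\<And>p x. x \<in> hcomp M p \<Longrightarrow> gact M p 0 x (gone R) = x"
  shows "graded_right_module R M"
  unfolding graded_right_module_def is_graded_space_def using assms by simp

lemma graded_right_module_shift:
  assumes M: "graded_right_module R M"
  shows "graded_right_module R (shift k M)"
proof (rule graded_right_moduleI)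
  have e: "p + q + k = p + k + q" for p q
    by simp
  fix p q s x y a b r
  assume x: "x \<in> hcomp (shift k M) p" and a: "a \<in> hcomp R q"
  note x' = x[unfolded shift_def, simplified]
  show "gact (shift k M) p q x a \<in> hcomp (shift k M) (p + q)"
    using graded_right_moduleD(3)[OF M x' a] by (simp add: shift_def e)
  show "gact (shift k M) p q (gscale (shift k M) p r x) a = gscale (shift k M) (p + q) r (gact (shift k M) p q x a)"
    using graded_right_moduleD(6)[OF M x' a] by (simp add: shift_def e)
  show "gact (shift k M) p q x (gscale R q r a) = gscale (shift k M) (p + q) r (gact (shift k M) p q x a)"
    using graded_right_moduleD(7)[OF M x' a] by (simp add: shift_def e)
  show "gact (shift k M) p q x (gadd R q a b) = gadd (shift k M) (p + q) (gact (shift k M) p q x a) (gact (shift k M) p q x b)"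
    if "b \<in> hcomp R q"
    using graded_right_moduleD(5)[OF M x' a that] by (simp add: shift_def e)
  show "gact (shift k M) p q (gadd (shift k M) p x y) a =
      gadd (shift k M) (p + q) (gact (shift k M) p q x a) (gact (shift k M) p q y a)" if "y \<in> hcomp (shift k M) p"
    using graded_right_moduleD(4)[OF M x' that[unfolded shift_def, simplified] a] by (simp add: shift_def e)
  show "gact (shift k M) (p + q) s (gact (shift k M) p q x a) b = gact (shift k M) p (q + s) x (gmul R q s a b)"
    if "b \<in> hcomp R s"
    using graded_right_moduleD(8)[OF M x' a that] by (simp add: shift_def e)
next
  show "gact (shift k M) p 0 x (gone R) = x" if "x \<in> hcomp (shift k M) p" for p x
    using graded_right_moduleD(9)[OF M] that by (simp add: shift_def)
qed (use graded_right_moduleD(1,2)[OF M] in \<open>auto simp: shift_def\<close>)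

lemma graded_right_module_direct_sum:
  assumes M: "graded_right_module R M" and N: "graded_right_module R N"
  shows "graded_right_module R (direct_sum M N)"
proof (rule graded_right_moduleI)
  show "\<exists>z. real_vs (hcomp (direct_sum M N) p) (gadd (direct_sum M N) p) (gscale (direct_sum M N) p) z" for p
    using graded_right_moduleD(2)[OF M, of p] graded_right_moduleD(2)[OF N, of p] real_vs_prod
    by (fastforce simp: direct_sum_def)
qed (auto simp: direct_sum_def graded_right_moduleD[OF M] graded_right_moduleD[OF N])

section \<open>VB-groupoids\<close>

context
  fixes G :: "('g, 'm) groupoid"
  assumes G: "lie_groupoid G"
begin

lemma groupoid_mul_ends:
  assumes "g \<in> points (arrows G)" "h \<in> points (arrows G)" "src G g = tgt G h"
  shows "src G (mul G g h) = src G h" "tgt G (mul G g h) = tgt G g"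
proof -
  have "(g, h) \<in> composable_pairs G"
    using assms by (simp add: composable_pairs_def)
  then show "src G (mul G g h) = src G h" "tgt G (mul G g h) = tgt G g"
    using G unfolding lie_groupoid_def by blast+
qed

lemma groupoid_assoc:
  assumes "g \<in> points (arrows G)" "h \<in> points (arrows G)" "k \<in> points (arrows G)"
    "src G g = tgt G h" "src G h = tgt G k"
  shows "mul G (mul G g h) k = mul G g (mul G h k)"
proof -
  have "(g, h) \<in> composable_pairs G" "(h, k) \<in> composable_pairs G"
    using assms by (simp_all add: composable_pairs_def)
  then show ?thesis
    using G unfolding lie_groupoid_def by blast
qed

lemma groupoid_unit_ends:
  "x \<in> points (objects G) \<Longrightarrow> src G (unit G x) = x" "x \<in> points (objects G) \<Longrightarrow> tgt G (unit G x) = x"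
  using G unfolding lie_groupoid_def by auto

lemma groupoid_laws:
  assumes "g \<in> points (arrows G)"
  shows "mul G (unit G (tgt G g)) g = g" "mul G g (unit G (src G g)) = g"
    "src G (ginv G g) = tgt G g" "tgt G (ginv G g) = src G g"
    "mul G g (ginv G g) = unit G (tgt G g)" "mul G (ginv G g) g = unit G (src G g)"
  using G assms unfolding lie_groupoid_def by auto

lemma groupoid_inverse_unique:
  assumes g: "g \<in> points (arrows G)" "k \<in> points (arrows G)" and "src G g = tgt G k" "mul G g k = unit G (tgt G g)"
  shows "k = ginv G g"
proof -
  note [simp] = g lie_groupoid_points[OF G] groupoid_laws
  have "src G k = tgt G g"
    using groupoid_mul_ends(1)[OF g assms(3)] assms(4) groupoid_unit_ends(1)[of "tgt G g"] by simp
  have "k = mul G (mul G (ginv G g) g) k"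
    using groupoid_laws(1)[OF g(2)] assms(3) by simp
  also have "\<dots> = mul G (ginv G g) (mul G g k)"
    by (rule groupoid_assoc) (use assms in auto)
  also have "\<dots> = ginv G g"
    using groupoid_laws(2)[of "ginv G g"] assms(4) by simp
  finally show ?thesis .
qed

end

text \<open>The rearrangement behind additivity of the splitting of a fibre of \<Gamma> into a
  horizontal and a core part.\<close>

lemma real_vs_add_swap:
  assumes V: "real_vs S add scl z" and m: "a \<in> S" "b \<in> S" "c \<in> S" "d \<in> S"
  shows "add (add a b) (add c d) = add (add a c) (add b d)"
proof -
  note A = real_vsD(4)[OF V] and P = real_vsD(2)[OF V]
  have "add (add a b) (add c d) = add a (add (add b c) d)"
    using A[OF m(1,2) P[OF m(3,4)]] A[OF m(2,3,4)] by simp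
  also have "add b c = add c b"
    by (rule real_vsD(5)[OF V m(2,3)])
  also have "add a (add (add c b) d) = add (add a c) (add b d)"
    using A[OF m(1,3) P[OF m(2,4)]] A[OF m(3,2,4)] by simp
  finally show ?thesis .
qed

text \<open>Smoothness of the operations as maps of two variables is the case of
  \<open>smooth_on_vadd\<close> and \<open>smooth_on_vscale\<close> in which the two arguments are
  the projections from the set of admissible pairs.\<close>

lemma smooth_family_vector_bundle:
  assumes G: "lie_groupoid G" and B: "vector_bundle B" and base: "vbase B = objects G"
  shows "smooth_family G B"
proof
  let ?T = "vtotal B"
  note T = vector_bundleD(7)[OF B]
  let ?S = "{(v, w). \<exists>x\<in>points (objects G). v \<in> vfib B x \<and> w \<in> vfib B x}"
  have S: "?S \<subseteq> points ?T \<times> points ?T"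
    using vector_bundle_fibre(1)[OF B] base by auto
  have TT: "charted (prod_manifold ?T ?T)"
    by (intro charted_prod T)
  have proj: "smooth_on (prod_manifold ?T ?T) ?S (vbase B) (\<lambda>vw. vproj B (fst vw))"
    by (rule smooth_on_compose[OF T smooth_on_fst[OF T T S] vector_bundleD(3)[OF B]]) (use vector_bundle_fibre(1)[OF B] base in auto)
  have "smooth_on (prod_manifold ?T ?T) ?S ?T (\<lambda>vw. vadd B (fst vw) (snd vw))"
    by (rule smooth_on_vadd[OF B TT proj smooth_on_fst[OF T T S] _ smooth_on_snd[OF T T S]])
      (use vector_bundle_fibre(2)[OF B] base in auto)
  then show "smooth_on (prod_manifold ?T ?T) ?S ?T (\<lambda>(v, w). vadd B v w)"
    by (simp only: case_prod_unfold)
  let ?S' = "{(r, v). \<exists>x\<in>points (objects G). v \<in> vfib B x} :: (real \<times> 'c) set"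
  have S': "?S' \<subseteq> points real_line \<times> points ?T"
    using vector_bundle_fibre(1)[OF B] base by auto
  have RT: "charted (prod_manifold real_line ?T)"
    by (intro charted_prod T charted_real_line)
  have proj': "smooth_on (prod_manifold real_line ?T) ?S' (vbase B) (\<lambda>vw. vproj B (snd vw))"
    by (rule smooth_on_compose[OF T smooth_on_snd[OF charted_real_line T S'] vector_bundleD(3)[OF B]]) (use vector_bundle_fibre(1)[OF B] base in auto)
  have "smooth_on (prod_manifold real_line ?T) ?S' ?T (\<lambda>rv. vscale B (fst rv) (snd rv))"
    by (rule smooth_on_vscale[OF B RT proj' smooth_on_fst[OF charted_real_line T S'] smooth_on_snd[OF charted_real_line T S']])
      (use vector_bundle_fibre(2)[OF B] base in auto)
  then show "smooth_on (prod_manifold real_line ?T) ?S' ?T (\<lambda>(r, v). vscale B r v)"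
    by (simp only: case_prod_unfold)
  show "smooth_on (objects G) (points (objects G)) ?T (vzero B)"
    using smooth_on_vzero[OF B vector_bundleD(8)[OF B] smooth_on_id[OF vector_bundleD(8)[OF B] subset_refl]]
    by (simp add: base)
qed (use G vector_bundleD(5,7)[OF B] base in auto)

section \<open>Linearity from additivity and differentiability at 0\<close>

lemma smooth_real_differentiable:
  assumes "smooth_on real_line UNIV real_line f"
  obtains D where "(f has_real_derivative D) (at 0)"
proof -
  have "smooth_near real_line UNIV 0 (\<lambda>_. True) (Suc 0) (\<lambda>y _. f y)"
    using assms by (simp add: smooth_on_real_iff)
  then obtain W F where W: "(\<lambda>i. 0) \<in> W" "smooth_map 1 1 W F"
    "\<And>y. (\<lambda>i. if i = 0 then y else 0) \<in> W \<Longrightarrow> f y = F (\<lambda>i. if i = 0 then y else 0) 0"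
    unfolding smooth_near_def by (auto simp: real_line_def cong: if_cong)
  have "k_times_diff 1 (Suc 0) W (\<lambda>x. F x 0)"
    using smooth_mapD(3)[OF W(2)] by blast
  then obtain F' where "\<forall>x\<in>W. ((\<lambda>t. F (x(0 := x 0 + t)) 0) has_real_derivative F' x) (at 0)"
    unfolding k_times_diff.simps by auto
  then have "((\<lambda>t. F ((\<lambda>i. 0)(0 := 0 + t)) 0) has_real_derivative F' (\<lambda>i. 0)) (at 0)"
    using W(1) by blast
  moreover have "(\<lambda>i. 0)(0 := 0 + t) = (\<lambda>i::nat. if i = 0 then t else 0)" for t :: real
    by auto
  ultimately have D: "((\<lambda>t. F (\<lambda>i. if i = 0 then t else 0) 0) has_real_derivative F' (\<lambda>i. 0)) (at 0)"
    by simp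
  obtain e where e: "e > 0" "\<And>z. \<lbrakk>\<And>j. j < 1 \<Longrightarrow> \<bar>z j - 0\<bar> < e; z \<in> topspace (Euclidean_space 1)\<rbrakk> \<Longrightarrow> z \<in> W"
    using box_in_openin_Euclidean_space[OF smooth_mapD(1)[OF W(2)] W(1)] by metis
  have "f t = F (\<lambda>i. if i = 0 then t else 0) 0" if "t \<in> ball 0 e" for t
    using that by (intro W(3) e(2)) (auto simp: topspace_Euclidean_space)
  then have "(f has_real_derivative F' (\<lambda>i. 0)) (at 0)"
    using e(1) by (intro has_field_derivative_transform_within_open[OF D, of "ball 0 e"]) auto
  then show ?thesis
    by (rule that)
qed

text \<open>Additivity gives \<open>f (r / n) / (r / n) = f r / r\<close> for every positive integer
  n, and the left side tends to the derivative at 0. So \<open>f r / r\<close> is the same constant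
  for all nonzero r.\<close>

lemma additive_differentiable_linear:
  fixes f :: "real \<Rightarrow> real"
  assumes add: "\<And>r s. f (r + s) = f r + f s" and D: "(f has_real_derivative D) (at 0)"
  shows "f r = r * f 1"
proof -
  have f0: "f 0 = 0"
    using add[of 0 0] by simp
  have mult: "f (real n * r) = real n * f r" for n r
    by (induction n) (auto simp: f0 add algebra_simps)
  have *: "f r = r * D" for r
  proof (cases "r = 0")
    case False
    have "((\<lambda>t. f t / t) \<longlongrightarrow> D) (at 0)"
      using D f0 by (simp add: has_field_derivative_iff)
    \<comment> \<open>\<open>Suc n\<close> avoids division by 0; \<open>r \<noteq> 0\<close> keeps
      the sequence away from its limit 0, where the difference quotient is not evaluated.\<close>
    moreover have "filterlim (\<lambda>n. r / real (Suc n)) (at 0) sequentially"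
      using False LIMSEQ_Suc[OF lim_const_over_n[of r]] by (intro filterlim_atI) (auto simp del: of_nat_Suc)
    ultimately have "(\<lambda>n. f (r / real (Suc n)) / (r / real (Suc n))) \<longlonglongrightarrow> D"
      by (rule filterlim_compose)
    moreover have "f (r / real (Suc n)) / (r / real (Suc n)) = f r / r" for n
      using mult[of "Suc n" "r / real (Suc n)"] False by (simp add: field_simps del: of_nat_Suc)
    ultimately have "(\<lambda>n. f r / r) \<longlonglongrightarrow> D"
      by (simp only:)
    then have "f r / r = D"
      by (simp add: LIMSEQ_const_iff)
    then show ?thesis
      using False by (simp add: field_simps)
  qed (simp add: f0)
  show ?thesis
    using *[of r] *[of 1] by simp
qed

section \<open>Coordinate functionals of a trivialization\<close>

lemma dual_coframe:
  assumes B: "vector_bundle B" and T: "local_trivialization B V \<Psi>" and x: "x \<in> V"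
  shows "(\<lambda>v\<in>vfib B x. \<Psi> v i) \<in> dual_fib B x"
proof -
  have "x \<in> points (vbase B)"
    using trivialization_domain(2)[OF B T] x by blast
  note vs = real_vsD(2,3)[OF vector_bundleD(5)[OF B this]]
  show ?thesis
    unfolding dual_fib_def by (simp add: vs trivialization_linear[OF B T x])
qed

lemma smooth_on_coframe:
  assumes B: "vector_bundle B" and T: "local_trivialization B V \<Psi>" and M: "charted M"
    and x: "smooth_on M A (vbase B) x" and A: "\<And>a. a \<in> A \<Longrightarrow> x a \<in> V" and i: "i < vrank B"
  shows "smooth_on M A (dual_manifold B) (\<lambda>a. (x a, \<lambda>v\<in>vfib B (x a). \<Psi> v i))"
proof (rule smooth_into_dual[OF B M])
  fix V' \<Psi>' j assume T': "local_trivialization B V' \<Psi>'" and j: "j < vrank B"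
  let ?A = "{a \<in> A. fst (x a, \<lambda>v\<in>vfib B (x a). \<Psi> v i) \<in> V'}"
  have A': "x a \<in> V'" "x a \<in> V" "frame B \<Psi>' j (x a) \<in> vfib B (x a)" "x a \<in> points (vbase B)" if "a \<in> ?A" for a
    using that A frame_in_fibre[OF B T' _ j] smooth_on_image[OF x] by auto
  have xs: "smooth_on M ?A (vbase B) x"
    by (rule smooth_on_subset[OF x]) auto
  have "smooth_on M ?A real_line (\<lambda>a. \<Psi> (frame B \<Psi>' j (x a)) i)"
  proof (rule smooth_on_trivialization[OF B T M smooth_on_frame[OF B T' M xs A'(1) j] _ i])
    show "vproj B (frame B \<Psi>' j (x a)) \<in> V" if "a \<in> ?A" for a
      using A'(2)[OF that] vector_bundle_fibre(2)[OF B A'(4)[OF that] A'(3)[OF that]] by simp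
  qed
  then show "smooth_on M ?A real_line (\<lambda>a. snd (x a, \<lambda>v\<in>vfib B (x a). \<Psi> v i)
      (frame B \<Psi>' j (fst (x a, \<lambda>v\<in>vfib B (x a). \<Psi> v i))))"
  proof (rule smooth_on_cong)
    show "\<Psi> (frame B \<Psi>' j (x a)) i = snd (x a, \<lambda>v\<in>vfib B (x a). \<Psi> v i)
      (frame B \<Psi>' j (fst (x a, \<lambda>v\<in>vfib B (x a). \<Psi> v i)))" if "a \<in> ?A" for a
      using A'(3)[OF that] by simp
  qed
qed (simp_all add: x dual_coframe[OF B T A])

text \<open>The coordinate functionals of one trivialization around \<open>x\<close> already tell
  two vectors apart.\<close>

lemma dual_separates:
  assumes B: "vector_bundle B" and x: "x \<in> points (vbase B)" and v: "v \<in> vfib B x" "w \<in> vfib B x"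
    and eq: "\<And>\<xi>. \<xi> \<in> dual_fib B x \<Longrightarrow> \<xi> v = \<xi> w"
  shows "v = w"
proof -
  obtain V \<Psi> where V: "x \<in> V" "local_trivialization B V \<Psi>"
    using vector_bundleD(6)[OF B x] by blast
  have "\<Psi> v i = \<Psi> w i" for i
    using eq[OF dual_coframe[OF B V(2,1)], of i] v by simp
  then show ?thesis
    using trivialization_eqI[OF B V(2,1) v] by blast
qed

section \<open>Fibrewise algebra of a VB-groupoid with a horizontal lift\<close>

locale vb_groupoid_lift =
  fixes V :: "('c, 'e, 'g, 'm) vb_groupoid_data" and h :: "'g \<Rightarrow> 'e \<Rightarrow> 'c"
  assumes V: "vb_groupoid V" and h: "horizontal_lift V h"
begin

abbreviation "\<Gamma> \<equiv> big V"
abbreviation "G \<equiv> small V"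
abbreviation "Q \<equiv> big_bundle V"
abbreviation "E \<equiv> side_bundle V"
abbreviation "C \<equiv> core V"
abbreviation "z \<equiv> vzero (big_bundle V)"

lemma vb_structure:
  "lie_groupoid \<Gamma>" "lie_groupoid G" "vector_bundle Q" "vector_bundle E"
  "vb_morphism Q E (src \<Gamma>) (src G)" "vb_morphism Q E (tgt \<Gamma>) (tgt G)"
  "lie_groupoid_morphism \<Gamma> G (vproj Q) (vproj E)"
  and carriers [simp]: "vtotal Q = arrows \<Gamma>" "vbase Q = arrows G" "vtotal E = objects \<Gamma>" "vbase E = objects G"
  using V unfolding vb_groupoid_def Let_def by blast+

lemmas \<Gamma>_groupoid = vb_structure(1)
lemmas G_groupoid = vb_structure(2)
lemmas Q_bundle = vb_structure(3)
lemmas E_bundle = vb_structure(4)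
lemmas Q_fibre = vector_bundle_fibre[OF Q_bundle, simplified]
lemmas E_fibre = vector_bundle_fibre[OF E_bundle, simplified]
lemmas Q_vs = vector_bundleD(5)[OF Q_bundle, simplified]
lemmas E_vs = vector_bundleD(5)[OF E_bundle, simplified]
lemmas G_points = lie_groupoid_points[OF G_groupoid]
lemmas \<Gamma>_points = lie_groupoid_points[OF \<Gamma>_groupoid]
lemmas G_laws = groupoid_laws[OF G_groupoid]
lemmas \<Gamma>_laws = groupoid_laws[OF \<Gamma>_groupoid]

lemma in_Q_fibre: "\<gamma> \<in> vfib Q g \<longleftrightarrow> \<gamma> \<in> points (arrows \<Gamma>) \<and> vproj Q \<gamma> = g" if "g \<in> points (arrows G)"
  using vector_bundleD(4)[OF Q_bundle, simplified, OF that] by simp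

lemma in_E_fibre: "e \<in> vfib E x \<longleftrightarrow> e \<in> points (objects \<Gamma>) \<and> vproj E e = x" if "x \<in> points (objects G)"
  using vector_bundleD(4)[OF E_bundle, simplified, OF that] by simp

lemma src_tgt_fibre:
  assumes "g \<in> points (arrows G)" "\<gamma> \<in> vfib Q g"
  shows "src \<Gamma> \<gamma> \<in> vfib E (src G g)" "tgt \<Gamma> \<gamma> \<in> vfib E (tgt G g)"
proof -
  note \<gamma> = Q_fibre[OF assms]
  have "vproj E (src \<Gamma> \<gamma>) = src G g" "vproj E (tgt \<Gamma> \<gamma>) = tgt G g"
    using vb_structure(5,6) \<gamma> unfolding vb_morphism_def by auto
  then show "src \<Gamma> \<gamma> \<in> vfib E (src G g)" "tgt \<Gamma> \<gamma> \<in> vfib E (tgt G g)"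
    using G_points assms(1) \<Gamma>_points \<gamma>(1) by (simp_all add: in_E_fibre)
qed

lemma src_tgt_linear:
  assumes "g \<in> points (arrows G)" "\<gamma> \<in> vfib Q g"
  shows "\<delta> \<in> vfib Q g \<Longrightarrow> src \<Gamma> (vadd Q \<gamma> \<delta>) = vadd E (src \<Gamma> \<gamma>) (src \<Gamma> \<delta>)"
    "\<delta> \<in> vfib Q g \<Longrightarrow> tgt \<Gamma> (vadd Q \<gamma> \<delta>) = vadd E (tgt \<Gamma> \<gamma>) (tgt \<Gamma> \<delta>)"
    "src \<Gamma> (vscale Q r \<gamma>) = vscale E r (src \<Gamma> \<gamma>)" "tgt \<Gamma> (vscale Q r \<gamma>) = vscale E r (tgt \<Gamma> \<gamma>)"
  using vb_structure(5,6) assms unfolding vb_morphism_def by simp_all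

text \<open>Composability in \<Gamma> forces composability of the base arrows: the common object in
  the side bundle lies over the source of one and over the target of the other.\<close>

lemma mul_fibre:
  assumes "g \<in> points (arrows G)" "k \<in> points (arrows G)" "\<gamma> \<in> vfib Q g" "\<delta> \<in> vfib Q k" "src \<Gamma> \<gamma> = tgt \<Gamma> \<delta>"
  shows "src G g = tgt G k" "mul \<Gamma> \<gamma> \<delta> \<in> vfib Q (mul G g k)"
proof -
  note \<gamma> = Q_fibre[OF assms(1,3)] Q_fibre[OF assms(2,4)]
  show gk: "src G g = tgt G k"
    using src_tgt_fibre(1)[OF assms(1,3)] src_tgt_fibre(2)[OF assms(2,4)] assms(5)
      E_fibre(2)[OF G_points(1)[OF assms(1)]] E_fibre(2)[OF G_points(2)[OF assms(2)]] by metis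
  have "vproj Q (mul \<Gamma> \<gamma> \<delta>) = mul G g k"
    using vb_structure(7) \<gamma> assms(5) unfolding lie_groupoid_morphism_def composable_pairs_def by auto
  then show "mul \<Gamma> \<gamma> \<delta> \<in> vfib Q (mul G g k)"
    using \<Gamma>_points(5)[OF \<gamma>(1,3) assms(5)] G_points(5)[OF assms(1,2) gk] by (simp add: in_Q_fibre)
qed

lemma unit_fibre: "x \<in> points (objects G) \<Longrightarrow> e \<in> vfib E x \<Longrightarrow> unit \<Gamma> e \<in> vfib Q (unit G x)"
  using vb_structure(7) \<Gamma>_points(3) G_points(3)
  by (auto simp: in_Q_fibre in_E_fibre lie_groupoid_morphism_def)

text \<open>\<open>lie_groupoid_morphism\<close> has no clause about inverses. The projection of the
  inverse multiplies with \<open>g\<close> to a unit, and inverses in the base groupoid are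
  unique.\<close>

lemma ginv_fibre:
  assumes g: "g \<in> points (arrows G)" and \<gamma>: "\<gamma> \<in> vfib Q g"
  shows "ginv \<Gamma> \<gamma> \<in> vfib Q (ginv G g)"
proof -
  note p = Q_fibre[OF g \<gamma>]
  note pi = \<Gamma>_points(4)[OF p(1)]
  have gi: "vproj Q (ginv \<Gamma> \<gamma>) \<in> points (arrows G)"
    using vector_bundle_proj[OF Q_bundle] pi by simp
  have i: "ginv \<Gamma> \<gamma> \<in> vfib Q (vproj Q (ginv \<Gamma> \<gamma>))"
    using pi gi by (simp add: in_Q_fibre)
  have st: "src \<Gamma> \<gamma> = tgt \<Gamma> (ginv \<Gamma> \<gamma>)"
    using \<Gamma>_laws(4)[OF p(1)] by simp
  note m = mul_fibre[OF g gi \<gamma> i st]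
  have "unit \<Gamma> (tgt \<Gamma> \<gamma>) \<in> vfib Q (mul G g (vproj Q (ginv \<Gamma> \<gamma>)))"
    using m(2) \<Gamma>_laws(5)[OF p(1)] by simp
  moreover have "unit \<Gamma> (tgt \<Gamma> \<gamma>) \<in> vfib Q (unit G (tgt G g))"
    using unit_fibre[OF G_points(2)[OF g] src_tgt_fibre(2)[OF g \<gamma>]] .
  ultimately have "mul G g (vproj Q (ginv \<Gamma> \<gamma>)) = unit G (tgt G g)"
    using Q_fibre(2)[OF G_points(5)[OF g gi m(1)]] Q_fibre(2)[OF G_points(3)[OF G_points(2)[OF g]]] by metis
  then have "vproj Q (ginv \<Gamma> \<gamma>) = ginv G g"
    by (rule groupoid_inverse_unique[OF G_groupoid g gi m(1)])
  then show ?thesis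
    using i by simp
qed

lemma interchange:
  assumes g: "g \<in> points (arrows G)" "k \<in> points (arrows G)"
    and "\<gamma>1 \<in> vfib Q g" "\<gamma>2 \<in> vfib Q k" "\<gamma>3 \<in> vfib Q g" "\<gamma>4 \<in> vfib Q k"
    and "src \<Gamma> \<gamma>1 = tgt \<Gamma> \<gamma>2" "src \<Gamma> \<gamma>3 = tgt \<Gamma> \<gamma>4"
  shows "mul \<Gamma> (vadd Q \<gamma>1 \<gamma>3) (vadd Q \<gamma>2 \<gamma>4) = vadd Q (mul \<Gamma> \<gamma>1 \<gamma>2) (mul \<Gamma> \<gamma>3 \<gamma>4)"
proof -
  have "(\<gamma>1, \<gamma>2) \<in> composable_pairs \<Gamma>" "(\<gamma>3, \<gamma>4) \<in> composable_pairs \<Gamma>"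
    "vproj Q \<gamma>1 = vproj Q \<gamma>3" "vproj Q \<gamma>2 = vproj Q \<gamma>4"
    using assms Q_fibre by (auto simp: composable_pairs_def)
  then show ?thesis
    using V unfolding vb_groupoid_def Let_def by blast
qed

lemma zero_fibre: "g \<in> points (arrows G) \<Longrightarrow> z g \<in> vfib Q g"
  by (rule real_vsD(1)[OF Q_vs])

text \<open>The zero vector is 0 times itself, and source and target respect scalar
  multiplication.\<close>

lemma src_tgt_zero:
  assumes g: "g \<in> points (arrows G)"
  shows "src \<Gamma> (z g) = vzero E (src G g)" "tgt \<Gamma> (z g) = vzero E (tgt G g)"
proof -
  have "z g = vscale Q 0 (z g)"
    using real_vs_scale_0[OF Q_vs[OF g] zero_fibre[OF g]] by simp
  then show "src \<Gamma> (z g) = vzero E (src G g)" "tgt \<Gamma> (z g) = vzero E (tgt G g)"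
    using src_tgt_linear(3,4)[OF g zero_fibre[OF g], of 0] src_tgt_fibre[OF g zero_fibre[OF g]]
      real_vs_scale_0[OF E_vs[OF G_points(1)[OF g]]] real_vs_scale_0[OF E_vs[OF G_points(2)[OF g]]] by metis+
qed

text \<open>By the interchange law the product of the two zeros, each written as its own double, is
  its own double; an idempotent vector is zero.\<close>

lemma mul_zero:
  assumes g: "g \<in> points (arrows G)" "k \<in> points (arrows G)" "src G g = tgt G k"
  shows "mul \<Gamma> (z g) (z k) = z (mul G g k)"
proof -
  have st: "src \<Gamma> (z g) = tgt \<Gamma> (z k)"
    using src_tgt_zero g by simp
  note m = mul_fibre(2)[OF g(1,2) zero_fibre[OF g(1)] zero_fibre[OF g(2)] st]
  show ?thesis
    using interchange[OF g(1,2) zero_fibre[OF g(1)] zero_fibre[OF g(2)] zero_fibre[OF g(1)] zero_fibre[OF g(2)] st st]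
      real_vsD(6)[OF Q_vs[OF g(1)] zero_fibre[OF g(1)]] real_vsD(6)[OF Q_vs[OF g(2)] zero_fibre[OF g(2)]]
    by (intro real_vs_idempotent[OF Q_vs[OF G_points(5)[OF g]] m]) simp
qed

lemma lift_fibre:
  assumes "g \<in> points (arrows G)" "e \<in> vfib E (src G g)"
  shows "h g e \<in> vfib Q g" "src \<Gamma> (h g e) = e"
    "e' \<in> vfib E (src G g) \<Longrightarrow> h g (vadd E e e') = vadd Q (h g e) (h g e')"
    "h g (vscale E r e) = vscale Q r (h g e)"
  using h assms unfolding horizontal_lift_def Let_def by blast+

lemma lift_unit: "x \<in> points (objects G) \<Longrightarrow> e \<in> vfib E x \<Longrightarrow> h (unit G x) e = unit \<Gamma> e"
  using h unfolding horizontal_lift_def Let_def by blast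

lemma lift_zero:
  assumes g: "g \<in> points (arrows G)"
  shows "h g (vzero E (src G g)) = z g"
proof -
  note Ev = E_vs[OF G_points(1)[OF g]]
  note e = real_vsD(1)[OF Ev]
  show ?thesis
    using lift_fibre(4)[OF g e, of 0] real_vs_scale_0[OF Ev e] real_vs_scale_0[OF Q_vs[OF g] lift_fibre(1)[OF g e]]
    by simp
qed

text \<open>Over a unit arrow the lift of \<open>e\<close> is the unit at \<open>e\<close>, so
  linearity of the lift passes to the units.\<close>

lemma unit_linear:
  assumes x: "x \<in> points (objects G)" "e \<in> vfib E x"
  shows "e' \<in> vfib E x \<Longrightarrow> unit \<Gamma> (vadd E e e') = vadd Q (unit \<Gamma> e) (unit \<Gamma> e')"
    "unit \<Gamma> (vscale E r e) = vscale Q r (unit \<Gamma> e)"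
    "unit \<Gamma> (vzero E x) = z (unit G x)"
proof -
  have s: "src G (unit G x) = x"
    by (rule groupoid_unit_ends(1)[OF G_groupoid x(1)])
  note L = lift_fibre(3,4)[OF G_points(3)[OF x(1)], unfolded s, OF x(2)] lift_zero[OF G_points(3)[OF x(1)], unfolded s]
  show "unit \<Gamma> (vadd E e e') = vadd Q (unit \<Gamma> e) (unit \<Gamma> e')" if "e' \<in> vfib E x"
    using L(1)[OF that] lift_unit[OF x(1)] x(2) that real_vsD(2)[OF E_vs[OF x(1)]] by simp
  show "unit \<Gamma> (vscale E r e) = vscale Q r (unit \<Gamma> e)"
    using L(2)[of r] lift_unit[OF x(1)] x(2) real_vsD(3)[OF E_vs[OF x(1)]] by simp
  show "unit \<Gamma> (vzero E x) = z (unit G x)"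
    using L(3) lift_unit[OF x(1)] real_vsD(1)[OF E_vs[OF x(1)]] by simp
qed

context
  fixes M :: "'a manifold" and A :: "'a set"
  assumes M: "charted M"
begin

lemma smooth_mul:
  assumes "smooth_on M A (arrows \<Gamma>) f" "smooth_on M A (arrows \<Gamma>) f'" "\<And>a. a \<in> A \<Longrightarrow> src \<Gamma> (f a) = tgt \<Gamma> (f' a)"
  shows "smooth_on M A (arrows \<Gamma>) (\<lambda>a. mul \<Gamma> (f a) (f' a))"
  using smooth_on_compose[OF charted_prod[OF lie_groupoidD(1)[OF \<Gamma>_groupoid] lie_groupoidD(1)[OF \<Gamma>_groupoid]]
      smooth_on_Pair[OF M assms(1,2)] lie_groupoidD(6)[OF \<Gamma>_groupoid]]
    smooth_on_image[OF assms(1)] smooth_on_image[OF assms(2)] assms(3) by (simp add: composable_pairs_def)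

lemma smooth_structure:
  assumes "smooth_on M A (arrows \<Gamma>) f"
  shows "smooth_on M A (arrows \<Gamma>) (\<lambda>a. ginv \<Gamma> (f a))" "smooth_on M A (objects \<Gamma>) (\<lambda>a. src \<Gamma> (f a))"
  using lie_groupoidD(3,7)[OF \<Gamma>_groupoid] smooth_on_image[OF assms]
  by (auto intro!: smooth_on_compose[OF lie_groupoidD(1)[OF \<Gamma>_groupoid] assms])

lemma smooth_ginv_base:
  assumes "smooth_on M A (arrows G) g"
  shows "smooth_on M A (arrows G) (\<lambda>a. ginv G (g a))"
  by (rule smooth_on_compose[OF lie_groupoidD(1)[OF G_groupoid] assms lie_groupoidD(7)[OF G_groupoid]])
    (rule smooth_on_image[OF assms])

lemma smooth_vzero:
  assumes "smooth_on M A (arrows G) g"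
  shows "smooth_on M A (arrows \<Gamma>) (\<lambda>a. z (g a))"
  using smooth_on_vzero[OF Q_bundle M, simplified, OF assms] .

lemma smooth_lift:
  assumes g: "smooth_on M A (arrows G) g" and e: "smooth_on M A (objects \<Gamma>) e"
    and "\<And>a. a \<in> A \<Longrightarrow> e a \<in> vfib E (src G (g a))"
  shows "smooth_on M A (arrows \<Gamma>) (\<lambda>a. h (g a) (e a))"
proof -
  have "smooth_on (prod_manifold (arrows G) (objects \<Gamma>))
      {(g, e). g \<in> points (arrows G) \<and> e \<in> vfib E (src G g)} (arrows \<Gamma>) (\<lambda>(g, e). h g e)"
    using h unfolding horizontal_lift_def Let_def by simp
  from smooth_on_compose[OF charted_prod[OF lie_groupoidD(1)[OF G_groupoid] lie_groupoidD(2)[OF \<Gamma>_groupoid]]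
      smooth_on_Pair[OF M g e] this]
  show ?thesis
    using assms(3) smooth_on_image[OF g] by simp
qed

lemmas smooth_vadd = smooth_on_vadd[OF Q_bundle M, simplified]
lemmas smooth_vscale = smooth_on_vscale[OF Q_bundle M, simplified]

end

text \<open>
  Condition (4) only makes the multiplication additive; homogeneity follows since an additive
  function \<open>\<real> \<rightarrow> \<real>\<close> that is differentiable at \<open>0\<close> is linear.
\<close>

lemma mul_scale:
  assumes g: "g \<in> points (arrows G)" "k \<in> points (arrows G)"
    and \<gamma>: "\<gamma> \<in> vfib Q g" "\<delta> \<in> vfib Q k" and st: "src \<Gamma> \<gamma> = tgt \<Gamma> \<delta>"
  shows "mul \<Gamma> (vscale Q r \<gamma>) (vscale Q r \<delta>) = vscale Q r (mul \<Gamma> \<gamma> \<delta>)"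
proof -
  note m = mul_fibre[OF g \<gamma> st]
  note gk = G_points(5)[OF g m(1)]
  have sc: "vscale Q r \<gamma> \<in> vfib Q g" "vscale Q r \<delta> \<in> vfib Q k"
    "src \<Gamma> (vscale Q r \<gamma>) = tgt \<Gamma> (vscale Q r \<delta>)" for r
    using real_vsD(3)[OF Q_vs[OF g(1)] \<gamma>(1)] real_vsD(3)[OF Q_vs[OF g(2)] \<gamma>(2)]
      src_tgt_linear(3)[OF g(1) \<gamma>(1)] src_tgt_linear(4)[OF g(2) \<gamma>(2)] st by simp_all
  let ?m = "\<lambda>r. mul \<Gamma> (vscale Q r \<gamma>) (vscale Q r \<delta>)"
  have mr: "?m r \<in> vfib Q (mul G g k)" for r
    by (rule mul_fibre(2)[OF g sc])
  obtain U \<Psi> where U: "mul G g k \<in> U" "local_trivialization Q U \<Psi>"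
    using vector_bundleD(6)[OF Q_bundle, of "mul G g k"] gk by auto
  have add: "?m (r + s) = vadd Q (?m r) (?m s)" for r s
    using interchange[OF g sc(1,2) sc(1,2) sc(3) sc(3), of r s]
      real_vsD(9)[OF Q_vs[OF g(1)] \<gamma>(1)] real_vsD(9)[OF Q_vs[OF g(2)] \<gamma>(2)] by simp
  note R = charted_real_line
  have id: "smooth_on real_line UNIV real_line (\<lambda>r. r)"
    by (rule smooth_on_id[OF R]) simp
  have const: "smooth_on real_line UNIV N (\<lambda>_. c)" if "charted N" "c \<in> points N" for N :: "'z manifold" and c
    by (rule smooth_on_const[OF R that(1) _ that(2)]) simp
  note Gc = lie_groupoidD(1)[OF G_groupoid] and \<Gamma>c = lie_groupoidD(1)[OF \<Gamma>_groupoid]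
  have "smooth_on real_line UNIV (arrows \<Gamma>) (\<lambda>r. vscale Q r \<gamma>)"
    by (rule smooth_vscale[OF R const[OF Gc g(1)] id const[OF \<Gamma>c Q_fibre(1)[OF g(1) \<gamma>(1)]]]) (rule \<gamma>(1))
  moreover have "smooth_on real_line UNIV (arrows \<Gamma>) (\<lambda>r. vscale Q r \<delta>)"
    by (rule smooth_vscale[OF R const[OF Gc g(2)] id const[OF \<Gamma>c Q_fibre(1)[OF g(2) \<gamma>(2)]]]) (rule \<gamma>(2))
  \<comment> \<open>The multiplication is smooth along the curve of multiples; its fibre
    coordinates, already additive in \<open>r\<close>, thereby become differentiable at 0.\<close>
  ultimately have sm: "smooth_on real_line UNIV (arrows \<Gamma>) ?m"
    by (rule smooth_mul[OF R]) (rule sc(3))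
  have "?m r = vscale Q r (?m 1)"
  proof (rule trivialization_eqI[OF Q_bundle U(2,1) mr real_vsD(3)[OF Q_vs[OF gk] mr]])
    fix i assume i: "i < vrank Q"
    have "smooth_on real_line UNIV real_line (\<lambda>r. \<Psi> (?m r) i)"
      by (rule smooth_on_trivialization[OF Q_bundle U(2) R _ _ i]) (use sm U(1) Q_fibre(2)[OF gk mr] in simp_all)
    then obtain D where "((\<lambda>r. \<Psi> (?m r) i) has_real_derivative D) (at 0)"
      by (rule smooth_real_differentiable)
    then have "\<Psi> (?m r) i = r * \<Psi> (?m 1) i"
      by (rule additive_differentiable_linear[rotated])
        (simp add: add trivialization_linear(1)[OF Q_bundle U(2,1) mr mr])
    then show "\<Psi> (?m r) i = \<Psi> (vscale Q r (?m 1)) i"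
      using trivialization_linear(2)[OF Q_bundle U(2,1) mr] by simp
  qed
  then show ?thesis
    using real_vsD(11)[OF Q_vs[OF g(1)] \<gamma>(1)] real_vsD(11)[OF Q_vs[OF g(2)] \<gamma>(2)] by simp
qed

text \<open>Uniqueness of inverses: the proposed expression is a right inverse because
  multiplication and units are linear.\<close>

lemma ginv_linear:
  assumes g: "g \<in> points (arrows G)" and \<gamma>: "\<gamma> \<in> vfib Q g"
  shows "\<delta> \<in> vfib Q g \<Longrightarrow> ginv \<Gamma> (vadd Q \<gamma> \<delta>) = vadd Q (ginv \<Gamma> \<gamma>) (ginv \<Gamma> \<delta>)"
    "ginv \<Gamma> (vscale Q r \<gamma>) = vscale Q r (ginv \<Gamma> \<gamma>)"
proof -
  note gi = G_points(4)[OF g] and tg = G_points(2)[OF g]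
  note p = Q_fibre(1)[OF g] and pi = Q_fibre(1)[OF gi]
  note i = ginv_fibre[OF g]
  have st: "src \<Gamma> \<gamma> = tgt \<Gamma> (ginv \<Gamma> \<gamma>)" "mul \<Gamma> \<gamma> (ginv \<Gamma> \<gamma>) = unit \<Gamma> (tgt \<Gamma> \<gamma>)" if "\<gamma> \<in> vfib Q g" for \<gamma>
    using \<Gamma>_laws(4,5)[OF p[OF that]] by simp_all
  show "ginv \<Gamma> (vadd Q \<gamma> \<delta>) = vadd Q (ginv \<Gamma> \<gamma>) (ginv \<Gamma> \<delta>)" if \<delta>: "\<delta> \<in> vfib Q g"
  proof (rule groupoid_inverse_unique[OF \<Gamma>_groupoid, symmetric])
    note a = real_vsD(2)[OF Q_vs[OF g] \<gamma> \<delta>] and ai = real_vsD(2)[OF Q_vs[OF gi] i[OF \<gamma>] i[OF \<delta>]]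
    show "vadd Q \<gamma> \<delta> \<in> points (arrows \<Gamma>)" "vadd Q (ginv \<Gamma> \<gamma>) (ginv \<Gamma> \<delta>) \<in> points (arrows \<Gamma>)"
      using p[OF a] pi[OF ai] by auto
    show "src \<Gamma> (vadd Q \<gamma> \<delta>) = tgt \<Gamma> (vadd Q (ginv \<Gamma> \<gamma>) (ginv \<Gamma> \<delta>))"
      using src_tgt_linear(1)[OF g \<gamma> \<delta>] src_tgt_linear(2)[OF gi i[OF \<gamma>] i[OF \<delta>]] st(1)[OF \<gamma>] st(1)[OF \<delta>] by simp
    show "mul \<Gamma> (vadd Q \<gamma> \<delta>) (vadd Q (ginv \<Gamma> \<gamma>) (ginv \<Gamma> \<delta>)) = unit \<Gamma> (tgt \<Gamma> (vadd Q \<gamma> \<delta>))"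
      using interchange[OF g gi \<gamma> i[OF \<gamma>] \<delta> i[OF \<delta>] st(1)[OF \<gamma>] st(1)[OF \<delta>]] st(2)[OF \<gamma>] st(2)[OF \<delta>]
        unit_linear(1)[OF tg src_tgt_fibre(2)[OF g \<gamma>] src_tgt_fibre(2)[OF g \<delta>]] src_tgt_linear(2)[OF g \<gamma> \<delta>] by simp
  qed
  show "ginv \<Gamma> (vscale Q r \<gamma>) = vscale Q r (ginv \<Gamma> \<gamma>)"
  proof (rule groupoid_inverse_unique[OF \<Gamma>_groupoid, symmetric])
    show "vscale Q r \<gamma> \<in> points (arrows \<Gamma>)" "vscale Q r (ginv \<Gamma> \<gamma>) \<in> points (arrows \<Gamma>)"
      using p[OF real_vsD(3)[OF Q_vs[OF g] \<gamma>]] pi[OF real_vsD(3)[OF Q_vs[OF gi] i[OF \<gamma>]]] by auto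
    show "src \<Gamma> (vscale Q r \<gamma>) = tgt \<Gamma> (vscale Q r (ginv \<Gamma> \<gamma>))"
      using src_tgt_linear(3)[OF g \<gamma>] src_tgt_linear(4)[OF gi i[OF \<gamma>]] st(1)[OF \<gamma>] by simp
    show "mul \<Gamma> (vscale Q r \<gamma>) (vscale Q r (ginv \<Gamma> \<gamma>)) = unit \<Gamma> (tgt \<Gamma> (vscale Q r \<gamma>))"
      using mul_scale[OF g gi \<gamma> i[OF \<gamma>] st(1)[OF \<gamma>]] st(2)[OF \<gamma>]
        unit_linear(2)[OF tg src_tgt_fibre(2)[OF g \<gamma>]] src_tgt_linear(4)[OF g \<gamma>] by simp
  qed
qed

subsection \<open>The core\<close>

lemma core_fibre: "vfib C x = {c \<in> vfib Q (unit G x). src \<Gamma> c = vzero E x}"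
  and core_ops [simp]: "vtotal C = arrows \<Gamma>" "vadd C = vadd Q" "vscale C = vscale Q" "vzero C x = z (unit G x)"
  by (simp_all add: core_def)

lemma core_fibreD:
  assumes "c \<in> vfib C x" shows "c \<in> vfib Q (unit G x)" "src \<Gamma> c = vzero E x"
  using assms by (auto simp: core_fibre)

lemma core_vs:
  assumes x: "x \<in> points (objects G)"
  shows "real_vs (vfib C x) (vadd C) (vscale C) (vzero C x)"
proof -
  note u = G_points(3)[OF x]
  have s: "src G (unit G x) = x"
    by (rule groupoid_unit_ends(1)[OF G_groupoid x])
  note Qv = Q_vs[OF u] and Ev = E_vs[OF x]
  have z: "z (unit G x) \<in> vfib C x"
    using zero_fibre[OF u] src_tgt_zero(1)[OF u] s by (simp add: core_fibre)
  have add: "vadd Q c d \<in> vfib C x" if "c \<in> vfib C x" "d \<in> vfib C x" for c d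
    using that real_vsD(2)[OF Qv] src_tgt_linear(1)[OF u] real_vsD(6)[OF Ev real_vsD(1)[OF Ev]] by (simp add: core_fibre)
  have scale: "vscale Q r c \<in> vfib C x" if "c \<in> vfib C x" for c r
    using that real_vsD(3)[OF Qv] src_tgt_linear(3)[OF u] real_vs_scale_zero[OF Ev] by (simp add: core_fibre)
  have sub: "c \<in> vfib Q (unit G x)" if "c \<in> vfib C x" for c
    using that core_fibreD(1) by blast
  show ?thesis
    unfolding real_vs_def core_ops
  proof (intro conjI ballI allI)
    fix c assume c: "c \<in> vfib C x"
    show "\<exists>w\<in>vfib C x. vadd Q c w = z (unit G x)"
      using real_vs_right_minus[OF Qv sub[OF c]] scale[OF c] by blast
    show "vadd Q c d = vadd Q d c" if "d \<in> vfib C x" for d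
      by (rule real_vsD(5)[OF Qv sub[OF c] sub[OF that]])
  qed (use z add scale sub in \<open>simp_all add: real_vsD(4,6,8-11)[OF Qv]\<close>)
qed

text \<open>The core carries the operations of the bundle over the arrows and is regarded as a
  subset of \<Gamma>, so smoothness is inherited; linearity of the source map makes each core fibre
  a subspace.\<close>

lemma smooth_family_core: "smooth_family G C"
proof
  let ?T = "arrows \<Gamma>"
  note T = lie_groupoidD(1)[OF \<Gamma>_groupoid]
  let ?S = "{(v, w). \<exists>x\<in>points (objects G). v \<in> vfib C x \<and> w \<in> vfib C x}"
  have S: "?S \<subseteq> points ?T \<times> points ?T"
    using Q_fibre(1)[OF G_points(3)] core_fibreD(1) by auto
  have TT: "charted (prod_manifold ?T ?T)"
    by (intro charted_prod T)
  note pr = vector_bundleD(3)[OF Q_bundle, simplified]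
  have proj: "smooth_on (prod_manifold ?T ?T) ?S (arrows G) (\<lambda>vw. vproj Q (fst vw))"
    by (rule smooth_on_compose[OF T smooth_on_fst[OF T T S] pr]) (use Q_fibre(1)[OF G_points(3)] core_fibreD(1) in auto)
  have mem: "fst vw \<in> vfib Q (vproj Q (fst vw))" "snd vw \<in> vfib Q (vproj Q (fst vw))" if "vw \<in> ?S" for vw
    using that Q_fibre(2)[OF G_points(3)] core_fibreD(1) by auto
  have "smooth_on (prod_manifold ?T ?T) ?S ?T (\<lambda>vw. vadd Q (fst vw) (snd vw))"
    by (rule smooth_vadd[OF TT proj smooth_on_fst[OF T T S] mem(1) smooth_on_snd[OF T T S] mem(2)])
  then show "smooth_on (prod_manifold (vtotal C) (vtotal C)) ?S (vtotal C) (\<lambda>(v, w). vadd C v w)"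
    by (simp only: case_prod_unfold core_ops)
  let ?S' = "{(r, v). \<exists>x\<in>points (objects G). v \<in> vfib C x} :: (real \<times> 'c) set"
  have S': "?S' \<subseteq> points real_line \<times> points ?T"
    using Q_fibre(1)[OF G_points(3)] core_fibreD(1) by auto
  have RT: "charted (prod_manifold real_line ?T)"
    by (intro charted_prod T charted_real_line)
  have proj': "smooth_on (prod_manifold real_line ?T) ?S' (arrows G) (\<lambda>vw. vproj Q (snd vw))"
    by (rule smooth_on_compose[OF T smooth_on_snd[OF charted_real_line T S'] pr]) (use Q_fibre(1)[OF G_points(3)] core_fibreD(1) in auto)
  have mem': "snd vw \<in> vfib Q (vproj Q (snd vw))" if "vw \<in> ?S'" for vw
    using that Q_fibre(2)[OF G_points(3)] core_fibreD(1) by auto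
  have "smooth_on (prod_manifold real_line ?T) ?S' ?T (\<lambda>rv. vscale Q (fst rv) (snd rv))"
    by (rule smooth_vscale[OF RT proj' smooth_on_fst[OF charted_real_line T S'] smooth_on_snd[OF charted_real_line T S'] mem'])
  then show "smooth_on (prod_manifold real_line (vtotal C)) ?S' (vtotal C) (\<lambda>(r, v). vscale C r v)"
    by (simp only: case_prod_unfold core_ops)
  show "smooth_on (objects G) (points (objects G)) (vtotal C) (vzero C)"
    using smooth_vzero[OF lie_groupoidD(2)[OF G_groupoid] lie_groupoidD(5)[OF G_groupoid]]
    by (simp add: core_def)
qed (use G_groupoid core_vs lie_groupoidD(1)[OF \<Gamma>_groupoid] in auto)

lemma smooth_family_side: "smooth_family G E"
  by (rule smooth_family_vector_bundle[OF G_groupoid E_bundle]) simp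

text \<open>Right translation by the zero over \<open>g\<close> takes the core fibre at the target
  of \<open>g\<close> into the kernel of \<open>src\<close> in the fibre over \<open>g\<close>. It
  is linear because the zero is its own sum and its own multiple.\<close>

lemma core_mul_zero:
  assumes g: "g \<in> points (arrows G)" and c: "c \<in> vfib C (tgt G g)"
  shows "mul \<Gamma> c (z g) \<in> vfib Q g" "src \<Gamma> (mul \<Gamma> c (z g)) = vzero E (src G g)"
    "src \<Gamma> c = tgt \<Gamma> (z g)"
    "d \<in> vfib C (tgt G g) \<Longrightarrow> mul \<Gamma> (vadd Q c d) (z g) = vadd Q (mul \<Gamma> c (z g)) (mul \<Gamma> d (z g))"
    "mul \<Gamma> (vscale Q r c) (z g) = vscale Q r (mul \<Gamma> c (z g))"
proof -
  note u = G_points(3)[OF G_points(2)[OF g]]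
  note zg = zero_fibre[OF g]
  have st: "src \<Gamma> c = tgt \<Gamma> (z g)" if "c \<in> vfib C (tgt G g)" for c
    using core_fibreD(2)[OF that] src_tgt_zero(2)[OF g] by simp
  then show "src \<Gamma> c = tgt \<Gamma> (z g)"
    using c by blast
  note cQ = core_fibreD(1)[OF c]
  show "mul \<Gamma> c (z g) \<in> vfib Q g"
    using mul_fibre(2)[OF u g cQ zg st[OF c]] G_laws(1)[OF g] by simp
  show "src \<Gamma> (mul \<Gamma> c (z g)) = vzero E (src G g)"
    using groupoid_mul_ends(1)[OF \<Gamma>_groupoid Q_fibre(1)[OF u cQ] Q_fibre(1)[OF g zg] st[OF c]] src_tgt_zero(1)[OF g] by simp
  show "mul \<Gamma> (vadd Q c d) (z g) = vadd Q (mul \<Gamma> c (z g)) (mul \<Gamma> d (z g))" if d: "d \<in> vfib C (tgt G g)"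
    using interchange[OF u g cQ zg core_fibreD(1)[OF d] zg st[OF c] st[OF d]] real_vsD(6)[OF Q_vs[OF g] zg] by simp
  show "mul \<Gamma> (vscale Q r c) (z g) = vscale Q r (mul \<Gamma> c (z g))"
    using mul_scale[OF u g cQ zg st[OF c], of r] real_vs_scale_zero[OF Q_vs[OF g]] by simp
qed

text \<open>Right translation by the zero over the inverse arrow goes back from the kernel of
  \<open>src\<close> to the core: the product of the two zeros is the zero over a unit arrow, and
  this is a unit of \<Gamma>.\<close>

lemma vertical_mul_zero:
  assumes g: "g \<in> points (arrows G)" and \<delta>: "\<delta> \<in> vfib Q g" "src \<Gamma> \<delta> = vzero E (src G g)"
  shows "mul \<Gamma> \<delta> (z (ginv G g)) \<in> vfib C (tgt G g)" "mul \<Gamma> (mul \<Gamma> \<delta> (z (ginv G g))) (z g) = \<delta>"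
    "src \<Gamma> \<delta> = tgt \<Gamma> (z (ginv G g))"
proof -
  note gi = G_points(4)[OF g]
  note p = Q_fibre(1)[OF g \<delta>(1)] and zi = Q_fibre(1)[OF gi zero_fibre[OF gi]] and zg = Q_fibre(1)[OF g zero_fibre[OF g]]
  show st: "src \<Gamma> \<delta> = tgt \<Gamma> (z (ginv G g))"
    using \<delta>(2) src_tgt_zero(2)[OF gi] G_laws(4)[OF g] by simp
  show "mul \<Gamma> \<delta> (z (ginv G g)) \<in> vfib C (tgt G g)"
    using mul_fibre(2)[OF g gi \<delta>(1) zero_fibre[OF gi] st] G_laws(5)[OF g] groupoid_mul_ends(1)[OF \<Gamma>_groupoid p zi st]
      src_tgt_zero(1)[OF gi] G_laws(3)[OF g] by (simp add: core_fibre)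
  have "mul \<Gamma> (mul \<Gamma> \<delta> (z (ginv G g))) (z g) = mul \<Gamma> \<delta> (mul \<Gamma> (z (ginv G g)) (z g))"
    by (rule groupoid_assoc[OF \<Gamma>_groupoid p zi zg st]) (simp add: src_tgt_zero[OF g] src_tgt_zero[OF gi] G_laws(3)[OF g])
  also have "mul \<Gamma> (z (ginv G g)) (z g) = unit \<Gamma> (vzero E (src G g))"
    using mul_zero[OF gi g] G_laws(3,6)[OF g] unit_linear(3)[OF G_points(1)[OF g] real_vsD(1)[OF E_vs[OF G_points(1)[OF g]]]] by simp
  also have "mul \<Gamma> \<delta> (unit \<Gamma> (vzero E (src G g))) = \<delta>"
    using \<Gamma>_laws(2)[OF p] \<delta>(2) by simp
  finally show "mul \<Gamma> (mul \<Gamma> \<delta> (z (ginv G g))) (z g) = \<delta>" .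
qed

lemma core_mul_zero_cancel:
  assumes g: "g \<in> points (arrows G)" and c: "c \<in> vfib C (tgt G g)"
  shows "mul \<Gamma> (mul \<Gamma> c (z g)) (z (ginv G g)) = c"
proof -
  note gi = G_points(4)[OF g] and u = G_points(3)[OF G_points(2)[OF g]]
  note p = Q_fibre(1)[OF u core_fibreD(1)[OF c]] and zi = Q_fibre(1)[OF gi zero_fibre[OF gi]]
    and zg = Q_fibre(1)[OF g zero_fibre[OF g]]
  have "mul \<Gamma> (mul \<Gamma> c (z g)) (z (ginv G g)) = mul \<Gamma> c (mul \<Gamma> (z g) (z (ginv G g)))"
    by (rule groupoid_assoc[OF \<Gamma>_groupoid p zg zi core_mul_zero(3)[OF g c]])
      (simp add: src_tgt_zero[OF g] src_tgt_zero[OF gi] G_laws(4)[OF g])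
  also have "mul \<Gamma> (z g) (z (ginv G g)) = unit \<Gamma> (vzero E (tgt G g))"
    using mul_zero[OF g gi] G_laws(4,5)[OF g] unit_linear(3)[OF G_points(2)[OF g] real_vsD(1)[OF E_vs[OF G_points(2)[OF g]]]] by simp
  also have "mul \<Gamma> c (unit \<Gamma> (vzero E (tgt G g))) = c"
    using \<Gamma>_laws(2)[OF p] core_fibreD(2)[OF c] by simp
  finally show ?thesis .
qed

section \<open>The splitting of \<Gamma> along the horizontal lift\<close>

definition vertical :: "'g \<Rightarrow> 'c \<Rightarrow> 'c" where
  "vertical g \<gamma> = vadd Q \<gamma> (vscale Q (-1) (h g (src \<Gamma> \<gamma>)))"

text \<open>The core component: \<open>vertical\<close> projects onto the kernel of
  \<open>src\<close> along the image of the lift, and right translation carries this kernel to the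
  core fibre.\<close>

definition core_part :: "'g \<Rightarrow> 'c \<Rightarrow> 'c" where
  "core_part g \<gamma> = mul \<Gamma> (vertical g \<gamma>) (z (ginv G g))"

definition combine :: "'g \<Rightarrow> 'e \<Rightarrow> 'c \<Rightarrow> 'c" where
  "combine g e c = vadd Q (h g e) (mul \<Gamma> c (z g))"

lemma vertical_fibre:
  assumes g: "g \<in> points (arrows G)" and \<gamma>: "\<gamma> \<in> vfib Q g"
  shows "vertical g \<gamma> \<in> vfib Q g" "src \<Gamma> (vertical g \<gamma>) = vzero E (src G g)"
proof -
  note s = src_tgt_fibre(1)[OF g \<gamma>]
  note l = lift_fibre(1,2)[OF g s]
  note sc = real_vsD(3)[OF Q_vs[OF g] l(1), of "-1"]
  show "vertical g \<gamma> \<in> vfib Q g"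
    unfolding vertical_def by (rule real_vsD(2)[OF Q_vs[OF g] \<gamma> sc])
  show "src \<Gamma> (vertical g \<gamma>) = vzero E (src G g)"
    unfolding vertical_def src_tgt_linear(1)[OF g \<gamma> sc] src_tgt_linear(3)[OF g l(1)] l(2)
    by (rule real_vs_right_minus[OF E_vs[OF G_points(1)[OF g]] s])
qed

lemma core_part_fibre: "g \<in> points (arrows G) \<Longrightarrow> \<gamma> \<in> vfib Q g \<Longrightarrow> core_part g \<gamma> \<in> vfib C (tgt G g)"
  unfolding core_part_def by (intro vertical_mul_zero(1) vertical_fibre)

lemma combine_fibre:
  assumes g: "g \<in> points (arrows G)" and e: "e \<in> vfib E (src G g)" and c: "c \<in> vfib C (tgt G g)"
  shows "combine g e c \<in> vfib Q g" "src \<Gamma> (combine g e c) = e" "core_part g (combine g e c) = c"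
proof -
  note l = lift_fibre(1,2)[OF g e] and m = core_mul_zero(1,2)[OF g c]
  note Qv = Q_vs[OF g]
  show "combine g e c \<in> vfib Q g"
    unfolding combine_def by (rule real_vsD(2)[OF Qv l(1) m(1)])
  show s: "src \<Gamma> (combine g e c) = e"
    unfolding combine_def src_tgt_linear(1)[OF g l(1) m(1)] l(2) m(2)
    by (rule real_vs_add_0_right[OF E_vs[OF G_points(1)[OF g]] e])
  have "vertical g (combine g e c) = vadd Q (vadd Q (mul \<Gamma> c (z g)) (h g e)) (vscale Q (-1) (h g e))"
    unfolding vertical_def s unfolding combine_def using real_vsD(5)[OF Qv l(1) m(1)] by simp
  also have "\<dots> = mul \<Gamma> c (z g)"
    using real_vsD(4)[OF Qv m(1) l(1) real_vsD(3)[OF Qv l(1)]] real_vs_right_minus[OF Qv l(1)]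
      real_vs_add_0_right[OF Qv m(1)] by simp
  finally show "core_part g (combine g e c) = c"
    unfolding core_part_def using core_mul_zero_cancel[OF g c] by simp
qed

text \<open>Together with \<open>combine_fibre\<close> this makes the pair of \<open>src\<close> and
  \<open>core_part\<close> the inverse of \<open>combine\<close>, which is the unique decomposition
  of an element of the fibre over \<open>g\<close>.\<close>

lemma combine_core_part:
  assumes g: "g \<in> points (arrows G)" and \<gamma>: "\<gamma> \<in> vfib Q g"
  shows "combine g (src \<Gamma> \<gamma>) (core_part g \<gamma>) = \<gamma>"
proof -
  note l = lift_fibre(1)[OF g src_tgt_fibre(1)[OF g \<gamma>]]
  note Qv = Q_vs[OF g]
  have "combine g (src \<Gamma> \<gamma>) (core_part g \<gamma>) = vadd Q (h g (src \<Gamma> \<gamma>)) (vertical g \<gamma>)"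
    unfolding combine_def core_part_def vertical_mul_zero(2)[OF g vertical_fibre[OF g \<gamma>]] ..
  also have "\<dots> = vadd Q (vertical g \<gamma>) (h g (src \<Gamma> \<gamma>))"
    by (rule real_vsD(5)[OF Qv l vertical_fibre(1)[OF g \<gamma>]])
  also have "\<dots> = vadd Q \<gamma> (vadd Q (h g (src \<Gamma> \<gamma>)) (vscale Q (-1) (h g (src \<Gamma> \<gamma>))))"
    unfolding vertical_def
    using real_vsD(4)[OF Qv \<gamma> real_vsD(3)[OF Qv l] l] real_vsD(5)[OF Qv l real_vsD(3)[OF Qv l]] by simp
  also have "\<dots> = \<gamma>"
    unfolding real_vs_right_minus[OF Qv l] by (rule real_vs_add_0_right[OF Qv \<gamma>])
  finally show ?thesis .
qed

text \<open>Sums and multiples of decomposed elements are again decomposed, with the sums and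
  multiples of the parts; uniqueness of the decomposition gives the rest.\<close>

lemma core_part_linear:
  assumes g: "g \<in> points (arrows G)" and \<gamma>: "\<gamma> \<in> vfib Q g"
  shows "\<delta> \<in> vfib Q g \<Longrightarrow> core_part g (vadd Q \<gamma> \<delta>) = vadd Q (core_part g \<gamma>) (core_part g \<delta>)"
    "core_part g (vscale Q r \<gamma>) = vscale Q r (core_part g \<gamma>)"
proof -
  note Qv = Q_vs[OF g] and sg = G_points(1)[OF g] and tg = G_points(2)[OF g]
  note comb = combine_core_part[OF g, unfolded combine_def]
  have unique: "core_part g (vadd Q (h g e) (mul \<Gamma> c (z g))) = c" if "e \<in> vfib E (src G g)" "c \<in> vfib C (tgt G g)" for e c
    using combine_fibre(3)[OF g that] by (simp add: combine_def)
  note cp = core_part_fibre[OF g] and s = src_tgt_fibre(1)[OF g]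
  note cv = core_vs[OF tg, unfolded core_ops]
  show "core_part g (vadd Q \<gamma> \<delta>) = vadd Q (core_part g \<gamma>) (core_part g \<delta>)" if \<delta>: "\<delta> \<in> vfib Q g"
  proof -
    let ?a = "h g (src \<Gamma> \<gamma>)" and ?b = "mul \<Gamma> (core_part g \<gamma>) (z g)"
      and ?c = "h g (src \<Gamma> \<delta>)" and ?d = "mul \<Gamma> (core_part g \<delta>) (z g)"
    have mem: "?a \<in> vfib Q g" "?b \<in> vfib Q g" "?c \<in> vfib Q g" "?d \<in> vfib Q g"
      using lift_fibre(1)[OF g s] core_mul_zero(1)[OF g cp] \<gamma> \<delta> by auto
    have "vadd Q (vadd Q ?a ?b) (vadd Q ?c ?d) = vadd Q (vadd Q ?a ?c) (vadd Q ?b ?d)"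
      by (rule real_vs_add_swap[OF Qv mem])
    then have "vadd Q \<gamma> \<delta> = vadd Q (h g (vadd E (src \<Gamma> \<gamma>) (src \<Gamma> \<delta>))) (mul \<Gamma> (vadd Q (core_part g \<gamma>) (core_part g \<delta>)) (z g))"
      using comb[OF \<gamma>] comb[OF \<delta>] lift_fibre(3)[OF g s[OF \<gamma>] s[OF \<delta>]] core_mul_zero(4)[OF g cp[OF \<gamma>] cp[OF \<delta>]] by simp
    then show ?thesis
      using unique[OF real_vsD(2)[OF E_vs[OF sg] s[OF \<gamma>] s[OF \<delta>]] real_vsD(2)[OF cv cp[OF \<gamma>] cp[OF \<delta>]]] by simp
  qed
  have "vscale Q r \<gamma> = vadd Q (h g (vscale E r (src \<Gamma> \<gamma>))) (mul \<Gamma> (vscale Q r (core_part g \<gamma>)) (z g))"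
    using comb[OF \<gamma>] lift_fibre(4)[OF g s[OF \<gamma>], of r] core_mul_zero(5)[OF g cp[OF \<gamma>], of r]
      real_vsD(8)[OF Qv lift_fibre(1)[OF g s[OF \<gamma>]] core_mul_zero(1)[OF g cp[OF \<gamma>]], of r] by simp
  then show "core_part g (vscale Q r \<gamma>) = vscale Q r (core_part g \<gamma>)"
    using unique[OF real_vsD(3)[OF E_vs[OF sg] s[OF \<gamma>]] real_vsD(3)[OF cv cp[OF \<gamma>]]] by simp
qed

text \<open>\<open>core_part\<close> is assembled from the lift, the fibre operations, zeros,
  inversion of base arrows and the multiplication, all smooth as maps into \<Gamma>.\<close>

lemma smooth_core_part:
  assumes M: "charted M" and g: "smooth_on M A (arrows G) g" and \<gamma>: "smooth_on M A (arrows \<Gamma>) \<gamma>"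
    and mem: "\<And>a. a \<in> A \<Longrightarrow> \<gamma> a \<in> vfib Q (g a)"
  shows "smooth_on M A (arrows \<Gamma>) (\<lambda>a. core_part (g a) (\<gamma> a))"
proof -
  have gp: "g a \<in> points (arrows G)" if "a \<in> A" for a
    using smooth_on_image[OF g that] .
  have l: "smooth_on M A (arrows \<Gamma>) (\<lambda>a. h (g a) (src \<Gamma> (\<gamma> a)))"
    by (rule smooth_lift[OF M g smooth_structure(2)[OF M \<gamma>]]) (rule src_tgt_fibre(1)[OF gp mem])
  have lm: "h (g a) (src \<Gamma> (\<gamma> a)) \<in> vfib Q (g a)" if "a \<in> A" for a
    by (rule lift_fibre(1)[OF gp[OF that] src_tgt_fibre(1)[OF gp[OF that] mem[OF that]]])
  have w: "smooth_on M A (arrows \<Gamma>) (\<lambda>a. vscale Q (-1) (h (g a) (src \<Gamma> (\<gamma> a))))"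
    by (rule smooth_vscale[OF M g smooth_on_const[OF M charted_real_line smooth_on_domain[OF g]] l lm]) simp_all
  have v: "smooth_on M A (arrows \<Gamma>) (\<lambda>a. vertical (g a) (\<gamma> a))"
    unfolding vertical_def
    by (rule smooth_vadd[OF M g \<gamma> mem w real_vsD(3)[OF Q_vs[OF gp] lm]])
  show ?thesis
    unfolding core_part_def
    by (rule smooth_mul[OF M v smooth_vzero[OF M smooth_ginv_base[OF M g]]])
      (rule vertical_mul_zero(3)[OF gp vertical_fibre[OF gp mem]])
qed

lemma smooth_combine:
  assumes M: "charted M" and g: "smooth_on M A (arrows G) g" and e: "smooth_on M A (objects \<Gamma>) e"
    and c: "smooth_on M A (arrows \<Gamma>) c"
    and mem: "\<And>a. a \<in> A \<Longrightarrow> e a \<in> vfib E (src G (g a))" "\<And>a. a \<in> A \<Longrightarrow> c a \<in> vfib C (tgt G (g a))"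
  shows "smooth_on M A (arrows \<Gamma>) (\<lambda>a. combine (g a) (e a) (c a))"
proof -
  have gp: "g a \<in> points (arrows G)" if "a \<in> A" for a
    using smooth_on_image[OF g that] .
  have w: "smooth_on M A (arrows \<Gamma>) (\<lambda>a. mul \<Gamma> (c a) (z (g a)))"
    by (rule smooth_mul[OF M c smooth_vzero[OF M g]]) (rule core_mul_zero(3)[OF gp mem(2)])
  show ?thesis
    unfolding combine_def
    by (rule smooth_vadd[OF M g smooth_lift[OF M g e mem(1)] lift_fibre(1)[OF gp mem(1)] w core_mul_zero(1)[OF gp mem(2)]])
qed

end

section \<open>Left-projectable cochains\<close>

context vb_groupoid_lift
begin

section \<open>The dual structure maps and left multiplication by zero\<close>

abbreviation "D \<equiv> dual_manifold Q"

lemma in_D: "\<xi> \<in> points D \<longleftrightarrow> fst \<xi> \<in> points (arrows G) \<and> snd \<xi> \<in> dual_fib Q (fst \<xi>)"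
  by (cases \<xi>) (simp add: points_dual_manifold)

lemma unit_ends [simp]:
  "x \<in> points (objects G) \<Longrightarrow> src G (unit G x) = x" "x \<in> points (objects G) \<Longrightarrow> tgt G (unit G x) = x"
  using groupoid_unit_ends[OF G_groupoid] by blast+

lemma ginv_unit: "x \<in> points (objects G) \<Longrightarrow> ginv G (unit G x) = unit G x"
  using groupoid_inverse_unique[OF G_groupoid, of "unit G x" "unit G x"] G_points(3) G_laws(1)[of "unit G x"] by simp

text \<open>The vector on which the dual source evaluates a functional, up to sign. Such vectors
  form the kernel of \<open>tgt\<close> in the fibre over \<open>g\<close>, parametrized by the core
  at the source of \<open>g\<close>.\<close>

definition right_core :: "'g \<Rightarrow> 'c \<Rightarrow> 'c" where
  "right_core g c = mul \<Gamma> (z g) (ginv \<Gamma> c)"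

lemma right_core:
  assumes g: "g \<in> points (arrows G)" and c: "c \<in> vfib C (src G g)"
  shows "right_core g c \<in> vfib Q g" "src \<Gamma> (right_core g c) = tgt \<Gamma> c" "src \<Gamma> (z g) = tgt \<Gamma> (ginv \<Gamma> c)"
    "d \<in> vfib C (src G g) \<Longrightarrow> right_core g (vadd Q c d) = vadd Q (right_core g c) (right_core g d)"
    "right_core g (vscale Q r c) = vscale Q r (right_core g c)"
proof -
  note x = G_points(1)[OF g]
  note u = G_points(3)[OF x]
  note zg = zero_fibre[OF g]
  have ci: "ginv \<Gamma> c \<in> vfib Q (unit G (src G g))" if "c \<in> vfib C (src G g)" for c
    using ginv_fibre[OF u core_fibreD(1)[OF that]] ginv_unit[OF x] by simp
  have st: "src \<Gamma> (z g) = tgt \<Gamma> (ginv \<Gamma> c)" if "c \<in> vfib C (src G g)" for c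
    using \<Gamma>_laws(4)[OF Q_fibre(1)[OF u core_fibreD(1)[OF that]]] core_fibreD(2)[OF that] src_tgt_zero(1)[OF g] by simp
  then show "src \<Gamma> (z g) = tgt \<Gamma> (ginv \<Gamma> c)"
    using c by blast
  show "right_core g c \<in> vfib Q g"
    unfolding right_core_def using mul_fibre(2)[OF g u zg ci[OF c] st[OF c]] G_laws(2)[OF g] by simp
  show "src \<Gamma> (right_core g c) = tgt \<Gamma> c"
    unfolding right_core_def
    using groupoid_mul_ends(1)[OF \<Gamma>_groupoid Q_fibre(1)[OF g zg] Q_fibre(1)[OF u ci[OF c]] st[OF c]]
      \<Gamma>_laws(3)[OF Q_fibre(1)[OF u core_fibreD(1)[OF c]]] by simp
  show "right_core g (vadd Q c d) = vadd Q (right_core g c) (right_core g d)" if d: "d \<in> vfib C (src G g)"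
    unfolding right_core_def ginv_linear(1)[OF u core_fibreD(1)[OF c] core_fibreD(1)[OF d]]
    using interchange[OF g u zg ci[OF c] zg ci[OF d] st[OF c] st[OF d]] real_vsD(6)[OF Q_vs[OF g] zg] by simp
  show "right_core g (vscale Q r c) = vscale Q r (right_core g c)"
    unfolding right_core_def ginv_linear(2)[OF u core_fibreD(1)[OF c]]
    using mul_scale[OF g u zg ci[OF c] st[OF c], of r] real_vs_scale_zero[OF Q_vs[OF g]] by simp
qed

lemma smooth_right_core:
  assumes M: "charted M" and g: "smooth_on M A (arrows G) g" and c: "smooth_on M A (arrows \<Gamma>) c"
    and mem: "\<And>a. a \<in> A \<Longrightarrow> c a \<in> vfib C (src G (g a))"
  shows "smooth_on M A (arrows \<Gamma>) (\<lambda>a. right_core (g a) (c a))"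
  unfolding right_core_def
  by (rule smooth_mul[OF M smooth_vzero[OF M g] smooth_structure(1)[OF M c]])
    (rule right_core(3)[OF smooth_on_image[OF g] mem])

lemma dual_src_eq: "dual_src V \<xi> = (src G (fst \<xi>), \<lambda>c\<in>vfib C (src G (fst \<xi>)). - snd \<xi> (right_core (fst \<xi>) c))"
  and dual_tgt_eq: "dual_tgt V \<xi> = (tgt G (fst \<xi>), \<lambda>c\<in>vfib C (tgt G (fst \<xi>)). snd \<xi> (mul \<Gamma> c (z (fst \<xi>))))"
  by (simp_all add: dual_src_def dual_tgt_def right_core_def case_prod_unfold)

text \<open>Zero dual target means that \<xi> vanishes on all right translates of the core, hence on
  the kernel of \<open>src\<close> by \<open>vertical_mul_zero\<close>. Applied to a difference,
  this shows that \<xi> factors through \<open>src\<close>.\<close>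

lemma dual_kernel:
  assumes \<xi>: "\<xi> \<in> points D" and t: "dual_tgt V \<xi> = dual_zero C x"
  shows "tgt G (fst \<xi>) = x"
    "\<gamma> \<in> vfib Q (fst \<xi>) \<Longrightarrow> \<delta> \<in> vfib Q (fst \<xi>) \<Longrightarrow> src \<Gamma> \<gamma> = src \<Gamma> \<delta> \<Longrightarrow> snd \<xi> \<gamma> = snd \<xi> \<delta>"
proof -
  have g: "fst \<xi> \<in> points (arrows G)" and f: "snd \<xi> \<in> dual_fib Q (fst \<xi>)"
    using \<xi> by (auto simp: in_D)
  show x: "tgt G (fst \<xi>) = x"
    using t by (simp add: dual_tgt_eq dual_zero_def)
  have fun_eq: "(\<lambda>c\<in>vfib C x. snd \<xi> (mul \<Gamma> c (z (fst \<xi>)))) = (\<lambda>c\<in>vfib C x. 0)"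
    using t by (simp add: dual_tgt_eq dual_zero_def x)
  have 0: "snd \<xi> (mul \<Gamma> c (z (fst \<xi>))) = 0" if "c \<in> vfib C x" for c
    using fun_cong[OF fun_eq, of c] that by simp
  show "snd \<xi> \<gamma> = snd \<xi> \<delta>"
    if \<gamma>: "\<gamma> \<in> vfib Q (fst \<xi>)" and \<delta>: "\<delta> \<in> vfib Q (fst \<xi>)" and eq: "src \<Gamma> \<gamma> = src \<Gamma> \<delta>"
  proof -
    note m = real_vsD(3)[OF Q_vs[OF g] \<delta>, of "-1"]
    note s = src_tgt_fibre(1)[OF g \<delta>]
    let ?d = "vadd Q \<gamma> (vscale Q (-1) \<delta>)"
    have d: "?d \<in> vfib Q (fst \<xi>)"
      by (rule real_vsD(2)[OF Q_vs[OF g] \<gamma> m])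
    have "src \<Gamma> ?d = vzero E (src G (fst \<xi>))"
      unfolding src_tgt_linear(1)[OF g \<gamma> m] src_tgt_linear(3)[OF g \<delta>] eq
      by (rule real_vs_right_minus[OF E_vs[OF G_points(1)[OF g]] s])
    note v = vertical_mul_zero[OF g d this]
    have "snd \<xi> ?d = 0"
      using 0[OF v(1)[unfolded x]] v(2) by simp
    then show ?thesis
      using dual_fibD(1)[OF f \<gamma> m] dual_fibD(2)[OF f \<delta>, of "-1"] by simp
  qed
qed

text \<open>Closed form of the product of the zero functional over \<open>g\<close> with a
  functional that factors through \<open>src\<close>: the induced functional on the side bundle,
  pulled back to the fibre over the product arrow. The lift only picks a vector with the prescribed
  source.\<close>

definition left_zero :: "'g \<Rightarrow> 'g \<times> ('c \<Rightarrow> real) \<Rightarrow> 'g \<times> ('c \<Rightarrow> real)" where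
  "left_zero g \<xi> = (mul G g (fst \<xi>), \<lambda>\<gamma>\<in>vfib Q (mul G g (fst \<xi>)). snd \<xi> (h (fst \<xi>) (src \<Gamma> \<gamma>)))"

text \<open>\<open>dual_mul\<close> is a definite description over factorizations of a vector. In
  each of them the second factor has the source of the vector, and \<xi> sees nothing else by
  \<open>dual_kernel\<close>, so the value is unique. The dual source stays the same for the same
  reason: the vectors \<open>right_core\<close> over both arrows have the source
  \<open>tgt \<Gamma> c\<close>.\<close>

lemma dual_mul_zero:
  assumes g: "g \<in> points (arrows G)" and \<xi>: "\<xi> \<in> points D" and t: "dual_tgt V \<xi> = dual_zero C (src G g)"
  shows "dual_mul V (dual_zero Q g) \<xi> = left_zero g \<xi>"
    and "left_zero g \<xi> \<in> points D" and "dual_src V (left_zero g \<xi>) = dual_src V \<xi>"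
proof -
  have k: "fst \<xi> \<in> points (arrows G)" and f: "snd \<xi> \<in> dual_fib Q (fst \<xi>)"
    using \<xi> by (auto simp: in_D)
  note ker = dual_kernel[OF \<xi> t]
  have gk: "src G g = tgt G (fst \<xi>)"
    using ker(1) by simp
  note p = G_points(5)[OF g k gk]
  have src_p: "src G (mul G g (fst \<xi>)) = src G (fst \<xi>)"
    by (rule groupoid_mul_ends(1)[OF G_groupoid g k gk])
  have s: "src \<Gamma> \<gamma> \<in> vfib E (src G (fst \<xi>))" if "\<gamma> \<in> vfib Q (mul G g (fst \<xi>))" for \<gamma>
    using src_tgt_fibre(1)[OF p that] src_p by simp
  note l = lift_fibre[OF k s]
  have "(THE r. \<exists>\<gamma>1 \<in> vfib Q g. \<exists>\<gamma>2 \<in> vfib Q (fst \<xi>). src \<Gamma> \<gamma>1 = tgt \<Gamma> \<gamma>2 \<and> mul \<Gamma> \<gamma>1 \<gamma>2 = \<gamma> \<and>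
      r = (\<lambda>v\<in>vfib Q g. 0) \<gamma>1 + snd \<xi> \<gamma>2) = snd \<xi> (h (fst \<xi>) (src \<Gamma> \<gamma>))"
    if \<gamma>: "\<gamma> \<in> vfib Q (mul G g (fst \<xi>))" for \<gamma>
  proof (rule the_equality)
    \<comment> \<open>A factorization exists: a lift with the source of \<gamma> serves as second
      factor, and dividing \<gamma> by it gives a first factor over \<open>g\<close>.\<close>
    let ?\<gamma>2 = "h (fst \<xi>) (src \<Gamma> \<gamma>)"
    let ?\<gamma>1 = "mul \<Gamma> \<gamma> (ginv \<Gamma> ?\<gamma>2)"
    note ki = G_points(4)[OF k]
    note m2 = l(1)[OF \<gamma>] and m2' = ginv_fibre[OF k l(1)[OF \<gamma>]]
    note pt = Q_fibre(1)[OF p \<gamma>] Q_fibre(1)[OF k m2] Q_fibre(1)[OF ki m2']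
    have st: "src \<Gamma> \<gamma> = tgt \<Gamma> (ginv \<Gamma> ?\<gamma>2)" "src \<Gamma> (ginv \<Gamma> ?\<gamma>2) = tgt \<Gamma> ?\<gamma>2"
      using \<Gamma>_laws(3,4)[OF pt(2)] l(2)[OF \<gamma>] by simp_all
    have "mul G (mul G g (fst \<xi>)) (ginv G (fst \<xi>)) = g"
      using groupoid_assoc[OF G_groupoid g k ki gk] G_laws(4,5)[OF k] G_laws(2)[OF g] gk by simp
    then have m1: "?\<gamma>1 \<in> vfib Q g"
      using mul_fibre(2)[OF p ki \<gamma> m2' st(1)] by simp
    moreover have "src \<Gamma> ?\<gamma>1 = tgt \<Gamma> ?\<gamma>2"
      using groupoid_mul_ends(1)[OF \<Gamma>_groupoid pt(1,3) st(1)] st(2) by simp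
    moreover have "mul \<Gamma> ?\<gamma>1 ?\<gamma>2 = \<gamma>"
      using groupoid_assoc[OF \<Gamma>_groupoid pt(1,3,2) st] \<Gamma>_laws(6)[OF pt(2)] \<Gamma>_laws(2)[OF pt(1)] l(2)[OF \<gamma>] by simp
    ultimately show "\<exists>\<gamma>1 \<in> vfib Q g. \<exists>\<gamma>2 \<in> vfib Q (fst \<xi>). src \<Gamma> \<gamma>1 = tgt \<Gamma> \<gamma>2 \<and> mul \<Gamma> \<gamma>1 \<gamma>2 = \<gamma> \<and>
        snd \<xi> ?\<gamma>2 = (\<lambda>v\<in>vfib Q g. 0) \<gamma>1 + snd \<xi> \<gamma>2"
      using m2 by (intro bexI[of _ ?\<gamma>1] bexI[of _ ?\<gamma>2]) auto
    fix r assume "\<exists>\<gamma>1 \<in> vfib Q g. \<exists>\<gamma>2 \<in> vfib Q (fst \<xi>). src \<Gamma> \<gamma>1 = tgt \<Gamma> \<gamma>2 \<and> mul \<Gamma> \<gamma>1 \<gamma>2 = \<gamma> \<and>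
        r = (\<lambda>v\<in>vfib Q g. 0) \<gamma>1 + snd \<xi> \<gamma>2"
    then obtain \<gamma>1 \<gamma>2 where *: "\<gamma>1 \<in> vfib Q g" "\<gamma>2 \<in> vfib Q (fst \<xi>)" "src \<Gamma> \<gamma>1 = tgt \<Gamma> \<gamma>2" "mul \<Gamma> \<gamma>1 \<gamma>2 = \<gamma>"
      "r = snd \<xi> \<gamma>2"
      by auto
    have "src \<Gamma> \<gamma>2 = src \<Gamma> \<gamma>"
      using groupoid_mul_ends(1)[OF \<Gamma>_groupoid Q_fibre(1)[OF g *(1)] Q_fibre(1)[OF k *(2)] *(3)] *(4) by simp
    then show "r = snd \<xi> ?\<gamma>2"
      using ker(2)[OF *(2) m2] l(2)[OF \<gamma>] *(5) by simp
  qed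
  then show "dual_mul V (dual_zero Q g) \<xi> = left_zero g \<xi>"
    unfolding left_zero_def dual_mul_def dual_zero_def by (auto simp: case_prod_unfold intro!: restrict_ext)
  have "(\<lambda>\<gamma>\<in>vfib Q (mul G g (fst \<xi>)). snd \<xi> (h (fst \<xi>) (src \<Gamma> \<gamma>))) \<in> dual_fib Q (mul G g (fst \<xi>))"
    unfolding dual_fib_def
    using real_vsD(2,3)[OF Q_vs[OF p]] src_tgt_linear(1,3)[OF p] l(3)[OF _ s] l(4) dual_fibD(1)[OF f l(1) l(1)]
      dual_fibD(2)[OF f l(1)] by simp
  then show "left_zero g \<xi> \<in> points D"
    using p by (simp add: in_D left_zero_def)
  have "snd \<xi> (h (fst \<xi>) (src \<Gamma> (right_core (mul G g (fst \<xi>)) c))) = snd \<xi> (right_core (fst \<xi>) c)"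
    if c: "c \<in> vfib C (src G (fst \<xi>))" for c
  proof -
    note r = right_core[OF p, unfolded src_p, OF c] and r' = right_core[OF k c]
    show ?thesis
      using ker(2)[OF l(1)[OF r(1)] r'(1)] l(2)[OF r(1)] r(2) r'(2) by simp
  qed
  then show "dual_src V (left_zero g \<xi>) = dual_src V \<xi>"
    using right_core(1)[OF p, unfolded src_p] by (auto simp: dual_src_eq src_p left_zero_def intro!: restrict_ext)
qed

lemma dual_nerveD:
  assumes "\<xi>s \<in> dual_nerve V (int n)"
  shows "n > 0" "length \<xi>s = n" "i < n \<Longrightarrow> \<xi>s ! i \<in> points D" "\<xi>s \<noteq> []" "hd \<xi>s \<in> points D"
    "Suc i < n \<Longrightarrow> dual_src V (\<xi>s ! i) = dual_tgt V (\<xi>s ! Suc i)"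
  using assms by (auto simp: dual_nerve_def)

lemma dual_nerveI:
  assumes "n > 0" "length \<xi>s = n" "\<And>i. i < n \<Longrightarrow> \<xi>s ! i \<in> points D"
    "\<And>i. Suc i < n \<Longrightarrow> dual_src V (\<xi>s ! i) = dual_tgt V (\<xi>s ! Suc i)"
  shows "\<xi>s \<in> dual_nerve V (int n)"
proof -
  have "\<forall>\<xi>\<in>set \<xi>s. \<xi> \<in> points D"
    unfolding all_set_conv_all_nth using assms(2,3) by simp
  then show ?thesis
    using assms by (auto simp: dual_nerve_def)
qed

lemma dual_nerve_neg: "p \<le> 0 \<Longrightarrow> dual_nerve V p = {}"
  by (auto simp: dual_nerve_def)

lemma dual_nerve_base:
  assumes "\<xi>s \<in> dual_nerve V (int n)"
  shows "map fst \<xi>s \<in> chains G n" "fst (hd \<xi>s) = hd (map fst \<xi>s)"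
proof -
  have "src G (fst (\<xi>s ! i)) = tgt G (fst (\<xi>s ! Suc i))" if "Suc i < n" for i
    using dual_nerveD(6)[OF assms that] by (simp add: dual_src_eq dual_tgt_eq)
  moreover have "\<forall>g\<in>set (map fst \<xi>s). g \<in> points (arrows G)"
    unfolding all_set_conv_all_nth using dual_nerveD(2,3)[OF assms] by (simp add: in_D)
  ultimately show "map fst \<xi>s \<in> chains G n"
    using dual_nerveD(2)[OF assms] by (auto simp: chains_def)
  show "fst (hd \<xi>s) = hd (map fst \<xi>s)"
    using dual_nerveD(4)[OF assms] by (simp add: hd_map)
qed

text \<open>The rest of a composable tuple sees the first entry through its dual source
  only.\<close>

lemma dual_nerve_Cons_cong:
  assumes "\<xi> # \<xi>s \<in> dual_nerve V p" "\<xi>' \<in> points D" "dual_src V \<xi>' = dual_src V \<xi>"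
  shows "\<xi>' # \<xi>s \<in> dual_nerve V p"
proof -
  have "dual_src V ((\<xi>' # \<xi>s) ! i) = dual_tgt V ((\<xi>' # \<xi>s) ! Suc i)" if "Suc i < nat p" for i
  proof -
    have "dual_src V ((\<xi> # \<xi>s) ! i) = dual_tgt V ((\<xi> # \<xi>s) ! Suc i)"
      using assms(1) that by (simp add: dual_nerve_def)
    then show ?thesis
      using assms(3) by (cases i) auto
  qed
  then show ?thesis
    using assms(1,2) by (simp add: dual_nerve_def)
qed

subsection \<open>Lifting chains to the dual\<close>

text \<open>The minus sign is the one in the dual source, which the dual target of this functional
  has to match.\<close>

definition next_lift :: "'g \<Rightarrow> 'g \<times> ('c \<Rightarrow> real) \<Rightarrow> 'g \<times> ('c \<Rightarrow> real)" where
  "next_lift g \<xi> = (g, \<lambda>\<gamma>\<in>vfib Q g. - snd \<xi> (right_core (fst \<xi>) (core_part g \<gamma>)))"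

lemma core_part_mul_zero:
  assumes g: "g \<in> points (arrows G)" and c: "c \<in> vfib C (tgt G g)"
  shows "core_part g (mul \<Gamma> c (z g)) = c"
  using combine_fibre(3)[OF g real_vsD(1)[OF E_vs[OF G_points(1)[OF g]]] c] lift_zero[OF g]
    real_vsD(6)[OF Q_vs[OF g] core_mul_zero(1)[OF g c]] by (simp add: combine_def)

lemma next_lift:
  assumes g: "g \<in> points (arrows G)" and \<xi>: "\<xi> \<in> points D" and st: "src G (fst \<xi>) = tgt G g"
  shows "next_lift g \<xi> \<in> points D" "dual_tgt V (next_lift g \<xi>) = dual_src V \<xi>"
proof -
  have k: "fst \<xi> \<in> points (arrows G)" and f: "snd \<xi> \<in> dual_fib Q (fst \<xi>)"
    using \<xi> by (auto simp: in_D)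
  note cp = core_part_fibre[OF g, folded st] and R = right_core[OF k]
  have "(\<lambda>\<gamma>\<in>vfib Q g. - snd \<xi> (right_core (fst \<xi>) (core_part g \<gamma>))) \<in> dual_fib Q g"
    unfolding dual_fib_def
    using real_vsD(2,3)[OF Q_vs[OF g]] core_part_linear[OF g] R(4)[OF cp cp] R(5)[OF cp]
      dual_fibD(1)[OF f R(1)[OF cp] R(1)[OF cp]] dual_fibD(2)[OF f R(1)[OF cp]] by simp
  then show "next_lift g \<xi> \<in> points D"
    using g by (simp add: in_D next_lift_def)
  show "dual_tgt V (next_lift g \<xi>) = dual_src V \<xi>"
    using core_part_mul_zero[OF g] core_mul_zero(1)[OF g]
    by (auto simp: dual_tgt_eq dual_src_eq st next_lift_def intro!: restrict_ext)
qed

text \<open>The value on a frame vector is minus the pairing of \<open>F a\<close> with a vector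
  obtained by applying \<open>core_part\<close> and then \<open>right_core\<close>; both preserve
  smoothness, and so does the pairing.\<close>

lemma smooth_next_lift:
  assumes M: "charted M" and g: "smooth_on M A (arrows G) g" and F: "smooth_on M A D F"
    and st: "\<And>a. a \<in> A \<Longrightarrow> src G (fst (F a)) = tgt G (g a)"
  shows "smooth_on M A D (\<lambda>a. next_lift (g a) (F a))"
proof (rule smooth_into_dual[OF Q_bundle M])
  have gp: "g a \<in> points (arrows G)" and Fp: "F a \<in> points D" if "a \<in> A" for a
    using smooth_on_image[OF g that] smooth_on_image[OF F that] by auto
  show "smooth_on M A (vbase Q) (\<lambda>a. fst (next_lift (g a) (F a)))"
    using g by (simp add: next_lift_def)
  show "snd (next_lift (g a) (F a)) \<in> dual_fib Q (fst (next_lift (g a) (F a)))" if "a \<in> A" for a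
    using next_lift(1)[OF gp Fp st] that by (simp add: in_D)
  fix U \<Psi> i assume T: "local_trivialization Q U \<Psi>" and i: "i < vrank Q"
  let ?A = "{a \<in> A. fst (next_lift (g a) (F a)) \<in> U}"
  have A: "a \<in> A" "g a \<in> U" if "a \<in> ?A" for a
    using that by (auto simp: next_lift_def)
  have gA: "smooth_on M ?A (arrows G) g" and FA: "smooth_on M ?A D F"
    by (auto intro: smooth_on_subset[OF g] smooth_on_subset[OF F])
  have base: "smooth_on M ?A (arrows G) (\<lambda>a. fst (F a))"
    using smooth_on_dual_base[OF Q_bundle M FA] by simp
  have fr: "smooth_on M ?A (arrows \<Gamma>) (\<lambda>a. frame Q \<Psi> i (g a))"
    using smooth_on_frame[OF Q_bundle T M, where A = ?A and x = g and i = i] A(2) i gA by simp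
  note frm = frame_in_fibre[OF Q_bundle T A(2) i]
  have cp: "core_part (g a) (frame Q \<Psi> i (g a)) \<in> vfib C (src G (fst (F a)))" if "a \<in> ?A" for a
    using core_part_fibre[OF gp[OF A(1)[OF that]] frm[OF that]] st[OF A(1)[OF that]] by simp
  have rc: "smooth_on M ?A (arrows \<Gamma>) (\<lambda>a. right_core (fst (F a)) (core_part (g a) (frame Q \<Psi> i (g a))))"
    by (rule smooth_right_core[OF M base smooth_core_part[OF M gA fr frm] cp])
  have "smooth_on M ?A real_line (\<lambda>a. snd (F a) (right_core (fst (F a)) (core_part (g a) (frame Q \<Psi> i (g a)))))"
  proof (rule smooth_on_pairing[OF Q_bundle M FA])
    show "right_core (fst (F a)) (core_part (g a) (frame Q \<Psi> i (g a))) \<in> vfib Q (fst (F a))" if "a \<in> ?A" for a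
      using right_core(1)[OF _ cp[OF that]] Fp[OF A(1)[OF that]] by (simp add: in_D)
  qed (use rc in simp)
  from smooth_on_minus[OF M this]
  show "smooth_on M ?A real_line (\<lambda>a. snd (next_lift (g a) (F a)) (frame Q \<Psi> i (fst (next_lift (g a) (F a)))))"
  proof (rule smooth_on_cong)
    show "- snd (F a) (right_core (fst (F a)) (core_part (g a) (frame Q \<Psi> i (g a)))) =
        snd (next_lift (g a) (F a)) (frame Q \<Psi> i (fst (next_lift (g a) (F a))))" if "a \<in> ?A" for a
      using frm[OF that] by (simp add: next_lift_def)
  qed
qed

text \<open>Recursion on the position, with the whole chain as a parameter: this permits an
  induction on the position when smoothness in the chain is proved.\<close>

primrec lift_nth :: "'g list \<Rightarrow> 'g \<times> ('c \<Rightarrow> real) \<Rightarrow> nat \<Rightarrow> 'g \<times> ('c \<Rightarrow> real)" where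
  "lift_nth gs \<xi> 0 = \<xi>"
| "lift_nth gs \<xi> (Suc i) = next_lift (gs ! Suc i) (lift_nth gs \<xi> i)"

definition lift_chain :: "'g list \<Rightarrow> 'g \<times> ('c \<Rightarrow> real) \<Rightarrow> ('g \<times> ('c \<Rightarrow> real)) list" where
  "lift_chain gs \<xi> = map (lift_nth gs \<xi>) [0..<length gs]"

lemma lift_nth:
  assumes gs: "gs \<in> chains G n" and \<xi>: "\<xi> \<in> points D" "fst \<xi> = gs ! 0"
  shows "i < n \<Longrightarrow> lift_nth gs \<xi> i \<in> points D \<and> fst (lift_nth gs \<xi> i) = gs ! i"
proof (induction i)
  case (Suc i)
  then have "lift_nth gs \<xi> i \<in> points D" "fst (lift_nth gs \<xi> i) = gs ! i"
    by auto
  then show ?case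
    using next_lift(1)[OF chainsD(3)[OF gs Suc.prems], of "lift_nth gs \<xi> i"] chainsD(4)[OF gs Suc.prems]
    by (simp add: next_lift_def)
qed (use \<xi> in auto)

lemma lift_chain:
  assumes gs: "gs \<in> chains G n" and n: "n > 0" and \<xi>: "\<xi> \<in> points D" "fst \<xi> = hd gs"
  shows "lift_chain gs \<xi> \<in> dual_nerve V (int n)" "map fst (lift_chain gs \<xi>) = gs" "hd (lift_chain gs \<xi>) = \<xi>"
proof -
  note len = chainsD(1)[OF gs]
  have \<xi>0: "fst \<xi> = gs ! 0"
    using \<xi>(2) chains_nonempty[OF gs n] by (simp add: hd_conv_nth)
  note L = lift_nth[OF gs \<xi>(1) \<xi>0]
  have "dual_src V (lift_nth gs \<xi> i) = dual_tgt V (lift_nth gs \<xi> (Suc i))" if "Suc i < n" for i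
    using next_lift(2)[OF chainsD(3)[OF gs that], of "lift_nth gs \<xi> i"] L[of i] that chainsD(4)[OF gs that] by simp
  then show "lift_chain gs \<xi> \<in> dual_nerve V (int n)"
    using n L by (auto simp: dual_nerve_def lift_chain_def len)
  show "map fst (lift_chain gs \<xi>) = gs"
    using L by (auto simp: lift_chain_def len intro!: nth_equalityI)
  show "hd (lift_chain gs \<xi>) = \<xi>"
    using n by (simp add: lift_chain_def len hd_map upt_conv_Cons)
qed

subsection \<open>Linear operations on tuples\<close>

lemma dual_add_D:
  assumes \<xi>: "\<xi> \<in> points D" and \<eta>: "\<eta> \<in> points D" and eq: "fst \<xi> = fst \<eta>"
  shows "dual_add Q \<xi> \<eta> \<in> points D" "fst (dual_add Q \<xi> \<eta>) = fst \<xi>"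
    "\<gamma> \<in> vfib Q (fst \<xi>) \<Longrightarrow> snd (dual_add Q \<xi> \<eta>) \<gamma> = snd \<xi> \<gamma> + snd \<eta> \<gamma>"
    "dual_src V (dual_add Q \<xi> \<eta>) = dual_add C (dual_src V \<xi>) (dual_src V \<eta>)"
    "dual_tgt V (dual_add Q \<xi> \<eta>) = dual_add C (dual_tgt V \<xi>) (dual_tgt V \<eta>)"
proof -
  have g: "fst \<xi> \<in> points (arrows G)" and f: "snd \<xi> \<in> dual_fib Q (fst \<xi>)" "snd \<eta> \<in> dual_fib Q (fst \<xi>)"
    using \<xi> \<eta> eq by (auto simp: in_D)
  show "fst (dual_add Q \<xi> \<eta>) = fst \<xi>"
    by (simp add: dual_add_def)
  show "snd (dual_add Q \<xi> \<eta>) \<gamma> = snd \<xi> \<gamma> + snd \<eta> \<gamma>" if "\<gamma> \<in> vfib Q (fst \<xi>)"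
    using that by (simp add: dual_add_def)
  have "snd (dual_add Q \<xi> \<eta>) \<in> dual_fib Q (fst \<xi>)"
    using real_vsD(2,3)[OF Q_vs[OF g]] dual_fibD(1,2)[OF f(1)] dual_fibD(1,2)[OF f(2)]
    by (simp add: dual_fib_def dual_add_def algebra_simps)
  then show "dual_add Q \<xi> \<eta> \<in> points D"
    using g by (simp add: in_D dual_add_def)
  show "dual_src V (dual_add Q \<xi> \<eta>) = dual_add C (dual_src V \<xi>) (dual_src V \<eta>)"
    using right_core(1)[OF g] eq by (auto simp: dual_src_eq dual_add_def intro!: restrict_ext)
  show "dual_tgt V (dual_add Q \<xi> \<eta>) = dual_add C (dual_tgt V \<xi>) (dual_tgt V \<eta>)"
    using core_mul_zero(1)[OF g] eq by (auto simp: dual_tgt_eq dual_add_def intro!: restrict_ext)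
qed

lemma dual_scale_D:
  assumes \<xi>: "\<xi> \<in> points D"
  shows "dual_scale Q r \<xi> \<in> points D" "fst (dual_scale Q r \<xi>) = fst \<xi>"
    "\<gamma> \<in> vfib Q (fst \<xi>) \<Longrightarrow> snd (dual_scale Q r \<xi>) \<gamma> = r * snd \<xi> \<gamma>"
    "dual_src V (dual_scale Q r \<xi>) = dual_scale C r (dual_src V \<xi>)"
    "dual_tgt V (dual_scale Q r \<xi>) = dual_scale C r (dual_tgt V \<xi>)"
proof -
  have g: "fst \<xi> \<in> points (arrows G)" and f: "snd \<xi> \<in> dual_fib Q (fst \<xi>)"
    using \<xi> by (auto simp: in_D)
  show "fst (dual_scale Q r \<xi>) = fst \<xi>"
    by (simp add: dual_scale_def)
  show "snd (dual_scale Q r \<xi>) \<gamma> = r * snd \<xi> \<gamma>" if "\<gamma> \<in> vfib Q (fst \<xi>)"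
    using that by (simp add: dual_scale_def)
  have "snd (dual_scale Q r \<xi>) \<in> dual_fib Q (fst \<xi>)"
    using real_vsD(2,3)[OF Q_vs[OF g]] dual_fibD(1,2)[OF f]
    by (simp add: dual_fib_def dual_scale_def algebra_simps)
  then show "dual_scale Q r \<xi> \<in> points D"
    using g by (simp add: in_D dual_scale_def)
  show "dual_src V (dual_scale Q r \<xi>) = dual_scale C r (dual_src V \<xi>)"
    using right_core(1)[OF g] by (auto simp: dual_src_eq dual_scale_def intro!: restrict_ext)
  show "dual_tgt V (dual_scale Q r \<xi>) = dual_scale C r (dual_tgt V \<xi>)"
    using core_mul_zero(1)[OF g] by (auto simp: dual_tgt_eq dual_scale_def intro!: restrict_ext)
qed

text \<open>Dual source and target are fibrewise linear, so entrywise sums of composable tuples over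
  the same chain are composable. With \<open>dual_nerve_scale\<close> this gives the linear
  structure on tuples that \<open>linear_cochains\<close> refers to.\<close>

lemma dual_nerve_add:
  assumes \<xi>s: "\<xi>s \<in> dual_nerve V (int n)" and \<eta>s: "\<eta>s \<in> dual_nerve V (int n)" and eq: "map fst \<xi>s = map fst \<eta>s"
  shows "map2 (dual_add Q) \<xi>s \<eta>s \<in> dual_nerve V (int n)" "map fst (map2 (dual_add Q) \<xi>s \<eta>s) = map fst \<xi>s"
    "hd (map2 (dual_add Q) \<xi>s \<eta>s) = dual_add Q (hd \<xi>s) (hd \<eta>s)"
proof -
  note x = dual_nerveD[OF \<xi>s] and y = dual_nerveD[OF \<eta>s]
  have nth: "map2 (dual_add Q) \<xi>s \<eta>s ! i = dual_add Q (\<xi>s ! i) (\<eta>s ! i)" if "i < n" for i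
    using that x(2) y(2) by simp
  have fsts: "fst (\<xi>s ! i) = fst (\<eta>s ! i)" if "i < n" for i
    using arg_cong[OF eq, of "\<lambda>l. l ! i"] that x(2) y(2) by simp
  note A = dual_add_D[OF x(3) y(3) fsts]
  show "map2 (dual_add Q) \<xi>s \<eta>s \<in> dual_nerve V (int n)"
    using x(1,2,6) y(2,6) A(1,4,5) nth by (intro dual_nerveI) simp_all
  show "map fst (map2 (dual_add Q) \<xi>s \<eta>s) = map fst \<xi>s"
    using x(2) y(2) by (auto simp: dual_add_def intro!: nth_equalityI)
  show "hd (map2 (dual_add Q) \<xi>s \<eta>s) = dual_add Q (hd \<xi>s) (hd \<eta>s)"
    using x(4) y(4) by (cases \<xi>s; cases \<eta>s) auto
qed

lemma dual_nerve_scale: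
  assumes \<xi>s: "\<xi>s \<in> dual_nerve V (int n)"
  shows "map (dual_scale Q r) \<xi>s \<in> dual_nerve V (int n)" "map fst (map (dual_scale Q r) \<xi>s) = map fst \<xi>s"
    "hd (map (dual_scale Q r) \<xi>s) = dual_scale Q r (hd \<xi>s)"
proof -
  note x = dual_nerveD[OF \<xi>s]
  note A = dual_scale_D[OF x(3)]
  show "map (dual_scale Q r) \<xi>s \<in> dual_nerve V (int n)"
    using x(1,2,6) A(1,4,5) by (intro dual_nerveI) simp_all
  show "map fst (map (dual_scale Q r) \<xi>s) = map fst \<xi>s"
    by (simp add: dual_scale_def)
  show "hd (map (dual_scale Q r) \<xi>s) = dual_scale Q r (hd \<xi>s)"
    using x(4) by (simp add: hd_map)
qed

lemma linear_cochainsD: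
  assumes "\<phi> \<in> linear_cochains V p"
  shows "\<phi> \<in> extensional (dual_nerve V p)"
    "smooth_on (power_manifold D (nat p)) (dual_nerve V p) real_line \<phi>"
    "\<xi>s \<in> dual_nerve V p \<Longrightarrow> \<eta>s \<in> dual_nerve V p \<Longrightarrow> map fst \<xi>s = map fst \<eta>s \<Longrightarrow>
       \<phi> (map2 (dual_add Q) \<xi>s \<eta>s) = \<phi> \<xi>s + \<phi> \<eta>s"
    "\<xi>s \<in> dual_nerve V p \<Longrightarrow> \<phi> (map (dual_scale Q r) \<xi>s) = r * \<phi> \<xi>s"
  using assms unfolding linear_cochains_def by blast+

lemma left_projectableD:
  assumes "left_projectable V p \<phi>" "g \<in> points (arrows G)"
  shows "dual_zero Q g # \<xi>s \<in> dual_nerve V p \<Longrightarrow> \<phi> (dual_zero Q g # \<xi>s) = 0"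
    "\<xi> # \<xi>s \<in> dual_nerve V p \<Longrightarrow> dual_tgt V \<xi> = dual_zero C (src G g) \<Longrightarrow>
      \<phi> (dual_mul V (dual_zero Q g) \<xi> # \<xi>s) = \<phi> (\<xi> # \<xi>s)"
  using assms unfolding left_projectable_def by blast+

subsection \<open>The map \<open>\<phi> \<mapsto> \<phi>\<close>-hat\<close>

context
  fixes n \<phi>
  assumes n: "n > 0" and lin: "\<phi> \<in> linear_cochains V (int n)" and proj: "left_projectable V (int n) \<phi>"
begin

lemma cochain_head:
  assumes \<xi>s: "\<xi>s \<in> dual_nerve V (int n)" and \<eta>s: "\<eta>s \<in> dual_nerve V (int n)"
    and eq: "map fst \<xi>s = map fst \<eta>s" "hd \<xi>s = hd \<eta>s"
  shows "\<phi> \<xi>s = \<phi> \<eta>s"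
proof -
  note s = dual_nerve_scale[OF \<eta>s, of "-1"]
  let ?\<zeta>s = "map2 (dual_add Q) \<xi>s (map (dual_scale Q (-1)) \<eta>s)"
  have eq': "map fst \<xi>s = map fst (map (dual_scale Q (-1)) \<eta>s)"
    using eq(1) s(2) by simp
  note a = dual_nerve_add[OF \<xi>s s(1) eq']
  have "hd ?\<zeta>s = dual_zero Q (fst (hd \<xi>s))"
    unfolding a(3) s(3) eq(2)[symmetric] by (auto simp: dual_add_def dual_scale_def dual_zero_def intro!: restrict_ext)
  then have "dual_zero Q (fst (hd \<xi>s)) # tl ?\<zeta>s = ?\<zeta>s"
    using dual_nerveD(4)[OF a(1)] by (metis list.collapse)
  moreover have "fst (hd \<xi>s) \<in> points (arrows G)"
    using dual_nerveD(5)[OF \<xi>s] by (simp add: in_D)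
  ultimately have "\<phi> ?\<zeta>s = 0"
    using left_projectableD(1)[OF proj, of "fst (hd \<xi>s)" "tl ?\<zeta>s"] a(1) by simp
  then show ?thesis
    using linear_cochainsD(3)[OF lin \<xi>s s(1) eq'] linear_cochainsD(4)[OF lin \<eta>s, of "-1"] by simp
qed

text \<open>Over a fixed chain \<phi> is a linear functional of the first entry, that is, an element
  of the double dual of a finite-dimensional fibre. It is evaluation at the vector whose coordinates
  are its values on the dual frame.\<close>

lemma hat_exists:
  assumes gs: "gs \<in> chains G n"
  shows "\<exists>\<gamma>\<in>vfib Q (hd gs). \<forall>\<xi>s \<in> dual_nerve V (int n). map fst \<xi>s = gs \<longrightarrow> snd (hd \<xi>s) \<gamma> = \<phi> \<xi>s"
proof -
  let ?g = "hd gs"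
  have g: "?g \<in> points (arrows G)"
    by (rule hd_in_arrows[OF gs n])
  obtain U \<Psi> where U: "?g \<in> U" "local_trivialization Q U \<Psi>"
    using vector_bundleD(6)[OF Q_bundle, of ?g] g by auto
  let ?k = "vrank Q"
  define \<epsilon> where "\<epsilon> = (\<lambda>i. (?g, \<lambda>v\<in>vfib Q ?g. \<Psi> v i))"
  have \<epsilon>: "\<epsilon> i \<in> points D" "fst (\<epsilon> i) = ?g" for i
    using g dual_coframe[OF Q_bundle U(2,1)] by (auto simp: \<epsilon>_def in_D)
  \<comment> \<open>\<phi> as a function of the first entry alone; by \<open>cochain_head\<close>
    the continuation chosen by \<open>lift_chain\<close> does not matter.\<close>
  define L where "L = (\<lambda>\<xi>. \<phi> (lift_chain gs \<xi>))"
  have L: "L (hd \<xi>s) = \<phi> \<xi>s" if "\<xi>s \<in> dual_nerve V (int n)" "map fst \<xi>s = gs" for \<xi>s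
  proof -
    have "fst (hd \<xi>s) = hd gs" "hd \<xi>s \<in> points D"
      using dual_nerve_base(2)[OF that(1)] that(2) dual_nerveD(5)[OF that(1)] by auto
    note l = lift_chain[OF gs n this(2,1)]
    show ?thesis
      unfolding L_def by (rule cochain_head[OF l(1) that(1)]) (simp_all add: l that)
  qed
  have L_add: "L (dual_add Q \<xi> \<eta>) = L \<xi> + L \<eta>" if "\<xi> \<in> points D" "fst \<xi> = ?g" "\<eta> \<in> points D" "fst \<eta> = ?g" for \<xi> \<eta>
  proof -
    note l = lift_chain[OF gs n that(1,2)] and m = lift_chain[OF gs n that(3,4)]
    have eq: "map fst (lift_chain gs \<xi>) = map fst (lift_chain gs \<eta>)"
      using l(2) m(2) by simp
    note a = dual_nerve_add[OF l(1) m(1) eq]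
    show ?thesis
      using L[OF a(1)] a(2,3) l(2,3) m(3) linear_cochainsD(3)[OF lin l(1) m(1) eq] by (simp add: L_def)
  qed
  have L_scale: "L (dual_scale Q r \<xi>) = r * L \<xi>" if "\<xi> \<in> points D" "fst \<xi> = ?g" for r \<xi>
  proof -
    note l = lift_chain[OF gs n that]
    note a = dual_nerve_scale[OF l(1), of r]
    show ?thesis
      using L[OF a(1)] a(2,3) l(2,3) linear_cochainsD(4)[OF lin l(1), of r] by (simp add: L_def)
  qed
  define \<gamma> where "\<gamma> = inv_into (vfib Q ?g) \<Psi> (\<lambda>i. if i < ?k then L (\<epsilon> i) else 0)"
  have E\<gamma>: "(\<lambda>i. if i < ?k then L (\<epsilon> i) else 0) \<in> topspace (Euclidean_space ?k)"
    by (auto simp: topspace_Euclidean_space)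
  have \<gamma>: "\<gamma> \<in> vfib Q ?g" "\<And>i. i < ?k \<Longrightarrow> \<Psi> \<gamma> i = L (\<epsilon> i)"
    using trivialization_inverse(1,2)[OF Q_bundle U(2,1) E\<gamma>] by (auto simp: \<gamma>_def)
  have "snd \<xi> \<gamma> = L \<xi>" if \<xi>: "\<xi> \<in> points D" "fst \<xi> = ?g" for \<xi>
  proof -
    have f: "snd \<xi> \<in> dual_fib Q ?g"
      using \<xi> by (simp add: in_D)
    define a where "a = (\<lambda>i. snd \<xi> (frame Q \<Psi> i ?g))"
    \<comment> \<open>Partial sums of the expansion of \<xi> in the dual frame, built as elements of
      the dual so that additivity and homogeneity of \<open>L\<close> apply step by step.\<close>
    define \<sigma> where "\<sigma> = (\<lambda>m. (?g, \<lambda>v\<in>vfib Q ?g. \<Sum>i<m. a i * \<Psi> v i))"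
    have expand: "snd \<xi> v = (\<Sum>i<?k. a i * \<Psi> v i)" if "v \<in> vfib Q ?g" for v
      using linear_functional_frame[OF Q_bundle U(2,1) that, of "snd \<xi>"] dual_fibD(1,2)[OF f] by (simp add: a_def mult.commute)
    have \<sigma>: "\<sigma> m \<in> points D \<and> L (\<sigma> m) = (\<Sum>i<m. a i * L (\<epsilon> i))" for m
    proof (induction m)
      case 0
      \<comment> \<open>The zero functional as a multiple of the 0-th coordinate functional, which
        is an element of the dual fibre also when the rank is 0.\<close>
      have eq: "\<sigma> 0 = dual_scale Q 0 (\<epsilon> 0)"
        by (auto simp: \<sigma>_def dual_scale_def \<epsilon>_def intro!: restrict_ext)
      show ?case
        unfolding eq using dual_scale_D(1)[OF \<epsilon>(1)] L_scale[OF \<epsilon>] by simp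
    next
      case (Suc m)
      have eq: "\<sigma> (Suc m) = dual_add Q (\<sigma> m) (dual_scale Q (a m) (\<epsilon> m))"
        by (auto simp: \<sigma>_def dual_add_def dual_scale_def \<epsilon>_def intro!: restrict_ext)
      have \<sigma>m: "\<sigma> m \<in> points D" "fst (\<sigma> m) = ?g"
        using Suc.IH by (auto simp: \<sigma>_def)
      note s = dual_scale_D(1,2)[OF \<epsilon>(1)[of m], of "a m"]
      show ?case
        unfolding eq using dual_add_D(1)[OF \<sigma>m(1) s(1)] L_add[OF \<sigma>m s(1)] s(2) \<epsilon>(2) \<sigma>m(2) L_scale[OF \<epsilon>, of "a m" m] Suc.IH
        by simp
    qed
    have "\<xi> = \<sigma> ?k"
    proof (rule prod_eqI)
      show "snd \<xi> = snd (\<sigma> ?k)"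
        using dual_fibD(3)[OF f] expand by (auto simp: \<sigma>_def fun_eq_iff extensional_def restrict_def)
    qed (simp add: \<xi> \<sigma>_def)
    then have "L \<xi> = (\<Sum>i<?k. a i * \<Psi> \<gamma> i)"
      using \<sigma>[of ?k] \<gamma>(2) by simp
    then show ?thesis
      using expand[OF \<gamma>(1)] by simp
  qed
  then show ?thesis
    using \<gamma>(1) L dual_nerve_base(2) dual_nerveD(5) by (intro bexI[of _ \<gamma>]) auto
qed

end

lemma smooth_hd:
  assumes n: "n > 0"
  shows "smooth_on (power_manifold (arrows G) n) (chains G n) (arrows G) hd"
  using smooth_on_chain_nth[OF G_groupoid n]
  by (rule smooth_on_cong) (simp add: hd_conv_nth chains_nonempty[OF _ n])

text \<open>By \<open>lift_chain\<close> every functional over the first arrow starts some tuple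
  over \<open>gs\<close>, so the defining condition prescribes all its values on the vector, and
  functionals separate vectors.\<close>

lemma hat_eqI:
  assumes n: "n > 0" and gs: "gs \<in> chains G n" and \<gamma>: "\<gamma> \<in> vfib Q (hd gs)"
    and eq: "\<And>\<xi>s. \<xi>s \<in> dual_nerve V (int n) \<Longrightarrow> map fst \<xi>s = gs \<Longrightarrow> snd (hd \<xi>s) \<gamma> = \<phi> \<xi>s"
  shows "hat V (int n) \<phi> gs = \<gamma>"
  unfolding hat_def
proof (rule the_equality)
  fix \<delta> assume \<delta>: "\<delta> \<in> vfib Q (hd gs) \<and> (\<forall>\<xi>s \<in> dual_nerve V (int n). map fst \<xi>s = gs \<longrightarrow> snd (hd \<xi>s) \<delta> = \<phi> \<xi>s)"
  have g: "hd gs \<in> points (arrows G)"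
    by (rule hd_in_arrows[OF gs n])
  show "\<delta> = \<gamma>"
  proof (rule dual_separates[OF Q_bundle, of "hd gs"])
    fix \<xi> assume "\<xi> \<in> dual_fib Q (hd gs)"
    then have "(hd gs, \<xi>) \<in> points D"
      using g by (simp add: in_D)
    note l = lift_chain[OF gs n this]
    show "\<xi> \<delta> = \<xi> \<gamma>"
      using \<delta> eq[OF l(1)] l by auto
  qed (use g \<delta> \<gamma> in auto)
qed (use \<gamma> eq in auto)

context
  fixes n \<phi>
  assumes n: "n > 0" and lin: "\<phi> \<in> linear_cochains V (int n)" and proj: "left_projectable V (int n) \<phi>"
begin

lemma hat:
  assumes gs: "gs \<in> chains G n"
  shows "hat V (int n) \<phi> gs \<in> vfib Q (hd gs)"
    "\<xi>s \<in> dual_nerve V (int n) \<Longrightarrow> map fst \<xi>s = gs \<Longrightarrow> snd (hd \<xi>s) (hat V (int n) \<phi> gs) = \<phi> \<xi>s"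
proof -
  obtain \<gamma> where \<gamma>: "\<gamma> \<in> vfib Q (hd gs)" "\<And>\<xi>s. \<xi>s \<in> dual_nerve V (int n) \<Longrightarrow> map fst \<xi>s = gs \<Longrightarrow> snd (hd \<xi>s) \<gamma> = \<phi> \<xi>s"
    using hat_exists[OF n lin proj gs] by blast
  have "hat V (int n) \<phi> gs = \<gamma>"
    by (rule hat_eqI[OF n gs \<gamma>])
  then show "hat V (int n) \<phi> gs \<in> vfib Q (hd gs)"
    "\<xi>s \<in> dual_nerve V (int n) \<Longrightarrow> map fst \<xi>s = gs \<Longrightarrow> snd (hd \<xi>s) (hat V (int n) \<phi> gs) = \<phi> \<xi>s"
    using \<gamma> by simp_all
qed

lemma smooth_hat: "smooth_on (power_manifold (arrows G) n) (chains G n) (arrows \<Gamma>) (hat V (int n) \<phi>)"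
proof -
  let ?M = "power_manifold (arrows G) n"
  note M = charted_chains[OF G_groupoid, of n]
  have "smooth_on ?M (chains G n) (vtotal Q) (hat V (int n) \<phi>)"
  proof (rule smooth_into_bundle[OF Q_bundle M])
    show "smooth_on ?M (chains G n) (vbase Q) hd"
      using smooth_hd[OF n] by simp
    show "hat V (int n) \<phi> gs \<in> vfib Q (hd gs)" if "gs \<in> chains G n" for gs
      by (rule hat(1)[OF that])
    fix U \<Psi> i assume T: "local_trivialization Q U \<Psi>" and i: "i < vrank Q"
    let ?A = "{gs \<in> chains G n. hd gs \<in> U}"
    let ?\<epsilon> = "\<lambda>gs. (hd gs, \<lambda>v\<in>vfib Q (hd gs). \<Psi> v i)"
    have A: "?A \<subseteq> points ?M"
      using chains_power by blast
    have \<epsilon>: "?\<epsilon> gs \<in> points D" if "gs \<in> ?A" for gs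
      using that hd_in_arrows[OF _ n] dual_coframe[OF Q_bundle T] by (auto simp: in_D)
    have \<epsilon>0: "fst (?\<epsilon> gs) = gs ! 0" if "gs \<in> ?A" for gs
      using that chains_nonempty[of gs G n] n by (simp add: hd_conv_nth)
    have nth: "smooth_on ?M ?A D (\<lambda>gs. lift_nth gs (?\<epsilon> gs) j)" if "j < n" for j
      using that
    proof (induction j)
      case 0
      have "smooth_on ?M ?A (vbase Q) hd"
        unfolding carriers by (rule smooth_on_subset[OF smooth_hd[OF n]]) auto
      then have "smooth_on ?M ?A D ?\<epsilon>"
        by (rule smooth_on_coframe[OF Q_bundle T M _ _ i]) simp
      then show ?case
        by (simp only: lift_nth.simps)
    next
      case (Suc j)
      have "smooth_on ?M ?A (arrows G) (\<lambda>gs. gs ! Suc j)"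
        by (rule smooth_on_subset[OF smooth_on_chain_nth[OF G_groupoid Suc.prems]]) auto
      moreover have "smooth_on ?M ?A D (\<lambda>gs. lift_nth gs (?\<epsilon> gs) j)"
        by (rule Suc.IH[OF Suc_lessD[OF Suc.prems]])
      moreover have "src G (fst (lift_nth gs (?\<epsilon> gs) j)) = tgt G (gs ! Suc j)" if gs: "gs \<in> ?A" for gs
        using lift_nth[OF _ \<epsilon>[OF gs] \<epsilon>0[OF gs], of n j] chainsD(4)[of gs G n j] Suc.prems gs by simp
      ultimately have "smooth_on ?M ?A D (\<lambda>gs. next_lift (gs ! Suc j) (lift_nth gs (?\<epsilon> gs) j))"
        by (rule smooth_next_lift[OF M])
      then show ?case
        by (simp only: lift_nth.simps)
    qed
    have list: "smooth_on ?M ?A (power_manifold D n) (\<lambda>gs. lift_chain gs (?\<epsilon> gs))"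
    proof (rule smooth_on_list[OF M A])
      show "smooth_on ?M ?A D (\<lambda>gs. lift_chain gs (?\<epsilon> gs) ! j)" if "j < n" for j
        by (rule smooth_on_cong[OF nth[OF that]]) (auto simp: lift_chain_def chainsD(1) that)
      show "length (lift_chain gs (?\<epsilon> gs)) = n" if "gs \<in> ?A" for gs
        using that chainsD(1)[of gs G n] by (simp add: lift_chain_def)
    qed
    have smooth_\<phi>: "smooth_on (power_manifold D n) (dual_nerve V (int n)) real_line \<phi>"
      using linear_cochainsD(2)[OF lin] by simp
    have l: "lift_chain gs (?\<epsilon> gs) \<in> dual_nerve V (int n)" "map fst (lift_chain gs (?\<epsilon> gs)) = gs"
      "hd (lift_chain gs (?\<epsilon> gs)) = ?\<epsilon> gs" if "gs \<in> ?A" for gs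
      using lift_chain[OF _ n \<epsilon>[OF that]] that by auto
    have "smooth_on ?M ?A real_line (\<lambda>gs. \<phi> (lift_chain gs (?\<epsilon> gs)))"
      by (rule smooth_on_compose[OF charted_power[OF charted_dual[OF Q_bundle]] list smooth_\<phi> l(1)])
    then show "smooth_on ?M ?A real_line (\<lambda>gs. \<Psi> (hat V (int n) \<phi> gs) i)"
    proof (rule smooth_on_cong)
      \<comment> \<open>Pairing with the i-th coordinate functional returns the i-th fibre
        coordinate, so this coordinate of \<phi>-hat is \<phi> along a smooth family of
        tuples.\<close>
      show "\<phi> (lift_chain gs (?\<epsilon> gs)) = \<Psi> (hat V (int n) \<phi> gs) i" if "gs \<in> ?A" for gs
        using hat(2)[OF _ l(1,2)[OF that]] l(3)[OF that] hat(1)[of gs] that by simp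
    qed
  qed
  then show ?thesis
    by simp
qed

text \<open>
  Left projectability applied to the pullback of a functional on \<open>E\<close> along the source map: such a
  pullback is unaffected by left multiplication with \<open>0\<close>.
\<close>

lemma src_hat:
  assumes gs: "g # gs \<in> chains G n"
  shows "src \<Gamma> (hat V (int n) \<phi> (g # gs)) = src \<Gamma> (hat V (int n) \<phi> (unit G (src G g) # gs))"
    and "unit G (src G g) # gs \<in> chains G n"
proof -
  define x where "x = src G g"
  have g: "g \<in> points (arrows G)"
    using chainsD(2)[OF gs] by simp
  then have x: "x \<in> points (objects G)"
    by (simp add: x_def G_points)
  note u = G_points(3)[OF x]
  have "src G ((unit G x # gs) ! i) = tgt G ((unit G x # gs) ! Suc i)" if "Suc i < n" for i
    using chainsD(4)[OF gs that] x by (cases i) (auto simp: x_def)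
  then have us: "unit G x # gs \<in> chains G n"
    using chainsD(1,2)[OF gs] u by (simp add: chains_def)
  then show "unit G (src G g) # gs \<in> chains G n"
    by (simp add: x_def)
  have hg: "hat V (int n) \<phi> (g # gs) \<in> vfib Q g" and hu: "hat V (int n) \<phi> (unit G x # gs) \<in> vfib Q (unit G x)"
    using hat(1)[OF gs] hat(1)[OF us] by auto
  have "src \<Gamma> (hat V (int n) \<phi> (g # gs)) = src \<Gamma> (hat V (int n) \<phi> (unit G x # gs))"
  proof (rule dual_separates[OF E_bundle, of x])
    show "src \<Gamma> (hat V (int n) \<phi> (g # gs)) \<in> vfib E x" "src \<Gamma> (hat V (int n) \<phi> (unit G x # gs)) \<in> vfib E x"
      using src_tgt_fibre(1)[OF g hg] src_tgt_fibre(1)[OF u hu] x by (simp_all add: x_def)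
    fix \<eta> assume \<eta>: "\<eta> \<in> dual_fib E x"
    \<comment> \<open>The pullback of \<eta> is taken over the unit at \<open>x\<close>, so that
      multiplication by the zero over \<open>g\<close> moves the first base arrow from the unit to
      \<open>g\<close>. Its dual target is zero because core elements have zero source.\<close>
    define \<xi> where "\<xi> = (unit G x, \<lambda>\<gamma>\<in>vfib Q (unit G x). \<eta> (src \<Gamma> \<gamma>))"
    have s: "src \<Gamma> \<gamma> \<in> vfib E x" if "\<gamma> \<in> vfib Q (unit G x)" for \<gamma>
      using src_tgt_fibre(1)[OF u that] x by simp
    have "(\<lambda>\<gamma>\<in>vfib Q (unit G x). \<eta> (src \<Gamma> \<gamma>)) \<in> dual_fib Q (unit G x)"
      unfolding dual_fib_def
      using real_vsD(2,3)[OF Q_vs[OF u]] src_tgt_linear(1,3)[OF u] dual_fibD(1)[OF \<eta> s s] dual_fibD(2)[OF \<eta> s] by simp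
    then have \<xi>: "\<xi> \<in> points D" "fst \<xi> = hd (unit G x # gs)"
      using u by (simp_all add: in_D \<xi>_def)
    note l = lift_chain[OF us n \<xi>]
    have \<eta>0: "\<eta> (vzero E x) = 0"
      using dual_fibD(2)[OF \<eta> real_vsD(1)[OF E_vs[OF x]], of 0] real_vs_scale_zero[OF E_vs[OF x]] by simp
    have t: "dual_tgt V \<xi> = dual_zero C (src G g)"
      using core_mul_zero(1,2)[OF u] x \<eta>0
      by (auto simp: dual_tgt_eq dual_zero_def \<xi>_def x_def[symmetric] intro!: restrict_ext)
    obtain \<xi>s where \<xi>s: "lift_chain (unit G x # gs) \<xi> = \<xi> # \<xi>s"
      using l(3) dual_nerveD(4)[OF l(1)] by (metis list.collapse)
    note m = dual_mul_zero[OF g \<xi>(1) t]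
    have gu: "mul G g (unit G x) = g"
      using G_laws(2)[OF g] by (simp add: x_def)
    let ?\<zeta> = "dual_mul V (dual_zero Q g) \<xi>"
    have \<zeta>: "fst ?\<zeta> = g" "snd ?\<zeta> (hat V (int n) \<phi> (g # gs)) = \<eta> (src \<Gamma> (hat V (int n) \<phi> (g # gs)))"
    proof -
      show "fst ?\<zeta> = g"
        unfolding m(1) using gu by (simp add: \<xi>_def left_zero_def)
      have e: "src \<Gamma> (hat V (int n) \<phi> (g # gs)) \<in> vfib E (src G (unit G x))"
        using src_tgt_fibre(1)[OF g hg] x by (simp add: x_def)
      show "snd ?\<zeta> (hat V (int n) \<phi> (g # gs)) = \<eta> (src \<Gamma> (hat V (int n) \<phi> (g # gs)))"
        unfolding m(1) using hg gu lift_fibre(1,2)[OF u e] by (simp add: \<xi>_def left_zero_def)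
    qed
    have \<zeta>s: "?\<zeta> # \<xi>s \<in> dual_nerve V (int n)"
      unfolding m(1) by (rule dual_nerve_Cons_cong[OF l(1)[unfolded \<xi>s] m(2,3)])
    moreover have "map fst (?\<zeta> # \<xi>s) = g # gs"
      using l(2) \<zeta>(1) unfolding \<xi>s by simp
    ultimately have "\<eta> (src \<Gamma> (hat V (int n) \<phi> (g # gs))) = \<phi> (?\<zeta> # \<xi>s)"
      using hat(2)[OF gs] \<zeta>(2) by fastforce
    also have "\<dots> = \<phi> (\<xi> # \<xi>s)"
      by (rule left_projectableD(2)[OF proj g l(1)[unfolded \<xi>s] t])
    also have "\<dots> = snd \<xi> (hat V (int n) \<phi> (unit G x # gs))"
      using hat(2)[OF us l(1,2)] unfolding \<xi>s by simp
    also have "\<dots> = \<eta> (src \<Gamma> (hat V (int n) \<phi> (unit G x # gs)))"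
      using hu by (simp add: \<xi>_def)
    finally show "\<eta> (src \<Gamma> (hat V (int n) \<phi> (g # gs))) = \<eta> (src \<Gamma> (hat V (int n) \<phi> (unit G x # gs)))" .
  qed (use x in simp)
  then show "src \<Gamma> (hat V (int n) \<phi> (g # gs)) = src \<Gamma> (hat V (int n) \<phi> (unit G (src G g) # gs))"
    by (simp add: x_def)
qed

end

end

section \<open>The isomorphism\<close>

lemma real_vs_transfer:
  assumes V: "real_vs S add scl z" and S': "\<Xi> ` S = S'"
    and add: "\<And>v w. v \<in> S \<Longrightarrow> w \<in> S \<Longrightarrow> add' (\<Xi> v) (\<Xi> w) = \<Xi> (add v w)"
    and scl: "\<And>r v. v \<in> S \<Longrightarrow> scl' r (\<Xi> v) = \<Xi> (scl r v)"
  shows "real_vs S' add' scl' (\<Xi> z)"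
proof -
  note v = real_vsD[OF V]
  show ?thesis
    unfolding real_vs_def S'[symmetric] ball_simps bex_simps
  proof (intro conjI ballI allI)
    fix a assume a: "a \<in> S"
    obtain b where "b \<in> S" "add a b = z"
      using v(7)[OF a] by blast
    then show "\<exists>b\<in>S. add' (\<Xi> a) (\<Xi> b) = \<Xi> z"
      using add[OF a] by auto
    show "add' (\<Xi> a) (\<Xi> b) = add' (\<Xi> b) (\<Xi> a)" if "b \<in> S" for b
      using add a that v(5)[OF a that] by simp
    show "add' (add' (\<Xi> a) (\<Xi> b)) (\<Xi> c) = add' (\<Xi> a) (add' (\<Xi> b) (\<Xi> c))" if "b \<in> S" "c \<in> S" for b c
      using add a that v(2) v(4)[OF a that] by simp
  qed (simp_all add: add scl v(1-3,6,8-11))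
qed

text \<open>The axioms are transported from \<open>N\<close> along the inverse \<open>\<Xi>\<close>, so \<open>M\<close> need not be known to be a module.\<close>

lemma graded_right_module_iso_inverse:
  assumes N: "graded_right_module R N"
    and surj: "\<And>p. \<Xi> p ` hcomp N p = hcomp M p"
    and inv: "\<And>p y. y \<in> hcomp N p \<Longrightarrow> \<Theta> p (\<Xi> p y) = y"
    and add: "\<And>p x y. x \<in> hcomp N p \<Longrightarrow> y \<in> hcomp N p \<Longrightarrow> gadd M p (\<Xi> p x) (\<Xi> p y) = \<Xi> p (gadd N p x y)"
    and scale: "\<And>p r y. y \<in> hcomp N p \<Longrightarrow> gscale M p r (\<Xi> p y) = \<Xi> p (gscale N p r y)"
    and act: "\<And>p q y a. y \<in> hcomp N p \<Longrightarrow> a \<in> hcomp R q \<Longrightarrow> gact M p q (\<Xi> p y) a = \<Xi> (p + q) (gact N p q y a)"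
  shows "graded_right_module_iso R M N \<Theta>"
proof -
  note m = graded_right_moduleD[OF N]
  have N_vs: "gadd N p x y \<in> hcomp N p" "gscale N p r x \<in> hcomp N p"
    if "x \<in> hcomp N p" "y \<in> hcomp N p" for p r x y
    using m(2)[of p] real_vsD(2,3) that by metis+
  have mem: "\<exists>y\<in>hcomp N p. x = \<Xi> p y" if "x \<in> hcomp M p" for x p
    using surj[of p] that by blast
  have \<Xi>: "\<Xi> p y \<in> hcomp M p" if "y \<in> hcomp N p" for y p
    using surj[of p] that by blast
  have M: "graded_right_module R M"
  proof (rule graded_right_moduleI)
    show "graded_algebra R"
      by (rule m(1))
    show "\<exists>z. real_vs (hcomp M p) (gadd M p) (gscale M p) z" for p
    proof -
      obtain z where "real_vs (hcomp N p) (gadd N p) (gscale N p) z"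
        using m(2) by blast
      from real_vs_transfer[OF this surj] show ?thesis
        using add scale by blast
    qed
  next
    fix p q s x y a b r
    assume "x \<in> hcomp M p" and a: "a \<in> hcomp R q"
    then obtain u where u: "u \<in> hcomp N p" "x = \<Xi> p u"
      using mem by blast
    note ua = m(3)[OF u(1) a]
    show "gact M p q x a \<in> hcomp M (p + q)"
      using act[OF u(1) a] \<Xi>[OF ua] u(2) by simp
    show "gact M p q (gscale M p r x) a = gscale M (p + q) r (gact M p q x a)"
      using m(6)[OF u(1) a, of r] N_vs(2)[OF u(1) u(1)] by (simp add: u scale act a ua)
    have "gscale R q r a \<in> hcomp R q"
      using m(1) a real_vsD(3) unfolding graded_algebra_def is_graded_space_def by metis
    then show "gact M p q x (gscale R q r a) = gscale M (p + q) r (gact M p q x a)"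
      using m(7)[OF u(1) a, of r] by (simp add: u scale act a ua)
    show "gact M p q x (gadd R q a b) = gadd M (p + q) (gact M p q x a) (gact M p q x b)" if b: "b \<in> hcomp R q"
    proof -
      have "gadd R q a b \<in> hcomp R q"
        using m(1) a b real_vsD(2) unfolding graded_algebra_def is_graded_space_def by metis
      then show ?thesis
        using m(5)[OF u(1) a b] m(3)[OF u(1) b] by (simp add: u add act a b ua)
    qed
    show "gact M p q (gadd M p x y) a = gadd M (p + q) (gact M p q x a) (gact M p q y a)" if y: "y \<in> hcomp M p"
    proof -
      obtain w where w: "w \<in> hcomp N p" "y = \<Xi> p w"
        using mem[OF y] by blast
      show ?thesis
        using m(4)[OF u(1) w(1) a] m(3)[OF w(1) a] N_vs(1)[OF u(1) w(1)] by (simp add: u w add act a ua)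
    qed
    show "gact M (p + q) s (gact M p q x a) b = gact M p (q + s) x (gmul R q s a b)" if b: "b \<in> hcomp R s"
    proof -
      have "gmul R q s a b \<in> hcomp R (q + s)"
        using m(1) a b unfolding graded_algebra_def by blast
      then show ?thesis
        using m(8)[OF u(1) a b] by (simp add: u act a b ua add.assoc)
    qed
  next
    fix p x assume "x \<in> hcomp M p"
    then obtain u where u: "u \<in> hcomp N p" "x = \<Xi> p u"
      using mem by blast
    have "gone R \<in> hcomp R 0"
      using m(1) unfolding graded_algebra_def by blast
    then show "gact M p 0 x (gone R) = x"
      using act[OF u(1), of "gone R" 0] m(9)[OF u(1)] u(2) by simp
  qed
  have "bij_betw (\<Theta> p) (hcomp M p) (hcomp N p)" for p
    by (rule bij_betw_byWitness[of _ "\<Xi> p"]) (use surj inv mem in force)+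
  moreover have "(\<forall>y\<in>hcomp M p. \<Theta> p (gadd M p x y) = gadd N p (\<Theta> p x) (\<Theta> p y)) \<and>
      (\<forall>r. \<Theta> p (gscale M p r x) = gscale N p r (\<Theta> p x)) \<and>
      (\<forall>q. \<forall>a\<in>hcomp R q. \<Theta> (p + q) (gact M p q x a) = gact N p q (\<Theta> p x) a)" if x: "x \<in> hcomp M p" for p x
  proof -
    obtain u where u: "u \<in> hcomp N p" "x = \<Xi> p u"
      using mem[OF x] by blast
    have "\<Theta> p (gadd M p x y) = gadd N p (\<Theta> p x) (\<Theta> p y)" if y: "y \<in> hcomp M p" for y
    proof -
      obtain w where w: "w \<in> hcomp N p" "y = \<Xi> p w"
        using mem[OF y] by blast
      show ?thesis
        using N_vs(1)[OF u(1) w(1)] u(1) w(1) by (simp add: u(2) w(2) add inv)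
    qed
    moreover have "\<Theta> p (gscale M p r x) = gscale N p r (\<Theta> p x)" for r
      using N_vs(2)[OF u(1) u(1)] u(1) by (simp add: u(2) scale inv)
    moreover have "\<Theta> (p + q) (gact M p q x a) = gact N p q (\<Theta> p x) a" if "a \<in> hcomp R q" for q a
      using m(3)[OF u(1) that] u(1) that by (simp add: u(2) act inv)
    ultimately show ?thesis
      by blast
  qed
  ultimately show ?thesis
    using M N unfolding graded_right_module_iso_def by blast
qed

context vb_groupoid_lift
begin

text \<open>The inverse of \<open>\<Theta>\<^sub>h\<close>.\<close>

definition synth_fun :: "int \<Rightarrow> (('m, 'g) nerve_point \<Rightarrow> 'e) \<Rightarrow> (('m, 'g) nerve_point \<Rightarrow> 'c) \<Rightarrow>
    ('g \<times> ('c \<Rightarrow> real)) list \<Rightarrow> real" where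
  "synth_fun p \<omega>E \<omega>C = (\<lambda>\<xi>s\<in>dual_nerve V p. snd (hd \<xi>s)
     (combine (fst (hd \<xi>s)) (\<omega>E (right_part G 1 (Arr (map fst \<xi>s)))) (\<omega>C (Arr (map fst \<xi>s)))))"

definition synth :: "int \<Rightarrow> (('m, 'g) nerve_point \<Rightarrow> 'e) \<Rightarrow> (('m, 'g) nerve_point \<Rightarrow> 'c) \<Rightarrow> ('m, 'g, 'c) vb_cochain" where
  "synth p \<omega>E \<omega>C = (if p = 0 then Sect \<omega>C else Lin (synth_fun p \<omega>E \<omega>C))"

lemma synth_neg: "p < 0 \<Longrightarrow> synth p \<omega>E \<omega>C = Lin (\<lambda>_. undefined)"
  by (simp add: synth_def synth_fun_def dual_nerve_neg restrict_def)

text \<open>For a single arrow nothing remains but its source; for a longer chain the next arrow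
  starts there by composability. This includes the evaluation at the source of \<open>g\<close> in
  degree 1.\<close>

lemma right_part_1_hd:
  assumes "gs \<in> chains G n" "n > 0"
  shows "left_end G (right_part G 1 (Arr gs)) = src G (hd gs)" "right_part G 1 (Arr gs) \<in> nerve G (int (n - 1))"
proof -
  show "right_part G 1 (Arr gs) \<in> nerve G (int (n - 1))"
    using right_part_in_nerve[OF G_groupoid, of "Arr gs" 1 "n - 1"] assms nerve_pos[of n G] by simp
  obtain g gs' where gs: "gs = g # gs'"
    using chains_nonempty[OF assms] by (cases gs) auto
  show "left_end G (right_part G 1 (Arr gs)) = src G (hd gs)"
    using chainsD(4)[OF assms(1), of 0] chainsD(1)[OF assms(1)] by (cases gs') (auto simp: gs)
qed

context
  fixes n \<omega>E \<omega>C
  assumes n: "n > 0" and E: "\<omega>E \<in> cochains G E (int n - 1)" and C: "\<omega>C \<in> cochains G C (int n)"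
begin

lemma degree: "int n - 1 = int (n - 1)"
  using n by simp

lemma component_fibres:
  assumes "gs \<in> chains G n"
  shows "hd gs \<in> points (arrows G)" "\<omega>E (right_part G 1 (Arr gs)) \<in> vfib E (src G (hd gs))"
    "\<omega>C (Arr gs) \<in> vfib C (tgt G (hd gs))"
proof -
  show "hd gs \<in> points (arrows G)"
    by (rule hd_in_arrows[OF assms n])
  show "\<omega>E (right_part G 1 (Arr gs)) \<in> vfib E (src G (hd gs))"
    using cochainsD(2)[OF E[unfolded degree] right_part_1_hd(2)[OF assms n]] right_part_1_hd(1)[OF assms n] by simp
  show "\<omega>C (Arr gs) \<in> vfib C (tgt G (hd gs))"
    using cochainsD(2)[OF C, of "Arr gs"] nerve_pos[OF n, of G] assms by simp
qed

text \<open>The function pairs the first entry with a smooth section depending on the base chain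
  only. This gives smoothness, linearity and the vanishing on tuples that start with zero.\<close>

lemma synth_in_vb_cochains: "synth (int n) \<omega>E \<omega>C \<in> vb_cochains V (int n)"
proof -
  let ?f = "\<lambda>gs. combine (hd gs) (\<omega>E (right_part G 1 (Arr gs))) (\<omega>C (Arr gs))"
  let ?PG = "power_manifold (arrows G) n" and ?PD = "power_manifold D n"
  note PG = charted_chains[OF G_groupoid, of n]
  note PD = charted_power[OF charted_dual[OF Q_bundle], of n]
  let ?N = "dual_nerve V (int n)"
  have app: "synth_fun (int n) \<omega>E \<omega>C \<xi>s = snd (hd \<xi>s) (?f (map fst \<xi>s))" if "\<xi>s \<in> ?N" for \<xi>s
    using that dual_nerve_base(2)[OF that] by (simp add: synth_fun_def)
  have f: "?f gs \<in> vfib Q (hd gs)" if "gs \<in> chains G n" for gs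
    by (rule combine_fibre(1)[OF component_fibres[OF that]])
  have "smooth_cochain G (objects \<Gamma>) (int (1 + (n - 1))) (\<lambda>\<sigma>. \<omega>E (right_part G 1 \<sigma>))"
    using cochainsD(3)[OF E] unfolding degree by (intro smooth_cochain_right_part[OF G_groupoid]) simp
  moreover have "1 + (n - 1) = n"
    using n by simp
  ultimately have smE: "smooth_on ?PG (chains G n) (objects \<Gamma>) (\<lambda>gs. \<omega>E (right_part G 1 (Arr gs)))"
    by (simp only: smooth_cochain_pos[OF G_groupoid n])
  have smC: "smooth_on ?PG (chains G n) (arrows \<Gamma>) (\<lambda>gs. \<omega>C (Arr gs))"
    using cochainsD(3)[OF C] by (simp only: core_ops smooth_cochain_pos[OF G_groupoid n])
  have smf: "smooth_on ?PG (chains G n) (arrows \<Gamma>) ?f"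
    by (rule smooth_combine[OF PG smooth_hd[OF n] smE smC component_fibres(2,3)])
  have N: "?N \<subseteq> points ?PD"
    by (auto simp: dual_nerve_def)
  have nth: "smooth_on ?PD ?N D (\<lambda>\<xi>s. \<xi>s ! i)" if "i < n" for i
    by (rule smooth_on_nth[OF charted_dual[OF Q_bundle] N that])
  have base: "smooth_on ?PD ?N ?PG (map fst)"
  proof (rule smooth_on_list[OF PD N])
    fix i assume i: "i < n"
    have "smooth_on ?PD ?N (arrows G) (\<lambda>\<xi>s. fst (\<xi>s ! i))"
      using smooth_on_dual_base[OF Q_bundle PD nth[OF i]] by simp
    then show "smooth_on ?PD ?N (arrows G) (\<lambda>\<xi>s. map fst \<xi>s ! i)"
      by (rule smooth_on_cong) (use i dual_nerveD(2) in simp)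
  qed (use dual_nerveD(2) in simp)
  have hd: "smooth_on ?PD ?N D hd"
    by (rule smooth_on_cong[OF nth[OF n]]) (simp add: hd_conv_nth dual_nerveD(4))
  have "smooth_on ?PD ?N real_line (\<lambda>\<xi>s. snd (hd \<xi>s) (?f (map fst \<xi>s)))"
  proof (rule smooth_on_pairing[OF Q_bundle PD hd])
    show "smooth_on ?PD ?N (vtotal Q) (\<lambda>\<xi>s. ?f (map fst \<xi>s))"
      using smooth_on_compose[OF PG base smf dual_nerve_base(1)] by simp
    show "?f (map fst \<xi>s) \<in> vfib Q (fst (hd \<xi>s))" if "\<xi>s \<in> ?N" for \<xi>s
      using f[OF dual_nerve_base(1)[OF that]] dual_nerve_base(2)[OF that] by simp
  qed
  then have sm: "smooth_on ?PD ?N real_line (synth_fun (int n) \<omega>E \<omega>C)"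
    by (rule smooth_on_cong) (simp add: app)
  have fib: "?f (map fst \<xi>s) \<in> vfib Q (fst (hd \<xi>s))" if "\<xi>s \<in> ?N" for \<xi>s
    using f[OF dual_nerve_base(1)[OF that]] dual_nerve_base(2)[OF that] by simp
  have add: "synth_fun (int n) \<omega>E \<omega>C (map2 (dual_add Q) \<xi>s \<eta>s) = synth_fun (int n) \<omega>E \<omega>C \<xi>s + synth_fun (int n) \<omega>E \<omega>C \<eta>s"
    if "\<xi>s \<in> ?N" "\<eta>s \<in> ?N" "map fst \<xi>s = map fst \<eta>s" for \<xi>s \<eta>s
  proof -
    note a = dual_nerve_add[OF that]
    have eq: "fst (hd \<xi>s) = fst (hd \<eta>s)"
      using dual_nerve_base(2)[OF that(1)] dual_nerve_base(2)[OF that(2)] that(3) by simp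
    show ?thesis
      unfolding app[OF that(1)] app[OF that(2)] app[OF a(1)] a(2,3)
      using dual_add_D(3)[OF dual_nerveD(5)[OF that(1)] dual_nerveD(5)[OF that(2)] eq fib[OF that(1)]] that(3) by simp
  qed
  have scale: "synth_fun (int n) \<omega>E \<omega>C (map (dual_scale Q r) \<xi>s) = r * synth_fun (int n) \<omega>E \<omega>C \<xi>s"
    if "\<xi>s \<in> ?N" for r \<xi>s
  proof -
    note a = dual_nerve_scale[OF that, of r]
    show ?thesis
      unfolding app[OF that] app[OF a(1)] a(2,3)
      by (rule dual_scale_D(3)[OF dual_nerveD(5)[OF that] fib[OF that]])
  qed
  have zero: "synth_fun (int n) \<omega>E \<omega>C (dual_zero Q g # \<xi>s) = 0" if "dual_zero Q g # \<xi>s \<in> ?N" for g \<xi>s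
    using app[OF that] fib[OF that] by (simp add: dual_zero_def)
  \<comment> \<open>Both tuples see the section through its source, which is the value of
    \<open>\<omega>E\<close>. That value depends on the tail of the base chain, and the tail is the
    same for both; in degree 1 it is the source of the first arrow, which left multiplication
    preserves.\<close>
  have mult: "synth_fun (int n) \<omega>E \<omega>C (dual_mul V (dual_zero Q g) \<xi> # \<xi>s) = synth_fun (int n) \<omega>E \<omega>C (\<xi> # \<xi>s)"
    if g: "g \<in> points (arrows G)" and \<xi>s: "\<xi> # \<xi>s \<in> ?N" and t: "dual_tgt V \<xi> = dual_zero C (src G g)" for g \<xi> \<xi>s
  proof -
    have \<xi>: "\<xi> \<in> points D" "fst \<xi> \<in> points (arrows G)"
      using dual_nerveD(5)[OF \<xi>s] by (simp_all add: in_D)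
    note m = dual_mul_zero[OF g \<xi>(1) t]
    note ker = dual_kernel[OF \<xi>(1) t]
    have m\<xi>s: "left_zero g \<xi> # \<xi>s \<in> ?N"
      by (rule dual_nerve_Cons_cong[OF \<xi>s m(2,3)])
    let ?gs = "map fst (\<xi> # \<xi>s)" and ?gs' = "map fst (left_zero g \<xi> # \<xi>s)"
    note c = component_fibres[OF dual_nerve_base(1)[OF \<xi>s]] and c' = component_fibres[OF dual_nerve_base(1)[OF m\<xi>s]]
    have fst_m: "fst (left_zero g \<xi>) = mul G g (fst \<xi>)"
      by (simp add: left_zero_def)
    have sg: "src G (mul G g (fst \<xi>)) = src G (fst \<xi>)"
      using groupoid_mul_ends(1)[OF G_groupoid g \<xi>(2)] ker(1) by simp
    have rp: "right_part G 1 (Arr ?gs') = right_part G 1 (Arr ?gs)"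
      using sg fst_m by simp
    let ?e = "\<omega>E (right_part G 1 (Arr ?gs))"
    have e: "?e \<in> vfib E (src G (fst \<xi>))"
      using c(2) by simp
    have f': "?f ?gs' \<in> vfib Q (mul G g (fst \<xi>))" "src \<Gamma> (?f ?gs') = ?e"
      using combine_fibre(1,2)[OF c'] fst_m rp by simp_all
    have f: "?f ?gs \<in> vfib Q (fst \<xi>)" "src \<Gamma> (?f ?gs) = ?e"
      using combine_fibre(1,2)[OF c] by simp_all
    have "synth_fun (int n) \<omega>E \<omega>C (left_zero g \<xi> # \<xi>s) = snd (left_zero g \<xi>) (?f ?gs')"
      using app[OF m\<xi>s] by simp
    also have "\<dots> = snd \<xi> (h (fst \<xi>) ?e)"
      using f' by (simp add: left_zero_def)
    also have "\<dots> = snd \<xi> (?f ?gs)"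
      by (rule ker(2)[OF lift_fibre(1)[OF \<xi>(2) e] f(1)]) (simp only: lift_fibre(2)[OF \<xi>(2) e] f(2))
    also have "\<dots> = synth_fun (int n) \<omega>E \<omega>C (\<xi> # \<xi>s)"
      using app[OF \<xi>s] by simp
    finally show ?thesis
      unfolding m(1) .
  qed
  have "synth_fun (int n) \<omega>E \<omega>C \<in> linear_cochains V (int n)"
    using sm add scale by (simp add: linear_cochains_def) (simp add: synth_fun_def)
  moreover have "left_projectable V (int n) (synth_fun (int n) \<omega>E \<omega>C)"
    unfolding left_projectable_def using zero mult by blast
  ultimately show ?thesis
    using n by (simp add: vb_cochains_def synth_def)
qed

lemma hat_synth:
  assumes gs: "gs \<in> chains G n"
  shows "hat V (int n) (synth_fun (int n) \<omega>E \<omega>C) gs =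
    combine (hd gs) (\<omega>E (right_part G 1 (Arr gs))) (\<omega>C (Arr gs))"
  by (rule hat_eqI[OF n gs combine_fibre(1)[OF component_fibres[OF gs]]])
    (use dual_nerve_base(2) in \<open>auto simp: synth_fun_def\<close>)

end

section \<open>Bijectivity in every degree\<close>

lemma synth_in:
  assumes E: "\<omega>E \<in> cochains G E (p - 1)" and C: "\<omega>C \<in> cochains G C p"
  shows "synth p \<omega>E \<omega>C \<in> vb_cochains V p"
proof (cases p "0 :: int" rule: linorder_cases)
  case less
  then show ?thesis
    by (simp add: synth_neg vb_cochains_def linear_cochains_def left_projectable_def dual_nerve_neg
        smooth_on_def extensional_def image_iff)
next
  case equal
  then show ?thesis
    using C by (simp add: synth_def vb_cochains_def)
next
  case greater
  then obtain n where "p = int n" "n > 0"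
    by (metis zero_less_imp_eq_int)
  then show ?thesis
    using synth_in_vb_cochains E C by blast
qed

text \<open>A right inverse of the removal of the first arrow. Values of a function of the tail are
  read off on these chains.\<close>

fun unit_extend :: "('m, 'g) nerve_point \<Rightarrow> 'g list" where
  "unit_extend (Obj x) = [unit G x]"
| "unit_extend (Arr gs) = unit G (tgt G (hd gs)) # gs"

lemma unit_extend:
  assumes \<sigma>: "\<sigma> \<in> nerve G (int n)"
  shows "unit_extend \<sigma> \<in> chains G (Suc n)" "right_part G 1 (Arr (unit_extend \<sigma>)) = \<sigma>"
    "hd (unit_extend \<sigma>) = unit G (left_end G \<sigma>)"
proof -
  have "unit_extend \<sigma> \<in> chains G (Suc n) \<and> right_part G 1 (Arr (unit_extend \<sigma>)) = \<sigma> \<and>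
      hd (unit_extend \<sigma>) = unit G (left_end G \<sigma>)"
    using \<sigma>
  proof (cases rule: nerve_cases)
    case (Obj x)
    then show ?thesis
      using G_points(3) by (auto simp: chains_def)
  next
    case (Arr gs)
    note x = G_points(2)[OF hd_in_arrows[OF Arr(3,1)]]
    have "src G ((unit G (tgt G (hd gs)) # gs) ! i) = tgt G ((unit G (tgt G (hd gs)) # gs) ! Suc i)" if "Suc i < Suc n" for i
      using chainsD(4)[OF Arr(3)] x that chains_nonempty[OF Arr(3,1)] by (cases i) (auto simp: hd_conv_nth)
    then show ?thesis
      using chainsD(1,2)[OF Arr(3)] G_points(3)[OF x] Arr(1,2) by (auto simp: chains_def)
  qed
  then show "unit_extend \<sigma> \<in> chains G (Suc n)" "right_part G 1 (Arr (unit_extend \<sigma>)) = \<sigma>"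
    "hd (unit_extend \<sigma>) = unit G (left_end G \<sigma>)"
    by auto
qed

lemma cochains_neg: "\<omega> \<in> cochains G B p \<Longrightarrow> p < 0 \<Longrightarrow> \<omega> = (\<lambda>_. undefined)"
  by (auto dest!: cochainsD(1) simp: nerve_neg extensional_def)

text \<open>In positive degree \<open>hat_synth\<close> recovers the combined section, and
  \<open>src\<close> and \<open>core_part\<close> recover its two parts. Every point of the nerve in
  degree \<open>p - 1\<close> is the tail of its unit extension, so the E-parts agree
  everywhere.\<close>

lemma synth_inject:
  assumes E: "\<omega>E \<in> cochains G E (p - 1)" "\<eta>E \<in> cochains G E (p - 1)"
    and C: "\<omega>C \<in> cochains G C p" "\<eta>C \<in> cochains G C p"
    and eq: "synth p \<omega>E \<omega>C = synth p \<eta>E \<eta>C"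
  shows "\<omega>E = \<eta>E \<and> \<omega>C = \<eta>C"
proof (cases "p > 0")
  case False
  then have "\<omega>E = \<eta>E"
    using cochains_neg[OF E(1)] cochains_neg[OF E(2)] by simp
  moreover have "\<omega>C = \<eta>C"
  proof (cases "p = 0")
    case True
    then show ?thesis
      using eq by (simp add: synth_def)
  next
    case F: False
    with False show ?thesis
      using cochains_neg[OF C(1)] cochains_neg[OF C(2)] by simp
  qed
  ultimately show ?thesis
    by blast
next
  case True
  then obtain n where p: "p = int n" and n: "n > 0"
    by (metis zero_less_imp_eq_int)
  have "synth_fun (int n) \<omega>E \<omega>C = synth_fun (int n) \<eta>E \<eta>C"
    using eq n by (simp add: synth_def p)
  then have comb: "combine (hd gs) (\<omega>E (right_part G 1 (Arr gs))) (\<omega>C (Arr gs)) =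
      combine (hd gs) (\<eta>E (right_part G 1 (Arr gs))) (\<eta>C (Arr gs))" if "gs \<in> chains G n" for gs
    using hat_synth[OF n E(1)[unfolded p] C(1)[unfolded p] that] hat_synth[OF n E(2)[unfolded p] C(2)[unfolded p] that] by simp
  note f = component_fibres[OF n E(1)[unfolded p] C(1)[unfolded p]]
    and f' = component_fibres[OF n E(2)[unfolded p] C(2)[unfolded p]]
  have e: "\<omega>E (right_part G 1 (Arr gs)) = \<eta>E (right_part G 1 (Arr gs))" and c: "\<omega>C (Arr gs) = \<eta>C (Arr gs)"
    if "gs \<in> chains G n" for gs
    using comb[OF that] combine_fibre(2,3)[OF f[OF that]] combine_fibre(2,3)[OF f'[OF that]] by metis+
  have "\<omega>C = \<eta>C"
    by (rule cochains_eqI[OF cochainsD(1)[OF C(1)] cochainsD(1)[OF C(2)]]) (use c n in \<open>auto simp: p nerve_pos\<close>)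
  moreover have "\<omega>E = \<eta>E"
  proof (rule cochains_eqI[OF cochainsD(1)[OF E(1)] cochainsD(1)[OF E(2)]])
    fix \<sigma> assume "\<sigma> \<in> nerve G (p - 1)"
    then have "\<sigma> \<in> nerve G (int (n - 1))"
      using n by (simp add: p)
    note u = unit_extend[OF this]
    show "\<omega>E \<sigma> = \<eta>E \<sigma>"
      using e[of "unit_extend \<sigma>"] u(1,2) n by simp
  qed
  ultimately show ?thesis
    by blast
qed

text \<open>The core part is \<open>core_part\<close> of \<phi>-hat. The E-part is the source of
  \<phi>-hat on unit extensions, which is smooth as a composition; that it also serves chains with
  an arbitrary first arrow is \<open>src_hat\<close>.\<close>

lemma synth_surj:
  assumes \<phi>: "\<phi> \<in> vb_cochains V p"
  shows "\<exists>\<omega>E\<in>cochains G E (p - 1). \<exists>\<omega>C\<in>cochains G C p. \<phi> = synth p \<omega>E \<omega>C"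
proof (cases p "0 :: int" rule: linorder_cases)
  case less
  then have "\<phi> = synth p (cochain_zero G E (p - 1)) (cochain_zero G C p)"
    using \<phi> by (auto simp: vb_cochains_def synth_neg linear_cochains_def dual_nerve_neg extensional_def)
  then show ?thesis
    using smooth_family.cochain_zero_in_cochains[OF smooth_family_side] smooth_family.cochain_zero_in_cochains[OF smooth_family_core]
    by blast
next
  case equal
  then show ?thesis
    using \<phi> smooth_family.cochain_zero_in_cochains[OF smooth_family_side, of "p - 1"]
    by (auto simp: vb_cochains_def synth_def)
next
  case greater
  then obtain n where p: "p = int n" and n: "n > 0"
    by (metis zero_less_imp_eq_int)
  obtain a where a: "\<phi> = Lin a" and lin: "a \<in> linear_cochains V (int n)" and proj: "left_projectable V (int n) a"
    using \<phi> n by (auto simp: vb_cochains_def p)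
  let ?hat = "hat V (int n) a"
  note H = hat[OF n lin proj] and smH = smooth_hat[OF n lin proj]
  note PG = charted_chains[OF G_groupoid]
  define \<omega>E where "\<omega>E = (\<lambda>\<sigma>\<in>nerve G (int (n - 1)). src \<Gamma> (?hat (unit_extend \<sigma>)))"
  \<comment> \<open>Since \<open>n > 0\<close> the nerve consists of \<open>Arr\<close> points, so
    the value for \<open>Obj\<close> is never taken.\<close>
  define \<omega>C where "\<omega>C = (\<lambda>\<sigma>\<in>nerve G (int n). case \<sigma> of Obj x \<Rightarrow> undefined | Arr gs \<Rightarrow> core_part (hd gs) (?hat gs))"
  have hd: "hd gs \<in> points (arrows G)" if "gs \<in> chains G n" for gs
    by (rule hd_in_arrows[OF that n])
  have ext: "unit_extend \<sigma> \<in> chains G n" "hd (unit_extend \<sigma>) = unit G (left_end G \<sigma>)" "left_end G \<sigma> \<in> points (objects G)"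
    if "\<sigma> \<in> nerve G (int (n - 1))" for \<sigma>
    using unit_extend[OF that] left_end_in_objects[OF G_groupoid that] n by simp_all
  have "\<omega>E \<in> cochains G E (int (n - 1))"
    unfolding \<omega>E_def
  proof (rule smooth_family.restrict_in_cochains[OF smooth_family_side])
    show "src \<Gamma> (?hat (unit_extend \<sigma>)) \<in> vfib E (left_end G \<sigma>)" if "\<sigma> \<in> nerve G (int (n - 1))" for \<sigma>
      using src_tgt_fibre(1)[OF hd H(1), OF ext(1,1)[OF that]] ext(2,3)[OF that] by simp
    have sm_src: "smooth_on (power_manifold (arrows G) n) (chains G n) (objects \<Gamma>) (\<lambda>gs. src \<Gamma> (?hat gs))"
      by (rule smooth_structure(2)[OF PG smH])
    show "smooth_cochain G (vtotal E) (int (n - 1)) (\<lambda>\<sigma>. src \<Gamma> (?hat (unit_extend \<sigma>)))"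
    \<comment> \<open>For \<open>n = 1\<close> the E-part is a function on the manifold of objects
      and the extension produces one-arrow chains; otherwise it is a map between spaces of
      lists.\<close>
    proof (cases "n = 1")
      case True
      have "smooth_on (objects G) (points (objects G)) (power_manifold (arrows G) n) (\<lambda>x. [unit G x])"
        by (rule smooth_on_list[OF lie_groupoidD(2)[OF G_groupoid] subset_refl])
          (use True lie_groupoidD(5)[OF G_groupoid] in auto)
      from smooth_on_compose[OF PG this sm_src]
      have "smooth_on (objects G) (points (objects G)) (objects \<Gamma>) (\<lambda>x. src \<Gamma> (?hat [unit G x]))"
        using unit_extend(1)[of "Obj _" 0] True by (simp add: nerve_0)
      then show ?thesis
        using True by (simp add: smooth_cochain_0[OF G_groupoid])
    next
      case False
      with n have n1: "0 < n - 1"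
        by simp
      have "smooth_on (power_manifold (arrows G) (n - 1)) (chains G (n - 1)) (power_manifold (arrows G) n)
          (\<lambda>gs. unit G (tgt G (hd gs)) # gs)"
      proof (rule smooth_on_list[OF PG chains_power])
        fix i assume i: "i < n"
        show "smooth_on (power_manifold (arrows G) (n - 1)) (chains G (n - 1)) (arrows G)
            (\<lambda>gs. (unit G (tgt G (hd gs)) # gs) ! i)"
        proof (cases i)
          case 0
          have "smooth_on (power_manifold (arrows G) (n - 1)) (chains G (n - 1)) (arrows G) (\<lambda>gs. unit G (tgt G (hd gs)))"
            by (rule smooth_on_compose[OF lie_groupoidD(2)[OF G_groupoid] smooth_on_tgt_hd[OF G_groupoid n1] lie_groupoidD(5)[OF G_groupoid]])
              (rule G_points(2)[OF hd_in_arrows[OF _ n1]])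
          then show ?thesis
            using 0 by simp
        next
          case (Suc j)
          then show ?thesis
            using smooth_on_chain_nth[OF G_groupoid, of j "n - 1"] i by simp
        qed
      qed (use n chainsD(1) in fastforce)
      moreover have "unit G (tgt G (hd gs)) # gs \<in> chains G n" if "gs \<in> chains G (n - 1)" for gs
      proof -
        have "Arr gs \<in> nerve G (int (n - 1))"
          unfolding nerve_pos[OF n1] using that by (rule imageI)
        from ext(1)[OF this] show ?thesis
          by simp
      qed
      ultimately have "smooth_on (power_manifold (arrows G) (n - 1)) (chains G (n - 1)) (objects \<Gamma>)
          (\<lambda>gs. src \<Gamma> (?hat (unit G (tgt G (hd gs)) # gs)))"
        by (rule smooth_on_compose[OF PG _ sm_src])
      then show ?thesis
        unfolding smooth_cochain_pos[OF G_groupoid n1] by simp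
    qed
  qed
  then have E: "\<omega>E \<in> cochains G E (p - 1)"
    using n by (simp add: p)
  have C: "\<omega>C \<in> cochains G C p"
    unfolding \<omega>C_def p
  proof (rule smooth_family.restrict_in_cochains[OF smooth_family_core])
    show "(case \<sigma> of Obj x \<Rightarrow> undefined | Arr gs \<Rightarrow> core_part (hd gs) (?hat gs)) \<in> vfib C (left_end G \<sigma>)"
      if "\<sigma> \<in> nerve G (int n)" for \<sigma>
      using that core_part_fibre[OF hd H(1)] by (auto simp: nerve_pos[OF n])
    show "smooth_cochain G (vtotal C) (int n) (\<lambda>\<sigma>. case \<sigma> of Obj x \<Rightarrow> undefined | Arr gs \<Rightarrow> core_part (hd gs) (?hat gs))"
      using smooth_core_part[OF PG smooth_hd[OF n] smH H(1)] by (simp add: smooth_cochain_pos[OF G_groupoid n])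
  qed
  have "a \<xi>s = synth_fun (int n) \<omega>E \<omega>C \<xi>s" for \<xi>s
  proof (cases "\<xi>s \<in> dual_nerve V (int n)")
    case True
    let ?gs = "map fst \<xi>s"
    note gs = dual_nerve_base[OF True]
    obtain g gs' where g: "?gs = g # gs'"
      using chains_nonempty[OF gs(1) n] by (cases ?gs) auto
    have c: "g # gs' \<in> chains G n"
      using gs(1) g by simp
    \<comment> \<open>Removing the first arrow and extending by a unit replaces that arrow by the
      unit at its source; in degree 1 the unit is attached to the source itself.\<close>
    have rp: "unit_extend (right_part G 1 (Arr ?gs)) = unit G (src G g) # gs'"
      using chainsD(4)[OF c, of 0] chainsD(1)[OF c] by (cases gs') (auto simp: g)
    have "\<omega>E (right_part G 1 (Arr ?gs)) = src \<Gamma> (?hat ?gs)"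
      using right_part_1_hd(2)[OF gs(1) n] rp src_hat(1)[OF n lin proj c] by (simp add: \<omega>E_def g)
    moreover have "\<omega>C (Arr ?gs) = core_part (hd ?gs) (?hat ?gs)"
      using gs(1) by (simp add: \<omega>C_def nerve_pos[OF n])
    ultimately have "combine (hd ?gs) (\<omega>E (right_part G 1 (Arr ?gs))) (\<omega>C (Arr ?gs)) = ?hat ?gs"
      using combine_core_part[OF hd[OF gs(1)] H(1)[OF gs(1)]] by simp
    then show ?thesis
      using H(2)[OF gs(1) True] True gs(2) by (simp add: synth_fun_def)
  next
    case False
    then show ?thesis
      using linear_cochainsD(1)[OF lin] by (simp add: synth_fun_def extensional_def)
  qed
  then have "\<phi> = synth p \<omega>E \<omega>C"
    using n by (auto simp: synth_def p a)
  with E C show ?thesis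
    by blast
qed

text \<open>The defining equation says that \<phi>-hat is \<open>combine\<close> of the components,
  which by \<open>hat_synth\<close> is the hat section of the cochain they generate. The definite
  description in \<open>Theta\<close> thereby becomes inversion of \<open>synth\<close>.\<close>

lemma is_components_synth:
  assumes \<phi>: "\<phi> \<in> vb_cochains V p"
  shows "is_components V h p \<phi> (\<omega>E, \<omega>C) \<longleftrightarrow>
    \<omega>E \<in> cochains G E (p - 1) \<and> \<omega>C \<in> cochains G C p \<and> \<phi> = synth p \<omega>E \<omega>C"
proof -
  obtain \<eta>E \<eta>C where \<eta>: "\<eta>E \<in> cochains G E (p - 1)" "\<eta>C \<in> cochains G C p" "\<phi> = synth p \<eta>E \<eta>C"
    using synth_surj[OF \<phi>] by blast
  consider "p < 0" | "p = 0" | n where "p = int n" "n > 0"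
    by (metis linorder_neqE_linordered_idom zero_less_imp_eq_int)
  then show ?thesis
  proof cases
    case 1
    then show ?thesis
      using \<eta>(3) by (auto simp: is_components_def synth_neg)
  next
    case 2
    then show ?thesis
      using \<eta>(3) by (auto simp: is_components_def synth_def)
  next
    case (3 n)
    note n = 3(2)
    have \<phi>: "\<phi> = Lin (synth_fun (int n) \<eta>E \<eta>C)"
      using \<eta>(3) 3 by (simp add: synth_def)
    note hat_\<eta> = hat_synth[OF n \<eta>(1,2)[unfolded 3(1)]]
    show ?thesis
    proof
      assume c: "is_components V h p \<phi> (\<omega>E, \<omega>C)"
      then have \<omega>: "\<omega>E \<in> cochains G E (int n - 1)" "\<omega>C \<in> cochains G C (int n)"
        by (auto simp: is_components_def 3(1))
      have comb: "combine (hd gs) (\<eta>E (right_part G 1 (Arr gs))) (\<eta>C (Arr gs)) =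
          combine (hd gs) (\<omega>E (right_part G 1 (Arr gs))) (\<omega>C (Arr gs))" if "gs \<in> chains G n" for gs
        using c that n hat_\<eta>[OF that] by (simp add: is_components_def \<phi> 3(1) combine_def)
      have "synth_fun (int n) \<eta>E \<eta>C = synth_fun (int n) \<omega>E \<omega>C"
        unfolding synth_fun_def
      proof (rule restrict_ext)
        fix \<xi>s assume "\<xi>s \<in> dual_nerve V (int n)"
        note b = dual_nerve_base[OF this]
        show "snd (hd \<xi>s) (combine (fst (hd \<xi>s)) (\<eta>E (right_part G 1 (Arr (map fst \<xi>s)))) (\<eta>C (Arr (map fst \<xi>s)))) =
            snd (hd \<xi>s) (combine (fst (hd \<xi>s)) (\<omega>E (right_part G 1 (Arr (map fst \<xi>s)))) (\<omega>C (Arr (map fst \<xi>s))))"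
          unfolding b(2) comb[OF b(1)] ..
      qed
      then show "\<omega>E \<in> cochains G E (p - 1) \<and> \<omega>C \<in> cochains G C p \<and> \<phi> = synth p \<omega>E \<omega>C"
        using \<omega> n by (simp add: \<phi> 3(1) synth_def)
    next
      assume \<omega>: "\<omega>E \<in> cochains G E (p - 1) \<and> \<omega>C \<in> cochains G C p \<and> \<phi> = synth p \<omega>E \<omega>C"
      then have \<phi>': "\<phi> = Lin (synth_fun (int n) \<omega>E \<omega>C)"
        using 3 by (simp add: synth_def)
      have E: "\<omega>E \<in> cochains G E (int n - 1)" and C: "\<omega>C \<in> cochains G C (int n)"
        using \<omega> by (simp_all add: 3(1))
      show "is_components V h p \<phi> (\<omega>E, \<omega>C)"
        using E C hat_synth[OF n E C] by (simp add: is_components_def \<phi>' 3(1) combine_def)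
    qed
  qed
qed

lemma components_unique:
  assumes "\<phi> \<in> vb_cochains V p"
  shows "\<exists>!c. is_components V h p \<phi> c"
proof -
  obtain \<omega>E \<omega>C where \<omega>: "\<omega>E \<in> cochains G E (p - 1)" "\<omega>C \<in> cochains G C p" "\<phi> = synth p \<omega>E \<omega>C"
    using synth_surj[OF assms] by blast
  show ?thesis
  proof (rule ex1I)
    show "is_components V h p \<phi> (\<omega>E, \<omega>C)"
      using is_components_synth[OF assms] \<omega> by blast
    fix c assume "is_components V h p \<phi> c"
    then show "c = (\<omega>E, \<omega>C)"
      using is_components_synth[OF assms, of "fst c" "snd c"] synth_inject \<omega> by (metis prod.collapse)
  qed
qed

lemma Theta_synth:
  assumes "\<omega>E \<in> cochains G E p" "\<omega>C \<in> cochains G C (p + 1)"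
  shows "Theta V h p (synth (p + 1) \<omega>E \<omega>C) = (\<omega>E, \<omega>C)"
proof -
  have E: "\<omega>E \<in> cochains G E (p + 1 - 1)"
    using assms(1) by simp
  note v = synth_in[OF E assms(2)]
  have "is_components V h (p + 1) (synth (p + 1) \<omega>E \<omega>C) (\<omega>E, \<omega>C)"
    using is_components_synth[OF v] E assms(2) by blast
  then show ?thesis
    unfolding Theta_def using components_unique[OF v] by (rule the1_equality[rotated])
qed

subsection \<open>Compatibility with the module structures\<close>

lemma combine_linear:
  assumes g: "g \<in> points (arrows G)" and e: "e \<in> vfib E (src G g)" and c: "c \<in> vfib C (tgt G g)"
  shows "e' \<in> vfib E (src G g) \<Longrightarrow> c' \<in> vfib C (tgt G g) \<Longrightarrow>
      combine g (vadd E e e') (vadd Q c c') = vadd Q (combine g e c) (combine g e' c')"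
    "combine g (vscale E r e) (vscale Q r c) = vscale Q r (combine g e c)"
proof -
  note Qv = Q_vs[OF g]
  show "combine g (vadd E e e') (vadd Q c c') = vadd Q (combine g e c) (combine g e' c')"
    if e': "e' \<in> vfib E (src G g)" and c': "c' \<in> vfib C (tgt G g)"
    unfolding combine_def lift_fibre(3)[OF g e e'] core_mul_zero(4)[OF g c c']
    by (rule real_vs_add_swap[OF Qv lift_fibre(1)[OF g e] lift_fibre(1)[OF g e'] core_mul_zero(1)[OF g c] core_mul_zero(1)[OF g c']])
  show "combine g (vscale E r e) (vscale Q r c) = vscale Q r (combine g e c)"
    unfolding combine_def lift_fibre(4)[OF g e] core_mul_zero(5)[OF g c]
    using real_vsD(8)[OF Qv lift_fibre(1)[OF g e] core_mul_zero(1)[OF g c]] by simp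
qed

text \<open>The second fact handles degree 0: a section of the core has no E-part, and its products
  with functions of positive degree have E-part zero.\<close>

lemma combine_zero:
  assumes g: "g \<in> points (arrows G)"
  shows "combine g (vzero E (src G g)) (z (unit G (tgt G g))) = z g"
    and "c \<in> vfib C (tgt G g) \<Longrightarrow> combine g (vzero E (src G g)) c = mul \<Gamma> c (z g)"
proof -
  show *: "combine g (vzero E (src G g)) c = mul \<Gamma> c (z g)" if "c \<in> vfib C (tgt G g)" for c
    unfolding combine_def lift_zero[OF g] by (rule real_vsD(6)[OF Q_vs[OF g] core_mul_zero(1)[OF g that]])
  have t: "tgt G g \<in> points (objects G)"
    by (rule G_points(2)[OF g])
  have "mul \<Gamma> (z (unit G (tgt G g))) (z g) = z g"
    using mul_zero[OF G_points(3)[OF t] g] t G_laws(1)[OF g] by simp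
  then show "combine g (vzero E (src G g)) (z (unit G (tgt G g))) = z g"
    using *[OF real_vsD(1)[OF core_vs[OF t], unfolded core_ops]] by simp
qed

abbreviation "ME \<equiv> cochain_module G E"
abbreviation "MC \<equiv> cochain_module G C"

context
  fixes p \<omega>E \<omega>C
  assumes E: "\<omega>E \<in> cochains G E (p - 1)" and C: "\<omega>C \<in> cochains G C p"
begin

lemma dual_nerve_components:
  assumes "\<xi>s \<in> dual_nerve V p"
  shows "fst (hd \<xi>s) \<in> points (arrows G)" "snd (hd \<xi>s) \<in> dual_fib Q (fst (hd \<xi>s))"
    "\<omega>E (right_part G 1 (Arr (map fst \<xi>s))) \<in> vfib E (src G (fst (hd \<xi>s)))"
    "\<omega>C (Arr (map fst \<xi>s)) \<in> vfib C (tgt G (fst (hd \<xi>s)))"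
    "right_part G 1 (Arr (map fst \<xi>s)) \<in> nerve G (p - 1)" "Arr (map fst \<xi>s) \<in> nerve G p"
proof -
  obtain n where p: "p = int n" and n: "n > 0"
    using assms dual_nerve_neg[of p] zero_less_imp_eq_int[of p] by fastforce
  note a = assms[unfolded p]
  note b = dual_nerve_base[OF a]
  note f = component_fibres[OF n E[unfolded p] C[unfolded p] b(1)]
  show "fst (hd \<xi>s) \<in> points (arrows G)" "snd (hd \<xi>s) \<in> dual_fib Q (fst (hd \<xi>s))"
    using dual_nerveD(5)[OF a] by (simp_all add: in_D)
  show "\<omega>E (right_part G 1 (Arr (map fst \<xi>s))) \<in> vfib E (src G (fst (hd \<xi>s)))"
    "\<omega>C (Arr (map fst \<xi>s)) \<in> vfib C (tgt G (fst (hd \<xi>s)))"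
    using f(2,3) b(2) by simp_all
  show "right_part G 1 (Arr (map fst \<xi>s)) \<in> nerve G (p - 1)"
    using right_part_1_hd(2)[OF b(1) n] n by (simp add: p)
  show "Arr (map fst \<xi>s) \<in> nerve G p"
    using b(1) by (simp add: p nerve_pos[OF n])
qed

lemma synth_add:
  assumes E': "\<eta>E \<in> cochains G E (p - 1)" and C': "\<eta>C \<in> cochains G C p"
  shows "vb_add V p (synth p \<omega>E \<omega>C) (synth p \<eta>E \<eta>C) = synth p (gadd ME (p - 1) \<omega>E \<eta>E) (gadd MC p \<omega>C \<eta>C)"
proof (cases "p = 0")
  case False
  have "(\<lambda>\<xi>s\<in>dual_nerve V p. synth_fun p \<omega>E \<omega>C \<xi>s + synth_fun p \<eta>E \<eta>C \<xi>s) =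
      synth_fun p (gadd ME (p - 1) \<omega>E \<eta>E) (gadd MC p \<omega>C \<eta>C)"
    unfolding synth_fun_def
  proof (rule restrict_ext)
    fix \<xi>s assume \<xi>s: "\<xi>s \<in> dual_nerve V p"
    \<comment> \<open>Inside this context the fact is tied to the fixed pair; the exported form
      supplies it for the second pair.\<close>
    note d = dual_nerve_components[OF \<xi>s] and d' = vb_groupoid_lift.dual_nerve_components[OF vb_groupoid_lift_axioms E' C' \<xi>s]
    show "(\<lambda>\<xi>s\<in>dual_nerve V p. snd (hd \<xi>s) (combine (fst (hd \<xi>s)) (\<omega>E (right_part G 1 (Arr (map fst \<xi>s)))) (\<omega>C (Arr (map fst \<xi>s))))) \<xi>s +
      (\<lambda>\<xi>s\<in>dual_nerve V p. snd (hd \<xi>s) (combine (fst (hd \<xi>s)) (\<eta>E (right_part G 1 (Arr (map fst \<xi>s)))) (\<eta>C (Arr (map fst \<xi>s))))) \<xi>s =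
      snd (hd \<xi>s) (combine (fst (hd \<xi>s)) (gadd ME (p - 1) \<omega>E \<eta>E (right_part G 1 (Arr (map fst \<xi>s))))
        (gadd MC p \<omega>C \<eta>C (Arr (map fst \<xi>s))))"
      using combine_linear(1)[OF d(1,3,4) d'(3,4)]
        dual_fibD(1)[OF d(2) combine_fibre(1)[OF d(1,3,4)] combine_fibre(1)[OF d(1) d'(3,4)]] d(5,6) \<xi>s
      by (simp add: cochain_module_def)
  qed
  with False show ?thesis
    by (simp add: synth_def vb_add_def)
qed (simp add: synth_def vb_add_def)

lemma synth_scale: "vb_scale V p r (synth p \<omega>E \<omega>C) = synth p (gscale ME (p - 1) r \<omega>E) (gscale MC p r \<omega>C)"
proof (cases "p = 0")
  case False
  have "(\<lambda>\<xi>s\<in>dual_nerve V p. r * synth_fun p \<omega>E \<omega>C \<xi>s) = synth_fun p (gscale ME (p - 1) r \<omega>E) (gscale MC p r \<omega>C)"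
    unfolding synth_fun_def
  proof (rule restrict_ext)
    fix \<xi>s assume \<xi>s: "\<xi>s \<in> dual_nerve V p"
    note d = dual_nerve_components[OF \<xi>s]
    show "r * (\<lambda>\<xi>s\<in>dual_nerve V p. snd (hd \<xi>s) (combine (fst (hd \<xi>s)) (\<omega>E (right_part G 1 (Arr (map fst \<xi>s)))) (\<omega>C (Arr (map fst \<xi>s))))) \<xi>s =
      snd (hd \<xi>s) (combine (fst (hd \<xi>s)) (gscale ME (p - 1) r \<omega>E (right_part G 1 (Arr (map fst \<xi>s))))
        (gscale MC p r \<omega>C (Arr (map fst \<xi>s))))"
      using combine_linear(2)[OF d(1,3,4), of r] dual_fibD(2)[OF d(2) combine_fibre(1)[OF d(1,3,4)], of r] d(5,6) \<xi>s
      by (simp add: cochain_module_def)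
  qed
  with False show ?thesis
    by (simp add: synth_def vb_scale_def)
qed (simp add: synth_def vb_scale_def)

end

lemma dual_zero_value: "g \<in> points (arrows G) \<Longrightarrow> \<xi> \<in> dual_fib Q g \<Longrightarrow> \<xi> (z g) = 0"
  using dual_fibD(2)[of \<xi> Q g "z g" 0] zero_fibre real_vs_scale_0[OF Q_vs zero_fibre] by simp

text \<open>Matches the conventions for negative degrees: there the action on VB-cochains returns
  \<open>vb_zero\<close>, and the action on components returns a pair of zero cochains.\<close>

lemma synth_zero: "synth p (cochain_zero G E (p - 1)) (cochain_zero G C p) = vb_zero V p"
proof (cases "p = 0")
  case False
  have "synth_fun p (cochain_zero G E (p - 1)) (cochain_zero G C p) = (\<lambda>\<xi>s\<in>dual_nerve V p. 0)"
    unfolding synth_fun_def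
  proof (rule restrict_ext)
    fix \<xi>s assume \<xi>s: "\<xi>s \<in> dual_nerve V p"
    note d = dual_nerve_components[OF smooth_family.cochain_zero_in_cochains[OF smooth_family_side]
        smooth_family.cochain_zero_in_cochains[OF smooth_family_core] \<xi>s]
    obtain n where p: "p = int n" and n: "n > 0"
      using \<xi>s dual_nerve_neg[of p] zero_less_imp_eq_int[of p] by fastforce
    note b = dual_nerve_base[OF \<xi>s[unfolded p]]
    have "cochain_zero G E (p - 1) (right_part G 1 (Arr (map fst \<xi>s))) = vzero E (src G (fst (hd \<xi>s)))"
      using d(5) right_part_1_hd(1)[OF b(1) n] b(2) by (simp add: cochain_zero_def)
    moreover have "cochain_zero G C p (Arr (map fst \<xi>s)) = z (unit G (tgt G (fst (hd \<xi>s))))"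
      using d(6) b(2) by (simp add: cochain_zero_def)
    ultimately show "snd (hd \<xi>s) (combine (fst (hd \<xi>s)) (cochain_zero G E (p - 1) (right_part G 1 (Arr (map fst \<xi>s))))
        (cochain_zero G C p (Arr (map fst \<xi>s)))) = 0"
      using combine_zero(1)[OF d(1)] dual_zero_value[OF d(1,2)] by simp
  qed
  with False show ?thesis
    by (simp add: synth_def vb_zero_def)
qed (simp add: synth_def vb_zero_def)

text \<open>The cases follow the definition of \<open>vb_act\<close>: a negative degree, total
  degree 0, a core section times a function of positive degree, and positive degree of the left
  factor. Only in the last one do both components contribute.\<close>

lemma synth_act:
  assumes E: "\<omega>E \<in> cochains G E (p - 1)" and C: "\<omega>C \<in> cochains G C p" and f: "f \<in> cochains G real_family q"
  shows "vb_act V p q (synth p \<omega>E \<omega>C) f = synth (p + q) (gact ME (p - 1) q \<omega>E f) (gact MC p q \<omega>C f)"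
proof (cases "p < 0 \<or> q < 0")
  case True
  then have "gact ME (p - 1) q \<omega>E f = cochain_zero G E (p + q - 1)" "gact MC p q \<omega>C f = cochain_zero G C (p + q)"
    by (auto simp: cochain_module_def algebra_simps)
  then show ?thesis
    using True by (simp add: synth_zero vb_act_def)
next
  case False
  then obtain m k where pq: "p = int m" "q = int k"
    by (metis nonneg_int_cases not_less)
  show ?thesis
  \<comment> \<open>In total degree 0 both sides are the same section of the core, and the E-part
    does not enter \<open>synth\<close>.\<close>
  proof (cases "m + k = 0")
    case True
    then show ?thesis
      by (simp add: pq vb_act_def synth_def)
  next
    case mk: False
    then have n: "m + k > 0"
      by simp
    note gE = smooth_family.gact_in_cochains[OF smooth_family_side E f]
    have gE': "gact ME (p - 1) q \<omega>E f \<in> cochains G E (p + q - 1)"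
      using gE by (simp add: algebra_simps)
    note gC = smooth_family.gact_in_cochains[OF smooth_family_core C f]
    show ?thesis
    proof (cases "m = 0")
      case True
      then have k: "k > 0"
        using mk by simp
      have "(\<lambda>\<xi>s\<in>dual_nerve V q. (case dual_tgt V (hd \<xi>s) of (x, \<mu>) \<Rightarrow> \<mu> (\<omega>C (Obj x))) * f (Arr (map fst \<xi>s))) =
          synth_fun q (gact ME (p - 1) q \<omega>E f) (gact MC p q \<omega>C f)"
        unfolding synth_fun_def
      proof (rule restrict_ext)
        fix \<xi>s assume \<xi>s: "\<xi>s \<in> dual_nerve V q"
        then have "\<xi>s \<in> dual_nerve V (p + q)"
          by (simp add: pq True)
        note d = dual_nerve_components[OF gE' gC this]
        note b = dual_nerve_base[OF \<xi>s[unfolded pq(2)]]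
        let ?g = "fst (hd \<xi>s)"
        have ne: "map fst \<xi>s \<noteq> []"
          by (rule chains_nonempty[OF b(1) k])
        \<comment> \<open>The E-part has degree -1 here, so its product with \<open>f\<close> is
          zero by convention, although the product lives in the nonnegative degree
          \<open>q - 1\<close>.\<close>
        have e: "gact ME (p - 1) q \<omega>E f (right_part G 1 (Arr (map fst \<xi>s))) = vzero E (src G ?g)"
          using d(5) right_part_1_hd(1)[OF b(1) k] b(2) by (simp add: cochain_module_def cochain_zero_def pq True)
        have oC: "\<omega>C (Obj (tgt G ?g)) \<in> vfib C (tgt G ?g)"
          using cochainsD(2)[OF C, of "Obj (tgt G ?g)"] G_points(2)[OF d(1)] by (simp add: pq True nerve_0)
        have c: "gact MC p q \<omega>C f (Arr (map fst \<xi>s)) = vscale Q (f (Arr (map fst \<xi>s))) (\<omega>C (Obj (tgt G ?g)))"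
          using d(6) b(2) ne by (simp add: cochain_module_def pq True)
        note m = core_mul_zero[OF d(1) oC]
        have cmem: "vscale Q (f (Arr (map fst \<xi>s))) (\<omega>C (Obj (tgt G ?g))) \<in> vfib C (tgt G ?g)"
          using real_vsD(3)[OF core_vs[OF G_points(2)[OF d(1)]] oC] by simp
        have "snd (hd \<xi>s) (combine ?g (vzero E (src G ?g)) (vscale Q (f (Arr (map fst \<xi>s))) (\<omega>C (Obj (tgt G ?g))))) =
            f (Arr (map fst \<xi>s)) * snd (hd \<xi>s) (mul \<Gamma> (\<omega>C (Obj (tgt G ?g))) (z ?g))"
          \<comment> \<open>With zero E-part only the right translate of the core value is left, and
            pairing with it is what the dual target does.\<close>
          unfolding combine_zero(2)[OF d(1) cmem] m(5) by (rule dual_fibD(2)[OF d(2) m(1)])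
        then show "(case dual_tgt V (hd \<xi>s) of (x, \<mu>) \<Rightarrow> \<mu> (\<omega>C (Obj x))) * f (Arr (map fst \<xi>s)) =
          snd (hd \<xi>s) (combine ?g (gact ME (p - 1) q \<omega>E f (right_part G 1 (Arr (map fst \<xi>s))))
            (gact MC p q \<omega>C f (Arr (map fst \<xi>s))))"
          unfolding e c using oC by (simp add: dual_tgt_eq mult.commute)
      qed
      then show ?thesis
        using True k by (simp add: pq vb_act_def synth_def)
    next
      case False
      then have m: "m > 0"
        by simp
      have p1: "p - 1 = int (m - 1)"
        using m by (simp add: pq)
      have "(\<lambda>\<xi>s\<in>dual_nerve V (p + q). synth_fun p \<omega>E \<omega>C (take m \<xi>s) * f (right_part G m (Arr (map fst \<xi>s)))) =
          synth_fun (p + q) (gact ME (p - 1) q \<omega>E f) (gact MC p q \<omega>C f)"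
        unfolding synth_fun_def[of "p + q"]
      proof (rule restrict_ext)
        fix \<xi>s assume \<xi>s: "\<xi>s \<in> dual_nerve V (p + q)"
        note d = dual_nerve_components[OF gE' gC \<xi>s]
        have \<xi>s': "\<xi>s \<in> dual_nerve V (int (m + k))"
          using \<xi>s by (simp add: pq)
        note b = dual_nerve_base[OF \<xi>s'] and D = dual_nerveD[OF \<xi>s']
        have take: "take m \<xi>s \<in> dual_nerve V p"
          unfolding pq(1) by (rule dual_nerveI[OF m]) (use D(2,3,6) in auto)
        have hd: "hd (take m \<xi>s) = hd \<xi>s"
          using m by (simp add: hd_take)
        let ?gs = "map fst \<xi>s" and ?g = "fst (hd \<xi>s)"
        let ?e = "\<omega>E (right_part G 1 (Arr (take m ?gs)))" and ?c = "\<omega>C (Arr (take m ?gs))"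
          and ?r = "f (right_part G m (Arr ?gs))"
        have dt: "?e \<in> vfib E (src G ?g)" "?c \<in> vfib C (tgt G ?g)"
          using dual_nerve_components(3,4)[OF E C take] hd by (simp_all add: take_map)
        have gs: "Arr ?gs \<in> nerve G (int (m + k))" "Arr ?gs \<in> nerve G (int (1 + (m - 1) + k))"
        proof -
          show 1: "Arr ?gs \<in> nerve G (int (m + k))"
            unfolding nerve_pos[OF n] using b(1) by (rule imageI)
          have "1 + (m - 1) + k = m + k"
            using m by simp
          with 1 show "Arr ?gs \<in> nerve G (int (1 + (m - 1) + k))"
            by (simp only:)
        qed
        \<comment> \<open>The E-part lives on the tail, so its cut comes after \<open>m - 1\<close>
          arrows of the tail; this is the cut after \<open>m\<close> arrows of the full chain, so
          both components are multiplied by the same value of \<open>f\<close>.\<close>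
        have rl: "left_part G (m - 1) (right_part G 1 (Arr ?gs)) = right_part G 1 (Arr (take m ?gs))"
          using right_part_left_part[OF gs(2)] m by simp
        have rr: "right_part G (m - 1) (right_part G 1 (Arr ?gs)) = right_part G m (Arr ?gs)"
          using right_part_right_part[OF gs(2)] m by simp
        have "right_part G 1 (Arr ?gs) \<in> nerve G (int (m - 1 + k))"
          using right_part_1_hd(2)[OF b(1) n] m by simp
        then have e: "gact ME (p - 1) q \<omega>E f (right_part G 1 (Arr ?gs)) = vscale E ?r ?e"
          unfolding p1 pq(2) smooth_family.gact_nonneg[OF smooth_family_side] using rl rr by simp
        have c: "gact MC p q \<omega>C f (Arr ?gs) = vscale Q ?r ?c"
          unfolding pq smooth_family.gact_nonneg[OF smooth_family_core] using gs(1) m by simp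
        have "synth_fun p \<omega>E \<omega>C (take m \<xi>s) = snd (hd \<xi>s) (combine ?g ?e ?c)"
          using take hd by (simp add: synth_fun_def take_map)
        then show "synth_fun p \<omega>E \<omega>C (take m \<xi>s) * ?r =
            snd (hd \<xi>s) (combine ?g (gact ME (p - 1) q \<omega>E f (right_part G 1 (Arr ?gs))) (gact MC p q \<omega>C f (Arr ?gs)))"
          unfolding e c combine_linear(2)[OF d(1) dt]
          using dual_fibD(2)[OF d(2) combine_fibre(1)[OF d(1) dt], of ?r] by (simp add: mult.commute)
      qed
      then show ?thesis
        using m by (simp add: pq vb_act_def synth_def)
    qed
  qed
qed

lemma Theta_iso:
  "graded_right_module_iso (cochain_algebra G) (shift 1 (vb_cochain_module V))
     (direct_sum ME (shift 1 MC)) (Theta V h)"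
proof (rule graded_right_module_iso_inverse[where \<Xi> = "\<lambda>p (\<omega>E, \<omega>C). synth (p + 1) \<omega>E \<omega>C"])
  \<comment> \<open>The shift adds 1 to the total degree of a product, whereas the action sees it
    added to the first degree.\<close>
  have degree: "p + q + 1 = p + 1 + q" for p q :: int
    by simp
  have N: "hcomp (direct_sum ME (shift 1 MC)) p = cochains G E p \<times> cochains G C (p + 1)" for p
    by (simp add: direct_sum_def shift_def cochain_module_def)
  show "graded_right_module (cochain_algebra G) (direct_sum ME (shift 1 MC))"
    by (intro graded_right_module_direct_sum graded_right_module_shift
        smooth_family.graded_right_module_cochain_module smooth_family_side smooth_family_core)
  show "(\<lambda>(\<omega>E, \<omega>C). synth (p + 1) \<omega>E \<omega>C) ` hcomp (direct_sum ME (shift 1 MC)) p = hcomp (shift 1 (vb_cochain_module V)) p" for p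
    unfolding N using synth_in[of _ "p + 1"] synth_surj[of _ "p + 1"]
    by (fastforce simp: shift_def vb_cochain_module_def)
  fix p y assume "y \<in> hcomp (direct_sum ME (shift 1 MC)) p"
  then obtain \<omega>E \<omega>C where y: "y = (\<omega>E, \<omega>C)" "\<omega>E \<in> cochains G E p" "\<omega>C \<in> cochains G C (p + 1)"
    unfolding N by blast
  have E: "\<omega>E \<in> cochains G E (p + 1 - 1)"
    using y(2) by simp
  show "Theta V h p (case y of (\<omega>E, \<omega>C) \<Rightarrow> synth (p + 1) \<omega>E \<omega>C) = y"
    using Theta_synth[OF y(2,3)] by (simp add: y(1))
  show "gscale (shift 1 (vb_cochain_module V)) p r (case y of (\<omega>E, \<omega>C) \<Rightarrow> synth (p + 1) \<omega>E \<omega>C) =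
      (case gscale (direct_sum ME (shift 1 MC)) p r y of (\<omega>E, \<omega>C) \<Rightarrow> synth (p + 1) \<omega>E \<omega>C)" for r
    using synth_scale[OF E y(3), of r] by (simp add: y(1) shift_def vb_cochain_module_def direct_sum_def)
  show "gact (shift 1 (vb_cochain_module V)) p q (case y of (\<omega>E, \<omega>C) \<Rightarrow> synth (p + 1) \<omega>E \<omega>C) a =
      (case gact (direct_sum ME (shift 1 MC)) p q y a of (\<omega>E, \<omega>C) \<Rightarrow> synth (p + q + 1) \<omega>E \<omega>C)"
    if "a \<in> hcomp (cochain_algebra G) q" for q a
  proof -
    have "a \<in> cochains G real_family q"
      using that by (simp add: cochain_algebra_def)
    from synth_act[OF E y(3) this] show ?thesis
      by (simp add: y(1) shift_def vb_cochain_module_def direct_sum_def degree)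
  qed
  fix x assume "x \<in> hcomp (direct_sum ME (shift 1 MC)) p"
  then obtain \<eta>E \<eta>C where x: "x = (\<eta>E, \<eta>C)" "\<eta>E \<in> cochains G E p" "\<eta>C \<in> cochains G C (p + 1)"
    unfolding N by blast
  have E': "\<eta>E \<in> cochains G E (p + 1 - 1)"
    using x(2) by simp
  show "gadd (shift 1 (vb_cochain_module V)) p (case x of (\<omega>E, \<omega>C) \<Rightarrow> synth (p + 1) \<omega>E \<omega>C)
        (case y of (\<omega>E, \<omega>C) \<Rightarrow> synth (p + 1) \<omega>E \<omega>C) =
      (case gadd (direct_sum ME (shift 1 MC)) p x y of (\<omega>E, \<omega>C) \<Rightarrow> synth (p + 1) \<omega>E \<omega>C)"
    using synth_add[OF E' x(3) E y(3)] by (simp add: x(1) y(1) shift_def vb_cochain_module_def direct_sum_def)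
qed

end

text \<open>The first conjunct makes the definite description in \<open>Theta\<close> meaningful in
  every degree, so that the second one speaks of the components and not of an unspecified
  value.\<close>

theorem theorem5p6:
  fixes V :: "('c, 'e, 'g, 'm) vb_groupoid_data"
    and h :: "'g \<Rightarrow> 'e \<Rightarrow> 'c"
  assumes "vb_groupoid V"
    and "horizontal_lift V h"
  shows "(\<forall>p. \<forall>\<phi> \<in> vb_cochains V p. \<exists>!c. is_components V h p \<phi> c) \<and>
    graded_right_module_iso (cochain_algebra (small V))
      (shift 1 (vb_cochain_module V))
      (direct_sum (cochain_module (small V) (side_bundle V))
                  (shift 1 (cochain_module (small V) (core V))))
      (Theta V h)"
proof -
  interpret vb_groupoid_lift V h
    using assms by unfold_locales
  show ?thesis
    using components_unique Theta_iso by blast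
qed

end
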